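(* Let $\mathbb{G}$ be a locally compact quantum group and let $x\in\mathcal{P}^\infty(\mathbb{G})\cap D(S)\cap D(S^{-1})$. Then there exists an admissible corepresentation $U=(U_{ij})$ of $C_0(\mathbb{G})$ such that $x$ is a matrix element of $U$. In particular, $x\in M(C_0(\mathbb{G}))$ and $x\in\mathcal{AP}(C_0(\mathbb{G}))$.
   Context: Locally compact quantum groups are in the sense of Kustermans and Vaes: $(L^\infty(\mathbb{G}),\Delta)$ is the von Neumann algebra with coproduct, $C_0(\mathbb{G})\subseteq L^\infty(\mathbb{G})$ is the reduced C$^*$-algebra, so $M(C_0(\mathbb{G}))\subseteq L^\infty(\mathbb{G})$. $S$ is the (in general unbounded) antipode on $L^\infty(\mathbb{G})$, with polar decomposition $S=R\tau_{-i/2}$ ($R$ the unitary antipode, $(\tau_t)$ the scaling group); $D(S)$, $D(S^{-1})$ are the domains of $S$ and $S^{-1}$, and $D(S^{-1})=D(S)^*$. $\mathcal{P}^\infty(\mathbb{G})$ is the set of periodic elements, i.e. those $x\in L^\infty(\mathbb{G})$ such that $\Delta(x)$ is a finite-rank tensor (lies in the algebraic tensor product $L^\infty(\mathbb{G})\odot L^\infty(\mathbb{G})$). A (finite-dimensional) corepresentation of $C_0(\mathbb{G})$ is $U=(U_{ij})\in\mathbb{M}_n(M(C_0(\mathbb{G})))$ with $\Delta(U_{ij})=\sum_kU_{ik}\otimes U_{kj}$; it is admissible if both $U$ and $U^\top=(U_{ji})$ are invertible. The matrix elements of $U$ are the elements of the linear span of the $U_{ij}$. $\mathcal{AP}(C_0(\mathbb{G}))\subseteq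 M(C_0(\mathbb{G}))$ is the set of all matrix elements of admissible corepresentations of $C_0(\mathbb{G})$. *)

theory Defs
  imports "HOL-Analysis.Analysis"
begin

section \<open>Hilbert spaces and bounded operators\<close>

class complex_vector = real_vector +
  fixes scaleC :: "complex \<Rightarrow> 'a \<Rightarrow> 'a" (infixr \<open>*\<^sub>C\<close> 75)
  assumes scaleC_add_right: "c *\<^sub>C (x + y) = c *\<^sub>C x + c *\<^sub>C y"
    and scaleC_add_left: "(c + d) *\<^sub>C x = c *\<^sub>C x + d *\<^sub>C x"
    and scaleC_scaleC: "c *\<^sub>C (d *\<^sub>C x) = (c * d) *\<^sub>C x"
    and scaleC_one: "1 *\<^sub>C x = x"
    and scaleC_of_real: "complex_of_real r *\<^sub>C x = r *\<^sub>R x"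

global_interpretation complex_vector: vector_space "scaleC :: complex \<Rightarrow> 'a \<Rightarrow> 'a::complex_vector"
  defines cspan = complex_vector.span
  by unfold_locales (simp_all add: scaleC_add_right scaleC_add_left scaleC_scaleC scaleC_one)

text \<open>
  Every Hilbert space has an orthonormal basis and is thus unitarily equivalent to
  \<open>\<ell>\<^sup>2(I)\<close> for some set \<open>I\<close>; the index set is an arbitrary type \<open>'i\<close>.  In this model the Hilbert space
  tensor product of \<open>\<ell>\<^sup>2(I)\<close> and \<open>\<ell>\<^sup>2(J)\<close> is \<open>\<ell>\<^sup>2(I \<times> J)\<close>.
\<close>

typedef 'i ell2 = "{f :: 'i \<Rightarrow> complex. (\<lambda>i. (cmod (f i))\<^sup>2) summable_on UNIV}"
  morphisms ell2_fun Abs_ell2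
  by (rule exI[of _ "\<lambda>_. 0"]) simp

setup_lifting type_definition_ell2

lemma cmod_mult_le_squares: "cmod (a * b) \<le> (cmod a)\<^sup>2 + (cmod b)\<^sup>2"
proof -
  have "0 \<le> cmod a * cmod b" by simp
  with sum_squares_bound[of "cmod a" "cmod b"] show ?thesis
    unfolding norm_mult mult.assoc by linarith
qed

lemma ell2_prod_abs_summable:
  assumes "(\<lambda>i. (cmod (f i))\<^sup>2) summable_on UNIV" and "(\<lambda>i. (cmod (g i))\<^sup>2) summable_on UNIV"
  shows "(\<lambda>i. cmod (f i * g i)) summable_on UNIV"
proof (rule summable_on_comparison_test)
  show "(\<lambda>i. (cmod (f i))\<^sup>2 + (cmod (g i))\<^sup>2) summable_on UNIV"
    using assms by (rule summable_on_add)
qed (auto simp: cmod_mult_le_squares)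

lemma ell2_prod_summable:
  assumes "(\<lambda>i. (cmod (f i))\<^sup>2) summable_on UNIV" and "(\<lambda>i. (cmod (g i))\<^sup>2) summable_on UNIV"
  shows "(\<lambda>i. cnj (f i) * g i) summable_on UNIV"
  by (rule abs_summable_summable, rule ell2_prod_abs_summable) (simp_all add: assms)

lemma ell2_add_summable:
  assumes "(\<lambda>i. (cmod (f i))\<^sup>2) summable_on UNIV" and "(\<lambda>i. (cmod (g i))\<^sup>2) summable_on UNIV"
  shows "(\<lambda>i. (cmod (f i + g i))\<^sup>2) summable_on UNIV"
proof (rule summable_on_comparison_test)
  show "(\<lambda>i. 2 * (cmod (f i))\<^sup>2 + 2 * (cmod (g i))\<^sup>2) summable_on UNIV"
    by (intro summable_on_add summable_on_cmult_right assms)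
  show "(cmod (f i + g i))\<^sup>2 \<le> 2 * (cmod (f i))\<^sup>2 + 2 * (cmod (g i))\<^sup>2" for i
  proof -
    have "(cmod (f i + g i))\<^sup>2 \<le> (cmod (f i) + cmod (g i))\<^sup>2"
      by (intro power_mono norm_triangle_ineq) simp
    also have "\<dots> \<le> 2 * (cmod (f i))\<^sup>2 + 2 * (cmod (g i))\<^sup>2"
      using zero_le_power2[of "cmod (f i) - cmod (g i)"]
      unfolding power2_diff power2_sum by linarith
    finally show ?thesis .
  qed
qed simp

lemma ell2_scale_summable:
  assumes "(\<lambda>i. (cmod (f i))\<^sup>2) summable_on UNIV"
  shows "(\<lambda>i. (cmod (c * f i))\<^sup>2) summable_on UNIV"
  using summable_on_cmult_right[OF assms, of "(cmod c)\<^sup>2"]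
  by (simp add: norm_mult power_mult_distrib)

instantiation ell2 :: (type) complex_vector
begin
lift_definition zero_ell2 :: "'a ell2" is "\<lambda>_. 0" by simp
lift_definition plus_ell2 :: "'a ell2 \<Rightarrow> 'a ell2 \<Rightarrow> 'a ell2" is "\<lambda>f g i. f i + g i"
  by (rule ell2_add_summable)
lift_definition uminus_ell2 :: "'a ell2 \<Rightarrow> 'a ell2" is "\<lambda>f i. - f i" by simp
lift_definition minus_ell2 :: "'a ell2 \<Rightarrow> 'a ell2 \<Rightarrow> 'a ell2" is "\<lambda>f g i. f i - g i"
  subgoal for f g using ell2_add_summable[of f "\<lambda>i. - g i"] by simp
  done
lift_definition scaleC_ell2 :: "complex \<Rightarrow> 'a ell2 \<Rightarrow> 'a ell2" is "\<lambda>c f i. c * f i"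
  by (rule ell2_scale_summable)
lift_definition scaleR_ell2 :: "real \<Rightarrow> 'a ell2 \<Rightarrow> 'a ell2" is "\<lambda>r f i. complex_of_real r * f i"
  by (rule ell2_scale_summable)
instance
  by standard (transfer; auto simp: fun_eq_iff algebra_simps)+
end

text \<open>The inner product is antilinear in the first argument.\<close>

lift_definition cinner :: "'i ell2 \<Rightarrow> 'i ell2 \<Rightarrow> complex" is
  "\<lambda>f g. \<Sum>\<^sub>\<infinity>i. cnj (f i) * g i" .

lemma cinner_add_left: "cinner (x + y) z = cinner x z + cinner y z"
  by transfer (simp add: distrib_right infsum_add ell2_prod_summable)

lemma cinner_commute: "cinner x y = cnj (cinner y x)"
  by transfer (simp flip: infsum_cnj add: mult.commute)

lemma cinner_scaleR_left: "cinner (r *\<^sub>R x) y = complex_of_real r * cinner x y"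
  by transfer (simp add: mult.assoc infsum_cmult_right')

lemma cinner_self: "cinner x x = complex_of_real (\<Sum>\<^sub>\<infinity>i. (cmod (ell2_fun x i))\<^sup>2)"
proof -
  have "cinner x x = (\<Sum>\<^sub>\<infinity>i. complex_of_real ((cmod (ell2_fun x i))\<^sup>2))"
    unfolding cinner.rep_eq
    by (intro infsum_cong) (simp only: complex_norm_square mult.commute)
  also have "\<dots> = complex_of_real (\<Sum>\<^sub>\<infinity>i. (cmod (ell2_fun x i))\<^sup>2)"
    by (intro infsumI has_sum_bounded_linear[OF bounded_linear_of_real] has_sum_infsum)
       (use ell2_fun[of x] in simp)
  finally show ?thesis .
qed

lemma ell2_norm_eq_0: "(\<Sum>\<^sub>\<infinity>i. (cmod (ell2_fun x i))\<^sup>2) = 0 \<longleftrightarrow> x = 0"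
proof
  assume *: "(\<Sum>\<^sub>\<infinity>i. (cmod (ell2_fun x i))\<^sup>2) = 0"
  have "(cmod (ell2_fun x i))\<^sup>2 = 0" for i
    by (rule nonneg_infsum_le_0D[where A = UNIV]) (use * ell2_fun[of x] in auto)
  then show "x = 0" by (simp add: ell2_fun_inject[symmetric] zero_ell2.rep_eq fun_eq_iff)
qed (simp add: zero_ell2.rep_eq)

instantiation ell2 :: (type) real_inner
begin
definition inner_ell2 :: "'a ell2 \<Rightarrow> 'a ell2 \<Rightarrow> real" where
  "inner_ell2 x y = Re (cinner x y)"
definition norm_ell2 :: "'a ell2 \<Rightarrow> real" where
  "norm_ell2 x = sqrt (\<Sum>\<^sub>\<infinity>i. (cmod (ell2_fun x i))\<^sup>2)"
definition sgn_ell2 :: "'a ell2 \<Rightarrow> 'a ell2" where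
  "sgn_ell2 x = x /\<^sub>R norm x"
definition dist_ell2 :: "'a ell2 \<Rightarrow> 'a ell2 \<Rightarrow> real" where
  "dist_ell2 x y = norm (x - y)"
definition uniformity_ell2 :: "('a ell2 \<times> 'a ell2) filter" where
  "uniformity_ell2 = (INF e\<in>{0 <..}. principal {(x, y). dist x y < e})"
definition open_ell2 :: "'a ell2 set \<Rightarrow> bool" where
  "open_ell2 U \<longleftrightarrow> (\<forall>x\<in>U. \<forall>\<^sub>F (x', y) in uniformity. x' = x \<longrightarrow> y \<in> U)"
instance
proof
  fix x y z :: "'a ell2" and r :: real
  show "inner x y = inner y x"
    by (metis inner_ell2_def cinner_commute complex_cnj(1) cnj.simps(1))
  show "inner x x \<ge> 0" "inner x x = 0 \<longleftrightarrow> x = 0" "norm x = sqrt (inner x x)"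
    by (simp_all add: inner_ell2_def norm_ell2_def cinner_self ell2_norm_eq_0 infsum_nonneg)
qed (simp_all add: inner_ell2_def cinner_add_left cinner_scaleR_left sgn_ell2_def dist_ell2_def
       uniformity_ell2_def open_ell2_def)
end

lemma norm_scaleC_ell2: "norm (c *\<^sub>C x) = cmod c * norm (x :: 'i ell2)"
  by (simp add: norm_ell2_def scaleC_ell2.rep_eq norm_mult power_mult_distrib infsum_cmult_right'
      real_sqrt_mult)

lift_definition tensor_vec :: "'i ell2 \<Rightarrow> 'j ell2 \<Rightarrow> ('i \<times> 'j) ell2" (infixr \<open>\<otimes>\<^sub>v\<close> 70) is
  "\<lambda>f g (i, j). f i * g j"
proof -
  fix f :: "'i \<Rightarrow> complex" and g :: "'j \<Rightarrow> complex"
  assume f: "(\<lambda>i. (cmod (f i))\<^sup>2) summable_on UNIV" and g: "(\<lambda>i. (cmod (g i))\<^sup>2) summable_on UNIV"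
  have "(\<lambda>(i, j). (cmod (f i))\<^sup>2 * (cmod (g j))\<^sup>2) summable_on (SIGMA i:UNIV. UNIV)"
  proof (rule summable_on_SigmaI)
    show "((\<lambda>j. (\<lambda>(i, j). (cmod (f i))\<^sup>2 * (cmod (g j))\<^sup>2) (i, j)) has_sum
        (cmod (f i))\<^sup>2 * (\<Sum>\<^sub>\<infinity>j. (cmod (g j))\<^sup>2)) UNIV" for i
      using g by (auto intro!: has_sum_cmult_right)
    show "(\<lambda>i. (cmod (f i))\<^sup>2 * (\<Sum>\<^sub>\<infinity>j. (cmod (g j))\<^sup>2)) summable_on UNIV"
      using f by (rule summable_on_cmult_left)
  qed auto
  then show "(\<lambda>ij. (cmod (case ij of (i, j) \<Rightarrow> f i * g j))\<^sup>2) summable_on UNIV"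
    by (simp add: case_prod_unfold norm_mult power_mult_distrib)
qed

text \<open>\<open>B(\<ell>\<^sup>2(I))\<close>\<close>

typedef 'i bop = "{T :: 'i ell2 \<Rightarrow> 'i ell2. bounded_linear T \<and> (\<forall>c x. T (c *\<^sub>C x) = c *\<^sub>C T x)}"
  morphisms apply_bop Abs_bop
  by (rule exI[of _ "\<lambda>_. 0"]) (simp add: complex_vector.scale_zero_right)

notation apply_bop (infixr \<open>*\<^sub>V\<close> 70)

setup_lifting type_definition_bop

instantiation bop :: (type) complex_vector
begin
lift_definition zero_bop :: "'a bop" is "\<lambda>_. 0" by (simp add: complex_vector.scale_zero_right)
lift_definition plus_bop :: "'a bop \<Rightarrow> 'a bop \<Rightarrow> 'a bop" is "\<lambda>S T x. S x + T x"
  by (simp add: bounded_linear_add scaleC_add_right)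
lift_definition uminus_bop :: "'a bop \<Rightarrow> 'a bop" is "\<lambda>T x. - T x"
  by (simp add: bounded_linear_minus complex_vector.scale_minus_right)
lift_definition minus_bop :: "'a bop \<Rightarrow> 'a bop \<Rightarrow> 'a bop" is "\<lambda>S T x. S x - T x"
  by (simp add: bounded_linear_sub complex_vector.scale_right_diff_distrib)
lift_definition scaleC_bop :: "complex \<Rightarrow> 'a bop \<Rightarrow> 'a bop" is "\<lambda>c T x. c *\<^sub>C T x"
proof -
  fix c and T :: "'a ell2 \<Rightarrow> 'a ell2"
  assume T: "bounded_linear T \<and> (\<forall>d x. T (d *\<^sub>C x) = d *\<^sub>C T x)"
  have "bounded_linear (\<lambda>x :: 'a ell2. c *\<^sub>C x)"
  proof (rule bounded_linear_intro)
    show "c *\<^sub>C (x + y) = c *\<^sub>C x + c *\<^sub>C y" for x y :: "'a ell2" by (rule scaleC_add_right)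
    show "c *\<^sub>C (r *\<^sub>R x) = r *\<^sub>R (c *\<^sub>C x)" for r and x :: "'a ell2"
      by (simp flip: scaleC_of_real add: scaleC_scaleC mult.commute)
    show "norm (c *\<^sub>C x) \<le> norm x * cmod c" for x :: "'a ell2" by (simp add: norm_scaleC_ell2)
  qed
  then have "bounded_linear (\<lambda>x. c *\<^sub>C T x)"
    using T bounded_linear_compose by blast
  with T show "bounded_linear (\<lambda>x. c *\<^sub>C T x) \<and> (\<forall>d x. c *\<^sub>C T (d *\<^sub>C x) = d *\<^sub>C c *\<^sub>C T x)"
    by (simp add: scaleC_scaleC mult.commute)
qed
lift_definition scaleR_bop :: "real \<Rightarrow> 'a bop \<Rightarrow> 'a bop" is "\<lambda>r T x. r *\<^sub>R T x"
  by (metis bounded_linear_const_scaleR mult.commute scaleC_of_real scaleC_scaleC)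
instance
  by standard (transfer; auto simp: fun_eq_iff algebra_simps scaleC_add_right scaleC_add_left
      scaleC_scaleC scaleC_one scaleC_of_real)+
end

lemma ex_nonzero_ell2: "\<exists>x :: 'i ell2. x \<noteq> 0"
proof -
  define x :: "'i ell2" where "x = Abs_ell2 (\<lambda>i. if i = undefined then 1 else 0)"
  have "(\<lambda>i :: 'i. (cmod (if i = undefined then 1 else 0))\<^sup>2) summable_on UNIV"
    by (rule summable_on_cong_neutral[THEN iffD1, OF _ _ _ summable_on_finite[of "{undefined}"]])
      auto
  then have "ell2_fun x = (\<lambda>i. if i = undefined then 1 else 0)"
    by (simp add: x_def Abs_ell2_inverse)
  then have "ell2_fun x undefined \<noteq> ell2_fun 0 undefined" by (simp add: zero_ell2.rep_eq)
  then show ?thesis by metis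
qed

instantiation bop :: (type) real_normed_algebra_1
begin
lift_definition one_bop :: "'a bop" is "\<lambda>x. x" by simp
lift_definition times_bop :: "'a bop \<Rightarrow> 'a bop \<Rightarrow> 'a bop" is "\<lambda>S T x. S (T x)"
  using bounded_linear_compose by auto
lift_definition norm_bop :: "'a bop \<Rightarrow> real" is onorm .
definition sgn_bop :: "'a bop \<Rightarrow> 'a bop" where
  "sgn_bop x = x /\<^sub>R norm x"
definition dist_bop :: "'a bop \<Rightarrow> 'a bop \<Rightarrow> real" where
  "dist_bop x y = norm (x - y)"
definition uniformity_bop :: "('a bop \<times> 'a bop) filter" where
  "uniformity_bop = (INF e\<in>{0 <..}. principal {(x, y). dist x y < e})"
definition open_bop :: "'a bop set \<Rightarrow> bool" where
  "open_bop U \<longleftrightarrow> (\<forall>x\<in>U. \<forall>\<^sub>F (x', y) in uniformity. x' = x \<longrightarrow> y \<in> U)"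
instance
proof
  fix S T U :: "'a bop" and r :: real
  show "S * T * U = S * (T * U)" by transfer simp
  show "(S + T) * U = S * U + T * U" by transfer simp
  show "S * (T + U) = S * T + S * U" by transfer (simp add: linear_simps fun_eq_iff)
  show "(r *\<^sub>R S) * T = r *\<^sub>R (S * T)" by transfer simp
  show "S * (r *\<^sub>R T) = r *\<^sub>R (S * T)" by transfer (simp add: linear_simps fun_eq_iff)
  show "1 * S = S" "S * 1 = S" by (transfer, simp)+
  obtain x :: "'a ell2" where x: "x \<noteq> 0" using ex_nonzero_ell2 by blast
  then have "apply_bop (0 :: 'a bop) x \<noteq> apply_bop 1 x"
    by (simp add: zero_bop.rep_eq one_bop.rep_eq)
  then show "(0 :: 'a bop) \<noteq> 1" by metis
  show "norm T = 0 \<longleftrightarrow> T = 0" by transfer (auto simp: onorm_eq_0)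
  show "norm (S + T) \<le> norm S + norm T" by transfer (simp add: onorm_triangle)
  show "norm (r *\<^sub>R T) = \<bar>r\<bar> * norm T" by transfer (simp add: onorm_scaleR)
  show "norm (S * T) \<le> norm S * norm T"
    by transfer (use onorm_compose in \<open>auto simp: o_def\<close>)
  show "norm (1 :: 'a bop) = 1"
  proof (rule antisym)
    show "norm (1 :: 'a bop) \<le> 1" unfolding norm_bop.rep_eq one_bop.rep_eq by (rule onorm_id_le)
    have "norm x \<le> norm (1 :: 'a bop) * norm x"
      using onorm[OF bounded_linear_ident, of x] unfolding norm_bop.rep_eq one_bop.rep_eq .
    with x show "1 \<le> norm (1 :: 'a bop)" by simp
  qed
qed (simp_all add: sgn_bop_def dist_bop_def uniformity_bop_def open_bop_def)
end

text \<open>Here and below, \<open>THE\<close> selects the unique bounded operator with the given matrix coefficients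
  (by the Riesz theorem) or the given values on the total set of elementary tensors.\<close>

definition adj :: "'i bop \<Rightarrow> 'i bop" where
  "adj T = (THE T'. \<forall>x y. cinner (T' *\<^sub>V x) y = cinner x (T *\<^sub>V y))"

definition tensor_op :: "'i bop \<Rightarrow> 'j bop \<Rightarrow> ('i \<times> 'j) bop" (infixr \<open>\<otimes>\<^sub>o\<close> 70) where
  "S \<otimes>\<^sub>o T = (THE X. \<forall>x y. X *\<^sub>V (x \<otimes>\<^sub>v y) = (S *\<^sub>V x) \<otimes>\<^sub>v (T *\<^sub>V y))"

definition pos_op :: "'i bop \<Rightarrow> bool" where
  "pos_op T \<longleftrightarrow> (\<forall>x. cinner x (T *\<^sub>V x) \<in> \<real>\<^sub>\<ge>\<^sub>0)"


section \<open>Normal functionals, slice maps and operator topologies\<close>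

definition sq_summable :: "(nat \<Rightarrow> 'i ell2) \<Rightarrow> bool" where
  "sq_summable \<xi> \<longleftrightarrow> summable (\<lambda>n. (norm (\<xi> n))\<^sup>2)"

text \<open>The predual \<open>B(H)\<^sub>*\<close>; for a von Neumann algebra \<open>M\<close> on \<open>H\<close>, the
  predual \<open>M\<^sub>*\<close> consists of the restrictions to \<open>M\<close> of its elements.\<close>

definition predual :: "('i bop \<Rightarrow> complex) set" where
  "predual = {\<lambda>T. \<Sum>n. cinner (\<eta> n) (T *\<^sub>V \<xi> n) | \<xi> \<eta>. sq_summable \<xi> \<and> sq_summable \<eta>}"

definition sigma_weak :: "'i bop topology" where
  "sigma_weak = topology_generated_by
     {{T. cmod (\<omega> T - \<omega> T\<^sub>0) < \<epsilon>} | \<omega> T\<^sub>0 \<epsilon>. \<omega> \<in> predual \<and> 0 < \<epsilon>}"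

definition sigma_strong_star :: "'i bop topology" where
  "sigma_strong_star = topology_generated_by
     {{T. (\<Sum>n. (norm ((T - T\<^sub>0) *\<^sub>V \<xi> n))\<^sup>2 + (norm (adj (T - T\<^sub>0) *\<^sub>V \<xi> n))\<^sup>2) < \<epsilon>}
      | \<xi> T\<^sub>0 \<epsilon>. sq_summable \<xi> \<and> 0 < \<epsilon>}"

text \<open>The slices \<open>(\<omega> \<otimes> id)(X)\<close> and \<open>(id \<otimes> \<omega>)(X)\<close>, first for the vector functionals
  \<open>\<omega>\<^sub>\<xi>\<^sub>,\<^sub>\<eta>(T) = cinner \<eta> (T *\<^sub>V \<xi>)\<close> and then in general by
  \<open>cinner \<theta> ((\<omega> \<otimes> id)(X) *\<^sub>V \<zeta>) = \<omega> ((id \<otimes> \<omega>\<^sub>\<zeta>\<^sub>,\<^sub>\<theta>)(X))\<close> and its mirror image.\<close>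

definition vec_slice_left :: "'i ell2 \<Rightarrow> 'i ell2 \<Rightarrow> ('i \<times> 'j) bop \<Rightarrow> 'j bop" where
  "vec_slice_left \<xi> \<eta> X =
     (THE T. \<forall>\<zeta> \<theta>. cinner \<theta> (T *\<^sub>V \<zeta>) = cinner (\<eta> \<otimes>\<^sub>v \<theta>) (X *\<^sub>V (\<xi> \<otimes>\<^sub>v \<zeta>)))"

definition vec_slice_right :: "'j ell2 \<Rightarrow> 'j ell2 \<Rightarrow> ('i \<times> 'j) bop \<Rightarrow> 'i bop" where
  "vec_slice_right \<xi> \<eta> X =
     (THE T. \<forall>\<zeta> \<theta>. cinner \<theta> (T *\<^sub>V \<zeta>) = cinner (\<theta> \<otimes>\<^sub>v \<eta>) (X *\<^sub>V (\<zeta> \<otimes>\<^sub>v \<xi>)))"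

definition slice_left :: "('i bop \<Rightarrow> complex) \<Rightarrow> ('i \<times> 'j) bop \<Rightarrow> 'j bop" where
  "slice_left \<omega> X = (THE T. \<forall>\<zeta> \<theta>. cinner \<theta> (T *\<^sub>V \<zeta>) = \<omega> (vec_slice_right \<zeta> \<theta> X))"

definition slice_right :: "('j bop \<Rightarrow> complex) \<Rightarrow> ('i \<times> 'j) bop \<Rightarrow> 'i bop" where
  "slice_right \<omega> X = (THE T. \<forall>\<zeta> \<theta>. cinner \<theta> (T *\<^sub>V \<zeta>) = \<omega> (vec_slice_left \<zeta> \<theta> X))"


section \<open>Von Neumann algebras and weights\<close>

definition commutant :: "'i bop set \<Rightarrow> 'i bop set" where
  "commutant A = {T. \<forall>S\<in>A. T * S = S * T}"

definition von_neumann_algebra :: "'i bop set \<Rightarrow> bool" where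
  "von_neumann_algebra M \<longleftrightarrow> adj ` M \<subseteq> M \<and> commutant (commutant M) = M"

definition tensor_vna :: "'i bop set \<Rightarrow> 'j bop set \<Rightarrow> ('i \<times> 'j) bop set" (infixr \<open>\<otimes>\<^sub>v\<^sub>N\<close> 70) where
  "M \<otimes>\<^sub>v\<^sub>N N = commutant (commutant {a \<otimes>\<^sub>o b | a b. a \<in> M \<and> b \<in> N})"

definition alg_tensor :: "'i bop set \<Rightarrow> 'j bop set \<Rightarrow> ('i \<times> 'j) bop set" (infixr \<open>\<odot>\<close> 70) where
  "M \<odot> N = cspan {a \<otimes>\<^sub>o b | a b. a \<in> M \<and> b \<in> N}"

definition normal_unital_star_hom :: "'i bop set \<Rightarrow> 'j bop set \<Rightarrow> ('i bop \<Rightarrow> 'j bop) \<Rightarrow> bool" where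
  "normal_unital_star_hom M N \<Phi> \<longleftrightarrow>
     \<Phi> ` M \<subseteq> N \<and>
     (\<forall>a\<in>M. \<forall>b\<in>M. \<Phi> (a + b) = \<Phi> a + \<Phi> b \<and> \<Phi> (a * b) = \<Phi> a * \<Phi> b) \<and>
     (\<forall>c. \<forall>a\<in>M. \<Phi> (c *\<^sub>C a) = c *\<^sub>C \<Phi> a) \<and>
     (\<forall>a\<in>M. \<Phi> (adj a) = adj (\<Phi> a)) \<and>
     \<Phi> 1 = 1 \<and>
     continuous_map (subtopology sigma_weak M) sigma_weak \<Phi>"

definition pos_part :: "'i bop set \<Rightarrow> 'i bop set" where
  "pos_part M = {a \<in> M. pos_op a}"

definition is_op_sup :: "'i bop set \<Rightarrow> 'i bop set \<Rightarrow> 'i bop \<Rightarrow> bool" where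
  "is_op_sup M D a \<longleftrightarrow> a \<in> pos_part M \<and> (\<forall>d\<in>D. pos_op (a - d)) \<and>
     (\<forall>b\<in>pos_part M. (\<forall>d\<in>D. pos_op (b - d)) \<longrightarrow> pos_op (b - a))"

text \<open>Weights on \<open>M\<close> are given on the positive cone of \<open>M\<close>; their values elsewhere are irrelevant.\<close>

definition weight :: "'i bop set \<Rightarrow> ('i bop \<Rightarrow> ennreal) \<Rightarrow> bool" where
  "weight M \<phi> \<longleftrightarrow>
     (\<forall>a\<in>pos_part M. \<forall>b\<in>pos_part M. \<phi> (a + b) = \<phi> a + \<phi> b) \<and>
     (\<forall>r\<ge>0. \<forall>a\<in>pos_part M. \<phi> (r *\<^sub>R a) = ennreal r * \<phi> a)"

definition left_ideal_of_weight :: "'i bop set \<Rightarrow> ('i bop \<Rightarrow> ennreal) \<Rightarrow> 'i bop set" where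
  "left_ideal_of_weight M \<phi> = {a \<in> M. \<phi> (adj a * a) < \<infinity>}"

definition normal_weight :: "'i bop set \<Rightarrow> ('i bop \<Rightarrow> ennreal) \<Rightarrow> bool" where
  "normal_weight M \<phi> \<longleftrightarrow>
     (\<forall>D a. D \<noteq> {} \<and> D \<subseteq> pos_part M \<and>
        (\<forall>d\<in>D. \<forall>e\<in>D. \<exists>f\<in>D. pos_op (f - d) \<and> pos_op (f - e)) \<and> is_op_sup M D a
        \<longrightarrow> \<phi> a = (SUP d\<in>D. \<phi> d))"

definition nsf_weight :: "'i bop set \<Rightarrow> ('i bop \<Rightarrow> ennreal) \<Rightarrow> bool" where
  "nsf_weight M \<phi> \<longleftrightarrow>
     weight M \<phi> \<and> normal_weight M \<phi> \<and>
     M \<subseteq> sigma_weak closure_of left_ideal_of_weight M \<phi> \<and>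
     (\<forall>a\<in>pos_part M. \<phi> a = 0 \<longrightarrow> a = 0)"

text \<open>By polarization, the norm condition says that \<open>\<langle>\<Lambda>(b), \<Lambda>(a)\<rangle> = \<phi>(b\<^sup>* a)\<close> for the linear
  extension of \<open>\<phi>\<close> to the linear span of the positive elements of finite weight.  The
  GNS representation is the given inclusion \<open>M \<subseteq> B(H)\<close>.\<close>

definition gns_construction ::
  "'i bop set \<Rightarrow> ('i bop \<Rightarrow> ennreal) \<Rightarrow> ('i bop \<Rightarrow> 'i ell2) \<Rightarrow> bool" where
  "gns_construction M \<phi> \<Lambda> \<longleftrightarrow>
     (let N = left_ideal_of_weight M \<phi> in
       (\<forall>a\<in>N. \<forall>b\<in>N. \<Lambda> (a + b) = \<Lambda> a + \<Lambda> b) \<and>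
       (\<forall>c. \<forall>a\<in>N. \<Lambda> (c *\<^sub>C a) = c *\<^sub>C \<Lambda> a) \<and>
       (\<forall>a\<in>N. ennreal ((norm (\<Lambda> a))\<^sup>2) = \<phi> (adj a * a)) \<and>
       (\<forall>m\<in>M. \<forall>a\<in>N. \<Lambda> (m * a) = m *\<^sub>V \<Lambda> a) \<and>
       closure (\<Lambda> ` N) = UNIV)"


section \<open>Locally compact quantum groups\<close>

text \<open>The two iterated coproducts act on \<open>(H \<otimes> H) \<otimes> H\<close> and \<open>H \<otimes> (H \<otimes> H)\<close>
  respectively; they are compared along the canonical identification of these spaces, by
  their matrix coefficients at elementary tensors.\<close>

definition coassociative :: "'i bop set \<Rightarrow> ('i bop \<Rightarrow> ('i \<times> 'i) bop) \<Rightarrow> bool" where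
  "coassociative M \<Delta> \<longleftrightarrow>
     (\<exists>\<Delta>_id id_\<Delta>.
        normal_unital_star_hom (M \<otimes>\<^sub>v\<^sub>N M) ((M \<otimes>\<^sub>v\<^sub>N M) \<otimes>\<^sub>v\<^sub>N M) \<Delta>_id \<and>
        (\<forall>a\<in>M. \<forall>b\<in>M. \<Delta>_id (a \<otimes>\<^sub>o b) = \<Delta> a \<otimes>\<^sub>o b) \<and>
        normal_unital_star_hom (M \<otimes>\<^sub>v\<^sub>N M) (M \<otimes>\<^sub>v\<^sub>N (M \<otimes>\<^sub>v\<^sub>N M)) id_\<Delta> \<and>
        (\<forall>a\<in>M. \<forall>b\<in>M. id_\<Delta> (a \<otimes>\<^sub>o b) = a \<otimes>\<^sub>o \<Delta> b) \<and>
        (\<forall>a\<in>M. \<forall>x y z x' y' z'.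
           cinner ((x \<otimes>\<^sub>v y) \<otimes>\<^sub>v z) (\<Delta>_id (\<Delta> a) *\<^sub>V ((x' \<otimes>\<^sub>v y') \<otimes>\<^sub>v z')) =
           cinner (x \<otimes>\<^sub>v (y \<otimes>\<^sub>v z)) (id_\<Delta> (\<Delta> a) *\<^sub>V (x' \<otimes>\<^sub>v (y' \<otimes>\<^sub>v z')))))"

definition left_invariant ::
  "'i bop set \<Rightarrow> ('i bop \<Rightarrow> ('i \<times> 'i) bop) \<Rightarrow> ('i bop \<Rightarrow> ennreal) \<Rightarrow> bool" where
  "left_invariant M \<Delta> \<phi> \<longleftrightarrow>
     (\<forall>\<omega>\<in>predual. (\<forall>a\<in>pos_part M. \<omega> a \<in> \<real>\<^sub>\<ge>\<^sub>0) \<longrightarrow>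
        (\<forall>a\<in>pos_part M. \<phi> a < \<infinity> \<longrightarrow> \<phi> (slice_left \<omega> (\<Delta> a)) = ennreal (Re (\<omega> 1)) * \<phi> a))"

definition right_invariant ::
  "'i bop set \<Rightarrow> ('i bop \<Rightarrow> ('i \<times> 'i) bop) \<Rightarrow> ('i bop \<Rightarrow> ennreal) \<Rightarrow> bool" where
  "right_invariant M \<Delta> \<psi> \<longleftrightarrow>
     (\<forall>\<omega>\<in>predual. (\<forall>a\<in>pos_part M. \<omega> a \<in> \<real>\<^sub>\<ge>\<^sub>0) \<longrightarrow>
        (\<forall>a\<in>pos_part M. \<psi> a < \<infinity> \<longrightarrow> \<psi> (slice_right \<omega> (\<Delta> a)) = ennreal (Re (\<omega> 1)) * \<psi> a))"

record 'i lcqg_data =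
  Linf :: "'i bop set"
  Delta :: "'i bop \<Rightarrow> ('i \<times> 'i) bop"
  left_haar :: "'i bop \<Rightarrow> ennreal"
  right_haar :: "'i bop \<Rightarrow> ennreal"
  Lam :: "'i bop \<Rightarrow> 'i ell2"

text \<open>Following Kustermans and Vaes, the von Neumann algebra acts on the GNS space \<open>L\<^sup>2(\<G>)\<close>
  of the left Haar weight, which is here identified with \<open>\<ell>\<^sup>2(I)\<close>.\<close>

definition lcqg :: "'i lcqg_data \<Rightarrow> bool" where
  "lcqg G \<longleftrightarrow>
     von_neumann_algebra (Linf G) \<and>
     normal_unital_star_hom (Linf G) (Linf G \<otimes>\<^sub>v\<^sub>N Linf G) (Delta G) \<and>
     coassociative (Linf G) (Delta G) \<and>
     nsf_weight (Linf G) (left_haar G) \<and> left_invariant (Linf G) (Delta G) (left_haar G) \<and>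
     nsf_weight (Linf G) (right_haar G) \<and> right_invariant (Linf G) (Delta G) (right_haar G) \<and>
     gns_construction (Linf G) (left_haar G) (Lam G)"

text \<open>The left regular representation \<open>W\<close>, given by
  \<open>W\<^sup>*(\<Lambda>(a) \<otimes> \<Lambda>(b)) = (\<Lambda> \<otimes> \<Lambda>)(\<Delta>(b)(a \<otimes> 1))\<close>.  Slicing the first leg turns this into
  \<open>(\<omega> \<otimes> id)(W\<^sup>*) \<Lambda>(b) = \<Lambda>((\<omega> \<otimes> id)(\<Delta>(b)))\<close>, which does not need the tensor product weight and
  determines the bounded operator \<open>W\<close>.  That \<open>W\<close> is unitary is a theorem, not part of the definition.\<close>

definition W_op :: "'i lcqg_data \<Rightarrow> ('i \<times> 'i) bop" where
  "W_op G = (THE W. \<forall>\<omega>\<in>predual. \<forall>b\<in>left_ideal_of_weight (Linf G) (left_haar G).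
     slice_left \<omega> (adj W) *\<^sub>V Lam G b = Lam G (slice_left \<omega> (Delta G b)))"

definition C0 :: "'i lcqg_data \<Rightarrow> 'i bop set" where
  "C0 G = closure {slice_right \<omega> (W_op G) | \<omega>. \<omega> \<in> predual}"

text \<open>As \<open>C\<^sub>0(\<G>)\<close> acts nondegenerately on \<open>L\<^sup>2(\<G>)\<close>, its multiplier algebra is the idealizer
  of \<open>C\<^sub>0(\<G>)\<close> in \<open>B(L\<^sup>2(\<G>))\<close>.\<close>

definition multiplier_algebra :: "'i bop set \<Rightarrow> 'i bop set" where
  "multiplier_algebra A = {x. \<forall>a\<in>A. x * a \<in> A \<and> a * x \<in> A}"

text \<open>The antipode is the \<open>\<sigma>\<close>-strong\<open>\<^sup>*\<close> closed linear map with core \<open>{(id \<otimes> \<omega>)(W)}\<close> and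
  \<open>S((id \<otimes> \<omega>)(W)) = (id \<otimes> \<omega>)(W\<^sup>*)\<close>.  It is injective, and the domain of its inverse is its range.\<close>

definition antipode_graph :: "'i lcqg_data \<Rightarrow> ('i bop \<times> 'i bop) set" where
  "antipode_graph G = prod_topology sigma_strong_star sigma_strong_star closure_of
     {(slice_right \<omega> (W_op G), slice_right \<omega> (adj (W_op G))) | \<omega>. \<omega> \<in> predual}"

definition dom_S :: "'i lcqg_data \<Rightarrow> 'i bop set" where
  "dom_S G = Domain (antipode_graph G)"

definition dom_S_inv :: "'i lcqg_data \<Rightarrow> 'i bop set" where
  "dom_S_inv G = Range (antipode_graph G)"

definition periodic_elements :: "'i lcqg_data \<Rightarrow> 'i bop set" where
  "periodic_elements G = {x \<in> Linf G. Delta G x \<in> Linf G \<odot> Linf G}"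


section \<open>Admissible corepresentations\<close>

text \<open>An \<open>n \<times> n\<close> matrix is a function whose values at indices below \<open>n\<close> are the entries.\<close>

definition corepresentation :: "'i lcqg_data \<Rightarrow> nat \<Rightarrow> (nat \<Rightarrow> nat \<Rightarrow> 'i bop) \<Rightarrow> bool" where
  "corepresentation G n U \<longleftrightarrow> 0 < n \<and>
     (\<forall>i<n. \<forall>j<n. U i j \<in> multiplier_algebra (C0 G) \<and>
        Delta G (U i j) = (\<Sum>k<n. U i k \<otimes>\<^sub>o U k j))"

definition matrix_invertible :: "'i bop set \<Rightarrow> nat \<Rightarrow> (nat \<Rightarrow> nat \<Rightarrow> 'i bop) \<Rightarrow> bool" where
  "matrix_invertible A n U \<longleftrightarrow>
     (\<exists>V. (\<forall>i<n. \<forall>j<n. V i j \<in> A) \<and>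
        (\<forall>i<n. \<forall>j<n. (\<Sum>k<n. U i k * V k j) = (if i = j then 1 else 0)) \<and>
        (\<forall>i<n. \<forall>j<n. (\<Sum>k<n. V i k * U k j) = (if i = j then 1 else 0)))"

definition admissible :: "'i lcqg_data \<Rightarrow> nat \<Rightarrow> (nat \<Rightarrow> nat \<Rightarrow> 'i bop) \<Rightarrow> bool" where
  "admissible G n U \<longleftrightarrow> corepresentation G n U \<and>
     matrix_invertible (multiplier_algebra (C0 G)) n U \<and>
     matrix_invertible (multiplier_algebra (C0 G)) n (\<lambda>i j. U j i)"

definition matrix_elements :: "nat \<Rightarrow> (nat \<Rightarrow> nat \<Rightarrow> 'i bop) \<Rightarrow> 'i bop set" where
  "matrix_elements n U = cspan {U i j | i j. i < n \<and> j < n}"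

definition AP :: "'i lcqg_data \<Rightarrow> 'i bop set" where
  "AP G = {x. \<exists>n U. admissible G n U \<and> x \<in> matrix_elements n U}"

end

theory Submission
 imports Defs
begin

text \<open>
 Kustermans and Vaes: the regular representation \<open>W\<close> is a unitary with \<open>\<Delta>(m) = W\<^sup>*(1 \<otimes> m)W\<close>.  The
 antipode is controlled by pairs of vector functionals \<open>(\<rho>, \<theta>)\<close> with \<open>\<rho> = \<theta> \<circ> S\<close> on its core; the strong
 invariance of the two Haar weights yields enough of them to separate points.  They show that \<open>S\<close> is
 antimultiplicative, and that slicing \<open>\<Delta>(x)\<close> by such functionals preserves the domains of \<open>S\<close> and \<open>S\<^sup>-\<^sup>1\<close>.

 Let \<open>\<Delta>(x) = \<Sum> a\<^sub>i \<otimes> b\<^sub>i\<close> be minimal.  Coassociativity gives \<open>\<Delta>(b\<^sub>i) = \<Sum> u\<^sub>i\<^sub>j \<otimes> b\<^sub>j\<close> for a matrix \<open>u\<close> with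
 \<open>\<Delta>(u\<^sub>i\<^sub>j) = \<Sum> u\<^sub>i\<^sub>k \<otimes> u\<^sub>k\<^sub>j\<close>, and \<open>b\<^sub>i\<close>, \<open>u\<^sub>i\<^sub>j\<close> are linear combinations of slices, so they are in the domains of
 \<open>S\<close> and \<open>S\<^sup>-\<^sup>1\<close>.  Then \<open>S(u)\<close> is inverse to \<open>u\<close>, the transpose of \<open>S\<^sup>-\<^sup>1(u)\<close> is inverse to that of \<open>u\<close>, and
 \<open>S(u) b\<close> is scalar, so that \<open>b\<close> and hence \<open>x\<close> are in the span of \<open>u\<close>.  Finally,
 \<open>W(u \<otimes> 1) = (1 \<otimes> u)W(1 \<otimes> u\<^sup>-\<^sup>1)\<close> shows that \<open>u\<close> consists of right multipliers of \<open>C\<^sub>0(\<G>)\<close>; applied to the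
 adjoints of the entries, this makes them two-sided, and the inverses have entries in the same C*-algebra.
\<close>

text \<open>The antipode enters only as the closure of a core, and there is no counit to evaluate a
  coproduct. Both difficulties are met by testing. A relation S(m) = n is checked on quadruples of
  vectors for which the core identity holds; products, adjoints and slices are handled through such
  tests, which is conclusive only because the test functionals separate operators. Here the two
  weights meet: left invariance makes the adjoint of W isometric, right invariance makes W injective
  and produces the functionals, and an approximation result relating the two weights gives
  separation.

  The place of a counit is taken by S(z1) z2 \<otimes> z3 = 1 \<otimes> z and z2 S^-1(z1) \<otimes>
  z3 = 1 \<otimes> z, in Sweedler notation; slicing them yields membership in spans.

  Totality of the vectors on which W can be compared with \<Delta> rests on the closability of the
  map from \<open>\<Lambda> y\<close> to \<open>\<Lambda> (adj y)\<close>, which is proved with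
  resolvents in place of spectral calculus.\<close>

unbundle no vec_syntax
notation apply_bop (infixr \<open>$\<close> 70)
notation tensor_vec (infixr \<open>\<otimes>\<close> 70)
notation scaleC (infixr \<open>*C\<close> 75)
notation scaleR (infixr \<open>*R\<close> 75)
abbreviation "rslice \<equiv> vec_slice_right"
abbreviation "lslice \<equiv> vec_slice_left"
abbreviation "csubspace \<equiv> complex_vector.subspace"

section \<open>Hilbert space geometry of \<open>\<ell>\<^sup>2(I)\<close>\<close>

notation cinner (\<open>\<langle>_,/ _\<rangle>\<close>)

lemmas scaleC_simps [simp] = complex_vector.scale_zero_left complex_vector.scale_zero_right
 complex_vector.scale_one
lemmas scaleC_rules = complex_vector.scale_right_diff_distrib complex_vector.scale_left_diff_distrib
 scaleC_add_right scaleC_add_left complex_vector.scale_minus_left complex_vector.scale_minus_right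

lemma cinner_add_right: "\<langle>x, y + z\<rangle> = \<langle>x, y\<rangle> + \<langle>x, z\<rangle>"
 by (metis cinner_add_left cinner_commute complex_cnj_add)

lemma cinner_scaleC_left: "\<langle>c *C x, y\<rangle> = cnj c * \<langle>x, y\<rangle>"
 by transfer (simp add: mult.assoc infsum_cmult_right')

lemma cinner_scaleC_right: "\<langle>x, c *C y\<rangle> = c * \<langle>x, y\<rangle>"
 by (metis cinner_scaleC_left cinner_commute complex_cnj_mult complex_cnj_cnj)

lemma cinner_zero_left [simp]: "\<langle>0, y\<rangle> = 0"
 using cinner_scaleC_left[of 0 0 y] by simp

lemma cinner_zero_right [simp]: "\<langle>x, 0\<rangle> = 0"
 using cinner_scaleC_right[of x 0 0] by simp

lemma cinner_minus_left: "\<langle>- x, y\<rangle> = - \<langle>x, y\<rangle>"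
 using cinner_add_left[of x "- x" y] by (simp add: eq_neg_iff_add_eq_0 add.commute)

lemma cinner_minus_right: "\<langle>x, - y\<rangle> = - \<langle>x, y\<rangle>"
 using cinner_add_right[of x y "- y"] by (simp add: eq_neg_iff_add_eq_0 add.commute)

lemma cinner_diff_left: "\<langle>x - y, z\<rangle> = \<langle>x, z\<rangle> - \<langle>y, z\<rangle>"
 using cinner_add_left[of x "- y" z] by (simp add: cinner_minus_left)

lemma cinner_diff_right: "\<langle>x, y - z\<rangle> = \<langle>x, y\<rangle> - \<langle>x, z\<rangle>"
 using cinner_add_right[of x y "- z"] by (simp add: cinner_minus_right)

lemma cinner_sum_left: "\<langle>\<Sum>i\<in>A. f i, y\<rangle> = (\<Sum>i\<in>A. \<langle>f i, y\<rangle>)"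
 by (induction A rule: infinite_finite_induct) (auto simp: cinner_add_left)

lemma cinner_sum_right: "\<langle>x, \<Sum>i\<in>A. f i\<rangle> = (\<Sum>i\<in>A. \<langle>x, f i\<rangle>)"
 by (induction A rule: infinite_finite_induct) (auto simp: cinner_add_right)

lemmas ci_rules = cinner_add_left cinner_add_right cinner_diff_left cinner_diff_right
 cinner_minus_left cinner_minus_right cinner_scaleC_left cinner_scaleC_right

lemma cinner_norm: "\<langle>x, x\<rangle> = complex_of_real ((norm x)^2)"
 unfolding cinner_self norm_ell2_def by (simp add: infsum_nonneg)

lemma inner_eq_Re_cinner: "inner x y = Re \<langle>x, y\<rangle>" for x y :: "'i ell2"
 by (simp add: inner_ell2_def)

lemma cinner_ext: "(\<And>z. \<langle>z, x\<rangle> = \<langle>z, y\<rangle>) ==> x = y"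
proof -
 assume "\<And>z. \<langle>z, x\<rangle> = \<langle>z, y\<rangle>"
 then have "\<langle>x - y, x - y\<rangle> = 0" by (simp add: cinner_diff_right)
 then show ?thesis by (simp add: cinner_norm)
qed

lemma cauchy_schwarz: "cmod \<langle>x, y\<rangle> \<le> norm x * norm y"
proof (cases "\<langle>x, y\<rangle> = 0")
 case False
 define c where "c = cnj (\<langle>x, y\<rangle>) / cmod \<langle>x, y\<rangle>"
 have c: "cmod c = 1" using False by (simp add: c_def norm_divide)
 have "Re \<langle>x, c *C y\<rangle> = cmod \<langle>x, y\<rangle>"
 proof -
  have "\<langle>x, c *C y\<rangle> = \<langle>x, y\<rangle> * cnj (\<langle>x, y\<rangle>) / cmod \<langle>x, y\<rangle>"
   by (simp add: cinner_scaleC_right c_def)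
  also have "\<dots> = of_real (cmod \<langle>x, y\<rangle>)"
   using False by (simp add: complex_norm_square[symmetric] power2_eq_square)
  finally show ?thesis by simp
 qed
 moreover have "Re \<langle>x, c *C y\<rangle> \<le> norm x * norm (c *C y)"
  using norm_cauchy_schwarz[of x "c *C y"] by (simp add: inner_eq_Re_cinner)
 ultimately show ?thesis by (simp add: norm_scaleC_ell2 c)
qed simp

lemma scaleC_scaleR_commute: "c *C (r *R x) = r *R (c *C (x :: 'a :: complex_vector))"
 by (simp flip: scaleC_of_real add: scaleC_scaleC mult.commute)

lemma cinner_scaleR_right: "\<langle>x, r *R y\<rangle> = r * \<langle>x, y\<rangle>"
 by (simp flip: scaleC_of_real add: cinner_scaleC_right)

lemma bounded_linear_cinner_right: "bounded_linear (\<lambda>y. \<langle>x, y\<rangle>)"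
 by (rule bounded_linear_intro[where K = "norm x"])
  (use cauchy_schwarz[of x] in "auto simp: cinner_add_right cinner_scaleR_right scaleR_conv_of_real mult.commute")

lemma bounded_linear_cinner_left: "bounded_linear (\<lambda>x. \<langle>x, y\<rangle>)"
 by (rule bounded_linear_intro[where K = "norm y"])
  (use cauchy_schwarz in "auto simp: cinner_add_left cinner_scaleR_left scaleR_conv_of_real")

lemma bounded_linear_scaleC: "bounded_linear (\<lambda>x :: 'i ell2. c *C x)"
 by (rule bounded_linear_intro[where K = "cmod c"])
  (auto simp: scaleC_add_right scaleC_scaleR_commute norm_scaleC_ell2 mult.commute)

lemma tendsto_cinner_right [tendsto_intros]:
 "(f \<longlongrightarrow> a) F ==> ((\<lambda>n. \<langle>x, f n\<rangle>) \<longlongrightarrow> \<langle>x, a\<rangle>) F"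
 by (rule bounded_linear.tendsto[OF bounded_linear_cinner_right])

lemma tendsto_cinner_left [tendsto_intros]:
 "(f \<longlongrightarrow> a) F ==> ((\<lambda>n. \<langle>f n, x\<rangle>) \<longlongrightarrow> \<langle>a, x\<rangle>) F"
 by (rule bounded_linear.tendsto[OF bounded_linear_cinner_left])

lemma tendsto_scaleC_right [tendsto_intros]:
 "(f \<longlongrightarrow> a) F ==> ((\<lambda>n. c *C (f n :: 'i ell2)) \<longlongrightarrow> c *C a) F"
 by (rule bounded_linear.tendsto[OF bounded_linear_scaleC])

section \<open>Coordinates and completeness\<close>

lemma ell2_add_fun: "ell2_fun (x + y) i = ell2_fun x i + ell2_fun y i"
 by transfer simp
lemma ell2_diff_fun: "ell2_fun (x - y) i = ell2_fun x i - ell2_fun y i"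
 by transfer simp
lemma ell2_scaleC_fun: "ell2_fun (c *C x) i = c * ell2_fun x i"
 by transfer simp
lemma ell2_zero_fun: "ell2_fun 0 i = 0"
 by transfer simp
lemma ell2_summable: "(\<lambda>i. (cmod (ell2_fun x i))^2) summable_on UNIV"
 using ell2_fun[of x] by simp

lemma norm_ell2_sq: "(norm x)^2 = (\<Sum>\<^sub>\<infinity>i. (cmod (ell2_fun x i))^2)"
 unfolding norm_ell2_def by (simp add: infsum_nonneg)

lemma norm_ell2_has_sum: "((\<lambda>i. (cmod (ell2_fun x i))^2) has_sum (norm x)^2) UNIV"
 unfolding norm_ell2_sq by (rule has_sum_infsum[OF ell2_summable])

lemma ell2_ext: "(\<And>i. ell2_fun x i = ell2_fun y i) ==> x = y"
 by (simp add: ell2_fun_inject[symmetric] fun_eq_iff)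

lemma ell2_sum_le_norm: "finite F ==> (\<Sum>i\<in>F. (cmod (ell2_fun x i))^2) \<le> (norm x)^2"
 unfolding norm_ell2_sq by (rule finite_sum_le_infsum[OF ell2_summable]) auto

lemma ell2_fun_le_norm: "cmod (ell2_fun x i) \<le> norm x"
 by (rule power2_le_imp_le) (use ell2_sum_le_norm[of "{i}" x] in auto)

text \<open>Bounded finite square sums are all that membership requires; vectors known by their
  coordinates, such as limits, flips and amplified vectors, are produced from it.\<close>

lemma ell2_construct:
 assumes "\<And>F. finite F ==> (\<Sum>i\<in>F. (cmod (f i))^2) \<le> C"
 obtains x where "ell2_fun x = f" "(norm x)^2 \<le> C"
proof -
 have s: "(\<lambda>i. (cmod (f i))^2) summable_on UNIV"
  by (rule nonneg_bdd_above_summable_on) (use assms in "auto intro!: bdd_aboveI[where M = C]")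
 then have e: "ell2_fun (Abs_ell2 f) = f" by (simp add: Abs_ell2_inverse)
 have "(norm (Abs_ell2 f))^2 \<le> C"
  unfolding norm_ell2_sq e by (rule infsum_le_finite_sums[OF s]) (use assms in auto)
 with e that show ?thesis by blast
qed

instance ell2 :: (type) complete_space
proof
 fix X :: "nat => 'a ell2"
 assume X: "Cauchy X"
 have "convergent (\<lambda>n. ell2_fun (X n) i)" for i
 proof (rule Cauchy_convergent, rule metric_CauchyI)
  fix e :: real assume "0 < e"
  then obtain N where N: "\<And>m n. m \<ge> N ==> n \<ge> N ==> dist (X m) (X n) < e"
   using metric_CauchyD[OF X] by metis
  show "\<exists>N. \<forall>m\<ge>N. \<forall>n\<ge>N. dist (ell2_fun (X m) i) (ell2_fun (X n) i) < e"
  proof (intro exI allI impI)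
   fix m n assume "m \<ge> N" "n \<ge> N"
   with N[of m n] ell2_fun_le_norm[of "X m - X n" i]
   show "dist (ell2_fun (X m) i) (ell2_fun (X n) i) < e"
    by (simp add: dist_norm ell2_diff_fun)
  qed
 qed
 then obtain f where f: "\<And>i. (\<lambda>n. ell2_fun (X n) i) \<longlonglongrightarrow> f i"
  unfolding convergent_def by metis
 \<comment> \<open>The coordinatewise limit \<open>f\<close> is not yet known to be square summable.
   The differences to \<open>f\<close> are bounded over finite sets by letting \<open>m\<close> tend
   to infinity, so they are vectors, and \<open>f\<close> is recovered from one of them.\<close>
 have key: "\<exists>y. ell2_fun y = (\<lambda>i. ell2_fun (X n) i - f i) \<and> (norm y)^2 \<le> e\<^sup>2"
  if n: "\<And>m. m \<ge> N ==> dist (X n) (X m) < e" and e: "e > 0" for n N e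
 proof -
  have "(\<Sum>i\<in>F. (cmod (ell2_fun (X n) i - f i))^2) \<le> e\<^sup>2" if F: "finite F" for F
  proof (rule tendsto_upperbound)
   show "(\<lambda>m. \<Sum>i\<in>F. (cmod (ell2_fun (X n) i - ell2_fun (X m) i))^2)
     \<longlonglongrightarrow> (\<Sum>i\<in>F. (cmod (ell2_fun (X n) i - f i))^2)"
    by (intro tendsto_intros f)
   show "\<forall>\<^sub>F m in sequentially. (\<Sum>i\<in>F. (cmod (ell2_fun (X n) i - ell2_fun (X m) i))^2) \<le> e\<^sup>2"
   proof (rule eventually_sequentiallyI)
    fix m assume "m \<ge> N"
    then have "norm (X n - X m) < e" using n by (simp add: dist_norm)
    then have "(norm (X n - X m))^2 \<le> e\<^sup>2" by (intro power_mono) auto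
    with ell2_sum_le_norm[OF F, of "X n - X m"]
    show "(\<Sum>i\<in>F. (cmod (ell2_fun (X n) i - ell2_fun (X m) i))^2) \<le> e\<^sup>2"
     by (simp add: ell2_diff_fun)
   qed
  qed simp
  then obtain y where "ell2_fun y = (\<lambda>i. ell2_fun (X n) i - f i)" "(norm y)^2 \<le> e\<^sup>2"
   by (rule ell2_construct)
  then show ?thesis by blast
 qed
 obtain N1 where "\<And>m n. m \<ge> N1 ==> n \<ge> N1 ==> dist (X m) (X n) < 1"
  using metric_CauchyD[OF X, of 1] by auto
 then obtain y where y: "ell2_fun y = (\<lambda>i. ell2_fun (X N1) i - f i)"
  using key[of N1 N1 1] by auto
 define L where "L = X N1 - y"
 have L: "ell2_fun L i = f i" for i by (simp add: L_def ell2_diff_fun y)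
 have "X \<longlonglongrightarrow> L"
 proof (rule metric_LIMSEQ_I)
  fix e :: real assume e: "0 < e"
  then obtain N where N: "\<And>m n. m \<ge> N ==> n \<ge> N ==> dist (X m) (X n) < e / 2"
   using metric_CauchyD[OF X, of "e / 2"] by auto
  show "\<exists>no. \<forall>n\<ge>no. dist (X n) L < e"
  proof (intro exI allI impI)
   fix n assume n: "n \<ge> N"
   then obtain y where y: "ell2_fun y = (\<lambda>i. ell2_fun (X n) i - f i)" "(norm y)^2 \<le> (e/2)^2"
    using key[of N n "e / 2"] N e by auto
   have "y = X n - L" by (rule ell2_ext) (simp add: y ell2_diff_fun L)
   with y(2) e have "norm (X n - L) \<le> e / 2" using power2_le_imp_le[of "norm y" "e/2"] by simp
   with e show "dist (X n) L < e" by (simp add: dist_norm)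
  qed
 qed
 then show "convergent X" by (auto simp: convergent_def)
qed

instance ell2 :: (type) banach ..

section \<open>Orthogonal projections and the Riesz theorem\<close>

lemma orthogonal_decomposition:
 fixes S :: "'a :: {real_inner, complete_space} set"
 assumes S: "subspace S" "closed S"
 obtains s where "s \<in> S" "\<And>t. t \<in> S ==> inner (x - s) t = 0"
proof -
 define d where "d = (INF t\<in>S. (norm (x - t))^2)"
 have 0: "0 \<in> S" using S by (simp add: subspace_0)
 have bdd: "bdd_below ((\<lambda>t. (norm (x - t))^2) ` S)" by (auto intro!: bdd_belowI[where m = 0])
 have d: "d \<le> (norm (x - t))^2" if "t \<in> S" for t
  unfolding d_def using bdd that by (rule cINF_lower)
 have "\<exists>t\<in>S. (norm (x - t))^2 < d + 1 / Suc n" for n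
  using cINF_less_iff[of S "\<lambda>t. (norm (x - t))^2" "d + 1 / Suc n"] bdd 0
  by (auto simp: d_def)
 then obtain s where s: "\<And>n. s n \<in> S" "\<And>n. (norm (x - s n))^2 < d + 1 / Suc n" by metis
 \<comment> \<open>The parallelogram law for the midpoint of \<open>u\<close> and \<open>v\<close>,
   whose squared distance to \<open>x\<close> is at least \<open>d\<close>, makes minimizing
   sequences Cauchy. The setting of real inner products also covers the product space in which
   \<open>total_Fdomain\<close> projects.\<close>
 have par: "(norm (u - v))^2 \<le> 2 * (norm (x - u))^2 + 2 * (norm (x - v))^2 - 4 * d"
  if "u \<in> S" "v \<in> S" for u v
 proof -
  have "(1/2) *R (u + v) \<in> S" using S that by (simp add: subspace_add subspace_scale)
  from d[OF this] have "4 * d \<le> (norm (2 *R (x - (1/2) *R (u + v))))^2"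
   by (simp add: power_mult_distrib)
  also have "2 *R (x - (1/2) *R (u + v)) = (x - u) + (x - v)"
   by (simp add: algebra_simps scaleR_2)
  finally have "4 * d \<le> (norm ((x - u) + (x - v)))^2" .
  moreover have "(norm ((x - u) + (x - v)))^2 + (norm (u - v))^2
    = 2 * (norm (x - u))^2 + 2 * (norm (x - v))^2"
   by (simp add: power2_norm_eq_inner inner_simps inner_commute algebra_simps)
  ultimately show ?thesis by linarith
 qed
 have "Cauchy s"
 proof (rule metric_CauchyI)
  fix e :: real assume e: "0 < e"
  obtain N where N: "4 / Suc N < e\<^sup>2"
   using reals_Archimedean[of "e\<^sup>2 / 4"] e by (auto simp: field_simps)
  show "\<exists>N. \<forall>m\<ge>N. \<forall>n\<ge>N. dist (s m) (s n) < e"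
  proof (intro exI allI impI)
   fix m n assume mn: "m \<ge> N" "n \<ge> N"
   have "1 / Suc m \<le> 1 / Suc N" "1 / Suc n \<le> 1 / Suc N" using mn by (auto simp: frac_le)
   with par[of "s m" "s n"] s(1)[of m] s(1)[of n] s(2)[of m] s(2)[of n]
   have "(norm (s m - s n))^2 < e\<^sup>2" using N by simp
   then show "dist (s m) (s n) < e" using e power2_less_imp_less[of "norm (s m - s n)" e] by (simp add: dist_norm)
  qed
 qed
 then obtain l where l: "s \<longlonglongrightarrow> l" using Cauchy_convergent convergent_def by blast
 have lS: "l \<in> S" using S(2) s(1) l by (metis closed_sequentially)
 have ld: "(norm (x - l))^2 \<le> d"
 proof (rule LIMSEQ_le)
  show "(\<lambda>n. (norm (x - s n))^2) \<longlonglongrightarrow> (norm (x - l))^2" by (intro tendsto_intros l)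
  show "(\<lambda>n. d + 1 / Suc n) \<longlonglongrightarrow> d"
   using tendsto_add[OF tendsto_const LIMSEQ_inverse_real_of_nat, of d] by (simp add: inverse_eq_divide)
  show "\<exists>N. \<forall>n\<ge>N. (norm (x - s n))^2 \<le> d + 1 / Suc n" using s(2) less_imp_le by blast
 qed
 have "inner (x - l) t = 0" if t: "t \<in> S" for t
 proof (cases "t = 0")
  case False
  define r where "r = inner (x - l) t / inner t t"
  have "l + r *R t \<in> S" using S lS t by (simp add: subspace_add subspace_scale)
  from d[OF this] ld have "(norm (x - l))^2 \<le> (norm ((x - l) - r *R t))^2"
   unfolding diff_diff_eq by linarith
  also have "(norm (u - r *R t))^2 = (norm u)^2 - 2 * r * inner u t + r\<^sup>2 * inner t t" for u
   by (simp only: power2_norm_eq_inner) (simp add: inner_simps inner_commute power2_eq_square algebra_simps)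
  also have "(norm (x - l))^2 - 2 * r * inner (x - l) t + r\<^sup>2 * inner t t
    = (norm (x - l))^2 - (inner (x - l) t)^2 / inner t t"
   using False by (simp add: r_def field_simps power2_eq_square)
  finally have "(inner (x - l) t)^2 / inner t t \<le> 0" by simp
  moreover have "inner t t > 0" using False by simp
  ultimately have "(inner (x - l) t)^2 \<le> 0" by (simp add: divide_le_0_iff)
  then show ?thesis by simp
 qed simp
 with lS that show ?thesis by blast
qed

lemma riesz_real:
 fixes f :: "'a :: {real_inner, complete_space} => real"
 assumes f: "bounded_linear f"
 obtains t where "\<And>x. f x = inner t x"
proof (cases "\<forall>x. f x = 0")
 case True
 then show ?thesis using that[of 0] by simp
next
 case False
 then obtain x where x: "f x \<noteq> 0" by auto
 interpret bounded_linear f by fact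
 define S where "S = {y. f y = 0}"
 have "subspace S" by (auto simp: S_def subspace_def add scaleR zero)
 moreover have "closed S"
  unfolding S_def by (intro closed_Collect_eq continuous_intros bounded_linear.continuous_on[OF f])
 ultimately obtain s where s: "s \<in> S" "\<And>t. t \<in> S ==> inner (x - s) t = 0"
  using orthogonal_decomposition by metis
 define z where "z = x - s"
 have fz: "f z = f x" using s(1) by (simp add: z_def diff S_def)
 then have z: "z \<noteq> 0" using x zero by auto
 have "f y = inner ((f z / inner z z) *R z) y" for y
 proof -
  have "f z *R y - f y *R z \<in> S" by (simp add: S_def diff scaleR)
  from s(2)[OF this] have "f z * inner z y = f y * inner z z"
   by (simp add: z_def[symmetric] inner_diff_right)
  with z show ?thesis by (simp add: field_simps)
 qed
 then show ?thesis by (rule that)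
qed

text \<open>The real Riesz vector of the real part also represents the imaginary part, as Im F(x) =
  - Re F(i x).\<close>

lemma riesz_complex:
 fixes F :: "'i ell2 => complex"
 assumes add: "\<And>x y. F (x + y) = F x + F y" and sc: "\<And>c x. F (c *C x) = c * F x"
  and bd: "\<And>x. cmod (F x) \<le> C * norm x"
 obtains t where "\<And>x. F x = \<langle>t, x\<rangle>"
proof -
 have "bounded_linear (\<lambda>x. Re (F x))"
 proof (rule bounded_linear_intro[where K = C])
  show "Re (F (r *R x)) = r *R Re (F x)" for r x
   using sc[of "of_real r" x] by (simp add: scaleC_of_real)
  show "norm (Re (F x)) \<le> norm x * C" for x
   using bd[of x] abs_Re_le_cmod[of "F x"] by (simp add: mult.commute)
 qed (simp add: add)
 then obtain t where t: "\<And>x. Re (F x) = inner t x" using riesz_real by metis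
 have "F x = \<langle>t, x\<rangle>" for x
 proof (rule complex_eqI)
  show "Re (F x) = Re \<langle>t, x\<rangle>" using t by (simp add: inner_eq_Re_cinner)
  have "Re (F (\<i> *C x)) = Re \<langle>t, \<i> *C x\<rangle>" using t by (simp add: inner_eq_Re_cinner)
  then show "Im (F x) = Im \<langle>t, x\<rangle>" by (simp add: sc cinner_scaleC_right)
 qed
 then show ?thesis by (rule that)
qed

lemma csubspace_imp_subspace: "csubspace S ==> subspace (S :: 'i ell2 set)"
 unfolding subspace_def complex_vector.subspace_def by (metis scaleC_of_real)

lemma csubspace_closure:
 assumes "csubspace (S :: 'i ell2 set)"
 shows "csubspace (closure S)"
 unfolding complex_vector.subspace_def
proof (intro conjI ballI allI)
 show "0 \<in> closure S" using assms closure_subset complex_vector.subspace_0 by blast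
next
 fix x y assume "x \<in> closure S" "y \<in> closure S"
 then obtain f g where fg: "\<And>n. f n \<in> S" "f \<longlonglongrightarrow> x" "\<And>n. g n \<in> S" "g \<longlonglongrightarrow> y"
  by (auto simp: closure_sequential)
 then have "(\<lambda>n. f n + g n) \<longlonglongrightarrow> x + y" "\<And>n. f n + g n \<in> S"
  using assms by (auto intro: tendsto_add complex_vector.subspace_add)
 then show "x + y \<in> closure S"
  unfolding closure_sequential by (intro exI[of _ "\<lambda>n. f n + g n"]) auto
next
 fix x c assume "x \<in> closure S"
 then obtain f where f: "\<And>n. f n \<in> S" "f \<longlonglongrightarrow> x" by (auto simp: closure_sequential)
 have "(\<lambda>n. c *C f n) \<longlonglongrightarrow> c *C x" by (intro tendsto_intros f)
 moreover have "c *C f n \<in> S" for n using f assms complex_vector.subspace_scale by blast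
 ultimately show "c *C x \<in> closure S"
  unfolding closure_sequential by (intro exI[of _ "\<lambda>n. c *C f n"]) auto
qed

lemma cinner_decomposition:
 assumes S: "csubspace (S :: 'i ell2 set)" "closed S"
 obtains s where "s \<in> S" "\<And>t. t \<in> S ==> \<langle>t, x - s\<rangle> = 0"
proof -
 obtain s where s: "s \<in> S" "\<And>t. t \<in> S ==> inner (x - s) t = 0"
  using orthogonal_decomposition[OF csubspace_imp_subspace[OF S(1)] S(2), of x] by metis
 have "\<langle>x - s, t\<rangle> = 0" if t: "t \<in> S" for t
 proof (rule complex_eqI)
  show "Re \<langle>x - s, t\<rangle> = Re 0" using s(2)[OF t] by (simp add: inner_eq_Re_cinner)
  have "\<i> *C t \<in> S" using S t complex_vector.subspace_scale by blast
  from s(2)[OF this] show "Im \<langle>x - s, t\<rangle> = Im 0"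
   by (simp add: inner_eq_Re_cinner cinner_scaleC_right)
 qed
 then have "\<langle>t, x - s\<rangle> = 0" if "t \<in> S" for t using that by (metis cinner_commute complex_cnj_zero)
 with s(1) that show ?thesis by blast
qed

lemma closure_UNIV_if_orthogonal_trivial:
 assumes "csubspace (S :: 'i ell2 set)"
  and "\<And>z. (\<And>s. s \<in> S ==> \<langle>s, z\<rangle> = 0) ==> z = 0"
 shows "closure S = UNIV"
proof -
 have "x \<in> closure S" for x
 proof -
  obtain s where s: "s \<in> closure S" "\<And>t. t \<in> closure S ==> \<langle>t, x - s\<rangle> = 0"
   using cinner_decomposition[OF csubspace_closure[OF assms(1)] closed_closure, of x] by metis
  have "x - s = 0" by (rule assms(2)) (use s(2) closure_subset in blast)
  with s(1) show ?thesis by simp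
 qed
 then show ?thesis by auto
qed

section \<open>Total sets\<close>

definition total :: "'i ell2 set => bool" where
 "total S \<longleftrightarrow> (\<forall>z. (\<forall>s\<in>S. \<langle>s, z\<rangle> = 0) \<longrightarrow> z = 0)"

lemma totalD: "total S ==> (\<And>s. s \<in> S ==> \<langle>s, z\<rangle> = 0) ==> z = 0"
 by (auto simp: total_def)

lemma totalD': "total S ==> (\<And>s. s \<in> S ==> \<langle>z, s\<rangle> = 0) ==> z = 0"
 using totalD[of S z] by (metis cinner_commute complex_cnj_zero)

lemma total_closure: "closure S = UNIV ==> total S"
 unfolding total_def
proof (intro allI impI)
 fix z assume *: "closure S = UNIV" "\<forall>s\<in>S. \<langle>s, z\<rangle> = 0"
 then obtain f where f: "\<And>n. f n \<in> S" "f \<longlonglongrightarrow> z" by (metis UNIV_I closure_sequential)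
 then have "(\<lambda>n. \<langle>f n, z\<rangle>) \<longlonglongrightarrow> \<langle>z, z\<rangle>" by (intro tendsto_intros)
 moreover have "\<langle>f n, z\<rangle> = 0" for n using f * by blast
 ultimately have "\<langle>z, z\<rangle> = 0" by (simp add: LIMSEQ_const_iff)
 then show "z = 0" by (simp add: cinner_norm)
qed

text \<open>The vectors satisfying \<open>P\<close> form a closed subspace with trivial orthogonal
  complement. Identities between bounded maps are extended from convenient total sets in this
  way.\<close>

lemma total_induct:
 assumes S: "total S" and P: "csubspace {x. P x}" "closed {x. P x}"
  and "\<And>s. s \<in> S ==> P s"
 shows "P x"
proof -
 have "closure {x. P x} = UNIV"
  by (rule closure_UNIV_if_orthogonal_trivial[OF P(1)], rule totalD[OF S]) (use assms in auto)
 then show ?thesis using P(2) by (metis UNIV_I closure_closed mem_Collect_eq)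
qed

subsection \<open>Bounded complex linear maps\<close>

definition bcl :: "('i ell2 => 'j ell2) => bool" where
 "bcl T \<longleftrightarrow> bounded_linear T \<and> (\<forall>c x. T (c *C x) = c *C T x)"

lemma bclI:
 assumes "\<And>x y. T (x + y) = T x + T y" "\<And>c x. T (c *C x) = c *C T x"
  and "\<And>x. norm (T x) \<le> C * norm x"
 shows "bcl T"
 unfolding bcl_def
proof (intro conjI allI)
 show "bounded_linear T"
  by (rule bounded_linear_intro[where K = C])
   (use assms in "auto simp: mult.commute simp flip: scaleC_of_real")
qed (use assms in auto)

lemma bcl_bounded_linear: "bcl T ==> bounded_linear T" by (simp add: bcl_def)
lemma bcl_add: "bcl T ==> T (x + y) = T x + T y"
 by (simp add: bcl_def bounded_linear.axioms(1) linear_add bounded_linear.linear)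
lemma bcl_scaleC: "bcl T ==> T (c *C x) = c *C T x" by (simp add: bcl_def)
lemma bcl_diff: "bcl T ==> T (x - y) = T x - T y"
 by (simp add: bcl_def linear_diff bounded_linear.linear)
lemma bcl_zero: "bcl T ==> T 0 = 0"
 by (simp add: bcl_def linear_0 bounded_linear.linear)
lemma bcl_sum: "bcl T ==> T (\<Sum>i\<in>A. f i) = (\<Sum>i\<in>A. T (f i))"
 by (simp add: bcl_def linear_sum bounded_linear.linear)
lemma bcl_bound: "bcl T ==> \<exists>C\<ge>0. \<forall>x. norm (T x) \<le> C * norm x"
 using bounded_linear.nonneg_bounded[of T] by (auto simp: bcl_def mult.commute)
lemma bcl_tendsto: "bcl T ==> (f \<longlongrightarrow> a) F ==> ((\<lambda>n. T (f n)) \<longlongrightarrow> T a) F"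
 by (simp add: bcl_def bounded_linear.tendsto)

lemma bcl_bop [simp]: "bcl (apply_bop T)"
 using apply_bop[of T] by (simp add: bcl_def)

lemma bcl_comp: "bcl S ==> bcl T ==> bcl (\<lambda>x. S (T x))"
 by (auto simp: bcl_def intro: bounded_linear_compose)

lemma bcl_add_fun: "bcl S ==> bcl T ==> bcl (\<lambda>x. S x + T x)"
 by (auto simp: bcl_def scaleC_add_right intro: bounded_linear_add)

lemma bcl_diff_fun: "bcl S ==> bcl T ==> bcl (\<lambda>x. S x - T x)"
 by (auto simp: bcl_def scaleC_rules intro: bounded_linear_sub)

lemma bcl_scaleC_fun: "bcl S ==> bcl (\<lambda>x. c *C S x)"
 by (auto simp: bcl_def scaleC_scaleC mult.commute
   intro: bounded_linear_compose[OF bounded_linear_scaleC])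

lemma bcl_zero_fun: "bcl (\<lambda>x. 0)"
 by (auto simp: bcl_def)

lemma sesquilinear_to_bcl:
 fixes B :: "'j ell2 => 'i ell2 => complex"
 assumes addl: "\<And>x x' y. B (x + x') y = B x y + B x' y"
  and scl: "\<And>c x y. B (c *C x) y = cnj c * B x y"
  and addr: "\<And>x y y'. B x (y + y') = B x y + B x y'"
  and scr: "\<And>c x y. B x (c *C y) = c * B x y"
  and bd: "\<And>x y. cmod (B x y) \<le> C * norm x * norm y"
 obtains T where "bcl T" "\<And>x y. \<langle>x, T y\<rangle> = B x y" "\<And>y. norm (T y) \<le> C * norm y"
proof -
 have "\<exists>t. \<forall>x. B x y = \<langle>x, t\<rangle>" for y
 proof -
  obtain t where t: "\<And>x. cnj (B x y) = \<langle>t, x\<rangle>"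
  proof (rule riesz_complex[of "\<lambda>x. cnj (B x y)" "C * norm y"])
   show "cmod (cnj (B x y)) \<le> C * norm y * norm x" for x
    using bd[of x y] by (simp add: mult_ac)
  qed (auto simp: addl scl)
  have "B x y = \<langle>x, t\<rangle>" for x using t[of x] by (metis cinner_commute complex_cnj_cnj)
  then show ?thesis by blast
 qed
 then obtain T where T: "\<And>x y. B x y = \<langle>x, T y\<rangle>" by metis
 have n: "norm (T y) \<le> C * norm y" for y
 proof (cases "T y = 0")
  case True
  have "0 \<le> C * norm y" if "y \<noteq> 0"
  proof -
   obtain x :: "'j ell2" where x: "x \<noteq> 0" using ex_nonzero_ell2 by blast
   have "0 \<le> C * norm x * norm y" using bd[of x y] norm_ge_zero[of "B x y"] by linarith
   then have "0 \<le> (C * norm y) * norm x" by (simp add: mult_ac)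
   then show ?thesis using x by (simp add: zero_le_mult_iff)
  qed
  with True show ?thesis by (cases "y = 0") auto
 next
  case False
  have "(norm (T y))^2 = cmod (B (T y) y)" by (simp add: T cinner_norm norm_power)
  also have "\<dots> \<le> C * norm (T y) * norm y" by (rule bd)
  finally have "norm (T y) * norm (T y) \<le> norm (T y) * (C * norm y)"
   by (simp add: power2_eq_square mult_ac)
  then show ?thesis using False by simp
 qed
 have "bcl T"
 proof (rule bclI[OF _ _ n])
  show "T (x + y) = T x + T y" for x y
   by (rule cinner_ext) (simp add: T[symmetric] addr cinner_add_right)
  show "T (c *C x) = c *C T x" for c x
   by (rule cinner_ext) (simp add: T[symmetric] scr cinner_scaleC_right)
 qed
 then show ?thesis using that T n by metis
qed

text \<open>An adjoint for maps between different spaces, as contractions of tensor legs and the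
  columns below require; \<open>adj\<close> covers endomorphisms. The choice is meaningful for
  bounded maps.\<close>

definition Adj :: "('i ell2 => 'j ell2) => 'j ell2 => 'i ell2" where
 "Adj T = (SOME S. bcl S \<and> (\<forall>x y. \<langle>S x, y\<rangle> = \<langle>x, T y\<rangle>))"

lemma Adj_exists:
 assumes "bcl T"
 shows "\<exists>S. bcl S \<and> (\<forall>x y. \<langle>S x, y\<rangle> = \<langle>x, T y\<rangle>)"
proof -
 obtain C where C: "\<And>x. norm (T x) \<le> C * norm x" using bcl_bound[OF assms] by blast
 obtain S where S: "bcl S" "\<And>x y. \<langle>x, S y\<rangle> = \<langle>T x, y\<rangle>"
 proof (rule sesquilinear_to_bcl[of "\<lambda>x y. \<langle>T x, y\<rangle>" C])
  show "cmod \<langle>T x, y\<rangle> \<le> C * norm x * norm y" for x y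
   using cauchy_schwarz[of "T x" y] mult_right_mono[OF C[of x], of "norm y"] by simp
 qed (auto simp: bcl_add[OF assms] bcl_scaleC[OF assms] ci_rules)
 have "\<langle>S x, y\<rangle> = \<langle>x, T y\<rangle>" for x y
  using S(2)[of y x] by (metis cinner_commute)
 with S(1) show ?thesis by blast
qed

lemma bcl_Adj: "bcl T ==> bcl (Adj T)"
 and cinner_Adj_left: "bcl T ==> \<langle>Adj T x, y\<rangle> = \<langle>x, T y\<rangle>"
 using someI_ex[OF Adj_exists[of T]] unfolding Adj_def by auto

lemma cinner_Adj_right: "bcl T ==> \<langle>y, Adj T x\<rangle> = \<langle>T y, x\<rangle>"
 by (metis cinner_Adj_left cinner_commute)

lemma Adj_eqI: "bcl T ==> (\<And>x y. \<langle>S x, y\<rangle> = \<langle>x, T y\<rangle>) ==> Adj T = S"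
proof (rule ext)
 fix x assume *: "bcl T" "\<And>x y. \<langle>S x, y\<rangle> = \<langle>x, T y\<rangle>"
 show "Adj T x = S x"
  by (rule cinner_ext) (metis * cinner_Adj_left cinner_commute)
qed

section \<open>Bounded operators\<close>

lemma bop_ext: "(\<And>x. A $ x = B $ x) ==> A = B"
 by (metis apply_bop_inject ext)

lemma bop_cinner_ext: "(\<And>x y. \<langle>y, A $ x\<rangle> = \<langle>y, B $ x\<rangle>) ==> A = B"
 by (intro bop_ext cinner_ext)

lemmas apply_bop_simps [simp] = zero_bop.rep_eq one_bop.rep_eq plus_bop.rep_eq minus_bop.rep_eq
 uminus_bop.rep_eq times_bop.rep_eq scaleC_bop.rep_eq scaleR_bop.rep_eq

lemma apply_Abs_bop: "bcl T ==> Abs_bop T $ x = T x"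
 by (simp add: Abs_bop_inverse bcl_def)

lemma bop_add_right: "A $ (x + y) = A $ x + A $ y" by (rule bcl_add) simp
lemma bop_diff_right: "A $ (x - y) = A $ x - A $ y" by (rule bcl_diff) simp
lemma bop_scaleC_right: "A $ (c *C x) = c *C (A $ x)" by (rule bcl_scaleC) simp
lemma bop_zero_right [simp]: "A $ 0 = 0" by (rule bcl_zero) simp
lemma bop_sum_right: "A $ (\<Sum>i\<in>I. f i) = (\<Sum>i\<in>I. A $ f i)" by (rule bcl_sum) simp
lemma bop_tendsto: "(f \<longlongrightarrow> a) F ==> ((\<lambda>n. A $ f n) \<longlongrightarrow> A $ a) F"
 by (rule bcl_tendsto) simp
lemma bop_sum_left: "(\<Sum>i\<in>I. A i) $ x = (\<Sum>i\<in>I. A i $ x)"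
 by (induction I rule: infinite_finite_induct) auto

lemmas bop_rules = bop_add_right bop_diff_right bop_scaleC_right

lemma norm_bop: "norm (A $ x) \<le> norm A * norm x"
 unfolding norm_bop.rep_eq by (rule onorm[OF bcl_bounded_linear]) simp

lemma norm_bop_le: "0 \<le> C ==> (\<And>x. norm (A $ x) \<le> C * norm x) ==> norm A \<le> C"
 unfolding norm_bop.rep_eq by (rule onorm_bound)

lemma bop_tendsto_apply: "(A \<longlongrightarrow> B) F ==> ((\<lambda>n. A n $ x) \<longlongrightarrow> B $ x) F"
proof -
 have "bounded_linear (\<lambda>A. A $ x)"
  by (rule bounded_linear_intro[where K = "norm x"]) (auto simp: norm_bop)
 then show "(A \<longlongrightarrow> B) F ==> ((\<lambda>n. A n $ x) \<longlongrightarrow> B $ x) F"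
  by (rule bounded_linear.tendsto)
qed

lemma scaleC_bop_times_left [simp]: "(c *C A) * B = c *C (A * B :: 'i bop)"
 by (rule bop_ext) simp
lemma scaleC_bop_times_right [simp]: "A * (c *C B) = c *C (A * B :: 'i bop)"
 by (rule bop_ext) (simp add: bop_scaleC_right)

lemma norm_scaleC_bop: "norm (c *C A) = cmod c * norm (A :: 'i bop)"
proof -
 have le: "norm (c *C A) \<le> cmod c * norm A" for c and A :: "'i bop"
  by (rule norm_bop_le) (auto simp: norm_scaleC_ell2 mult.assoc intro: mult_left_mono norm_bop)
 show ?thesis
 proof (cases "c = 0")
  case False
  have "norm A = norm (inverse c *C c *C A)" using False by (simp add: scaleC_scaleC)
  also have "\<dots> \<le> inverse (cmod c) * norm (c *C A)" using le[of "inverse c" "c *C A"] unfolding norm_inverse .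
  finally have "cmod c * norm A \<le> norm (c *C A)" using False by (simp add: field_simps)
  with le[of c A] show ?thesis by simp
 qed simp
qed

lemma bounded_linear_scaleC_bop: "bounded_linear (\<lambda>x :: 'i bop. c *C x)"
 by (rule bounded_linear_intro[where K = "cmod c"])
  (auto simp: scaleC_add_right scaleC_scaleR_commute norm_scaleC_bop mult.commute)

subsection \<open>Adjoints\<close>

lemma adj_eq_Adj: "adj T = Abs_bop (Adj (apply_bop T))"
 unfolding adj_def
proof (rule the_equality)
 show "\<forall>x y. \<langle>Abs_bop (Adj (apply_bop T)) $ x, y\<rangle> = \<langle>x, T $ y\<rangle>"
  by (simp add: apply_Abs_bop bcl_Adj cinner_Adj_left)
next
 fix S assume "\<forall>x y. \<langle>S $ x, y\<rangle> = \<langle>x, T $ y\<rangle>"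
 then have "Adj (apply_bop T) = apply_bop S" by (intro Adj_eqI) auto
 then show "S = Abs_bop (Adj (apply_bop T))" by (simp add: apply_bop_inverse)
qed

lemma adj_left: "\<langle>adj T $ x, y\<rangle> = \<langle>x, T $ y\<rangle>"
 by (simp add: adj_eq_Adj apply_Abs_bop bcl_Adj cinner_Adj_left)

lemma adj_right: "\<langle>x, adj T $ y\<rangle> = \<langle>T $ x, y\<rangle>"
 by (metis adj_left cinner_commute)

lemma adj_eqI: "(\<And>x y. \<langle>S $ x, y\<rangle> = \<langle>x, T $ y\<rangle>) ==> adj T = S"
 by (rule bop_cinner_ext) (metis adj_left cinner_commute)

lemma adj_adj [simp]: "adj (adj T) = T"
 by (rule adj_eqI) (simp add: adj_right)
lemma adj_add [simp]: "adj (A + B) = adj A + adj B"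
 by (rule adj_eqI) (simp add: ci_rules adj_left)
lemma adj_diff [simp]: "adj (A - B) = adj A - adj B"
 by (rule adj_eqI) (simp add: ci_rules adj_left)
lemma adj_minus [simp]: "adj (- A) = - adj A"
 by (rule adj_eqI) (simp add: ci_rules adj_left)
lemma adj_scaleC [simp]: "adj (c *C A) = cnj c *C adj A"
 by (rule adj_eqI) (simp add: ci_rules adj_left)
lemma adj_scaleR [simp]: "adj (r *R A) = r *R adj A"
 by (rule adj_eqI) (simp add: cinner_scaleR_left cinner_scaleR_right adj_left)
lemma adj_times [simp]: "adj (A * B) = adj B * adj A"
 by (rule adj_eqI) (simp add: adj_left)
lemma adj_one [simp]: "adj 1 = 1"
 by (rule adj_eqI) simp
lemma adj_zero [simp]: "adj 0 = 0"
 by (rule adj_eqI) simp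
lemma adj_sum: "adj (\<Sum>i\<in>I. A i) = (\<Sum>i\<in>I. adj (A i))"
 by (induction I rule: infinite_finite_induct) auto
lemma norm_adj [simp]: "norm (adj A) = norm A"
proof -
 have le: "norm (adj A) \<le> norm A" for A :: "'i bop"
 proof (rule norm_bop_le)
  fix x
  have "(norm (adj A $ x))^2 = cmod \<langle>A $ adj A $ x, x\<rangle>"
   by (simp add: adj_right[symmetric] cinner_norm norm_power)
  also have "\<dots> \<le> norm (A $ adj A $ x) * norm x" by (rule cauchy_schwarz)
  also have "\<dots> \<le> (norm A * norm (adj A $ x)) * norm x" by (intro mult_right_mono norm_bop) auto
  finally have "norm (adj A $ x) * norm (adj A $ x) \<le> norm (adj A $ x) * (norm A * norm x)"
   by (simp add: power2_eq_square mult_ac)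
  then show "norm (adj A $ x) \<le> norm A * norm x"
   by (cases "norm (adj A $ x) = 0") auto
 qed simp
 from le[of A] le[of "adj A"] show ?thesis by simp
qed

lemma bounded_linear_adj: "bounded_linear (adj :: 'i bop => 'i bop)"
 by (rule bounded_linear_intro[where K = 1]) auto

lemma tendsto_adj [tendsto_intros]: "(f \<longlongrightarrow> a) F ==> ((\<lambda>n. adj (f n)) \<longlongrightarrow> adj a) F"
 by (rule bounded_linear.tendsto[OF bounded_linear_adj])

lemma tendsto_scaleC_bop [tendsto_intros]:
 "(f \<longlongrightarrow> a) F ==> ((\<lambda>n. c *C (f n :: 'i bop)) \<longlongrightarrow> c *C a) F"
 by (rule bounded_linear.tendsto[OF bounded_linear_scaleC_bop])

instance bop :: (type) complete_space
proof
 fix X :: "nat => 'a bop"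
 assume X: "Cauchy X"
 have "Cauchy (\<lambda>n. X n $ x)" for x
 proof (rule metric_CauchyI)
  fix e :: real assume e: "0 < e"
  define d where "d = e / (norm x + 1)"
  have d: "d > 0" "d * norm x < e" using e by (auto simp: d_def field_simps add_pos_nonneg add_nonneg_pos)
  obtain N where N: "\<And>m n. m \<ge> N ==> n \<ge> N ==> dist (X m) (X n) < d"
   using metric_CauchyD[OF X d(1)] by metis
  show "\<exists>N. \<forall>m\<ge>N. \<forall>n\<ge>N. dist (X m $ x) (X n $ x) < e"
  proof (intro exI allI impI)
   fix m n assume "m \<ge> N" "n \<ge> N"
   then have "norm (X m - X n) \<le> d" using N[of m n] by (simp add: dist_norm)
   have "dist (X m $ x) (X n $ x) = norm ((X m - X n) $ x)" by (simp add: dist_norm)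
   also have "\<dots> \<le> norm (X m - X n) * norm x" by (rule norm_bop)
   also have "\<dots> \<le> d * norm x" by (rule mult_right_mono) (fact, simp)
   finally show "dist (X m $ x) (X n $ x) < e" using d by simp
  qed
 qed
 then have "\<exists>l. (\<lambda>n. X n $ x) \<longlonglongrightarrow> l" for x
  using Cauchy_convergent unfolding convergent_def by blast
 then obtain L where L: "\<And>x. (\<lambda>n. X n $ x) \<longlonglongrightarrow> L x" by metis
 obtain C where C: "\<And>n. norm (X n) \<le> C"
  using Cauchy_Bseq[OF X] unfolding Bseq_def by blast
 have bL: "bcl L"
 proof (rule bclI)
  show "L (x + y) = L x + L y" for x y
   by (rule LIMSEQ_unique[OF L]) (simp add: bop_add_right tendsto_add L)
  show "L (c *C x) = c *C L x" for c x
   by (rule LIMSEQ_unique[OF L]) (simp add: bop_scaleC_right tendsto_scaleC_right L)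
  show "norm (L x) \<le> C * norm x" for x
  proof (rule LIMSEQ_le_const2[OF tendsto_norm[OF L]], intro exI allI impI)
   fix n :: nat
   have "norm (X n $ x) \<le> norm (X n) * norm x" by (rule norm_bop)
   also have "\<dots> \<le> C * norm x" by (rule mult_right_mono[OF C]) simp
   finally show "norm (X n $ x) \<le> C * norm x" .
  qed
 qed
 have "X \<longlonglongrightarrow> Abs_bop L"
 proof (rule metric_LIMSEQ_I)
  fix e :: real assume e: "0 < e"
  obtain N where N: "\<And>m n. m \<ge> N ==> n \<ge> N ==> dist (X m) (X n) < e/2"
   using metric_CauchyD[OF X, of "e/2"] e by auto
  show "\<exists>no. \<forall>n\<ge>no. dist (X n) (Abs_bop L) < e"
  proof (intro exI allI impI)
   fix n assume n: "n \<ge> N"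
   have "norm (X n - Abs_bop L) \<le> e/2"
   proof (rule norm_bop_le)
    fix x
    show "norm ((X n - Abs_bop L) $ x) \<le> e/2 * norm x"
    proof (rule LIMSEQ_le_const2)
     show "(\<lambda>m. norm (X n $ x - X m $ x)) \<longlonglongrightarrow> norm ((X n - Abs_bop L) $ x)"
      by (auto simp: apply_Abs_bop bL intro!: tendsto_intros L)
     show "\<exists>N. \<forall>m\<ge>N. norm (X n $ x - X m $ x) \<le> e/2 * norm x"
     proof (intro exI allI impI)
      fix m assume "m \<ge> N"
      then have "norm (X n - X m) \<le> e/2" using N[of n m] n by (simp add: dist_norm)
      then have "norm (X n - X m) * norm x \<le> e/2 * norm x" by (rule mult_right_mono) simp
      then show "norm (X n $ x - X m $ x) \<le> e/2 * norm x"
       using norm_bop[of "X n - X m" x] by simp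
     qed
    qed
   qed (use e in simp)
   then show "dist (X n) (Abs_bop L) < e" using e by (simp add: dist_norm)
  qed
 qed
 then show "convergent X" by (auto simp: convergent_def)
qed

instance bop :: (type) banach ..

lemma sesquilinear_to_bop:
 fixes B :: "'i ell2 => 'i ell2 => complex"
 assumes "\<And>x x' y. B (x + x') y = B x y + B x' y"
  and "\<And>c x y. B (c *C x) y = cnj c * B x y"
  and "\<And>x y y'. B x (y + y') = B x y + B x y'"
  and "\<And>c x y. B x (c *C y) = c * B x y"
  and "\<And>x y. cmod (B x y) \<le> C * norm x * norm y"
 obtains T where "\<And>x y. \<langle>x, T $ y\<rangle> = B x y" "\<And>y. norm (T $ y) \<le> C * norm y"
proof -
 obtain T where T: "bcl T" "\<And>x y. \<langle>x, T y\<rangle> = B x y" "\<And>y. norm (T y) \<le> C * norm y"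
  using sesquilinear_to_bcl[of B C] assms by metis
 with that[of "Abs_bop T"] show ?thesis by (simp add: apply_Abs_bop)
qed

definition gram :: "('i ell2 => 'j ell2) => ('i ell2 => 'j ell2) => 'i bop" where
 "gram A B = Abs_bop (\<lambda>x. Adj A (B x))"

lemma cinner_gram: "bcl A ==> bcl B ==> \<langle>x, gram A B $ y\<rangle> = \<langle>A x, B y\<rangle>"
 by (simp add: gram_def apply_Abs_bop bcl_comp bcl_Adj cinner_Adj_right)

lemma gram_eqI: "bcl A ==> bcl B ==> (\<And>x y. \<langle>x, T $ y\<rangle> = \<langle>A x, B y\<rangle>) ==> gram A B = T"
 by (rule bop_cinner_ext) (simp add: cinner_gram)

lemma gram_apply_bop: "gram (apply_bop A) (apply_bop B) = adj A * B"
 by (rule gram_eqI) (auto simp: adj_right)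

lemma adj_gram: "bcl A ==> bcl B ==> adj (gram A B) = gram B A"
 by (rule bop_cinner_ext) (metis adj_right cinner_gram cinner_commute)

lemma gram_add_left: "bcl A ==> bcl A' ==> bcl B ==> gram (\<lambda>x. A x + A' x) B = gram A B + gram A' B"
 by (rule gram_eqI) (auto simp: bcl_add_fun cinner_gram ci_rules)
lemma gram_add_right: "bcl A ==> bcl B ==> bcl B' ==> gram A (\<lambda>x. B x + B' x) = gram A B + gram A B'"
 by (rule gram_eqI) (auto simp: bcl_add_fun cinner_gram ci_rules)
lemma gram_diff_left: "bcl A ==> bcl A' ==> bcl B ==> gram (\<lambda>x. A x - A' x) B = gram A B - gram A' B"
 by (rule gram_eqI) (auto simp: bcl_diff_fun cinner_gram ci_rules)
lemma gram_diff_right: "bcl A ==> bcl B ==> bcl B' ==> gram A (\<lambda>x. B x - B' x) = gram A B - gram A B'"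
 by (rule gram_eqI) (auto simp: bcl_diff_fun cinner_gram ci_rules)
lemma gram_scaleC_right: "bcl A ==> bcl B ==> gram A (\<lambda>x. c *C B x) = c *C gram A B"
 by (rule gram_eqI) (auto simp: bcl_scaleC_fun cinner_gram ci_rules)
lemma gram_scaleC_left: "bcl A ==> bcl B ==> gram (\<lambda>x. c *C A x) B = cnj c *C gram A B"
 by (rule gram_eqI) (auto simp: bcl_scaleC_fun cinner_gram ci_rules)
subsection \<open>Positivity\<close>

abbreviation bop_le :: "'i bop => 'i bop => bool" (infix \<open>\<preceq>\<close> 50) where
 "A \<preceq> B \<equiv> pos_op (B - A)"

lemma pos_op_real: "pos_op A ==> \<langle>x, A $ x\<rangle> = of_real (Re \<langle>x, A $ x\<rangle>)"
 and pos_op_nonneg: "pos_op A ==> 0 \<le> Re \<langle>x, A $ x\<rangle>"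
 by (auto simp: pos_op_def nonneg_Reals_def complex_eq_iff)

lemma pos_op_gram [simp]: "bcl A ==> pos_op (gram A A)"
 by (simp add: pos_op_def cinner_gram cinner_norm)

lemma pos_op_adj_times [simp]: "pos_op (adj A * A)"
 by (simp add: gram_apply_bop[symmetric])

lemma pos_op_zero [simp]: "pos_op 0" by (simp add: pos_op_def)
lemma pos_op_one [simp]: "pos_op 1" by (simp add: pos_op_def cinner_norm)

lemma pos_op_add: "pos_op A ==> pos_op B ==> pos_op (A + B)"
 by (auto simp: pos_op_def ci_rules nonneg_Reals_add_I)
lemma pos_op_scaleR: "pos_op A ==> 0 \<le> r ==> pos_op (r *R A)"
 by (auto simp: pos_op_def cinner_scaleR_right nonneg_Reals_mult_I)
lemma pos_op_sum: "(\<And>i. i \<in> I ==> pos_op (A i)) ==> pos_op (\<Sum>i\<in>I. A i)"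
 by (induction I rule: infinite_finite_induct) (auto intro: pos_op_add)

lemma pos_op_conj: "pos_op A ==> pos_op (adj B * A * B)"
 unfolding pos_op_def by (simp add: adj_right)

text \<open>Polarization over the complex field: replacing y by i y turns the vanishing of the
  symmetric part into that of the antisymmetric part.\<close>

lemma cinner_zero_if_quadratic_zero:
 assumes "\<And>x. \<langle>x, A $ x\<rangle> = 0" shows "A = 0"
proof (rule bop_cinner_ext)
 fix x y
 have 1: "\<langle>y, A $ x\<rangle> + \<langle>x, A $ y\<rangle> = 0" for x y
  using assms[of "x + y"] assms[of x] assms[of y] by (simp add: bop_rules ci_rules add.commute)
 have "\<i> * (\<langle>y, A $ x\<rangle> - \<langle>x, A $ y\<rangle>) = 0"
  using 1[of y "\<i> *C x"] by (simp add: bop_rules ci_rules algebra_simps)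
 then show "\<langle>y, A $ x\<rangle> = \<langle>y, 0 $ x\<rangle>" using 1[of y x] by simp
qed

lemma pos_op_adj: "pos_op A ==> adj A = A"
proof -
 assume A: "pos_op A"
 have "\<langle>x, adj A $ x\<rangle> = \<langle>x, A $ x\<rangle>" for x
  using pos_op_real[OF A, of x] by (metis adj_right cinner_commute complex_cnj_complex_of_real)
 then have "adj A - A = 0" by (intro cinner_zero_if_quadratic_zero) (simp add: ci_rules)
 then show ?thesis by simp
qed

lemma bop_le_trans: "A \<preceq> B ==> B \<preceq> C ==> A \<preceq> C"
 using pos_op_add[of "B - A" "C - B"] by simp

lemma bop_le_iff:
 assumes "adj A = A" "adj B = B"
 shows "A \<preceq> B \<longleftrightarrow> (\<forall>x. Re \<langle>x, A $ x\<rangle> \<le> Re \<langle>x, B $ x\<rangle>)"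
proof -
 have "Im \<langle>x, (B - A) $ x\<rangle> = 0" for x
 proof -
  have "cnj \<langle>x, (B - A) $ x\<rangle> = \<langle>x, (B - A) $ x\<rangle>"
   by (metis adj_diff assms adj_right cinner_commute)
  then show ?thesis by (metis cnj.simps(2) neg_equal_zero)
 qed
 then show ?thesis
  unfolding pos_op_def by (auto simp: complex_nonneg_Reals_iff ci_rules)
qed

lemma pos_op_cauchy_schwarz:
 assumes A: "pos_op A"
 shows "(cmod \<langle>x, A $ y\<rangle>)^2 \<le> Re \<langle>x, A $ x\<rangle> * Re \<langle>y, A $ y\<rangle>"
proof -
 define a b c where "a = Re \<langle>x, A $ x\<rangle>" and "b = Re \<langle>y, A $ y\<rangle>" and "c = cmod \<langle>x, A $ y\<rangle>"
 define u where "u = (if c = 0 then 1 else cnj \<langle>x, A $ y\<rangle> / c)"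
 have cu: "u * \<langle>x, A $ y\<rangle> = c" "cmod u = 1"
  by (auto simp: u_def c_def norm_divide complex_norm_square[symmetric] power2_eq_square mult.commute)
 have yx: "\<langle>y, A $ x\<rangle> = cnj \<langle>x, A $ y\<rangle>"
  by (metis A adj_right cinner_commute pos_op_adj)
 have "cnj u * \<langle>y, A $ x\<rangle> = c" using arg_cong[OF cu(1), of cnj] by (simp add: yx)
 moreover have "u * cnj u = 1" using cu(2) by (simp add: complex_norm_square[symmetric])
 ultimately have e: "Re \<langle>of_real r *C x + (of_real s * u) *C y, A $ (of_real r *C x + (of_real s * u) *C y)\<rangle>
   = r\<^sup>2 * a + 2 * r * s * c + s\<^sup>2 * b" for r s :: real
 proof -
  have "\<langle>of_real r *C x + (of_real s * u) *C y, A $ (of_real r *C x + (of_real s * u) *C y)\<rangle>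
   = of_real (r\<^sup>2) * \<langle>x, A $ x\<rangle> + of_real (r * s) * (u * \<langle>x, A $ y\<rangle>)
    + of_real (r * s) * (cnj u * \<langle>y, A $ x\<rangle>) + of_real (s\<^sup>2) * (u * cnj u) * \<langle>y, A $ y\<rangle>"
   by (simp add: bop_rules ci_rules algebra_simps power2_eq_square)
  then show ?thesis
   using \<open>cnj u * \<langle>y, A $ x\<rangle> = c\<close> \<open>u * cnj u = 1\<close> cu(1) by (simp add: a_def b_def)
 qed
 \<comment> \<open>In the degenerate case a = 0, the choice r = -(b + 1) / (2 c), s = 1 would give
   the value -1; otherwise r = -c, s = a gives a (a b - c^2).\<close>
 have q: "0 \<le> r\<^sup>2 * a + 2 * r * s * c + s\<^sup>2 * b" for r s :: real
  using pos_op_nonneg[OF A] e by metis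
 have "a \<ge> 0" "b \<ge> 0" unfolding a_def b_def by (rule pos_op_nonneg[OF A])+
 have "c\<^sup>2 \<le> a * b"
 proof (cases "a = 0")
  case True
  have "c = 0"
  proof (rule ccontr)
   assume "c \<noteq> 0"
   then have "c > 0" by (simp add: c_def)
   from q[of "- (b + 1) / (2 * c)" 1] True \<open>c > 0\<close> show False by (simp add: field_simps)
  qed
  with True show ?thesis by simp
 next
  case False
  then have "a > 0" using \<open>a \<ge> 0\<close> by simp
  have "0 \<le> a * (a * b - c\<^sup>2)" using q[of "-c" a] by (simp add: algebra_simps power2_eq_square)
  then show ?thesis using \<open>a > 0\<close> by (simp add: zero_le_mult_iff)
 qed
 then show ?thesis by (simp add: a_def b_def c_def)
qed

text \<open>Cauchy-Schwarz for the form of \<open>A\<close> at A x and x gives |A x|^4 \<le> c |A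
  x|^2 <x, A x>; this is A^2 \<le> c A.\<close>

lemma pos_op_norm_sq_le:
 assumes A: "pos_op A" and c: "\<And>x. Re \<langle>x, A $ x\<rangle> \<le> c * (norm x)^2"
 shows "(norm (A $ x))^2 \<le> c * Re \<langle>x, A $ x\<rangle>"
proof (cases "A $ x = 0")
 case False
 let ?n = "(norm (A $ x))^2"
 have "?n\<^sup>2 = (cmod \<langle>A $ x, A $ x\<rangle>)^2" by (simp add: cinner_norm norm_power)
 also have "\<dots> \<le> Re \<langle>A $ x, A $ A $ x\<rangle> * Re \<langle>x, A $ x\<rangle>" by (rule pos_op_cauchy_schwarz[OF A])
 also have "\<dots> \<le> (c * ?n) * Re \<langle>x, A $ x\<rangle>"
  by (rule mult_right_mono[OF c pos_op_nonneg[OF A]])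
 finally have "?n * ?n \<le> ?n * (c * Re \<langle>x, A $ x\<rangle>)" by (simp add: power2_eq_square mult_ac)
 moreover have "0 < ?n" using False by simp
 ultimately show ?thesis by (metis mult_le_cancel_left_pos)
qed simp

lemma adj_times_le: "adj (A * B) * (A * B) \<preceq> (norm A)^2 *R (adj B * B)"
proof -
 have "(norm (A $ B $ x))^2 \<le> (norm A)^2 * (norm (B $ x))^2" for x
  using power_mono[OF norm_bop[of A "B $ x"], of 2] by (simp add: power_mult_distrib)
 then show ?thesis
  by (subst bop_le_iff)
   (auto simp: adj_right cinner_norm cinner_scaleR_right)
qed

section \<open>Tensor products\<close>

lift_definition ket :: "'i => 'i ell2" is "\<lambda>i j. if j = i then 1 else 0"
proof -
 fix i :: 'i
 show "(\<lambda>j. (cmod (if j = i then 1 else 0))^2) summable_on UNIV"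
  by (rule summable_on_cong_neutral[THEN iffD1, OF _ _ _ summable_on_finite[of "{i}"]]) auto
qed

lemma cinner_ket: "\<langle>ket i, x\<rangle> = ell2_fun x i"
proof -
 have "\<langle>ket i, x\<rangle> = (\<Sum>\<^sub>\<infinity>j. cnj (ell2_fun (ket i) j) * ell2_fun x j)" by (rule cinner.rep_eq)
 also have "\<dots> = (\<Sum>\<^sub>\<infinity>j\<in>{i}. cnj (ell2_fun (ket i) j) * ell2_fun x j)"
  by (rule infsum_cong_neutral) (auto simp: ket.rep_eq)
 also have "\<dots> = ell2_fun x i" by (simp add: ket.rep_eq)
 finally show ?thesis .
qed

lemma norm_ket [simp]: "norm (ket i) = 1"
proof -
 have "complex_of_real ((norm (ket i))^2) = 1"
  by (simp only: cinner_norm[symmetric] cinner_ket) (simp add: ket.rep_eq)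
 then have "(norm (ket i))^2 = 1" using of_real_eq_1_iff by blast
 then show ?thesis by (simp add: power2_eq_1_iff) (metis norm_ge_zero neg_0_le_iff_le not_one_le_zero)
qed

lemma cinner_ket_ket: "\<langle>ket i, ket j\<rangle> = (if i = j then 1 else 0)"
 by (simp add: cinner_ket ket.rep_eq)

lemma total_ket: "total (range ket)"
 by (auto simp: total_def cinner_ket intro!: ell2_ext simp: ell2_zero_fun)

text \<open>Orthogonality and \<open>comp\<close> give |sum_F v - x|^2 = |x|^2 - sum_F |v|^2, so the
  condition on square sums is exactly convergence.\<close>

lemma orthogonal_has_sum:
 fixes v :: "'k => 'i ell2"
 assumes orth: "\<And>k l. k \<noteq> l ==> \<langle>v k, v l\<rangle> = 0"
  and comp: "\<And>k. \<langle>v k, x\<rangle> = of_real ((norm (v k))^2)"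
  and sum: "((\<lambda>k. (norm (v k))^2) has_sum (norm x)^2) UNIV"
 shows "(v has_sum x) UNIV"
 unfolding has_sum_def
proof (rule tendsto_norm_zero_cancel[THEN Lim_null[THEN iffD2]])
 have n: "(norm (sum v F - x))^2 = (norm x)^2 - (\<Sum>k\<in>F. (norm (v k))^2)" if "finite F" for F
 proof -
  have xv: "\<langle>x, v k\<rangle> = of_real ((norm (v k))^2)" for k
   using comp[of k] by (metis cinner_commute complex_cnj_complex_of_real)
  have "\<langle>sum v F, sum v F\<rangle> = (\<Sum>k\<in>F. \<Sum>l\<in>F. \<langle>v k, v l\<rangle>)"
   by (simp only: cinner_sum_left cinner_sum_right) (rule sum.swap)
  also have "\<dots> = (\<Sum>k\<in>F. \<Sum>l\<in>F. if k = l then of_real ((norm (v k))^2) else 0)"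
   by (intro sum.cong refl) (auto simp: orth cinner_norm)
  also have "\<dots> = (\<Sum>k\<in>F. of_real ((norm (v k))^2))" using that by simp
  finally have vv: "\<langle>sum v F, sum v F\<rangle> = (\<Sum>k\<in>F. of_real ((norm (v k))^2))" .
  have "complex_of_real ((norm (sum v F - x))^2) = \<langle>sum v F - x, sum v F - x\<rangle>"
   by (rule cinner_norm[symmetric])
  also have "\<dots> = \<langle>x, x\<rangle> - (\<Sum>k\<in>F. of_real ((norm (v k))^2))"
   by (simp only: cinner_diff_left cinner_diff_right vv) (simp add: cinner_sum_left cinner_sum_right comp xv)
  also have "\<dots> = complex_of_real ((norm x)^2 - (\<Sum>k\<in>F. (norm (v k))^2))"
   by (simp add: cinner_norm)
  finally show ?thesis using of_real_eq_iff by blast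
 qed
 have "((\<lambda>F. (norm x)^2 - (\<Sum>k\<in>F. (norm (v k))^2)) \<longlongrightarrow> (norm x)^2 - (norm x)^2) (finite_subsets_at_top UNIV)"
  using sum unfolding has_sum_def by (intro tendsto_intros)
 then have "((\<lambda>F. (norm (sum v F - x))^2) \<longlongrightarrow> (norm x)^2 - (norm x)^2) (finite_subsets_at_top UNIV)"
  by (rule Lim_transform_eventually) (rule eventually_finite_subsets_at_top_weakI, simp add: n)
 then have "((\<lambda>F. (norm (sum v F - x))^2) \<longlongrightarrow> 0) (finite_subsets_at_top UNIV)" by simp
 then have "((\<lambda>F. sqrt ((norm (sum v F - x))^2)) \<longlongrightarrow> sqrt 0) (finite_subsets_at_top UNIV)"
  by (rule tendsto_real_sqrt)
 then show "((\<lambda>F. norm (sum v F - x)) \<longlongrightarrow> 0) (finite_subsets_at_top UNIV)" by simp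
qed

subsection \<open>Elementary tensors\<close>

lemma tensor_vec_fun: "ell2_fun (x \<otimes> y) (i, j) = ell2_fun x i * ell2_fun y j"
 by (simp add: tensor_vec.rep_eq)

lemma tensor_vec_add_left: "(x + x') \<otimes> y = x \<otimes> y + x' \<otimes> y"
 by (rule ell2_ext) (auto simp: tensor_vec_fun ell2_add_fun algebra_simps split: prod.splits)
lemma tensor_vec_add_right: "x \<otimes> (y + y') = x \<otimes> y + x \<otimes> y'"
 by (rule ell2_ext) (auto simp: tensor_vec_fun ell2_add_fun algebra_simps split: prod.splits)
lemma tensor_vec_scaleC_left: "(c *C x) \<otimes> y = c *C (x \<otimes> y)"
 by (rule ell2_ext) (auto simp: tensor_vec_fun ell2_scaleC_fun algebra_simps split: prod.splits)
lemma tensor_vec_scaleC_right: "x \<otimes> (c *C y) = c *C (x \<otimes> y)"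
 by (rule ell2_ext) (auto simp: tensor_vec_fun ell2_scaleC_fun algebra_simps split: prod.splits)

lemma ket_pair: "ket (i, j) = ket i \<otimes> ket j"
 by (rule ell2_ext) (auto simp: tensor_vec_fun ket.rep_eq split: prod.splits if_splits)

lemma norm_tensor_vec: "norm (x \<otimes> y) = norm x * norm y"
proof -
 have "((\<lambda>ij. (cmod (ell2_fun (x \<otimes> y) ij))^2) has_sum (norm (x \<otimes> y))^2) (SIGMA i:UNIV. UNIV)"
  using norm_ell2_has_sum[of "x \<otimes> y"] by simp
 then have "((\<lambda>i. (cmod (ell2_fun x i))^2 * (norm y)^2) has_sum (norm (x \<otimes> y))^2) UNIV"
  by (rule has_sum_Sigma')
   (auto simp: tensor_vec_fun norm_mult power_mult_distrib intro!: has_sum_cmult_right norm_ell2_has_sum)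
 moreover have "((\<lambda>i. (cmod (ell2_fun x i))^2 * (norm y)^2) has_sum (norm x)^2 * (norm y)^2) UNIV"
  by (intro has_sum_cmult_left norm_ell2_has_sum)
 ultimately have "(norm (x \<otimes> y))^2 = (norm x * norm y)^2"
  unfolding power_mult_distrib by (rule has_sum_unique)
 then show ?thesis by simp
qed

lemma bcl_tensor_left: "bcl (\<lambda>x. x \<otimes> y)"
 by (rule bclI[where C = "norm y"])
  (auto simp: tensor_vec_add_left tensor_vec_scaleC_left norm_tensor_vec)
lemma bcl_tensor_right: "bcl (\<lambda>y. x \<otimes> y)"
 by (rule bclI[where C = "norm x"])
  (auto simp: tensor_vec_add_right tensor_vec_scaleC_right norm_tensor_vec)

lemma tensor_vec_zero [simp]: "0 \<otimes> y = 0" "x \<otimes> 0 = 0"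
 using bcl_zero[OF bcl_tensor_left] bcl_zero[OF bcl_tensor_right] by auto

lemma tensor_vec_diff_left: "(x - x') \<otimes> y = x \<otimes> y - x' \<otimes> y"
 by (rule bcl_diff[OF bcl_tensor_left])
lemma tensor_vec_diff_right: "x \<otimes> (y - y') = x \<otimes> y - x \<otimes> y'"
 by (rule bcl_diff[OF bcl_tensor_right])

lemmas tensor_vec_rules = tensor_vec_add_left tensor_vec_add_right tensor_vec_diff_left
 tensor_vec_diff_right tensor_vec_scaleC_left tensor_vec_scaleC_right

lemma cinner_tensor: "\<langle>x \<otimes> y, x' \<otimes> y'\<rangle> = \<langle>x, x'\<rangle> * \<langle>y, y'\<rangle>"
proof -
 have 1: "\<langle>x \<otimes> y, ket i \<otimes> ket j\<rangle> = \<langle>x, ket i\<rangle> * \<langle>y, ket j\<rangle>" for i j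
  unfolding ket_pair[symmetric]
  by (subst (1 2 3) cinner_commute) (simp add: cinner_ket tensor_vec_fun)
 have 2: "\<langle>x \<otimes> y, ket i \<otimes> y'\<rangle> = \<langle>x, ket i\<rangle> * \<langle>y, y'\<rangle>" for i
 proof (rule total_induct[OF total_ket, where P = "\<lambda>y'. \<langle>x \<otimes> y, ket i \<otimes> y'\<rangle> = \<langle>x, ket i\<rangle> * \<langle>y, y'\<rangle>"])
  show "closed {y'. \<langle>x \<otimes> y, ket i \<otimes> y'\<rangle> = \<langle>x, ket i\<rangle> * \<langle>y, y'\<rangle>}"
   by (intro closed_Collect_eq continuous_intros bounded_linear.continuous_on[OF bounded_linear_cinner_right]
     bounded_linear.continuous_on[OF bcl_bounded_linear[OF bcl_tensor_right]])
 qed (auto simp: complex_vector.subspace_def tensor_vec_rules ci_rules distrib_left 1)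
 show ?thesis
 proof (rule total_induct[OF total_ket, where P = "\<lambda>x'. \<langle>x \<otimes> y, x' \<otimes> y'\<rangle> = \<langle>x, x'\<rangle> * \<langle>y, y'\<rangle>"])
  show "closed {x'. \<langle>x \<otimes> y, x' \<otimes> y'\<rangle> = \<langle>x, x'\<rangle> * \<langle>y, y'\<rangle>}"
   by (intro closed_Collect_eq continuous_intros bounded_linear.continuous_on[OF bounded_linear_cinner_right]
     bounded_linear.continuous_on[OF bcl_bounded_linear[OF bcl_tensor_left]])
 qed (auto simp: complex_vector.subspace_def tensor_vec_rules ci_rules distrib_right 2)
qed

text \<open>Contraction of one leg: \<open>cl x \<Omega> = (x\<^sup>* \<otimes> 1)\<Omega>\<close> and \<open>cr y \<Omega> = (1 \<otimes> y\<^sup>*)\<Omega>\<close>.\<close>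

definition cl :: "'j ell2 => ('j \<times> 'i) ell2 => 'i ell2" where
 "cl x = Adj (\<lambda>y. x \<otimes> y)"

definition cr :: "'i ell2 => ('j \<times> 'i) ell2 => 'j ell2" where
 "cr y = Adj (\<lambda>x. x \<otimes> y)"

lemma bcl_cl [simp]: "bcl (cl x)" and bcl_cr [simp]: "bcl (cr y)"
 unfolding cl_def cr_def by (rule bcl_Adj, rule bcl_tensor_right bcl_tensor_left)+

lemma cinner_cl_right: "\<langle>y, cl x W\<rangle> = \<langle>x \<otimes> y, W\<rangle>"
 unfolding cl_def by (rule cinner_Adj_right[OF bcl_tensor_right])
lemma cinner_cr_right: "\<langle>x, cr y W\<rangle> = \<langle>x \<otimes> y, W\<rangle>"
 unfolding cr_def by (rule cinner_Adj_right[OF bcl_tensor_left])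
lemma cinner_cl_left: "\<langle>cl x W, y\<rangle> = \<langle>W, x \<otimes> y\<rangle>"
 unfolding cl_def by (rule cinner_Adj_left[OF bcl_tensor_right])
lemma cinner_cr_left: "\<langle>cr y W, x\<rangle> = \<langle>W, x \<otimes> y\<rangle>"
 unfolding cr_def by (rule cinner_Adj_left[OF bcl_tensor_left])

lemma cl_tensor [simp]: "cl x (x' \<otimes> y) = \<langle>x, x'\<rangle> *C y"
 by (rule cinner_ext) (simp add: cinner_cl_right cinner_tensor ci_rules)
lemma cr_tensor [simp]: "cr y (x \<otimes> y') = \<langle>y, y'\<rangle> *C x"
 by (rule cinner_ext) (simp add: cinner_cr_right cinner_tensor ci_rules)

lemma cl_rules: "cl x (W + W') = cl x W + cl x W'" "cl x (W - W') = cl x W - cl x W'"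
  "cl x (c *C W) = c *C cl x W" "cl x 0 = 0"
  "cl (x + x') W = cl x W + cl x' W" "cl (c *C x) W = cnj c *C cl x W" "cl (x - x') W = cl x W - cl x' W"
  "cl 0 W = 0"
 by (auto simp: bcl_add bcl_diff bcl_scaleC bcl_zero)
  (rule cinner_ext, simp add: cinner_cl_right tensor_vec_rules ci_rules)+

lemma cr_rules: "cr x (W + W') = cr x W + cr x W'" "cr x (W - W') = cr x W - cr x W'"
  "cr x (c *C W) = c *C cr x W" "cr x 0 = 0"
  "cr (x + x') W = cr x W + cr x' W" "cr (c *C x) W = cnj c *C cr x W" "cr (x - x') W = cr x W - cr x' W"
  "cr 0 W = 0"
 by (auto simp: bcl_add bcl_diff bcl_scaleC bcl_zero)
  (rule cinner_ext, simp add: cinner_cr_right tensor_vec_rules ci_rules)+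

lemma norm_cl: "norm (cl x W) \<le> norm x * norm W"
proof -
 have "(norm (cl x W))^2 = cmod \<langle>x \<otimes> cl x W, W\<rangle>"
  by (simp add: cinner_cl_right[symmetric] cinner_norm norm_power)
 also have "\<dots> \<le> norm x * norm (cl x W) * norm W"
  using cauchy_schwarz[of "x \<otimes> cl x W" W] by (simp add: norm_tensor_vec)
 finally have "norm (cl x W) * norm (cl x W) \<le> norm (cl x W) * (norm x * norm W)"
  by (simp add: power2_eq_square mult_ac)
 then show ?thesis by (cases "norm (cl x W) = 0") auto
qed

lemma norm_cr: "norm (cr y W) \<le> norm y * norm W"
proof -
 have "(norm (cr y W))^2 = cmod \<langle>cr y W \<otimes> y, W\<rangle>"
  by (simp add: cinner_cr_right[symmetric] cinner_norm norm_power)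
 also have "\<dots> \<le> norm y * norm (cr y W) * norm W"
  using cauchy_schwarz[of "cr y W \<otimes> y" W] by (simp add: norm_tensor_vec mult_ac)
 finally have "norm (cr y W) * norm (cr y W) \<le> norm (cr y W) * (norm y * norm W)"
  by (simp add: power2_eq_square mult_ac)
 then show ?thesis by (cases "norm (cr y W) = 0") auto
qed

lemma cl_ket_fun: "ell2_fun (cl (ket j) W) i = ell2_fun W (j, i)"
 by (metis cinner_cl_right cinner_ket ket_pair)
lemma cr_ket_fun: "ell2_fun (cr (ket i) W) j = ell2_fun W (j, i)"
 by (metis cinner_cr_right cinner_ket ket_pair)

lemma cl_ket_norm_has_sum: "((\<lambda>j. (norm (cl (ket j) W))^2) has_sum (norm W)^2) UNIV"
proof (rule has_sum_Sigma')
 show "((\<lambda>ij. (cmod (ell2_fun W ij))^2) has_sum (norm W)^2) (SIGMA i:UNIV. UNIV)"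
  using norm_ell2_has_sum[of W] by simp
 show "((\<lambda>i. (cmod (ell2_fun W (j, i)))^2) has_sum (norm (cl (ket j) W))^2) UNIV" for j
  using norm_ell2_has_sum[of "cl (ket j) W"] by (simp add: cl_ket_fun)
qed

lemma cr_ket_norm_has_sum: "((\<lambda>j. (norm (cr (ket j) W))^2) has_sum (norm W)^2) UNIV"
proof (rule has_sum_Sigma')
 have "((\<lambda>ij. (cmod (ell2_fun W ij))^2) has_sum (norm W)^2) (prod.swap ` UNIV)"
  using norm_ell2_has_sum[of W] by (simp add: surj_swap)
 then show "((\<lambda>ij. (cmod (ell2_fun W (prod.swap ij)))^2) has_sum (norm W)^2) (SIGMA i:UNIV. UNIV)"
  by (subst (asm) has_sum_reindex) (auto simp: o_def)
 show "((\<lambda>i. (cmod (ell2_fun W (prod.swap (j, i))))^2) has_sum (norm (cr (ket j) W))^2) UNIV" for j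
  using norm_ell2_has_sum[of "cr (ket j) W"] by (simp add: cr_ket_fun)
qed

lemma cl_expansion: "((\<lambda>j. ket j \<otimes> cl (ket j) W) has_sum W) UNIV"
proof (rule orthogonal_has_sum)
 show "((\<lambda>j. (norm (ket j \<otimes> cl (ket j) W))^2) has_sum (norm W)^2) UNIV"
  using cl_ket_norm_has_sum[of W] by (simp add: norm_tensor_vec)
qed (auto simp: cinner_tensor cinner_ket_ket cinner_cl_right[symmetric] norm_tensor_vec cinner_norm)

lemma cr_expansion: "((\<lambda>j. cr (ket j) W \<otimes> ket j) has_sum W) UNIV"
proof (rule orthogonal_has_sum)
 show "((\<lambda>j. (norm (cr (ket j) W \<otimes> ket j))^2) has_sum (norm W)^2) UNIV"
  using cr_ket_norm_has_sum[of W] by (simp add: norm_tensor_vec)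
qed (auto simp: cinner_tensor cinner_ket_ket cinner_cr_right[symmetric] norm_tensor_vec cinner_norm)

lemma cl_ket_parseval: "((\<lambda>j. \<langle>cl (ket j) V, cl (ket j) W\<rangle>) has_sum \<langle>V, W\<rangle>) UNIV"
 using has_sum_bounded_linear[OF bounded_linear_cinner_right cl_expansion, of V W]
 by (simp add: cinner_cl_left)

lemma cr_ket_parseval: "((\<lambda>j. \<langle>cr (ket j) V, cr (ket j) W\<rangle>) has_sum \<langle>V, W\<rangle>) UNIV"
 using has_sum_bounded_linear[OF bounded_linear_cinner_right cr_expansion, of V W]
 by (simp add: cinner_cr_left)

lemma ell2_eq_if_cl_ket_eq: "(\<And>j. cl (ket j) V = cl (ket j) W) ==> V = W"
 by (rule ell2_ext) (metis cl_ket_fun prod.collapse)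

lemma ell2_eq_if_cr_ket_eq: "(\<And>j. cr (ket j) V = cr (ket j) W) ==> V = W"
 by (rule ell2_ext) (metis cr_ket_fun prod.collapse)

lemma total_tensor:
 assumes "total A" "total B"
 shows "total {x \<otimes> y | x y. x \<in> A \<and> y \<in> B}"
 unfolding total_def
proof (intro allI impI)
 fix W assume *: "\<forall>s\<in>{x \<otimes> y | x y. x \<in> A \<and> y \<in> B}. \<langle>s, W\<rangle> = 0"
 have "cl x W = 0" if "x \<in> A" for x
  by (rule totalD[OF assms(2)]) (use * that in "auto simp: cinner_cl_right")
 then have "cr y W = 0" for y
  by (intro totalD[OF assms(1)]) (metis cinner_cl_right cinner_cr_right cinner_zero_right)
 then show "W = 0" by (intro ell2_eq_if_cr_ket_eq) (simp add: cr_rules)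
qed

lemma total_UNIV: "total UNIV"
 unfolding total_def by (metis UNIV_I cinner_ext cinner_zero_right)

lemma tensor_eqI:
 assumes "\<And>x y. \<langle>x \<otimes> y, V\<rangle> = \<langle>x \<otimes> y, W\<rangle>" shows "V = W"
 by (rule ell2_eq_if_cr_ket_eq, rule cinner_ext) (simp add: cinner_cr_right assms)

lemma bcl_eq_on_tensors:
 fixes S T :: "('j \<times> 'i) ell2 => 'k ell2"
 assumes "bcl S" "bcl T" "\<And>x y. x \<in> A ==> y \<in> B ==> S (x \<otimes> y) = T (x \<otimes> y)" "total A" "total B"
 shows "S W = T W"
proof (rule total_induct[OF total_tensor[OF assms(4,5)], where P = "\<lambda>W. S W = T W"])
 show "closed {W. S W = T W}"
  using assms(1,2) by (intro closed_Collect_eq) (auto simp: bcl_def linear_continuous_on)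
qed (use assms in "auto simp: complex_vector.subspace_def bcl_add bcl_scaleC bcl_zero")

lemma bop_tensor_ext:
 fixes S T :: "('j \<times> 'i) bop"
 assumes "\<And>x y. S $ (x \<otimes> y) = T $ (x \<otimes> y)"
 shows "S = T"
 by (rule bop_ext, rule bcl_eq_on_tensors[OF _ _ _ total_UNIV total_UNIV]) (auto simp: assms)

lemma bop_tensor_cinner_ext:
 fixes S T :: "('j \<times> 'i) bop"
 assumes "\<And>x y x' y'. \<langle>x' \<otimes> y', S $ (x \<otimes> y)\<rangle> = \<langle>x' \<otimes> y', T $ (x \<otimes> y)\<rangle>"
 shows "S = T"
 by (rule bop_tensor_ext, rule tensor_eqI) (rule assms)

subsection \<open>Tensor products of operators\<close>

text \<open>The operator 1 \<otimes> T is built row by row: row \<open>j\<close> of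
  \<open>S W\<close> is \<open>T\<close> applied to row \<open>j\<close> of \<open>W\<close>, and
  the bounds add up over the rows.\<close>

lemma amplification_exists:
 fixes T :: "'i ell2 => 'k ell2"
 assumes T: "bcl T" and C: "\<And>x. norm (T x) \<le> C * norm x"
 obtains S :: "('j \<times> 'i) ell2 => ('j \<times> 'k) ell2"
 where "bcl S" "\<And>j W. cl (ket j) (S W) = T (cl (ket j) W)" "\<And>W. (norm (S W))^2 \<le> C\<^sup>2 * (norm W)^2"
proof -
 have "\<exists>V. ell2_fun V = (\<lambda>(j, k). ell2_fun (T (cl (ket j) W)) k) \<and> (norm V)^2 \<le> C\<^sup>2 * (norm W)^2"
  for W :: "('j \<times> 'i) ell2"
 proof -
  have "(\<Sum>jk\<in>F. (cmod (case jk of (j, k) => ell2_fun (T (cl (ket j) W)) k))^2) \<le> C\<^sup>2 * (norm W)^2"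
   if F: "finite F" for F
  proof -
   have "(\<Sum>jk\<in>F. (cmod (case jk of (j, k) => ell2_fun (T (cl (ket j) W)) k))^2)
    \<le> (\<Sum>jk\<in>fst ` F \<times> snd ` F. (cmod (case jk of (j, k) => ell2_fun (T (cl (ket j) W)) k))^2)"
    using F by (intro sum_mono2) (auto intro: rev_image_eqI)
   also have "\<dots> = (\<Sum>j\<in>fst ` F. \<Sum>k\<in>snd ` F. (cmod (ell2_fun (T (cl (ket j) W)) k))^2)"
    by (simp add: sum.cartesian_product case_prod_unfold)
   also have "\<dots> \<le> (\<Sum>j\<in>fst ` F. (norm (T (cl (ket j) W)))^2)"
    using F by (intro sum_mono ell2_sum_le_norm) auto
   also have "\<dots> \<le> (\<Sum>j\<in>fst ` F. C\<^sup>2 * (norm (cl (ket j) W))^2)"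
    using power_mono[OF C norm_ge_zero, of _ 2] by (intro sum_mono) (simp add: power_mult_distrib)
   also have "\<dots> = C\<^sup>2 * (\<Sum>j\<in>fst ` F. (norm (cl (ket j) W))^2)" by (simp add: sum_distrib_left)
   also have "\<dots> \<le> C\<^sup>2 * (norm W)^2"
    using F by (intro mult_left_mono finite_sum_le_has_sum[OF cl_ket_norm_has_sum]) auto
   finally show ?thesis .
  qed
  then obtain V where "ell2_fun V = (\<lambda>(j, k). ell2_fun (T (cl (ket j) W)) k)" "(norm V)^2 \<le> C\<^sup>2 * (norm W)^2"
   by (rule ell2_construct)
  then show ?thesis by blast
 qed
 then obtain S :: "('j \<times> 'i) ell2 => ('j \<times> 'k) ell2" where S: "\<And>W. ell2_fun (S W) = (\<lambda>(j, k). ell2_fun (T (cl (ket j) W)) k)"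
  "\<And>W. (norm (S W))^2 \<le> C\<^sup>2 * (norm W)^2" by metis
 have cl: "cl (ket j) (S W) = T (cl (ket j) W)" for j W
  by (rule ell2_ext) (simp add: cl_ket_fun S)
 have "bcl S"
 proof (rule bclI[where C = "\<bar>C\<bar>"])
  show "norm (S W) \<le> \<bar>C\<bar> * norm W" for W
   by (rule power2_le_imp_le) (use S(2)[of W] in "auto simp: power_mult_distrib")
 qed (rule ell2_eq_if_cl_ket_eq, simp add: cl cl_rules bcl_add[OF T] bcl_scaleC[OF T])+
 with cl S(2) show ?thesis by (intro that) auto
qed

lemma id_tensor_exists: "\<exists>X :: ('j \<times> 'i) bop. \<forall>x y. X $ (x \<otimes> y) = x \<otimes> (T $ y)"
proof -
 obtain S :: "('j \<times> 'i) ell2 => ('j \<times> 'i) ell2"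
  where S: "bcl S" "\<And>j W. cl (ket j) (S W) = T $ (cl (ket j) W)"
  using amplification_exists[OF bcl_bop norm_bop, of T] by metis
 have "S (x \<otimes> y) = x \<otimes> (T $ y)" for x y
  by (rule ell2_eq_if_cl_ket_eq) (simp add: S bop_scaleC_right)
 then show ?thesis by (intro exI[of _ "Abs_bop S"]) (simp add: apply_Abs_bop S)
qed

lemma swap_exists: "\<exists>S :: ('j \<times> 'i) ell2 => ('i \<times> 'j) ell2. bcl S \<and> (\<forall>x y. S (x \<otimes> y) = y \<otimes> x)"
proof -
 have "\<exists>V. ell2_fun V = (\<lambda>ij. ell2_fun W (prod.swap ij)) \<and> (norm V)^2 \<le> (norm W)^2"
  for W :: "('j \<times> 'i) ell2"
 proof -
  have "(\<Sum>ij\<in>F. (cmod (ell2_fun W (prod.swap ij)))^2) \<le> (norm W)^2" if F: "finite F" for F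
  proof -
   have "(\<Sum>ij\<in>F. (cmod (ell2_fun W (prod.swap ij)))^2) = (\<Sum>ij\<in>prod.swap ` F. (cmod (ell2_fun W ij))^2)"
    by (simp add: sum.reindex inj_swap)
   with F show ?thesis using ell2_sum_le_norm[of "prod.swap ` F" W] by simp
  qed
  then obtain V where "ell2_fun V = (\<lambda>ij. ell2_fun W (prod.swap ij))" "(norm V)^2 \<le> (norm W)^2"
   by (rule ell2_construct)
  then show ?thesis by blast
 qed
 then obtain S :: "('j \<times> 'i) ell2 => ('i \<times> 'j) ell2" where S: "\<And>W. ell2_fun (S W) = (\<lambda>ij. ell2_fun W (prod.swap ij))"
  "\<And>W. (norm (S W))^2 \<le> (norm W)^2" by metis
 have "bcl S"
  by (rule bclI[where C = 1])
   (use S(2) in "auto intro!: ell2_ext simp: S(1) ell2_add_fun ell2_scaleC_fun intro: power2_le_imp_le")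
 moreover have "S (x \<otimes> y) = y \<otimes> x" for x y
  by (rule ell2_ext) (auto simp: S(1) tensor_vec_fun)
 ultimately show ?thesis by blast
qed

text \<open>Only operators of the form 1 \<otimes> T are constructed directly; S \<otimes> 1 is
  conjugate to such an operator by the flip.\<close>

lemma tensor_op_exists: "\<exists>X :: ('j \<times> 'i) bop. \<forall>x y. X $ (x \<otimes> y) = (S $ x) \<otimes> (T $ y)"
proof -
 obtain X :: "('j \<times> 'i) bop" where X: "\<And>x y. X $ (x \<otimes> y) = x \<otimes> (T $ y)"
  using id_tensor_exists[of T] by blast
 obtain Y :: "('i \<times> 'j) bop" where Y: "\<And>x y. Y $ (x \<otimes> y) = x \<otimes> (S $ y)"
  using id_tensor_exists[of S] by blast
 obtain F :: "('j \<times> 'i) ell2 => ('i \<times> 'j) ell2" where F: "bcl F" "\<And>x y. F (x \<otimes> y) = y \<otimes> x"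
  using swap_exists by blast
 obtain G :: "('i \<times> 'j) ell2 => ('j \<times> 'i) ell2" where G: "bcl G" "\<And>x y. G (x \<otimes> y) = y \<otimes> x"
  using swap_exists by blast
 have "bcl (\<lambda>W. G (Y $ F (X $ W)))"
  by (intro bcl_comp[OF G(1)] bcl_comp[OF bcl_bop] bcl_comp[OF F(1)] bcl_bop)
 then show ?thesis
  by (intro exI[of _ "Abs_bop (\<lambda>W. G (Y $ F (X $ W)))"]) (simp add: apply_Abs_bop F G X Y)
qed

lemma tensor_op_apply: "(S \<otimes>\<^sub>o T) $ (x \<otimes> y) = (S $ x) \<otimes> (T $ y)"
proof -
 obtain X :: "('a \<times> 'b) bop" where X: "\<And>x y. X $ (x \<otimes> y) = (S $ x) \<otimes> (T $ y)"
  using tensor_op_exists by blast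
 have "S \<otimes>\<^sub>o T = X"
  unfolding tensor_op_def by (rule the_equality) (auto simp: X intro: bop_tensor_ext)
 with X show ?thesis by simp
qed

lemma tensor_op_mult: "(S \<otimes>\<^sub>o T) * (S' \<otimes>\<^sub>o T') = (S * S') \<otimes>\<^sub>o (T * T')"
 by (rule bop_tensor_ext) (simp add: tensor_op_apply)
lemma adj_tensor_op: "adj (S \<otimes>\<^sub>o T) = adj S \<otimes>\<^sub>o adj T"
 by (rule bop_tensor_cinner_ext) (simp add: tensor_op_apply adj_right cinner_tensor)
lemma tensor_op_add_left: "(S + S') \<otimes>\<^sub>o T = S \<otimes>\<^sub>o T + S' \<otimes>\<^sub>o T"
 by (rule bop_tensor_ext) (simp add: tensor_op_apply tensor_vec_rules)
lemma tensor_op_add_right: "S \<otimes>\<^sub>o (T + T') = S \<otimes>\<^sub>o T + S \<otimes>\<^sub>o T'"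
 by (rule bop_tensor_ext) (simp add: tensor_op_apply tensor_vec_rules)
lemma tensor_op_scaleC_left: "(c *C S) \<otimes>\<^sub>o T = c *C (S \<otimes>\<^sub>o T)"
 by (rule bop_tensor_ext) (simp add: tensor_op_apply tensor_vec_rules)
lemma tensor_op_scaleC_right: "S \<otimes>\<^sub>o (c *C T) = c *C (S \<otimes>\<^sub>o T)"
 by (rule bop_tensor_ext) (simp add: tensor_op_apply tensor_vec_rules)
lemma tensor_op_one [simp]: "1 \<otimes>\<^sub>o 1 = 1"
 by (rule bop_tensor_ext) (simp add: tensor_op_apply)
lemma tensor_op_zero [simp]: "0 \<otimes>\<^sub>o T = 0" "S \<otimes>\<^sub>o 0 = 0"
 by (rule bop_tensor_ext, simp add: tensor_op_apply)+
lemma tensor_op_sum_left: "(\<Sum>i\<in>I. S i) \<otimes>\<^sub>o T = (\<Sum>i\<in>I. S i \<otimes>\<^sub>o T)"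
 by (induction I rule: infinite_finite_induct) (auto simp: tensor_op_add_left)
lemma tensor_op_sum_right: "S \<otimes>\<^sub>o (\<Sum>i\<in>I. T i) = (\<Sum>i\<in>I. S \<otimes>\<^sub>o T i)"
 by (induction I rule: infinite_finite_induct) (auto simp: tensor_op_add_right)

lemma cl_id_tensor: "cl x ((1 \<otimes>\<^sub>o T) $ W) = T $ cl x W"
proof (rule cinner_ext)
 fix y show "\<langle>y, cl x ((1 \<otimes>\<^sub>o T) $ W)\<rangle> = \<langle>y, T $ cl x W\<rangle>"
  by (simp add: cinner_cl_right adj_left[symmetric] adj_tensor_op tensor_op_apply)
qed
lemma cr_tensor_id: "cr y ((T \<otimes>\<^sub>o 1) $ W) = T $ cr y W"
proof (rule cinner_ext)
 fix x show "\<langle>x, cr y ((T \<otimes>\<^sub>o 1) $ W)\<rangle> = \<langle>x, T $ cr y W\<rangle>"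
  by (simp add: cinner_cr_right adj_left[symmetric] adj_tensor_op tensor_op_apply)
qed
lemma cr_id_tensor: "cr y ((1 \<otimes>\<^sub>o T) $ W) = cr (adj T $ y) W"
 by (rule cinner_ext) (simp add: cinner_cr_right adj_left[symmetric] adj_tensor_op tensor_op_apply)

subsection \<open>Slices\<close>

lemma rslice_eq: "rslice \<xi> \<eta> X = Abs_bop (\<lambda>z. cr \<eta> (X $ (z \<otimes> \<xi>)))"
proof -
 have b: "bcl (\<lambda>z. cr \<eta> (X $ (z \<otimes> \<xi>)))"
  by (intro bcl_comp[OF bcl_cr] bcl_comp[OF bcl_bop] bcl_tensor_left)
 show ?thesis
  unfolding vec_slice_right_def
  by (rule the_equality) (auto simp: apply_Abs_bop b cinner_cr_right intro!: bop_cinner_ext)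
qed

lemma lslice_eq: "lslice \<xi> \<eta> X = Abs_bop (\<lambda>z. cl \<eta> (X $ (\<xi> \<otimes> z)))"
proof -
 have b: "bcl (\<lambda>z. cl \<eta> (X $ (\<xi> \<otimes> z)))"
  by (intro bcl_comp[OF bcl_cl] bcl_comp[OF bcl_bop] bcl_tensor_right)
 show ?thesis
  unfolding vec_slice_left_def
  by (rule the_equality) (auto simp: apply_Abs_bop b cinner_cl_right intro!: bop_cinner_ext)
qed

lemma rslice_apply: "rslice \<xi> \<eta> X $ z = cr \<eta> (X $ (z \<otimes> \<xi>))"
 unfolding rslice_eq
 by (rule apply_Abs_bop) (intro bcl_comp[OF bcl_cr] bcl_comp[OF bcl_bop] bcl_tensor_left)

lemma lslice_apply: "lslice \<xi> \<eta> X $ z = cl \<eta> (X $ (\<xi> \<otimes> z))"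
 unfolding lslice_eq
 by (rule apply_Abs_bop) (intro bcl_comp[OF bcl_cl] bcl_comp[OF bcl_bop] bcl_tensor_right)

lemma cinner_rslice: "\<langle>y, rslice \<xi> \<eta> X $ z\<rangle> = \<langle>y \<otimes> \<eta>, X $ (z \<otimes> \<xi>)\<rangle>"
 by (simp add: rslice_apply cinner_cr_right)
lemma cinner_lslice: "\<langle>y, lslice \<xi> \<eta> X $ z\<rangle> = \<langle>\<eta> \<otimes> y, X $ (\<xi> \<otimes> z)\<rangle>"
 by (simp add: lslice_apply cinner_cl_right)

lemma norm_rslice: "norm (rslice \<xi> \<eta> X) \<le> norm X * norm \<xi> * norm \<eta>"
proof (rule norm_bop_le)
 fix z
 have "norm (cr \<eta> (X $ (z \<otimes> \<xi>))) \<le> norm \<eta> * norm (X $ (z \<otimes> \<xi>))" by (rule norm_cr)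
 also have "\<dots> \<le> norm \<eta> * (norm X * norm (z \<otimes> \<xi>))" by (intro mult_left_mono norm_bop) simp
 finally show "norm (rslice \<xi> \<eta> X $ z) \<le> norm X * norm \<xi> * norm \<eta> * norm z"
  by (simp add: rslice_apply norm_tensor_vec mult_ac)
qed simp

lemma norm_lslice: "norm (lslice \<xi> \<eta> X) \<le> norm X * norm \<xi> * norm \<eta>"
proof (rule norm_bop_le)
 fix z
 have "norm (cl \<eta> (X $ (\<xi> \<otimes> z))) \<le> norm \<eta> * norm (X $ (\<xi> \<otimes> z))" by (rule norm_cl)
 also have "\<dots> \<le> norm \<eta> * (norm X * norm (\<xi> \<otimes> z))" by (intro mult_left_mono norm_bop) simp
 finally show "norm (lslice \<xi> \<eta> X $ z) \<le> norm X * norm \<xi> * norm \<eta> * norm z"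
  by (simp add: lslice_apply norm_tensor_vec mult_ac)
qed simp

lemma rslice_rules:
 "rslice \<xi> \<eta> (X + Y) = rslice \<xi> \<eta> X + rslice \<xi> \<eta> Y"
 "rslice \<xi> \<eta> (X - Y) = rslice \<xi> \<eta> X - rslice \<xi> \<eta> Y"
 "rslice \<xi> \<eta> (c *C X) = c *C rslice \<xi> \<eta> X"
 "rslice (\<xi> + \<xi>') \<eta> X = rslice \<xi> \<eta> X + rslice \<xi>' \<eta> X"
 "rslice (\<xi> - \<xi>') \<eta> X = rslice \<xi> \<eta> X - rslice \<xi>' \<eta> X"
 "rslice (c *C \<xi>) \<eta> X = c *C rslice \<xi> \<eta> X"
 "rslice \<xi> (\<eta> + \<eta>') X = rslice \<xi> \<eta> X + rslice \<xi> \<eta>' X"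
 "rslice \<xi> (\<eta> - \<eta>') X = rslice \<xi> \<eta> X - rslice \<xi> \<eta>' X"
 "rslice \<xi> (c *C \<eta>) X = cnj c *C rslice \<xi> \<eta> X"
 "rslice 0 \<eta> X = 0" "rslice \<xi> 0 X = 0" "rslice \<xi> \<eta> 0 = 0"
 by (rule bop_cinner_ext, simp add: cinner_rslice tensor_vec_rules ci_rules bop_rules)+

lemma lslice_rules:
 "lslice \<xi> \<eta> (X + Y) = lslice \<xi> \<eta> X + lslice \<xi> \<eta> Y"
 "lslice \<xi> \<eta> (X - Y) = lslice \<xi> \<eta> X - lslice \<xi> \<eta> Y"
 "lslice \<xi> \<eta> (c *C X) = c *C lslice \<xi> \<eta> X"
 "lslice (\<xi> + \<xi>') \<eta> X = lslice \<xi> \<eta> X + lslice \<xi>' \<eta> X"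
 "lslice (\<xi> - \<xi>') \<eta> X = lslice \<xi> \<eta> X - lslice \<xi>' \<eta> X"
 "lslice (c *C \<xi>) \<eta> X = c *C lslice \<xi> \<eta> X"
 "lslice \<xi> (\<eta> + \<eta>') X = lslice \<xi> \<eta> X + lslice \<xi> \<eta>' X"
 "lslice \<xi> (\<eta> - \<eta>') X = lslice \<xi> \<eta> X - lslice \<xi> \<eta>' X"
 "lslice \<xi> (c *C \<eta>) X = cnj c *C lslice \<xi> \<eta> X"
 "lslice 0 \<eta> X = 0" "lslice \<xi> 0 X = 0" "lslice \<xi> \<eta> 0 = 0"
 by (rule bop_cinner_ext, simp add: cinner_lslice tensor_vec_rules ci_rules bop_rules)+

lemma adj_rslice: "adj (rslice \<xi> \<eta> X) = rslice \<eta> \<xi> (adj X)"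
 by (rule bop_cinner_ext) (metis adj_left adj_right cinner_commute cinner_rslice)
lemma adj_lslice: "adj (lslice \<xi> \<eta> X) = lslice \<eta> \<xi> (adj X)"
 by (rule bop_cinner_ext) (metis adj_left adj_right cinner_commute cinner_lslice)

lemma rslice_tensor: "rslice \<xi> \<eta> (S \<otimes>\<^sub>o T) = \<langle>\<eta>, T $ \<xi>\<rangle> *C S"
 by (rule bop_cinner_ext) (simp add: cinner_rslice tensor_op_apply cinner_tensor ci_rules)
lemma lslice_tensor: "lslice \<xi> \<eta> (S \<otimes>\<^sub>o T) = \<langle>\<eta>, S $ \<xi>\<rangle> *C T"
 by (rule bop_cinner_ext) (simp add: cinner_lslice tensor_op_apply cinner_tensor ci_rules)

lemma rslice_sum: "rslice \<xi> \<eta> (\<Sum>i\<in>I. X i) = (\<Sum>i\<in>I. rslice \<xi> \<eta> (X i))"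
 by (induction I rule: infinite_finite_induct) (auto simp: rslice_rules)
lemma lslice_sum: "lslice \<xi> \<eta> (\<Sum>i\<in>I. X i) = (\<Sum>i\<in>I. lslice \<xi> \<eta> (X i))"
 by (induction I rule: infinite_finite_induct) (auto simp: lslice_rules)

section \<open>Von Neumann algebras and normal maps\<close>

lemma tensor_op_mult_apply: "(S \<otimes>\<^sub>o T) $ (S' \<otimes>\<^sub>o T') $ x = ((S * S') \<otimes>\<^sub>o (T * T')) $ x"
 by (metis tensor_op_mult times_bop.rep_eq)

lemma commutantI: "(\<And>S. S \<in> A ==> T * S = S * T) ==> T \<in> commutant A"
 by (simp add: commutant_def)
lemma commutantD: "T \<in> commutant A ==> S \<in> A ==> T * S = S * T"
 by (simp add: commutant_def)

lemma commutant_antimono: "A \<subseteq> B ==> commutant B \<subseteq> commutant A"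
 by (auto simp: commutant_def)

lemma subset_bicommutant: "A \<subseteq> commutant (commutant A)"
 by (auto simp: commutant_def)

lemma commutant_adj: "adj ` A \<subseteq> A ==> T \<in> commutant A ==> adj T \<in> commutant A"
proof (rule commutantI)
 fix S assume *: "adj ` A \<subseteq> A" "T \<in> commutant A" "S \<in> A"
 then have "T * adj S = adj S * T" by (auto dest: commutantD)
 from arg_cong[OF this, of adj] show "adj T * S = S * adj T" by simp
qed

locale vna =
 fixes M :: "'i bop set"
 assumes vna: "von_neumann_algebra M"
begin

lemma memI: "(\<And>S. S \<in> commutant M ==> T * S = S * T) ==> T \<in> M"
 using vna by (auto simp: von_neumann_algebra_def commutant_def)

lemma memD: "T \<in> M ==> S \<in> commutant M ==> T * S = S * T"
 by (simp add: commutant_def)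

lemma memD_apply: "T \<in> M ==> S \<in> commutant M ==> T $ S $ x = S $ T $ x"
 using arg_cong[OF memD, of T S "\<lambda>X. X $ x"] by simp

lemma adj_mem [simp]: "T \<in> M ==> adj T \<in> M"
 using vna by (auto simp: von_neumann_algebra_def)
lemma adj_mem_commutant: "T \<in> commutant M ==> adj T \<in> commutant M"
 using vna by (auto simp: von_neumann_algebra_def intro: commutant_adj)

lemma one_mem [simp]: "1 \<in> M" by (rule memI) simp
lemma zero_mem [simp]: "0 \<in> M" by (rule memI) simp
lemma add_mem [simp]: "S \<in> M ==> T \<in> M ==> S + T \<in> M"
 by (rule memI) (simp add: distrib_left distrib_right memD)
lemma diff_mem [simp]: "S \<in> M ==> T \<in> M ==> S - T \<in> M"
 by (rule memI) (simp add: right_diff_distrib left_diff_distrib memD)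
lemma mult_mem [simp]: "S \<in> M ==> T \<in> M ==> S * T \<in> M"
 by (rule memI) (metis memD mult.assoc)
lemma scaleC_mem [simp]: "T \<in> M ==> c *C T \<in> M"
 by (rule memI) (simp add: memD)
lemma scaleR_mem [simp]: "T \<in> M ==> r *R T \<in> M"
 by (simp flip: scaleC_of_real)
lemma minus_mem [simp]: "T \<in> M ==> - T \<in> M"
 using diff_mem[of 0 T] by simp
lemma sum_mem: "(\<And>i. i \<in> I ==> f i \<in> M) ==> (\<Sum>i\<in>I. f i) \<in> M"
 by (induction I rule: infinite_finite_induct) auto

lemma weak_limit_mem:
 assumes "F \<noteq> bot" and lim: "\<And>x y. ((\<lambda>n. \<langle>x, A n $ y\<rangle>) \<longlongrightarrow> \<langle>x, T $ y\<rangle>) F"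
  and mem: "\<forall>\<^sub>F n in F. A n \<in> M"
 shows "T \<in> M"
proof (rule memI, rule bop_cinner_ext)
 fix S x y assume S: "S \<in> commutant M"
 have 1: "((\<lambda>n. \<langle>y, A n $ S $ x\<rangle>) \<longlongrightarrow> \<langle>y, T $ S $ x\<rangle>) F" by (rule lim)
 have "((\<lambda>n. \<langle>adj S $ y, A n $ x\<rangle>) \<longlongrightarrow> \<langle>adj S $ y, T $ x\<rangle>) F" by (rule lim)
 then have 2: "((\<lambda>n. \<langle>y, A n $ S $ x\<rangle>) \<longlongrightarrow> \<langle>adj S $ y, T $ x\<rangle>) F"
  by (rule Lim_transform_eventually)
   (use mem in eventually_elim, simp add: adj_left memD_apply[OF _ S])
 show "\<langle>y, (T * S) $ x\<rangle> = \<langle>y, (S * T) $ x\<rangle>"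
  using tendsto_unique[OF assms(1) 1 2] by (simp add: adj_left)
qed

lemma limit_mem:
 assumes "A \<longlonglongrightarrow> T" "\<And>n. A n \<in> M" shows "T \<in> M"
 by (rule weak_limit_mem[of sequentially A])
  (auto intro!: tendsto_cinner_right bop_tendsto_apply assms(1) simp: assms(2))

lemma closed: "closed M"
 unfolding closed_sequential_limits using limit_mem by blast

end

subsection \<open>Normal functionals\<close>

lemma suminf_bound:
 fixes c :: "nat => 'a :: banach"
 assumes "\<And>N. (\<Sum>n<N. norm (c n)) \<le> K"
 shows "summable c" "norm (suminf c) \<le> K"
proof -
 have s: "summable (\<lambda>n. norm (c n))" by (rule bounded_imp_summable[where B = K])
  (use assms in "auto simp: lessThan_Suc_atMost[symmetric] simp del: sum.lessThan_Suc")
 then show "summable c" by (rule summable_norm_cancel)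
 have "norm (suminf c) \<le> (\<Sum>n. norm (c n))" by (rule summable_norm[OF s])
 also have "\<dots> \<le> K" by (rule suminf_le_const[OF s assms])
 finally show "norm (suminf c) \<le> K" .
qed

text \<open>The free weight \<open>t\<close> is what later makes estimates small: it is adapted to
  the size of one family of vectors while the other one stays bounded.\<close>

lemma cmod_cinner_le_squares:
 assumes "t > 0" shows "cmod \<langle>x, y\<rangle> \<le> (t * (norm x)^2 + (norm y)^2 / t) / 2"
proof -
 have "0 \<le> (t * norm x - norm y)^2 / t" using assms by simp
 also have "\<dots> = t * (norm x)^2 + (norm y)^2 / t - 2 * (norm x * norm y)"
  using assms by (simp add: power2_eq_square field_simps)
 finally show ?thesis using cauchy_schwarz[of x y] by simp
qed

lemma sq_summable_sum_le: "sq_summable \<xi> ==> finite F ==> (\<Sum>n\<in>F. (norm (\<xi> n))^2) \<le> (\<Sum>n. (norm (\<xi> n))^2)"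
 unfolding sq_summable_def by (rule sum_le_suminf) auto

lemma predual_bound:
 assumes "sq_summable \<xi>" "sq_summable \<eta>" "t > 0"
  and v: "\<And>N. (\<Sum>n<N. (norm (T $ \<xi> n))^2) \<le> K"
 shows "summable (\<lambda>n. \<langle>\<eta> n, T $ \<xi> n\<rangle>)"
  "cmod (\<Sum>n. \<langle>\<eta> n, T $ \<xi> n\<rangle>) \<le> (t * (\<Sum>n. (norm (\<eta> n))^2) + K / t) / 2"
proof -
 have "(\<Sum>n<N. cmod \<langle>\<eta> n, T $ \<xi> n\<rangle>) \<le> (t * (\<Sum>n. (norm (\<eta> n))^2) + K / t) / 2" for N
 proof -
  have "(\<Sum>n<N. cmod \<langle>\<eta> n, T $ \<xi> n\<rangle>)
    \<le> (\<Sum>n<N. (t * (norm (\<eta> n))^2 + (norm (T $ \<xi> n))^2 / t) / 2)"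
   using assms(3) by (intro sum_mono cmod_cinner_le_squares)
  also have "\<dots> = (t * (\<Sum>n<N. (norm (\<eta> n))^2) + (\<Sum>n<N. (norm (T $ \<xi> n))^2) / t) / 2"
   by (simp add: sum.distrib sum_distrib_left sum_divide_distrib add_divide_distrib)
  also have "\<dots> \<le> (t * (\<Sum>n. (norm (\<eta> n))^2) + K / t) / 2"
   using assms sq_summable_sum_le[OF assms(2), of "{..<N}"]
   by (intro divide_right_mono add_mono mult_left_mono v) auto
  finally show ?thesis .
 qed
 from suminf_bound[OF this] show "summable (\<lambda>n. \<langle>\<eta> n, T $ \<xi> n\<rangle>)"
  "cmod (\<Sum>n. \<langle>\<eta> n, T $ \<xi> n\<rangle>) \<le> (t * (\<Sum>n. (norm (\<eta> n))^2) + K / t) / 2" by auto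
qed

lemma sq_summable_apply_bound:
 assumes "sq_summable \<xi>"
 shows "(\<Sum>n<N. (norm (T $ \<xi> n))^2) \<le> (norm T)^2 * (\<Sum>n. (norm (\<xi> n))^2)"
proof -
 have "(\<Sum>n<N. (norm (T $ \<xi> n))^2) \<le> (\<Sum>n<N. (norm T)^2 * (norm (\<xi> n))^2)"
  using power_mono[OF norm_bop, of T _ 2] by (intro sum_mono) (simp add: power_mult_distrib)
 also have "\<dots> = (norm T)^2 * (\<Sum>n<N. (norm (\<xi> n))^2)" by (simp add: sum_distrib_left)
 also have "\<dots> \<le> (norm T)^2 * (\<Sum>n. (norm (\<xi> n))^2)"
  by (intro mult_left_mono sq_summable_sum_le[OF assms]) auto
 finally show ?thesis .
qed

lemma sq_summable_nonneg: "sq_summable \<xi> ==> 0 \<le> (\<Sum>n. (norm (\<xi> n))^2)"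
 unfolding sq_summable_def by (rule suminf_nonneg) auto

lemma predual_summable:
 assumes "sq_summable \<xi>" "sq_summable \<eta>"
 shows "summable (\<lambda>n. \<langle>\<eta> n, T $ \<xi> n\<rangle>)"
 by (rule predual_bound(1)[OF assms zero_less_one sq_summable_apply_bound[OF assms(1)]])

lemma predual_scaleC: "\<omega> \<in> predual ==> \<omega> (c *C T) = c * \<omega> T"
 by (auto simp: predual_def ci_rules suminf_mult predual_summable)
lemma predual_diff: "\<omega> \<in> predual ==> \<omega> (S - T) = \<omega> S - \<omega> T"
 by (auto simp: predual_def ci_rules suminf_diff predual_summable)

lemma predual_norm_bound:
 assumes "\<omega> \<in> predual" obtains C where "C \<ge> 0" "\<And>T. cmod (\<omega> T) \<le> C * norm T"
proof -
 obtain \<xi> \<eta> where *: "sq_summable \<xi>" "sq_summable \<eta>" "\<omega> = (\<lambda>T. \<Sum>n. \<langle>\<eta> n, T $ \<xi> n\<rangle>)"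
  using assms by (auto simp: predual_def)
 define C where "C = ((\<Sum>n. (norm (\<eta> n))^2) + (\<Sum>n. (norm (\<xi> n))^2)) / 2"
 have "cmod (\<omega> T) \<le> C * norm T" for T
 proof (cases "T = 0")
  case False
  have "cmod (\<omega> T) \<le> (norm T * (\<Sum>n. (norm (\<eta> n))^2) + (norm T)^2 * (\<Sum>n. (norm (\<xi> n))^2) / norm T) / 2"
   unfolding *(3) using False
   by (intro predual_bound(2)[OF *(1,2) _ sq_summable_apply_bound[OF *(1)]]) auto
  with False show ?thesis by (simp add: C_def power2_eq_square field_simps)
 qed (simp add: *(3))
 moreover have "C \<ge> 0" using * by (simp add: C_def sq_summable_nonneg)
 ultimately show ?thesis by (rule that[rotated])
qed

lemma vector_predual: "(\<lambda>T. \<langle>\<eta>, T $ \<xi>\<rangle>) \<in> predual"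
proof -
 define f where "f = (\<lambda>(x :: 'a ell2) (n :: nat). if n = 0 then x else 0)"
 have "sq_summable (f x)" for x
  unfolding sq_summable_def f_def by (rule summable_finite[of "{0}"]) auto
 moreover have "(\<Sum>n. \<langle>f \<eta> n, T $ f \<xi> n\<rangle>) = \<langle>\<eta>, T $ \<xi>\<rangle>" for T
  by (subst suminf_finite[of "{0}"]) (auto simp: f_def)
 ultimately show ?thesis
  unfolding predual_def by (intro CollectI exI[of _ "f \<xi>"] exI[of _ "f \<eta>"]) (simp add: fun_eq_iff)
qed

lemma topspace_sigma_weak [simp]: "topspace sigma_weak = UNIV"
proof -
 let ?\<omega> = "\<lambda>T :: 'a bop. \<langle>0, T $ 0\<rangle>"
 have "UNIV = {T. cmod (?\<omega> T - ?\<omega> 0) < 1}" by auto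
 then have "UNIV \<in> {{T. cmod (\<omega> T - \<omega> T\<^sub>0) < \<epsilon>} | \<omega> (T\<^sub>0 :: 'a bop) \<epsilon>. \<omega> \<in> predual \<and> 0 < \<epsilon>}"
  using vector_predual[of 0 0]
  by (intro CollectI exI[of _ ?\<omega>] exI[of _ 0] exI[of _ 1] conjI) auto
 then show ?thesis unfolding sigma_weak_def topology_generated_by_topspace by auto
qed

text \<open>Subbasic sets are centred at arbitrary operators; the triangle inequality recentres them
  at \<open>X\<close>.\<close>

lemma sigma_weak_nbhd:
 assumes "openin sigma_weak U" "X \<in> U"
 obtains F \<epsilon> where "finite F" "F \<subseteq> predual" "\<epsilon> > 0" "\<forall>T. (\<forall>\<omega>\<in>F. cmod (\<omega> T - \<omega> X) < \<epsilon>) \<longrightarrow> T \<in> U"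
proof -
 have "generate_topology_on {{T. cmod (\<omega> T - \<omega> T\<^sub>0) < \<epsilon>} | \<omega> T\<^sub>0 \<epsilon>. \<omega> \<in> predual \<and> 0 < \<epsilon>} U"
  using assms(1) unfolding sigma_weak_def openin_topology_generated_by_iff .
 then have "X \<in> U ==> \<exists>F \<epsilon>. finite F \<and> F \<subseteq> predual \<and> \<epsilon> > 0 \<and>
   (\<forall>T. (\<forall>\<omega>\<in>F. cmod (\<omega> T - \<omega> X) < \<epsilon>) \<longrightarrow> T \<in> U)"
 proof (induction rule: generate_topology_on.induct)
  case (Int a b)
  then obtain F \<epsilon> F' \<epsilon>' where "finite F" "F \<subseteq> predual" "\<epsilon> > 0" "finite F'" "F' \<subseteq> predual" "\<epsilon>' > 0"
   "\<And>T. (\<forall>\<omega>\<in>F. cmod (\<omega> T - \<omega> X) < \<epsilon>) \<longrightarrow> T \<in> a" "\<And>T. (\<forall>\<omega>\<in>F'. cmod (\<omega> T - \<omega> X) < \<epsilon>') \<longrightarrow> T \<in> b"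
   by auto
  then show ?case by (intro exI[of _ "F \<union> F'"] exI[of _ "min \<epsilon> \<epsilon>'"]) auto
 next
  case (UN K)
  then obtain k where "k \<in> K" "X \<in> k" by auto
  with UN.IH[of k] show ?case by (meson UnionI)
 next
  case (Basis s)
  then obtain \<omega> T\<^sub>0 \<epsilon> where s: "s = {T. cmod (\<omega> T - \<omega> T\<^sub>0) < \<epsilon>}" "\<omega> \<in> predual" by auto
  with Basis have "cmod (\<omega> X - \<omega> T\<^sub>0) < \<epsilon>" by simp
  moreover have "cmod (\<omega> T - \<omega> T\<^sub>0) < \<epsilon>"
   if "cmod (\<omega> T - \<omega> X) < \<epsilon> - cmod (\<omega> X - \<omega> T\<^sub>0)" for T
   using norm_triangle_ineq[of "\<omega> T - \<omega> X" "\<omega> X - \<omega> T\<^sub>0"] that by simp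
  ultimately show ?case using s
   by (intro exI[of _ "{\<omega>}"] exI[of _ "\<epsilon> - cmod (\<omega> X - \<omega> T\<^sub>0)"]) auto
 qed auto
 with assms(2) show ?thesis by (auto intro: that)
qed

text \<open>\<open>\<sigma>\<close>-weak continuity of a linear functional on \<open>M\<close>.\<close>

definition normal_on :: "'i bop set => ('i bop => complex) => bool" where
 "normal_on M G \<longleftrightarrow> (\<forall>S\<in>M. \<forall>T\<in>M. G (S - T) = G S - G T) \<and> (\<forall>c. \<forall>T\<in>M. G (c *C T) = c * G T) \<and>
  (\<exists>F \<epsilon>. finite F \<and> F \<subseteq> predual \<and> \<epsilon> > 0 \<and> (\<forall>T\<in>M. (\<forall>\<omega>\<in>F. cmod (\<omega> T) < \<epsilon>) \<longrightarrow> cmod (G T) < 1))"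

lemma normal_on_predual: "\<omega> \<in> predual ==> normal_on M \<omega>"
 unfolding normal_on_def by (auto simp: predual_diff predual_scaleC intro!: exI[of _ "{\<omega>}"] exI[of _ 1])

lemma normal_on_diff:
 assumes "normal_on M G" "normal_on M G'" "vna M"
 shows "normal_on M (\<lambda>T. G T - G' T)"
proof -
 interpret vna M by fact
 obtain F \<epsilon> F' \<epsilon>' where F: "finite F" "F \<subseteq> predual" "\<epsilon> > 0" "finite F'" "F' \<subseteq> predual" "\<epsilon>' > 0"
  and G: "\<And>T. T \<in> M ==> (\<forall>\<omega>\<in>F. cmod (\<omega> T) < \<epsilon>) ==> cmod (G T) < 1"
  and G': "\<And>T. T \<in> M ==> (\<forall>\<omega>\<in>F'. cmod (\<omega> T) < \<epsilon>') ==> cmod (G' T) < 1"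
  using assms(1,2) unfolding normal_on_def by metis
 have "cmod (G T - G' T) < 1"
  if T: "T \<in> M" "\<forall>\<omega>\<in>F \<union> F'. cmod (\<omega> T) < min \<epsilon> \<epsilon>' / 2" for T
 proof -
  have s: "cmod (\<omega> (2 *C T)) < min \<epsilon> \<epsilon>'" if "\<omega> \<in> F \<union> F'" for \<omega>
  proof -
   have "\<omega> \<in> predual" using that F by auto
   then have "cmod (\<omega> (2 *C T)) = 2 * cmod (\<omega> T)" by (simp add: predual_scaleC norm_mult)
   with T(2) that show ?thesis by force
  qed
  have "cmod (G (2 *C T)) < 1" by (rule G) (use s T in auto)
  moreover have "cmod (G' (2 *C T)) < 1" by (rule G') (use s T in auto)
  moreover have "G (2 *C T) = 2 * G T" "G' (2 *C T) = 2 * G' T"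
   using assms(1,2) T unfolding normal_on_def by auto
  ultimately have "2 * cmod (G T) < 1" "2 * cmod (G' T) < 1" by (simp_all add: norm_mult)
  then show ?thesis using norm_triangle_ineq4[of "G T" "G' T"] by simp
 qed
 then show ?thesis
  using assms(1,2) F unfolding normal_on_def
  by (intro conjI exI[of _ "F \<union> F'"] exI[of _ "min \<epsilon> \<epsilon>' / 2"]) (auto simp: algebra_simps)
qed

text \<open>A nonzero value can be scaled to 1. By density, \<open>T\<close> minus a suitable
  element of \<open>A\<close>, scaled by the same factor, lies in a neighbourhood where
  \<open>G\<close> stays below 1, yet \<open>G\<close> takes the value 1 there.\<close>

lemma normal_on_zeroI:
 assumes G: "normal_on M G" and A: "A \<subseteq> M" "\<And>a. a \<in> A ==> G a = 0" and T: "T \<in> M" and M: "vna M"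
  and dense: "\<And>F \<delta>. finite F ==> F \<subseteq> predual ==> \<delta> > 0 ==> \<exists>a\<in>A. \<forall>\<omega>\<in>F. cmod (\<omega> (T - a)) < \<delta>"
 shows "G T = 0"
proof (rule ccontr)
 assume nz: "G T \<noteq> 0"
 interpret vna M by fact
 obtain F \<epsilon> where F: "finite F" "F \<subseteq> predual" "\<epsilon> > 0"
  and *: "\<And>T. T \<in> M ==> (\<forall>\<omega>\<in>F. cmod (\<omega> T) < \<epsilon>) ==> cmod (G T) < 1"
  using G unfolding normal_on_def by metis
 define c where "c = 1 / G T"
 have c: "c \<noteq> 0" "c * G T = 1" using nz by (auto simp: c_def)
 obtain a where a: "a \<in> A" "\<forall>\<omega>\<in>F. cmod (\<omega> (T - a)) < \<epsilon> / cmod c"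
  using dense[OF F(1,2), of "\<epsilon> / cmod c"] F(3) c by auto
 have "cmod (\<omega> (c *C (T - a))) < \<epsilon>" if w: "\<omega> \<in> F" for \<omega>
 proof -
  have "\<omega> (c *C (T - a)) = c * \<omega> (T - a)" using w F(2) by (intro predual_scaleC) auto
  moreover have "cmod (\<omega> (T - a)) < \<epsilon> / cmod c" using a(2) w by blast
  ultimately show ?thesis using c by (simp add: norm_mult pos_less_divide_eq mult.commute)
 qed
 then have "cmod (G (c *C (T - a))) < 1" using a A T by (intro *) auto
 moreover have "G (c *C (T - a)) = c * (G T - G a)"
  using G a A T unfolding normal_on_def by (auto simp: subset_iff)
 ultimately show False using a A c by simp
qed

lemma normal_on_bounded:
 assumes "normal_on M G" "vna M"
 obtains C where "C \<ge> 0" "\<And>T. T \<in> M ==> cmod (G T) \<le> C * norm T"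
proof -
 interpret vna M by fact
 obtain F \<epsilon> where F: "finite F" "F \<subseteq> predual" "\<epsilon> > 0"
  and *: "\<And>T. T \<in> M ==> (\<forall>\<omega>\<in>F. cmod (\<omega> T) < \<epsilon>) ==> cmod (G T) < 1"
  using assms(1) unfolding normal_on_def by metis
 have "\<forall>\<omega>\<in>F. \<exists>C\<ge>0. \<forall>T. cmod (\<omega> T) \<le> C * norm T"
  using F(2) predual_norm_bound by (metis subsetD)
 then obtain C where C: "\<And>\<omega>. \<omega> \<in> F ==> C \<omega> \<ge> 0" "\<And>\<omega> T. \<omega> \<in> F ==> cmod (\<omega> T) \<le> C \<omega> * norm T"
  by metis
 define D where "D = (1 + (\<Sum>\<omega>\<in>F. C \<omega>)) / \<epsilon>"
 have CD: "C \<omega> < D * \<epsilon>" if "\<omega> \<in> F" for \<omega>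
  using member_le_sum[OF that _ F(1), of C] C(1) F(3) by (simp add: D_def)
 have D: "D > 0" using F(3) C(1) by (simp add: D_def sum_nonneg add_pos_nonneg)
 have "cmod (G T) \<le> D * norm T" if T: "T \<in> M" for T
 proof (cases "T = 0")
  case True
  then show ?thesis using assms(1) T unfolding normal_on_def
   by (metis (no_types) diff_self norm_zero mult_zero_right order_refl T)
 next
  case False
  define s where "s = complex_of_real (inverse (D * norm T))"
  have "cmod (\<omega> (s *C T)) < \<epsilon>" if w: "\<omega> \<in> F" for \<omega>
  proof -
   have "\<omega> \<in> predual" using w F by auto
   then have "cmod (\<omega> (s *C T)) = inverse (D * norm T) * cmod (\<omega> T)"
    using D by (simp add: predual_scaleC norm_mult s_def norm_inverse)
   also have "\<dots> \<le> inverse (D * norm T) * (C \<omega> * norm T)"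
    using D by (intro mult_left_mono C(2)[OF w]) auto
   also have "\<dots> < \<epsilon>" using False D CD[OF w] by (simp add: field_simps)
   finally show ?thesis .
  qed
  then have "cmod (G (s *C T)) < 1" using T by (intro *) auto
  moreover have "G (s *C T) = s * G T" using assms(1) T unfolding normal_on_def by auto
  moreover have "cmod s = inverse (D * norm T)"
   unfolding s_def norm_of_real using D by simp
  ultimately have "inverse (D * norm T) * cmod (G T) < 1" by (simp only: norm_mult)
  moreover have "D * norm T > 0" using False D by simp
  ultimately show ?thesis by (simp add: inverse_eq_divide pos_divide_less_eq)
 qed
 then show ?thesis using D that[of D] by auto
qed

lemma normal_on_comp:
 assumes \<Phi>: "normal_unital_star_hom M N \<Phi>" and \<omega>: "\<omega> \<in> predual" and M: "vna M"
 shows "normal_on M (\<lambda>T. \<omega> (\<Phi> T))"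
proof -
 interpret vna M by fact
 have add: "\<And>a b. a \<in> M ==> b \<in> M ==> \<Phi> (a + b) = \<Phi> a + \<Phi> b"
  and sc: "\<And>c a. a \<in> M ==> \<Phi> (c *C a) = c *C \<Phi> a"
  and cont: "continuous_map (subtopology sigma_weak M) sigma_weak \<Phi>"
  using \<Phi> by (auto simp: normal_unital_star_hom_def)
 have diff: "\<Phi> (a - b) = \<Phi> a - \<Phi> b" if "a \<in> M" "b \<in> M" for a b
  using add[of "a - b" b] that by (simp add: algebra_simps)
 have z: "\<Phi> 0 = 0" using diff[of 0 0] by simp
 let ?U = "{T. cmod (\<omega> T - \<omega> 0) < 1}"
 have w0: "\<omega> 0 = 0" using predual_diff[OF \<omega>, of 0 0] by simp
 have "openin sigma_weak ?U"
  unfolding sigma_weak_def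
  by (rule topology_generated_by_Basis, intro CollectI exI conjI) (rule refl, use \<omega> in auto)
 then have "openin (subtopology sigma_weak M) {T \<in> topspace (subtopology sigma_weak M). \<Phi> T \<in> ?U}"
  by (rule openin_continuous_map_preimage[OF cont])
 then obtain V where V: "openin sigma_weak V"
  "{T \<in> topspace (subtopology sigma_weak M). \<Phi> T \<in> ?U} = V \<inter> M"
  by (auto simp: openin_subtopology)
 have "0 \<in> {T \<in> topspace (subtopology sigma_weak M). \<Phi> T \<in> ?U}" by (simp add: z)
 then have "0 \<in> V" unfolding V(2) by simp
 from sigma_weak_nbhd[OF V(1) this] obtain F \<epsilon> where F: "finite F" "F \<subseteq> predual" "\<epsilon> > 0"
  "\<forall>T. (\<forall>\<omega>\<in>F. cmod (\<omega> T - \<omega> 0) < \<epsilon>) \<longrightarrow> T \<in> V" by auto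
 have "cmod (\<omega> (\<Phi> T)) < 1" if T: "T \<in> M" "\<forall>\<omega>\<in>F. cmod (\<omega> T) < \<epsilon>" for T
 proof -
  have "T \<in> V"
  proof (rule F(4)[rule_format])
   fix \<omega>' assume w: "\<omega>' \<in> F"
   then have "\<omega>' 0 = 0" using predual_diff[of \<omega>' 0 0] F(2) by auto
   with T w show "cmod (\<omega>' T - \<omega>' 0) < \<epsilon>" by simp
  qed
  then have "\<Phi> T \<in> ?U" using V(2) T by blast
  then show ?thesis by (simp add: w0)
 qed
 then show ?thesis
  unfolding normal_on_def using F(1-3)
  by (auto simp: diff sc predual_diff[OF \<omega>] predual_scaleC[OF \<omega>])
qed

section \<open>Bicommutant density for finitely many normal functionals\<close>

lemma tensor_construct:
 fixes v :: "'k => 'i ell2"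
 assumes "\<And>K. finite K ==> (\<Sum>k\<in>K. (norm (v k))^2) \<le> C"
 obtains W :: "('k \<times> 'i) ell2" where "\<And>k. cl (ket k) W = v k" "(norm W)^2 \<le> C"
proof -
 have "(\<Sum>ki\<in>F. (cmod (case ki of (k, i) => ell2_fun (v k) i))^2) \<le> C" if F: "finite F" for F
 proof -
  have "(\<Sum>ki\<in>F. (cmod (case ki of (k, i) => ell2_fun (v k) i))^2)
    \<le> (\<Sum>ki\<in>fst ` F \<times> snd ` F. (cmod (case ki of (k, i) => ell2_fun (v k) i))^2)"
   using F by (intro sum_mono2) (auto intro: rev_image_eqI)
  also have "\<dots> = (\<Sum>k\<in>fst ` F. \<Sum>i\<in>snd ` F. (cmod (ell2_fun (v k) i))^2)"
   by (simp add: sum.cartesian_product case_prod_unfold)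
  also have "\<dots> \<le> (\<Sum>k\<in>fst ` F. (norm (v k))^2)"
   using F by (intro sum_mono ell2_sum_le_norm) auto
  also have "\<dots> \<le> C" using F by (intro assms) auto
  finally show ?thesis .
 qed
 then obtain W :: "('k \<times> 'i) ell2" where W: "ell2_fun W = (\<lambda>(k, i). ell2_fun (v k) i)" "(norm W)^2 \<le> C"
  by (rule ell2_construct)
 have "cl (ket k) W = v k" for k by (rule ell2_ext) (simp add: cl_ket_fun W)
 with W(2) that show ?thesis by blast
qed

text \<open>The vectors of the finitely many functionals are collected in one vector \<open>\<Xi>\<close> of an amplification; the
 projection onto the closure of \<open>(1 \<otimes> A)\<Xi>\<close> commutes with \<open>1 \<otimes> T\<close> for \<open>T\<close> in the bicommutant.\<close>

lemma double_commutant_dense: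
 fixes A :: "'i bop set"
 assumes A: "1 \<in> A" "\<And>a b. a \<in> A ==> b \<in> A ==> a + b \<in> A" "\<And>c a. a \<in> A ==> c *C a \<in> A"
  "\<And>a b. a \<in> A ==> b \<in> A ==> a * b \<in> A" "\<And>a. a \<in> A ==> adj a \<in> A"
  and T: "T \<in> commutant (commutant A)" and F: "finite F" "F \<subseteq> predual" and \<delta>: "\<delta> > 0"
 shows "\<exists>a\<in>A. \<forall>\<omega>\<in>F. cmod (\<omega> (T - a)) < \<delta>"
proof -
 have "\<forall>\<omega>\<in>F. \<exists>\<xi> \<eta>. sq_summable \<xi> \<and> sq_summable \<eta> \<and> \<omega> = (\<lambda>T. \<Sum>n. \<langle>\<eta> n, T $ \<xi> n\<rangle>)"
 proof
  fix \<omega> assume "\<omega> \<in> F"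
  then have "\<omega> \<in> predual" using F(2) by auto
  then show "\<exists>\<xi> \<eta>. sq_summable \<xi> \<and> sq_summable \<eta> \<and> \<omega> = (\<lambda>T. \<Sum>n. \<langle>\<eta> n, T $ \<xi> n\<rangle>)"
   unfolding predual_def by blast
 qed
 then obtain \<xi> \<eta> where x: "\<And>\<omega>. \<omega> \<in> F ==> sq_summable (\<xi> \<omega>)" "\<And>\<omega>. \<omega> \<in> F ==> sq_summable (\<eta> \<omega>)"
  "\<And>\<omega>. \<omega> \<in> F ==> \<omega> = (\<lambda>T. \<Sum>n. \<langle>\<eta> \<omega> n, T $ \<xi> \<omega> n\<rangle>)" by metis
 \<comment> \<open>The vectors of all functionals become the rows of one vector. The index set is a
   whole product type, so rows outside \<open>F\<close> are set to zero.\<close>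
 define v where "v = (\<lambda>(\<omega>, n). if \<omega> \<in> F then \<xi> \<omega> n else 0)"
 define C where "C = (\<Sum>\<omega>\<in>F. \<Sum>n. (norm (\<xi> \<omega> n))^2)"
 have bnd: "(\<Sum>k\<in>K. (norm (v k))^2) \<le> C" if K: "finite K" for K
 proof -
  have "(\<Sum>k\<in>K. (norm (v k))^2) = (\<Sum>k\<in>{k \<in> K. fst k \<in> F}. (norm (v k))^2)"
   using K by (intro sum.mono_neutral_right) (auto simp: v_def split: if_splits)
  also have "\<dots> \<le> (\<Sum>k\<in>F \<times> snd ` K. (norm (v k))^2)"
   using F K by (intro sum_mono2) (auto intro: rev_image_eqI)
  also have "\<dots> = (\<Sum>\<omega>\<in>F. \<Sum>n\<in>snd ` K. (norm (\<xi> \<omega> n))^2)"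
   unfolding sum.cartesian_product by (intro sum.cong refl) (auto simp: v_def)
  also have "\<dots> \<le> C"
   unfolding C_def using K x by (intro sum_mono sq_summable_sum_le) auto
  finally show ?thesis .
 qed
 obtain \<Xi> :: "((('i bop => complex) \<times> nat) \<times> 'i) ell2" where \<Xi>: "\<And>k. cl (ket k) \<Xi> = v k"
   and "(norm \<Xi>)^2 \<le> C"
  by (rule tensor_construct[OF bnd]) (assumption, metis that)
 let ?a = "\<lambda>a. 1 \<otimes>\<^sub>o a :: ((('i bop => complex) \<times> nat) \<times> 'i) bop"
 define E0 where "E0 = (\<lambda>a. ?a a $ \<Xi>) ` A"
 define E where "E = closure E0"
 have E0: "csubspace E0"
  unfolding complex_vector.subspace_def E0_def
 proof (intro conjI ballI allI)
  have "0 *C 1 \<in> A" by (intro A)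
  then show "0 \<in> (\<lambda>a. ?a a $ \<Xi>) ` A" by (intro rev_image_eqI[of 0]) auto
 next
  fix x y assume "x \<in> (\<lambda>a. ?a a $ \<Xi>) ` A" "y \<in> (\<lambda>a. ?a a $ \<Xi>) ` A"
  then obtain a b where "a \<in> A" "x = ?a a $ \<Xi>" "b \<in> A" "y = ?a b $ \<Xi>" by auto
  then show "x + y \<in> (\<lambda>a. ?a a $ \<Xi>) ` A"
   by (intro rev_image_eqI[of "a + b"]) (auto simp: A tensor_op_add_right)
 next
  fix c x assume "x \<in> (\<lambda>a. ?a a $ \<Xi>) ` A"
  then obtain a where "a \<in> A" "x = ?a a $ \<Xi>" by auto
  then show "c *C x \<in> (\<lambda>a. ?a a $ \<Xi>) ` A"
   by (intro rev_image_eqI[of "c *C a"]) (auto simp: A tensor_op_scaleC_right)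
 qed
 have E: "csubspace E" "closed E"
  unfolding E_def by (auto intro: csubspace_closure E0)
 have inv: "?a a $ x \<in> E" if a: "a \<in> A" and x: "x \<in> E" for a x
 proof -
  obtain f where f: "\<And>n. f n \<in> E0" "f \<longlonglongrightarrow> x" using x by (auto simp: E_def closure_sequential)
  have "?a a $ f n \<in> E0" for n
  proof -
   obtain b where "b \<in> A" "f n = ?a b $ \<Xi>" using f(1)[of n] by (auto simp: E0_def)
   then show ?thesis unfolding E0_def
    by (intro rev_image_eqI[of "a * b"]) (auto simp: A a tensor_op_mult_apply)
  qed
  moreover have "(\<lambda>n. ?a a $ f n) \<longlonglongrightarrow> ?a a $ x" by (rule bop_tendsto[OF f(2)])
  ultimately show ?thesis unfolding E_def closure_sequential by (intro exI[of _ "\<lambda>n. ?a a $ f n"]) auto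
 qed
 have "\<exists>s. s \<in> E \<and> (\<forall>t\<in>E. \<langle>t, x - s\<rangle> = 0)" for x
  using cinner_decomposition[OF E, of x] by metis
 then obtain P where P: "\<And>x. P x \<in> E" "\<And>x t. t \<in> E ==> \<langle>t, x - P x\<rangle> = 0" by metis
 have Puniq: "P x = s" if s: "s \<in> E" "\<And>t. t \<in> E ==> \<langle>t, x - s\<rangle> = 0" for x s
 proof -
  have d: "P x - s \<in> E" using E P(1) s(1) complex_vector.subspace_diff by blast
  have "\<langle>P x - s, (x - s) - (x - P x)\<rangle> = 0"
   unfolding cinner_diff_right[of _ "x - s"] using P(2)[OF d] s(2)[OF d] by simp
  then show ?thesis by (simp add: cinner_norm)
 qed
 have orth: "norm (P x) \<le> norm x" for x
 proof -
  have "(norm (P x))^2 = cmod \<langle>P x, x\<rangle>"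
   using P(2)[OF P(1)[of x], of x] by (simp add: cinner_diff_right cinner_norm norm_power)
  also have "\<dots> \<le> norm (P x) * norm x" by (rule cauchy_schwarz)
  finally have "norm (P x) * norm (P x) \<le> norm (P x) * norm x" by (simp add: power2_eq_square)
  then show ?thesis by (cases "norm (P x) = 0") auto
 qed
 have bP: "bcl P"
 proof (rule bclI[where C = 1])
  show "P (x + y) = P x + P y" for x y
  proof (rule Puniq)
   show "P x + P y \<in> E" using E P(1) complex_vector.subspace_add by blast
   have "x + y - (P x + P y) = (x - P x) + (y - P y)" by simp
   then show "\<langle>t, x + y - (P x + P y)\<rangle> = 0" if "t \<in> E" for t
    using P(2)[OF that] by (simp only: cinner_add_right) simp
  qed
  show "P (c *C x) = c *C P x" for c x
  proof (rule Puniq)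
   show "c *C P x \<in> E" using E P(1) complex_vector.subspace_scale by blast
   show "\<langle>t, c *C x - c *C P x\<rangle> = 0" if "t \<in> E" for t
    using P(2)[OF that, of x] by (simp add: complex_vector.scale_right_diff_distrib[symmetric] cinner_scaleC_right)
  qed
 qed (use orth in auto)
 define p where "p = Abs_bop P"
 have p: "p $ x = P x" for x by (simp add: p_def apply_Abs_bop bP)
 have comm: "p $ ?a a $ x = ?a a $ p $ x" if a: "a \<in> A" for a x
  unfolding p
 proof (rule Puniq)
  show "?a a $ P x \<in> E" by (rule inv[OF a P(1)])
  fix t assume t: "t \<in> E"
  have "\<langle>?a (adj a) $ t, x - P x\<rangle> = 0" by (rule P(2)[OF inv[OF A(5)[OF a] t]])
  then show "\<langle>t, ?a a $ x - ?a a $ P x\<rangle> = 0"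
   by (metis adj_adj adj_tensor_op adj_one bop_diff_right adj_left)
 qed
 \<comment> \<open>The blocks of the projection lie in the commutant of \<open>A\<close>, so
   \<open>T\<close> commutes with each of them; \<open>pTk\<close> and \<open>pT\<close> assemble
   the blocks.\<close>
 have slice: "lslice (ket l) (ket k) p \<in> commutant A" for k l
 proof (rule commutantI, rule bop_cinner_ext)
  fix a x y assume a: "a \<in> A"
  have "\<langle>y, (lslice (ket l) (ket k) p * a) $ x\<rangle> = \<langle>ket k \<otimes> y, p $ ?a a $ (ket l \<otimes> x)\<rangle>"
   by (simp add: cinner_lslice tensor_op_apply)
  also have "\<dots> = \<langle>ket k \<otimes> (adj a $ y), p $ (ket l \<otimes> x)\<rangle>"
   unfolding comm[OF a] by (simp add: adj_left[symmetric] adj_tensor_op tensor_op_apply)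
  also have "\<dots> = \<langle>y, (a * lslice (ket l) (ket k) p) $ x\<rangle>"
   by (simp add: cinner_lslice[symmetric] adj_left)
  finally show "\<langle>y, (lslice (ket l) (ket k) p * a) $ x\<rangle>
   = \<langle>y, (a * lslice (ket l) (ket k) p) $ x\<rangle>" .
 qed
 have pTk: "p $ ?a T $ (ket l \<otimes> y) = ?a T $ p $ (ket l \<otimes> y)" for l y
 proof (rule ell2_eq_if_cl_ket_eq)
  fix k
  have "cl (ket k) (p $ ?a T $ (ket l \<otimes> y)) = (lslice (ket l) (ket k) p * T) $ y"
   by (simp add: lslice_apply tensor_op_apply)
  also have "\<dots> = (T * lslice (ket l) (ket k) p) $ y"
   using commutantD[OF T slice] by simp
  also have "\<dots> = cl (ket k) (?a T $ p $ (ket l \<otimes> y))"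
   by (simp add: lslice_apply cl_id_tensor)
  finally show "cl (ket k) (p $ ?a T $ (ket l \<otimes> y)) = cl (ket k) (?a T $ p $ (ket l \<otimes> y))" .
 qed
 have pT: "p $ ?a T $ x = ?a T $ p $ x" for x
  by (rule bcl_eq_on_tensors[where S = "\<lambda>x. p $ ?a T $ x" and T = "\<lambda>x. ?a T $ p $ x"
     and A = "range ket" and B = UNIV])
   (auto simp: total_ket total_UNIV pTk intro: bcl_comp[OF bcl_bop])
 have "?a 1 $ \<Xi> \<in> E0" unfolding E0_def using A(1) by blast
 then have \<Xi>E: "\<Xi> \<in> E" using closure_subset by (auto simp: E_def)
 have "P \<Xi> = \<Xi>" by (rule Puniq[OF \<Xi>E]) simp
 then have "?a T $ \<Xi> = P (?a T $ \<Xi>)" using pT[of \<Xi>] by (simp add: p)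
 then have TE: "?a T $ \<Xi> \<in> E" using P(1) by metis
 define K where "K = 1 + (\<Sum>\<omega>\<in>F. \<Sum>n. (norm (\<eta> \<omega> n))^2)"
 have K: "(\<Sum>n. (norm (\<eta> \<omega> n))^2) + 1 \<le> K" if "\<omega> \<in> F" for \<omega>
  unfolding K_def using member_le_sum[OF that _ F(1), of "\<lambda>\<omega>. \<Sum>n. (norm (\<eta> \<omega> n))^2"] x
  by (simp add: sq_summable_nonneg)
 have Kpos: "K > 0"
  unfolding K_def using x by (intro add_pos_nonneg sum_nonneg) (auto simp: sq_summable_nonneg)
 \<comment> \<open>\<open>d\<close> is both the distance and the weight in
   \<open>predual_bound\<close>: the estimate becomes d (s + 1) / 2 \<le> d K / 2 < \<delta>, where
   s is the square sum of the \<open>\<eta> \<omega> n\<close>.\<close>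
 define d where "d = \<delta> / K"
 have d: "d > 0" using \<delta> Kpos by (simp add: d_def)
 obtain a where a: "a \<in> A" "dist (?a a $ \<Xi>) (?a T $ \<Xi>) < d"
  using TE d unfolding E_def closure_approachable E0_def by auto
 have "norm (?a (T - a) $ \<Xi>) < d"
 proof -
  have "?a (T - a) = ?a T - ?a a"
   by (rule bop_tensor_ext) (simp add: tensor_op_apply tensor_vec_rules)
  then show ?thesis using a(2) by (simp add: dist_norm norm_minus_commute)
 qed
 then have small: "(norm (?a (T - a) $ \<Xi>))^2 \<le> d\<^sup>2" by (intro power_mono) auto
 have "cmod (\<omega> (T - a)) < \<delta>" if w: "\<omega> \<in> F" for \<omega>
 proof -
  have b: "(\<Sum>n<N. (norm ((T - a) $ \<xi> \<omega> n))^2) \<le> d\<^sup>2" for N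
  proof -
   have "(\<Sum>n<N. (norm ((T - a) $ \<xi> \<omega> n))^2) = (\<Sum>k\<in>Pair \<omega> ` {..<N}. (norm (cl (ket k) (?a (T - a) $ \<Xi>)))^2)"
    by (subst sum.reindex) (auto simp: inj_on_def cl_id_tensor \<Xi> v_def w)
   also have "\<dots> \<le> (norm (?a (T - a) $ \<Xi>))^2"
    by (rule finite_sum_le_has_sum[OF cl_ket_norm_has_sum]) auto
   finally show ?thesis using small by linarith
  qed
  have "cmod (\<omega> (T - a)) \<le> (d * (\<Sum>n. (norm (\<eta> \<omega> n))^2) + d\<^sup>2 / d) / 2"
   using predual_bound(2)[OF x(1)[OF w] x(2)[OF w] d b] x(3)[OF w] by metis
  also have "\<dots> = d * ((\<Sum>n. (norm (\<eta> \<omega> n))^2) + 1) / 2"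
   using d by (simp add: power2_eq_square algebra_simps)
  also have "\<dots> \<le> d * K / 2" using K[OF w] d by (intro divide_right_mono mult_left_mono) auto
  also have "\<dots> < \<delta>" using Kpos \<delta> by (simp add: d_def)
  finally show ?thesis .
 qed
 with a(1) show ?thesis by blast
qed

lemma cspan_mult_closed:
 fixes S :: "'i bop set"
 assumes "\<And>a b. a \<in> S ==> b \<in> S ==> a * b \<in> S" "a \<in> cspan S" "b \<in> cspan S"
 shows "a * b \<in> cspan S"
 using assms(2)
proof (induction rule: complex_vector.span_induct_alt)
 case (step c x y)
 have "x * b \<in> cspan S" using assms(3)
 proof (induction rule: complex_vector.span_induct_alt)
  case (step c' x' y')
  then show ?case using assms(1) \<open>x \<in> S\<close>
   by (simp add: distrib_left complex_vector.span_add complex_vector.span_scale complex_vector.span_base)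
 qed (simp add: complex_vector.span_zero)
 with step show ?case
  by (simp add: distrib_right complex_vector.span_add complex_vector.span_scale)
qed (simp add: complex_vector.span_zero)

lemma cspan_adj_closed:
 fixes S :: "'i bop set"
 assumes "\<And>a. a \<in> S ==> adj a \<in> S" "a \<in> cspan S"
 shows "adj a \<in> cspan S"
 using assms(2)
 by (induction rule: complex_vector.span_induct_alt)
  (auto simp: complex_vector.span_zero complex_vector.span_add complex_vector.span_scale complex_vector.span_base assms)

lemma commutant_cspan: "commutant (cspan S) = commutant S"
proof
 show "commutant (cspan S) \<subseteq> commutant S"
  by (rule commutant_antimono) (auto intro: complex_vector.span_base)
 show "commutant S \<subseteq> commutant (cspan S)"
 proof (intro subsetI commutantI)
  fix T a assume T: "T \<in> commutant S" "a \<in> cspan S"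
  from T(2) show "T * a = a * T"
   by (induction rule: complex_vector.span_induct_alt)
    (auto simp: distrib_left distrib_right commutantD[OF T(1)])
 qed
qed

context vna begin

lemma tensor_vna_dense:
 assumes "T \<in> M \<otimes>\<^sub>v\<^sub>N M" "finite F" "F \<subseteq> predual" "\<delta> > 0"
 shows "\<exists>a\<in>M \<odot> M. \<forall>\<omega>\<in>F. cmod (\<omega> (T - a)) < \<delta>"
proof (rule double_commutant_dense)
 let ?S = "{a \<otimes>\<^sub>o b | a b. a \<in> M \<and> b \<in> M}"
 show "1 \<in> M \<odot> M" unfolding alg_tensor_def
  by (rule complex_vector.span_base) (use tensor_op_one one_mem in "metis (mono_tags, lifting) mem_Collect_eq")
 show "a * b \<in> M \<odot> M" if "a \<in> M \<odot> M" "b \<in> M \<odot> M" for a b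
  using that unfolding alg_tensor_def
  by (rule cspan_mult_closed[rotated]) (clarsimp simp: tensor_op_mult, metis mult_mem)
 show "adj a \<in> M \<odot> M" if "a \<in> M \<odot> M" for a
  using that unfolding alg_tensor_def
  by (rule cspan_adj_closed[rotated]) (clarsimp simp: adj_tensor_op, metis adj_mem)
 show "T \<in> commutant (commutant (M \<odot> M))"
  using assms(1) by (simp add: alg_tensor_def tensor_vna_def commutant_cspan)
qed (use assms in "auto simp: alg_tensor_def complex_vector.span_add complex_vector.span_scale")

lemma alg_tensor_subset: "M \<odot> M \<subseteq> M \<otimes>\<^sub>v\<^sub>N M"
proof
 fix T assume "T \<in> M \<odot> M"
 then show "T \<in> M \<otimes>\<^sub>v\<^sub>N M"
  unfolding tensor_vna_def commutant_cspan[symmetric, of "{a \<otimes>\<^sub>o b | a b. a \<in> M \<and> b \<in> M}"]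
  unfolding alg_tensor_def by (blast intro: subsetD[OF subset_bicommutant])
qed

lemma vna_tensor: "vna (M \<otimes>\<^sub>v\<^sub>N M)"
proof
 let ?S = "{a \<otimes>\<^sub>o b | a b. a \<in> M \<and> b \<in> M}"
 have a: "adj ` ?S \<subseteq> ?S" by (clarsimp simp: adj_tensor_op) (metis adj_mem)
 have "commutant (commutant (commutant ?S)) = commutant ?S"
  by (rule antisym, rule commutant_antimono[OF subset_bicommutant], rule subset_bicommutant)
 moreover have "adj ` commutant ?S \<subseteq> commutant ?S" using commutant_adj[OF a] by auto
 then have "adj ` commutant (commutant ?S) \<subseteq> commutant (commutant ?S)" using commutant_adj by blast
 ultimately show "von_neumann_algebra (M \<otimes>\<^sub>v\<^sub>N M)"
  unfolding von_neumann_algebra_def tensor_vna_def by simp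
qed

lemma tensor_vna_commute_left: "X \<in> M \<otimes>\<^sub>v\<^sub>N M ==> S \<in> commutant M ==> X * (S \<otimes>\<^sub>o 1) = (S \<otimes>\<^sub>o 1) * X"
 unfolding tensor_vna_def
 by (erule commutantD, rule commutantI, clarsimp simp: tensor_op_mult) (metis memD)

lemma tensor_vna_commute_right: "X \<in> M \<otimes>\<^sub>v\<^sub>N M ==> S \<in> commutant M ==> X * (1 \<otimes>\<^sub>o S) = (1 \<otimes>\<^sub>o S) * X"
 unfolding tensor_vna_def
 by (erule commutantD, rule commutantI, clarsimp simp: tensor_op_mult) (metis memD)

text \<open>Formulated by commutation because it is also applied to \<open>adj W\<close>, for which
  exactly this commutation is established.\<close>

lemma slice_right_mem_if_commute:
 assumes "\<And>S. S \<in> commutant M ==> X * (S \<otimes>\<^sub>o 1) = (S \<otimes>\<^sub>o 1) * X"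
 shows "rslice \<xi> \<eta> X \<in> M"
proof (rule memI, rule bop_cinner_ext)
 fix S x y assume S: "S \<in> commutant M"
 have "\<langle>y, (rslice \<xi> \<eta> X * S) $ x\<rangle> = \<langle>y \<otimes> \<eta>, (X * (S \<otimes>\<^sub>o 1)) $ (x \<otimes> \<xi>)\<rangle>"
  by (simp add: cinner_rslice tensor_op_apply)
 also have "\<dots> = \<langle>y, (S * rslice \<xi> \<eta> X) $ x\<rangle>"
  unfolding assms[OF S]
  by (simp add: rslice_apply cinner_cr_right[symmetric] cr_tensor_id)
 finally show "\<langle>y, (rslice \<xi> \<eta> X * S) $ x\<rangle> = \<langle>y, (S * rslice \<xi> \<eta> X) $ x\<rangle>" .
qed

lemma slice_left_mem_if_commute:
 assumes "\<And>S. S \<in> commutant M ==> X * (1 \<otimes>\<^sub>o S) = (1 \<otimes>\<^sub>o S) * X"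
 shows "lslice \<xi> \<eta> X \<in> M"
proof (rule memI, rule bop_cinner_ext)
 fix S x y assume S: "S \<in> commutant M"
 have "\<langle>y, (lslice \<xi> \<eta> X * S) $ x\<rangle> = \<langle>\<eta> \<otimes> y, (X * (1 \<otimes>\<^sub>o S)) $ (\<xi> \<otimes> x)\<rangle>"
  by (simp add: cinner_lslice tensor_op_apply)
 also have "\<dots> = \<langle>y, (S * lslice \<xi> \<eta> X) $ x\<rangle>"
  unfolding assms[OF S]
  by (simp add: lslice_apply cinner_cl_right[symmetric] cl_id_tensor)
 finally show "\<langle>y, (lslice \<xi> \<eta> X * S) $ x\<rangle> = \<langle>y, (S * lslice \<xi> \<eta> X) $ x\<rangle>" .
qed

lemma slice_right_mem [simp]: "X \<in> M \<otimes>\<^sub>v\<^sub>N M ==> rslice \<xi> \<eta> X \<in> M"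
 by (rule slice_right_mem_if_commute) (rule tensor_vna_commute_left)
lemma slice_left_mem [simp]: "X \<in> M \<otimes>\<^sub>v\<^sub>N M ==> lslice \<xi> \<eta> X \<in> M"
 by (rule slice_left_mem_if_commute) (rule tensor_vna_commute_right)

end

subsection \<open>Resolvents and monotone limits\<close>

text \<open>1 + T does not decrease norms, so its range is closed; a vector orthogonal to the range
  annihilates the form of 1 + T and is zero.\<close>

lemma one_plus_pos_inverse:
 assumes T: "pos_op T"
 shows "\<exists>R. (1 + T) * R = 1 \<and> R * (1 + T) = 1"
proof -
 let ?A = "1 + T"
 have lb: "norm x \<le> norm (?A $ x)" for x
 proof -
  have "norm x * norm x \<le> Re \<langle>x, ?A $ x\<rangle>"
   using pos_op_nonneg[OF T, of x] by (simp add: ci_rules cinner_norm power2_eq_square)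
  also have "\<dots> \<le> cmod \<langle>x, ?A $ x\<rangle>" by (rule complex_Re_le_cmod)
  also have "\<dots> \<le> norm x * norm (?A $ x)" by (rule cauchy_schwarz)
  finally show ?thesis by (cases "x = 0") auto
 qed
 have cl: "closure (range (apply_bop ?A)) = UNIV"
 proof (rule closure_UNIV_if_orthogonal_trivial)
  show "csubspace (range (apply_bop ?A))"
   unfolding complex_vector.subspace_def
  proof (intro conjI ballI allI)
   show "0 \<in> range (apply_bop ?A)" by (rule range_eqI[of _ _ 0]) simp
  next
   fix x y assume "x \<in> range (apply_bop ?A)" "y \<in> range (apply_bop ?A)"
   then show "x + y \<in> range (apply_bop ?A)" by (auto simp only: bop_add_right[symmetric] image_iff)
  next
   fix c x assume "x \<in> range (apply_bop ?A)"
   then show "c *C x \<in> range (apply_bop ?A)" by (auto simp only: bop_scaleC_right[symmetric] image_iff)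
  qed
  show "z = 0" if "\<And>s. s \<in> range (apply_bop ?A) ==> \<langle>s, z\<rangle> = 0" for z
  proof -
   have "\<langle>z, ?A $ z\<rangle> = 0" using that[of "?A $ z"] by (metis cinner_commute complex_cnj_zero rangeI)
   then have "Re \<langle>z, T $ z\<rangle> + (norm z)^2 = 0"
    by (metis add.commute cinner_add_right cinner_norm one_bop.rep_eq plus_bop.rep_eq Re_complex_of_real plus_complex.simps(1) zero_complex.simps(1))
   then show "z = 0" using pos_op_nonneg[OF T, of z] by (metis add_nonneg_eq_0_iff norm_eq_zero zero_eq_power2 zero_le_power2)
  qed
 qed
 have "\<exists>x. ?A $ x = y" for y
 proof -
  have "y \<in> closure (range (apply_bop ?A))" by (simp only: cl UNIV_I)
  then obtain f where f: "\<And>n. f n \<in> range (apply_bop ?A)" "f \<longlonglongrightarrow> y"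
   unfolding closure_sequential by (elim exE conjE) (rule that, auto)
  have "\<forall>n. \<exists>x. f n = ?A $ x" using f(1) by (simp add: image_iff del: plus_bop.rep_eq)
  then obtain g where g: "\<And>n. f n = ?A $ g n" by metis
  have le: "dist (g m) (g n) \<le> dist (f m) (f n)" for m n
   unfolding dist_norm g bop_diff_right[symmetric] by (rule lb)
  have "Cauchy g"
  proof (rule metric_CauchyI)
   fix e :: real assume "e > 0"
   then obtain N where "\<And>m n. m \<ge> N ==> n \<ge> N ==> dist (f m) (f n) < e"
    using LIMSEQ_imp_Cauchy[OF f(2)] by (meson metric_CauchyD)
   then show "\<exists>N. \<forall>m\<ge>N. \<forall>n\<ge>N. dist (g m) (g n) < e"
    using le_less_trans[OF le] by blast
  qed
  then obtain x where "g \<longlonglongrightarrow> x" using Cauchy_convergent by (auto simp: convergent_def)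
  then have "f \<longlonglongrightarrow> ?A $ x" using bop_tendsto[of g x _ ?A] unfolding g[symmetric] by simp
  with f(2) show ?thesis using LIMSEQ_unique by blast
 qed
 then obtain S where S: "\<And>y. ?A $ S y = y" by metis
 have inj: "x = y" if "?A $ x = ?A $ y" for x y
  using lb[of "x - y"] that by (simp only: bop_diff_right) simp
 have "bcl S"
 proof (rule bclI[where C = 1])
  show "S (x + y) = S x + S y" for x y by (rule inj) (simp only: S bop_add_right)
  show "S (c *C x) = c *C S x" for c x by (rule inj) (simp only: S bop_scaleC_right)
  show "norm (S x) \<le> 1 * norm x" for x using lb[of "S x"] unfolding S by simp
 qed
 then have *: "Abs_bop S $ y = S y" for y by (rule apply_Abs_bop)
 show ?thesis
 proof (intro exI[of _ "Abs_bop S"] conjI bop_ext)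
  fix x
  show "(?A * Abs_bop S) $ x = 1 $ x" using S[of x] by (simp add: *)
  show "(Abs_bop S * ?A) $ x = 1 $ x" using inj[OF S, of x] by (simp add: *)
 qed
qed

text \<open>Resolvents take the place of functional calculus. \<open>res T\<close> is the inverse of
  1 + T, and \<open>frac_op T\<close>, which equals T / (1 + T), is a monotone transform of T
  dominated by both T and 1.\<close>

definition res :: "'i bop => 'i bop" where
 "res T = (SOME R. (1 + T) * R = 1 \<and> R * (1 + T) = 1)"

abbreviation frac_op :: "'i bop => 'i bop" where "frac_op T \<equiv> 1 - res T"

lemma res_right: "pos_op T ==> (1 + T) * res T = 1"
 and res_left: "pos_op T ==> res T * (1 + T) = 1"
 unfolding res_def using someI_ex[OF one_plus_pos_inverse[of T]] by auto

lemma res_right_apply: "pos_op T ==> (1 + T) $ res T $ x = x"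
 using arg_cong[OF res_right, of T "\<lambda>A. A $ x"] by simp

lemma cinner_res: "pos_op T ==> \<langle>x, res T $ x\<rangle> = \<langle>(1 + T) $ res T $ x, res T $ x\<rangle>"
 by (simp only: res_right_apply)

lemma Re_cinner_swap: "Re \<langle>x, y\<rangle> = Re \<langle>y, x\<rangle>"
 by (metis cinner_commute complex_cnj(1) cnj.simps(1))

lemma pos_res: assumes T: "pos_op T" shows "pos_op (res T)"
proof -
 have T1: "pos_op (1 + T)" using T by (intro pos_op_add) auto
 then have "\<langle>x, res T $ x\<rangle> = \<langle>res T $ x, (1 + T) $ res T $ x\<rangle>" for x
  unfolding cinner_res[OF T] by (metis adj_left pos_op_adj)
 then show ?thesis using T1 unfolding pos_op_def by metis
qed

text \<open>With v = \<open>res T $ x\<close> one has Re <x, v> = |v|^2 + <v, T v>, and the form of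
  \<open>T\<close> dominates that of \<open>c *R (adj a * a)\<close>. The case c = 0 serves as the
  bare estimate of |v|.\<close>

lemma res_gram_bound:
 assumes T: "pos_op T" and a: "c *R (adj a * a) \<preceq> T"
 shows "c * (norm (a $ res T $ x))^2 + (norm (res T $ x))^2 \<le> Re \<langle>x, res T $ x\<rangle>"
proof -
 let ?v = "res T $ x"
 have "c * (norm (a $ ?v))^2 \<le> Re \<langle>?v, T $ ?v\<rangle>"
  using pos_op_nonneg[OF a, of ?v] by (simp add: ci_rules cinner_scaleR_right adj_right cinner_norm)
 moreover have "Re \<langle>x, ?v\<rangle> = (norm ?v)^2 + Re \<langle>?v, T $ ?v\<rangle>"
  unfolding cinner_res[OF T] by (simp add: ci_rules cinner_norm Re_cinner_swap[of "T $ ?v"])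
 ultimately show ?thesis by simp
qed

lemma norm_res: assumes T: "pos_op T" shows "norm (res T $ x) \<le> norm x"
proof -
 have "(norm (res T $ x))^2 \<le> Re \<langle>x, res T $ x\<rangle>" using res_gram_bound[OF T, of 0] T by simp
 also have "\<dots> \<le> norm x * norm (res T $ x)"
  using complex_Re_le_cmod cauchy_schwarz order_trans by blast
 finally show ?thesis by (cases "res T $ x = 0") (auto simp: power2_eq_square)
qed

lemma res_le_one: assumes T: "pos_op T" shows "res T \<preceq> 1"
proof -
 have "Re \<langle>x, res T $ x\<rangle> \<le> Re \<langle>x, 1 $ x\<rangle>" for x
 proof -
  have "Re \<langle>x, res T $ x\<rangle> \<le> norm x * norm (res T $ x)"
   using complex_Re_le_cmod cauchy_schwarz order_trans by blast
  also have "\<dots> \<le> norm x * norm x" using norm_res[OF T] by (intro mult_left_mono) auto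
  finally show ?thesis by (simp add: cinner_norm power2_eq_square)
 qed
 then show ?thesis by (subst bop_le_iff) (auto simp: pos_op_adj[OF pos_res[OF T]])
qed

lemma res_sq_le: assumes T: "pos_op T" shows "(norm (res T $ x))^2 \<le> Re \<langle>x, res T $ x\<rangle>"
 using res_gram_bound[OF T, of 0] T by simp

lemma norm_mult_res:
 assumes T: "pos_op T" and a: "c *R (adj a * a) \<preceq> T" and c: "c > 0"
 shows "norm (a $ res T $ x) \<le> norm x / sqrt c"
proof -
 have "c * (norm (a $ res T $ x))^2 \<le> Re \<langle>x, 1 $ x\<rangle>"
  using res_gram_bound[OF T a, of x] pos_op_nonneg[OF res_le_one[OF T], of x]
   zero_le_power2[of "norm (res T $ x)"] unfolding minus_bop.rep_eq cinner_diff_right minus_complex.simps by linarith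
 then have "(sqrt c * norm (a $ res T $ x))^2 \<le> (norm x)^2"
  using c by (simp add: power_mult_distrib cinner_norm)
 then have "sqrt c * norm (a $ res T $ x) \<le> norm x" by (rule power2_le_imp_le) simp
 then show ?thesis using c by (simp add: field_simps)
qed

text \<open>For w = \<open>a $ res T $ adj a $ x\<close> one gets c |w|^2 \<le> |x| |w|. Hence a
  large \<open>c\<close> makes the resolvent small on the range of \<open>adj a\<close>.\<close>

lemma res_adj_bound:
 assumes T: "pos_op T" and a: "c *R (adj a * a) \<preceq> T" and c: "c > 0"
 shows "Re \<langle>adj a $ x, res T $ adj a $ x\<rangle> \<le> (norm x)^2 / c"
proof -
 let ?w = "a $ res T $ adj a $ x"
 have "Re \<langle>adj a $ x, res T $ adj a $ x\<rangle> = Re \<langle>x, ?w\<rangle>" by (simp add: adj_left)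
 also have "\<dots> \<le> norm x * norm ?w" using complex_Re_le_cmod cauchy_schwarz order_trans by blast
 finally have 1: "Re \<langle>adj a $ x, res T $ adj a $ x\<rangle> \<le> norm x * norm ?w" .
 have "c * (norm ?w)^2 \<le> norm x * norm ?w"
  using res_gram_bound[OF T a, of "adj a $ x"] 1 zero_le_power2[of "norm (res T $ adj a $ x)"] by linarith
 then have "norm ?w \<le> norm x / c"
  using c by (cases "?w = 0") (auto simp: power2_eq_square field_simps)
 then have "norm x * norm ?w \<le> norm x * (norm x / c)" by (intro mult_left_mono) auto
 with 1 show ?thesis by (simp add: power2_eq_square)
qed

text \<open>Cauchy-Schwarz for the form of 1 + S at u = \<open>res S $ x\<close> and v =
  \<open>res T $ x\<close>, where <u, (1 + S) v> = <x, v>, and the form of 1 + S at v is at most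
  that of 1 + T, which is Re <x, v>.\<close>

lemma res_antimono:
 assumes S: "pos_op S" and T: "pos_op T" and le: "S \<preceq> T"
 shows "res T \<preceq> res S"
proof -
 have "Re \<langle>x, res T $ x\<rangle> \<le> Re \<langle>x, res S $ x\<rangle>" for x
 proof -
  let ?u = "res S $ x" and ?v = "res T $ x"
  have S1: "pos_op (1 + S)" using S by (intro pos_op_add) auto
  have "\<langle>?u, (1 + S) $ ?v\<rangle> = \<langle>x, ?v\<rangle>"
   by (metis S1 S adj_left pos_op_adj res_right_apply)
  moreover have "Re \<langle>?v, (1 + S) $ ?v\<rangle> \<le> Re \<langle>?v, (1 + T) $ ?v\<rangle>"
   using pos_op_nonneg[OF le, of ?v] by (simp add: ci_rules)
  moreover have "Re \<langle>?v, (1 + T) $ ?v\<rangle> = Re \<langle>x, ?v\<rangle>" "Re \<langle>?u, (1 + S) $ ?u\<rangle> = Re \<langle>x, ?u\<rangle>"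
   using Re_cinner_swap by (simp_all only: res_right_apply S T)
  moreover have "0 \<le> Re \<langle>x, ?u\<rangle>" "0 \<le> Re \<langle>x, ?v\<rangle>" using S T pos_res pos_op_nonneg by auto
  ultimately have "(cmod \<langle>x, ?v\<rangle>)^2 \<le> Re \<langle>x, ?u\<rangle> * Re \<langle>x, ?v\<rangle>"
   using pos_op_cauchy_schwarz[OF S1, of ?u ?v] by (smt (verit) mult_left_mono)
  moreover have "(Re \<langle>x, ?v\<rangle>)^2 \<le> (cmod \<langle>x, ?v\<rangle>)^2" by (simp add: cmod_power2)
  ultimately have "Re \<langle>x, ?v\<rangle> * Re \<langle>x, ?v\<rangle> \<le> Re \<langle>x, ?u\<rangle> * Re \<langle>x, ?v\<rangle>" by (simp add: power2_eq_square)
  with \<open>0 \<le> Re \<langle>x, ?u\<rangle>\<close> \<open>0 \<le> Re \<langle>x, ?v\<rangle>\<close> show ?thesis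
   by (cases "Re \<langle>x, ?v\<rangle> = 0") auto
 qed
 then show ?thesis using S T by (subst bop_le_iff) (auto simp: pos_op_adj[OF pos_res])
qed

lemma pos_frac: "pos_op T ==> pos_op (frac_op T)" by (rule res_le_one)

text \<open>T - T / (1 + T) equals T (1 + T)^-1 T, a conjugate of a positive operator.\<close>

lemma frac_le: assumes T: "pos_op T" shows "frac_op T \<preceq> T"
proof -
 have 1: "frac_op T = T * res T" using res_right[OF T] by (simp add: algebra_simps)
 have 2: "frac_op T = res T * T" using res_left[OF T] by (simp add: algebra_simps)
 have "adj T * res T * T = T * frac_op T" unfolding pos_op_adj[OF T] 2 by (rule mult.assoc)
 also have "\<dots> = T - T * res T" by (simp only: right_diff_distrib mult_1_right)
 also have "\<dots> = T - frac_op T" by (simp only: 1)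
 finally have "T - frac_op T = adj T * res T * T" by simp
 then show ?thesis using pos_op_conj[OF pos_res[OF T]] by simp
qed

lemma frac_le_one: "pos_op T ==> frac_op T \<preceq> 1" using pos_res by simp

lemma frac_sq_le: assumes T: "pos_op T" shows "adj (frac_op T) * frac_op T \<preceq> frac_op T"
proof -
 have "(norm (frac_op T $ x))^2 \<le> 1 * Re \<langle>x, frac_op T $ x\<rangle>" for x
  by (rule pos_op_norm_sq_le[OF pos_frac[OF T]])
   (use pos_op_nonneg[OF frac_le_one[OF T]] in "simp add: ci_rules cinner_norm")
 then show ?thesis
  by (subst bop_le_iff)
   (auto simp: pos_op_adj[OF pos_frac[OF T]] cinner_norm adj_left[symmetric] simp del: minus_bop.rep_eq adj_diff)
qed

lemma res_commute:
 assumes T: "pos_op T" and S: "T * S = S * T"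
 shows "res T * S = S * res T"
proof -
 have "res T * S = res T * S * ((1 + T) * res T)" by (simp add: res_right[OF T])
 also have "\<dots> = (res T * (1 + T)) * S * res T" by (simp add: algebra_simps S)
 finally show ?thesis by (simp add: res_left[OF T])
qed

lemma (in vna) res_mem [simp]: "T \<in> M ==> pos_op T ==> res T \<in> M"
 by (rule memI) (rule res_commute, auto intro: memD)

lemma polarization:
 fixes B :: "'a :: complex_vector => 'a => complex"
 assumes "\<And>x y z. B (x + y) z = B x z + B y z" "\<And>x y z. B z (x + y) = B z x + B z y"
  and "\<And>c x y. B (c *C x) y = cnj c * B x y" "\<And>c x y. B x (c *C y) = c * B x y"
 shows "4 * B x y = B (x + y) (x + y) - B (x + (-1) *C y) (x + (-1) *C y)
  - \<i> * B (x + \<i> *C y) (x + \<i> *C y) + \<i> * B (x + (-\<i>) *C y) (x + (-\<i>) *C y)"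
 unfolding assms by (simp add: algebra_simps)

text \<open>Monotone bounded quadratic forms converge, and polarization turns their limit into a
  bounded sesquilinear form, hence into an operator.\<close>

lemma mono_weak_limit:
 fixes A :: "nat => 'i bop"
 assumes pos: "\<And>n. pos_op (A n)" and mono: "\<And>n. A n \<preceq> A (Suc n)" and bd: "\<And>n. A n \<preceq> c *R 1"
 obtains B where "pos_op B" "\<And>x y. (\<lambda>n. \<langle>x, A n $ y\<rangle>) \<longlonglongrightarrow> \<langle>x, B $ y\<rangle>"
  "\<And>n. A n \<preceq> B" "B \<preceq> c *R 1"
proof -
 define q where "q n x = Re \<langle>x, A n $ x\<rangle>" for n x
 have q_le: "q n x \<le> c * (norm x)^2" for n x
  using pos_op_nonneg[OF bd[of n], of x] by (simp add: q_def ci_rules cinner_scaleR_right cinner_norm)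
 have q_inc: "incseq (\<lambda>n. q n x)" for x
  by (rule incseq_SucI) (use pos_op_nonneg[OF mono, of x] in "simp add: q_def ci_rules")
 have "convergent (\<lambda>n. q n x)" for x
  by (rule incseq_convergent[OF q_inc, of x "c * (norm x)^2"]) (use q_le in "auto simp: convergent_def")
 then obtain Q where Q: "\<And>x. (\<lambda>n. q n x) \<longlonglongrightarrow> Q x" unfolding convergent_def by metis
 have qc: "\<langle>x, A n $ x\<rangle> = of_real (q n x)" for n x unfolding q_def using pos_op_real[OF pos] by simp
 define P where "P x y = (complex_of_real (Q (x + y)) - Q (x + (-1) *C y) - \<i> * Q (x + \<i> *C y) + \<i> * Q (x + (-\<i>) *C y)) / 4" for x y
 have lim: "(\<lambda>n. \<langle>x, A n $ y\<rangle>) \<longlonglongrightarrow> P x y" for x y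
 proof -
  have "4 * \<langle>x, A n $ y\<rangle> = complex_of_real (q n (x + y)) - q n (x + (-1) *C y) - \<i> * q n (x + \<i> *C y) + \<i> * q n (x + (-\<i>) *C y)" for n
   unfolding qc[symmetric]
   by (rule polarization[where B = "\<lambda>x y. \<langle>x, A n $ y\<rangle>"]) (auto simp: bop_rules ci_rules)
  then have "\<langle>x, A n $ y\<rangle> = (complex_of_real (q n (x + y)) - q n (x + (-1) *C y) - \<i> * q n (x + \<i> *C y) + \<i> * q n (x + (-\<i>) *C y)) / 4" for n
   by (metis nonzero_mult_div_cancel_left zero_neq_numeral)
  then show ?thesis unfolding P_def by (simp only:) (intro tendsto_intros Q, simp)
 qed
 have A_bd: "cmod \<langle>x, A n $ y\<rangle> \<le> c * norm x * norm y" for x n y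
 proof -
  have c: "0 \<le> c * (norm x)^2" for x :: "'i ell2" using q_le[of 0 x] pos_op_nonneg[OF pos[of 0], of x] by (simp add: q_def)
  obtain z :: "'i ell2" where "z \<noteq> 0" using ex_nonzero_ell2 by blast
  with c[of z] have c0: "0 \<le> c" by (simp add: zero_le_mult_iff)
  have "(cmod \<langle>x, A n $ y\<rangle>)^2 \<le> q n x * q n y" unfolding q_def by (rule pos_op_cauchy_schwarz[OF pos])
  also have "\<dots> \<le> (c * (norm x)^2) * (c * (norm y)^2)"
   by (intro mult_mono q_le c) (simp add: q_def pos_op_nonneg[OF pos])
  finally have "(cmod \<langle>x, A n $ y\<rangle>)^2 \<le> (c * norm x * norm y)^2" by (simp add: power_mult_distrib power2_eq_square mult_ac)
  then show ?thesis by (rule power2_le_imp_le) (simp add: c0)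
 qed
 obtain B where B: "\<And>x y. \<langle>x, B $ y\<rangle> = P x y"
 proof (rule sesquilinear_to_bop)
  show "P (x + x') y = P x y + P x' y" for x x' y
   by (rule LIMSEQ_unique[OF lim]) (unfold ci_rules, intro tendsto_intros lim)
  show "P (k *C x) y = cnj k * P x y" for k x y
   by (rule LIMSEQ_unique[OF lim]) (unfold ci_rules, intro tendsto_intros lim)
  show "P x (y + y') = P x y + P x y'" for x y' y
   by (rule LIMSEQ_unique[OF lim]) (unfold ci_rules bop_rules, intro tendsto_intros lim)
  show "P x (k *C y) = k * P x y" for k x y
   by (rule LIMSEQ_unique[OF lim]) (unfold ci_rules bop_rules, intro tendsto_intros lim)
  show "cmod (P x y) \<le> c * norm x * norm y" for x y
   by (rule LIMSEQ_le_const2[OF tendsto_norm[OF lim]]) (use A_bd in blast)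
 qed (rule that)
 have Bl: "(\<lambda>n. \<langle>x, A n $ y\<rangle>) \<longlonglongrightarrow> \<langle>x, B $ y\<rangle>" for x y using lim B by simp
 have Bq: "\<langle>x, B $ x\<rangle> = of_real (Q x)" for x
 proof (rule LIMSEQ_unique[OF Bl])
  show "(\<lambda>n. \<langle>x, A n $ x\<rangle>) \<longlonglongrightarrow> of_real (Q x)" unfolding qc by (intro tendsto_intros Q)
 qed
 have le: "q n x \<le> Q x" for n x by (rule incseq_le[OF q_inc Q])
 have posB: "pos_op B" unfolding pos_op_def Bq
  using le[of 0] pos_op_nonneg[OF pos[of 0]] by (auto simp: q_def intro: order_trans)
 show thesis
 proof (rule that[OF posB Bl])
  show "A n \<preceq> B" for n
   using le by (subst bop_le_iff) (auto simp: posB pos pos_op_adj Bq qc)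
  have "Q x \<le> c * (norm x)^2" for x by (rule LIMSEQ_le_const2[OF Q]) (use q_le in blast)
  then show "B \<preceq> c *R 1"
   by (subst bop_le_iff) (auto simp: posB pos_op_adj Bq cinner_scaleR_right cinner_norm)
 qed
qed

section \<open>Weights\<close>

locale nsf = vna M for M :: "'i bop set" +
 fixes \<phi> :: "'i bop => ennreal"
 assumes nsf: "nsf_weight M \<phi>"
begin

definition Fin :: "'i bop set" where "Fin = {a \<in> pos_part M. \<phi> a < \<infinity>}"
definition wr :: "'i bop => real" where "wr a = enn2real (\<phi> a)"
abbreviation N :: "'i bop set" where "N \<equiv> left_ideal_of_weight M \<phi>"

lemma pos_partI: "a \<in> M ==> pos_op a ==> a \<in> pos_part M" by (simp add: pos_part_def)
lemma pos_partD: "a \<in> pos_part M ==> a \<in> M" "a \<in> pos_part M ==> pos_op a" by (auto simp: pos_part_def)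
lemma pos_part_add: "a \<in> pos_part M ==> b \<in> pos_part M ==> a + b \<in> pos_part M"
 by (auto simp: pos_part_def pos_op_add)
lemma pos_part_scale: "a \<in> pos_part M ==> 0 \<le> r ==> r *R a \<in> pos_part M"
 by (auto simp: pos_part_def pos_op_scaleR)
lemma pos_part_sum: "(\<And>i. i \<in> I ==> f i \<in> pos_part M) ==> sum f I \<in> pos_part M"
 by (auto simp: pos_part_def intro: sum_mem pos_op_sum)

lemma w_add: "a \<in> pos_part M ==> b \<in> pos_part M ==> \<phi> (a + b) = \<phi> a + \<phi> b"
 and w_scale: "0 \<le> r ==> a \<in> pos_part M ==> \<phi> (r *R a) = ennreal r * \<phi> a"
 and w_faithful: "a \<in> pos_part M ==> \<phi> a = 0 ==> a = 0"
 using nsf by (auto simp: nsf_weight_def weight_def)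

lemma w_mono: assumes "a \<in> pos_part M" "b \<in> pos_part M" "a \<preceq> b" shows "\<phi> a \<le> \<phi> b"
proof -
 have "\<phi> (a + (b - a)) = \<phi> a + \<phi> (b - a)"
  using assms by (intro w_add) (auto simp: pos_part_def)
 then show ?thesis by simp
qed

lemma zero_pos_part [simp]: "0 \<in> pos_part M" by (auto simp: pos_part_def)
lemma w_zero [simp]: "\<phi> 0 = 0" using w_scale[of 0 0] by simp

lemma FinD: "a \<in> Fin ==> a \<in> pos_part M" "a \<in> Fin ==> a \<in> M" "a \<in> Fin ==> pos_op a"
 "a \<in> Fin ==> \<phi> a < \<infinity>" by (auto simp: Fin_def pos_part_def)
lemma Fin_le: "b \<in> Fin ==> a \<in> M ==> pos_op a ==> a \<preceq> b ==> a \<in> Fin"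
 using w_mono[of a b] by (auto simp: Fin_def pos_part_def)
lemma Fin_add: "a \<in> Fin ==> b \<in> Fin ==> a + b \<in> Fin"
 by (auto simp: Fin_def pos_part_add w_add)
lemma Fin_scale: "a \<in> Fin ==> 0 \<le> r ==> r *R a \<in> Fin"
 by (auto simp: Fin_def pos_part_scale w_scale ennreal_mult_less_top)
lemma Fin_zero [simp]: "0 \<in> Fin" by (auto simp: Fin_def)
lemma Fin_sum: "(\<And>i. i \<in> I ==> f i \<in> Fin) ==> sum f I \<in> Fin"
 by (induction I rule: infinite_finite_induct) (auto intro: Fin_add)

lemma ennreal_wr: "a \<in> Fin ==> ennreal (wr a) = \<phi> a" by (auto simp: Fin_def wr_def)
lemma wr_nonneg [simp]: "0 \<le> wr a" by (simp add: wr_def)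
lemma wr_add: "a \<in> Fin ==> b \<in> Fin ==> wr (a + b) = wr a + wr b"
 by (auto simp: Fin_def wr_def w_add enn2real_plus)
lemma wr_scale: "a \<in> Fin ==> 0 \<le> r ==> wr (r *R a) = r * wr a"
 by (auto simp: Fin_def wr_def w_scale enn2real_mult)
lemma wr_zero [simp]: "wr 0 = 0" by (simp add: wr_def)
lemma wr_sum: "(\<And>i. i \<in> I ==> f i \<in> Fin) ==> wr (sum f I) = (\<Sum>i\<in>I. wr (f i))"
 by (induction I rule: infinite_finite_induct) (auto simp: wr_add Fin_sum)
lemma wr_mono: "b \<in> Fin ==> a \<in> M ==> pos_op a ==> a \<preceq> b ==> wr a \<le> wr b"
 unfolding wr_def using w_mono[of a b] by (auto simp: Fin_def pos_part_def intro!: enn2real_mono)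
lemma Fin_leI: "a \<in> pos_part M ==> \<phi> a \<le> ennreal c ==> a \<in> Fin"
 by (auto simp: Fin_def intro: le_less_trans)
lemma wr_le: "0 \<le> c ==> \<phi> a \<le> ennreal c ==> wr a \<le> c"
 unfolding wr_def using enn2real_mono[of "\<phi> a" "ennreal c"] by simp
lemma wr_faithful: "a \<in> Fin ==> wr a = 0 ==> a = 0"
 by (rule w_faithful) (simp_all add: FinD(1) ennreal_wr[symmetric])

subsection \<open>Normality\<close>

text \<open>Normality refers to least upper bounds in \<open>M\<close>, whereas limits are obtained
  from quadratic forms. If the forms of \<open>D\<close> approach that of \<open>a\<close> at each
  vector, every upper bound of \<open>D\<close> dominates \<open>a\<close>.\<close>

lemma w_sup:
 assumes D: "D \<noteq> {}" "D \<subseteq> pos_part M" and dir: "\<And>d e. d \<in> D ==> e \<in> D ==> \<exists>f\<in>D. d \<preceq> f \<and> e \<preceq> f"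
  and a: "a \<in> pos_part M" and le: "\<And>d. d \<in> D ==> d \<preceq> a"
  and ap: "\<And>x \<epsilon>. 0 < \<epsilon> ==> \<exists>d\<in>D. Re \<langle>x, a $ x\<rangle> - \<epsilon> < Re \<langle>x, d $ x\<rangle>"
 shows "\<phi> a = (SUP d\<in>D. \<phi> d)"
proof -
 have "a \<preceq> b" if b: "b \<in> pos_part M" "\<forall>d\<in>D. d \<preceq> b" for b
 proof (subst bop_le_iff)
  show "\<forall>x. Re \<langle>x, a $ x\<rangle> \<le> Re \<langle>x, b $ x\<rangle>"
  proof (rule allI, rule field_le_epsilon)
   fix x and e :: real assume "e > 0"
   from ap[OF this, of x] obtain d where "d \<in> D" "Re \<langle>x, a $ x\<rangle> - e < Re \<langle>x, d $ x\<rangle>" by blast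
   moreover have "Re \<langle>x, d $ x\<rangle> \<le> Re \<langle>x, b $ x\<rangle>"
    using pos_op_nonneg[OF bspec[OF b(2) \<open>d \<in> D\<close>], of x] by (simp add: ci_rules)
   ultimately show "Re \<langle>x, a $ x\<rangle> \<le> Re \<langle>x, b $ x\<rangle> + e" by linarith
  qed
 qed (simp_all add: pos_op_adj pos_partD a b)
 then have "is_op_sup M D a" using a le by (auto simp: is_op_sup_def)
 moreover have "normal_weight M \<phi>" using nsf by (simp add: nsf_weight_def)
 ultimately show ?thesis
  unfolding normal_weight_def using dir D by (elim allE[of _ D] allE[of _ a] mp) simp
qed

lemma w_increasing_limit:
 assumes P: "\<And>n. P n \<in> pos_part M" and inc: "\<And>n. P n \<preceq> P (Suc n)" and B: "pos_op B" "\<And>n. P n \<preceq> B"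
  and lim: "\<And>x y. (\<lambda>n. \<langle>x, P n $ y\<rangle>) \<longlonglongrightarrow> \<langle>x, B $ y\<rangle>"
 shows "B \<in> pos_part M" "\<phi> B = (SUP n. \<phi> (P n))"
proof -
 show BM: "B \<in> pos_part M"
  using B(1) weak_limit_mem[OF _ lim] P by (auto simp: pos_part_def)
 have "P m \<preceq> P n" if "m \<le> n" for m n
  using that by (induction rule: dec_induct) (use inc bop_le_trans in auto)
 then have dir: "\<exists>f\<in>range P. d \<preceq> f \<and> e \<preceq> f" if "d \<in> range P" "e \<in> range P" for d e
  using that by (metis imageE nle_le rangeI)
 have "\<phi> B = (SUP d\<in>range P. \<phi> d)"
 proof (rule w_sup[OF _ _ dir BM])
  show "range P \<noteq> {}" "range P \<subseteq> pos_part M" using P by auto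
  show "d \<preceq> B" if "d \<in> range P" for d using that B(2) by auto
  fix x and e :: real assume "e > 0"
  moreover have "(\<lambda>n. Re \<langle>x, P n $ x\<rangle>) \<longlonglongrightarrow> Re \<langle>x, B $ x\<rangle>" by (intro tendsto_intros lim)
  ultimately have "\<forall>\<^sub>F n in sequentially. Re \<langle>x, B $ x\<rangle> - e < Re \<langle>x, P n $ x\<rangle>"
   by (intro order_tendstoD) auto
  then obtain n where "Re \<langle>x, B $ x\<rangle> - e < Re \<langle>x, P n $ x\<rangle>"
   using eventually_happens'[OF sequentially_bot] by blast
  then show "\<exists>d\<in>range P. Re \<langle>x, B $ x\<rangle> - e < Re \<langle>x, d $ x\<rangle>" by blast
 qed
 then show "\<phi> B = (SUP n. \<phi> (P n))" by (simp add: image_comp)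
qed

lemma w_has_sum:
 assumes p: "\<And>k. p k \<in> pos_part M" and a: "a \<in> pos_part M"
  and s: "\<And>x. ((\<lambda>k. Re \<langle>x, p k $ x\<rangle>) has_sum Re \<langle>x, a $ x\<rangle>) UNIV"
 shows "\<phi> a = (SUP F\<in>{F. finite F}. \<Sum>k\<in>F. \<phi> (p k))"
proof -
 let ?D = "(\<lambda>F. \<Sum>k\<in>F. p k) ` {F. finite F}"
 have q: "Re \<langle>x, (\<Sum>k\<in>F. p k) $ x\<rangle> = (\<Sum>k\<in>F. Re \<langle>x, p k $ x\<rangle>)" for F x
  by (simp add: bop_sum_left cinner_sum_right)
 have sub: "(\<Sum>k\<in>F. p k) \<preceq> (\<Sum>k\<in>F'. p k)" if "finite F'" "F \<subseteq> F'" for F F'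
  using that p by (subst sum_diff[symmetric]) (auto intro: pos_op_sum pos_partD)
 have "\<phi> a = (SUP d\<in>?D. \<phi> d)"
 proof (rule w_sup)
  show "\<exists>f\<in>?D. d \<preceq> f \<and> e \<preceq> f" if "d \<in> ?D" "e \<in> ?D" for d e
  proof -
   from that obtain F F' where *: "finite F" "finite F'" "d = (\<Sum>k\<in>F. p k)" "e = (\<Sum>k\<in>F'. p k)" by auto
   show ?thesis
    by (rule bexI[of _ "\<Sum>k\<in>F \<union> F'. p k"]) (use * in "auto intro!: sub")
  qed
  show "d \<preceq> a" if "d \<in> ?D" for d
  proof (subst bop_le_iff)
   from that obtain F where F: "finite F" "d = (\<Sum>k\<in>F. p k)" by auto
   show "\<forall>x. Re \<langle>x, d $ x\<rangle> \<le> Re \<langle>x, a $ x\<rangle>"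
    unfolding F(2) q using F(1) p by (auto intro!: has_sum_mono_neutral[OF has_sum_finite s] pos_op_nonneg pos_partD)
   show "adj d = d" unfolding F(2) by (rule pos_op_adj, rule pos_op_sum, rule pos_partD(2)[OF p])
  qed (simp_all add: pos_op_adj pos_partD a)
  show "\<exists>d\<in>?D. Re \<langle>x, a $ x\<rangle> - e < Re \<langle>x, d $ x\<rangle>" if "0 < e" for x and e :: real
  proof -
   have "\<forall>\<^sub>F F in finite_subsets_at_top UNIV. Re \<langle>x, a $ x\<rangle> - e < (\<Sum>k\<in>F. Re \<langle>x, p k $ x\<rangle>)"
    using s[of x] that unfolding has_sum_def by (intro order_tendstoD) auto
   then obtain F where "finite F" "Re \<langle>x, a $ x\<rangle> - e < (\<Sum>k\<in>F. Re \<langle>x, p k $ x\<rangle>)"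
    unfolding eventually_finite_subsets_at_top by auto
   then show ?thesis by (auto simp: q)
  qed
  have "(\<Sum>k\<in>F. p k) \<in> pos_part M" for F by (rule pos_part_sum) (rule p)
  then show "?D \<subseteq> pos_part M" by blast
 qed (use a in auto)
 moreover have "\<phi> (\<Sum>k\<in>F. p k) = (\<Sum>k\<in>F. \<phi> (p k))" for F
  by (induction F rule: infinite_finite_induct) (auto simp: w_add p pos_part_sum)
 ultimately show ?thesis by (simp add: image_comp)
qed

lemma w_has_sum_le:
 assumes "\<And>k. p k \<in> pos_part M" "a \<in> pos_part M"
  and "\<And>x. ((\<lambda>k. Re \<langle>x, p k $ x\<rangle>) has_sum Re \<langle>x, a $ x\<rangle>) UNIV"
  and "\<And>F. finite F ==> (\<Sum>k\<in>F. \<phi> (p k)) \<le> C"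
 shows "\<phi> a \<le> C"
 unfolding w_has_sum[OF assms(1-3)] using assms(4) by (intro SUP_least) auto

lemma wr_has_sum:
 assumes p: "\<And>k. p k \<in> pos_part M" and a: "a \<in> Fin"
  and s: "\<And>x. ((\<lambda>k. Re \<langle>x, p k $ x\<rangle>) has_sum Re \<langle>x, a $ x\<rangle>) UNIV"
 shows "((\<lambda>k. wr (p k)) has_sum wr a) UNIV" "p k \<in> Fin"
proof -
 have eq: "\<phi> a = (SUP F\<in>{F. finite F}. \<Sum>k\<in>F. \<phi> (p k))" by (rule w_has_sum[OF p FinD(1)[OF a] s])
 have "(\<Sum>k\<in>{k}. \<phi> (p k)) \<le> \<phi> a" for k unfolding eq by (rule SUP_upper) simp
 then have Fin: "p k \<in> Fin" for k using FinD(4)[OF a] p by (auto simp: Fin_def intro: le_less_trans)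
 then show "p k \<in> Fin" .
 have "\<phi> (p k) = ennreal (wr (p k))" for k using ennreal_wr[OF Fin] by simp
 then have eq': "ennreal (wr a) = (SUP F\<in>{F. finite F}. ennreal (\<Sum>k\<in>F. wr (p k)))"
  using eq by (simp add: ennreal_wr[OF a] sum_ennreal)
 have le: "(\<Sum>k\<in>F. wr (p k)) \<le> wr a" if "finite F" for F
 proof -
  have "ennreal (\<Sum>k\<in>F. wr (p k)) \<le> ennreal (wr a)" unfolding eq' using that by (intro SUP_upper) auto
  then show ?thesis by (simp add: ennreal_le_iff)
 qed
 have sm: "(\<lambda>k. wr (p k)) summable_on UNIV"
  by (rule nonneg_bdd_above_summable_on) (auto intro!: bdd_aboveI2[where M = "wr a"] le)
 have "infsum (\<lambda>k. wr (p k)) UNIV = wr a"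
 proof (rule antisym)
  show "infsum (\<lambda>k. wr (p k)) UNIV \<le> wr a" by (rule infsum_le_finite_sums[OF sm]) (use le in auto)
  have "ennreal (wr a) \<le> ennreal (infsum (\<lambda>k. wr (p k)) UNIV)"
   unfolding eq' by (intro SUP_least ennreal_leI finite_sum_le_infsum sm) auto
  then show "wr a \<le> infsum (\<lambda>k. wr (p k)) UNIV" by (simp add: infsum_nonneg)
 qed
 then show "((\<lambda>k. wr (p k)) has_sum wr a) UNIV" using has_sum_infsum[OF sm] by simp
qed

lemma semifinite_approx:
 assumes "a \<in> M" "\<omega> \<in> predual" "0 < \<epsilon>"
 obtains n where "n \<in> N" "cmod (\<omega> n - \<omega> a) < \<epsilon>"
proof -
 define V where "V = {T. cmod (\<omega> T - \<omega> a) < \<epsilon>}"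
 have "a \<in> sigma_weak closure_of N" using nsf assms(1) by (auto simp: nsf_weight_def)
 moreover have "openin sigma_weak V"
  unfolding sigma_weak_def V_def by (intro topology_generated_by_Basis CollectI exI conjI refl) (use assms in auto)
 moreover have "a \<in> V" using assms(3) by (simp add: V_def)
 ultimately obtain n where "n \<in> N" "n \<in> V" unfolding in_closure_of by blast
 then show thesis by (intro that) (auto simp: V_def)
qed

lemma N_nondegenerate: assumes "\<And>a. a \<in> N ==> a $ x = 0" shows "x = 0"
proof -
 have "cmod \<langle>x, x\<rangle> < \<epsilon>" if e: "\<epsilon> > 0" for \<epsilon>
 proof -
  obtain n where n: "n \<in> N" and "cmod (\<langle>x, n $ x\<rangle> - \<langle>x, 1 $ x\<rangle>) < \<epsilon>"
   by (rule semifinite_approx[of 1 "\<lambda>T. \<langle>x, T $ x\<rangle>", OF one_mem vector_predual e])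
  with assms[OF n] show ?thesis by simp
 qed
 then have "\<not> 0 < cmod \<langle>x, x\<rangle>" by blast
 then show ?thesis by (simp add: cinner_norm)
qed

lemma total_N_adj: "total {adj a $ x | a x. a \<in> N}"
 unfolding total_def
proof (intro allI impI)
 fix z assume *: "\<forall>s\<in>{adj a $ x | a x. a \<in> N}. \<langle>s, z\<rangle> = 0"
 show "z = 0"
 proof (rule N_nondegenerate, rule cinner_ext)
  fix a x assume "a \<in> N"
  then have "\<langle>adj a $ x, z\<rangle> = 0" using * by blast
  then show "\<langle>x, a $ z\<rangle> = \<langle>x, 0\<rangle>" by (simp add: adj_left)
 qed
qed

subsection \<open>The linear extension of a weight\<close>

definition mdom :: "'i bop set" where
 "mdom = {p - q + \<i> *C (r - s) | p q r s. p \<in> Fin \<and> q \<in> Fin \<and> r \<in> Fin \<and> s \<in> Fin}"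

definition hat :: "'i bop => complex" where
 "hat z = (THE c. \<exists>p\<in>Fin. \<exists>q\<in>Fin. \<exists>r\<in>Fin. \<exists>s\<in>Fin. z = p - q + \<i> *C (r - s) \<and>
  c = Complex (wr p - wr q) (wr r - wr s))"

text \<open>Adjoints separate the real and imaginary parts of two decompositions. Moving the
  negative terms across leaves equalities of sums in \<open>Fin\<close>, where the weight is
  additive.\<close>

lemma hat_eq:
 assumes F: "p \<in> Fin" "q \<in> Fin" "r \<in> Fin" "s \<in> Fin"
 shows "hat (p - q + \<i> *C (r - s)) = Complex (wr p - wr q) (wr r - wr s)"
 unfolding hat_def
proof (rule the_equality)
 fix c assume "\<exists>p'\<in>Fin. \<exists>q'\<in>Fin. \<exists>r'\<in>Fin. \<exists>s'\<in>Fin. p - q + \<i> *C (r - s) = p' - q' + \<i> *C (r' - s') \<and>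
   c = Complex (wr p' - wr q') (wr r' - wr s')"
 then obtain p' q' r' s' where F': "p' \<in> Fin" "q' \<in> Fin" "r' \<in> Fin" "s' \<in> Fin"
  and e: "p - q + \<i> *C (r - s) = p' - q' + \<i> *C (r' - s')" and c: "c = Complex (wr p' - wr q') (wr r' - wr s')"
  by blast
 have "adj (p - q + \<i> *C (r - s)) = p - q - \<i> *C (r - s)" "adj (p' - q' + \<i> *C (r' - s')) = p' - q' - \<i> *C (r' - s')"
  using F F' by (simp_all add: pos_op_adj FinD complex_vector.scale_minus_left)
 with e have e': "p - q - \<i> *C (r - s) = p' - q' - \<i> *C (r' - s')" by metis
 have "2 *R (p - q) = 2 *R (p' - q')" unfolding scaleR_2 using arg_cong2[OF e e', of "(+)"] by simp
 then have 1: "p - q = p' - q'" by simp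
 with e have "\<i> *C (r - s) = \<i> *C (r' - s')" by simp
 then have "r - s = r' - s'" by (rule complex_vector.scale_left_imp_eq[rotated]) simp
 then have "p + q' = p' + q" "r + s' = r' + s" using 1 by (simp_all add: algebra_simps)
 then have "wr (p + q') = wr (p' + q)" "wr (r + s') = wr (r' + s)" by simp_all
 then have "wr p + wr q' = wr p' + wr q" "wr r + wr s' = wr r' + wr s" by (simp_all add: wr_add F F')
 then show "c = Complex (wr p - wr q) (wr r - wr s)" by (simp add: c complex_eq_iff)
qed (intro bexI[of _ p] bexI[of _ q] bexI[of _ r] bexI[of _ s] conjI refl F)

lemma mdomI: "p \<in> Fin ==> q \<in> Fin ==> r \<in> Fin ==> s \<in> Fin ==> p - q + \<i> *C (r - s) \<in> mdom"
 unfolding mdom_def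
 by (rule CollectI, rule exI[of _ p], rule exI[of _ q], rule exI[of _ r], rule exI[of _ s]) simp

lemma mdomE:
 assumes "z \<in> mdom"
 obtains p q r s where "p \<in> Fin" "q \<in> Fin" "r \<in> Fin" "s \<in> Fin" "z = p - q + \<i> *C (r - s)"
 using assms unfolding mdom_def by (elim CollectE exE conjE) (rule that)

lemma hat_add: "z \<in> mdom ==> w \<in> mdom ==> hat (z + w) = hat z + hat w"
 and mdom_add: "z \<in> mdom ==> w \<in> mdom ==> z + w \<in> mdom"
proof -
 assume z: "z \<in> mdom" and w: "w \<in> mdom"
 obtain p q r s where F1: "p \<in> Fin" "q \<in> Fin" "r \<in> Fin" "s \<in> Fin"
  and e1: "z = p - q + \<i> *C (r - s)" by (rule mdomE[OF z])
 obtain p' q' r' s' where F2: "p' \<in> Fin" "q' \<in> Fin" "r' \<in> Fin" "s' \<in> Fin"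
  and e2: "w = p' - q' + \<i> *C (r' - s')" by (rule mdomE[OF w])
 note F = F1 F2 and e = e1 e2
 have zw: "z + w = (p + p') - (q + q') + \<i> *C ((r + r') - (s + s'))"
  unfolding e by (simp add: scaleC_rules)
 show "z + w \<in> mdom" unfolding zw by (intro mdomI Fin_add F)
 show "hat (z + w) = hat z + hat w"
  unfolding zw unfolding e by (simp add: F Fin_add wr_add complex_eq_iff hat_eq)
qed

lemma mdom_scaleR_hat: "z \<in> mdom ==> 0 \<le> t ==> t *R z \<in> mdom \<and> hat (t *R z) = t * hat z"
proof -
 assume "0 \<le> t"
 assume "z \<in> mdom"
 then obtain p q r s where F: "p \<in> Fin" "q \<in> Fin" "r \<in> Fin" "s \<in> Fin"
  and e: "z = p - q + \<i> *C (r - s)" by (rule mdomE)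
 have tz: "t *R z = t *R p - t *R q + \<i> *C (t *R r - t *R s)"
  unfolding e scaleC_of_real[symmetric] by (simp add: scaleC_rules scaleC_scaleC mult.commute)
 show ?thesis unfolding tz
  using F \<open>0 \<le> t\<close> by (simp add: hat_eq mdomI Fin_scale wr_scale e complex_eq_iff right_diff_distrib)
qed

lemma mdom_i_hat: "z \<in> mdom ==> \<i> *C z \<in> mdom \<and> hat (\<i> *C z) = \<i> * hat z"
proof -
 assume "z \<in> mdom"
 then obtain p q r s where F: "p \<in> Fin" "q \<in> Fin" "r \<in> Fin" "s \<in> Fin"
  and e: "z = p - q + \<i> *C (r - s)" by (rule mdomE)
 have tz: "\<i> *C z = s - r + \<i> *C (p - q)"
  unfolding e by (simp add: scaleC_rules scaleC_scaleC)
 show ?thesis unfolding tz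
  using F by (simp add: hat_eq mdomI e complex_eq_iff)
qed

lemma mdom_minus_hat: assumes "z \<in> mdom" shows "- z \<in> mdom" "hat (- z) = - hat z"
proof -
 have "\<i> *C \<i> *C z = - z" by (simp add: scaleC_scaleC complex_vector.scale_minus_left)
 with mdom_i_hat[of "\<i> *C z"] mdom_i_hat[OF assms] show "- z \<in> mdom" "hat (- z) = - hat z" by (auto simp: mult.assoc[symmetric])
qed

lemma mdom_scaleR: "z \<in> mdom ==> t *R z \<in> mdom \<and> hat (t *R z) = t * hat z"
 using mdom_scaleR_hat[of z t] mdom_scaleR_hat[of z "- t"] mdom_minus_hat[of "(- t) *R z"]
 by (cases "t \<ge> 0") auto

lemma mdom_scaleC: "z \<in> mdom ==> c *C z \<in> mdom"
 and hat_scaleC: "z \<in> mdom ==> hat (c *C z) = c * hat z"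
proof -
 assume z: "z \<in> mdom"
 have "c = of_real (Re c) + of_real (Im c) * \<i>" by (simp add: complex_eq mult.commute)
 then have e: "c *C z = Re c *R z + Im c *R \<i> *C z"
  by (metis scaleC_add_left scaleC_of_real scaleC_scaleC)
 show "c *C z \<in> mdom" "hat (c *C z) = c * hat z"
  unfolding e using z mdom_i_hat[OF z]
  by (auto simp: mdom_add mdom_scaleR hat_add complex_eq_iff)
qed

lemma mdom_diff: "z \<in> mdom ==> w \<in> mdom ==> z - w \<in> mdom"
 and hat_diff: "z \<in> mdom ==> w \<in> mdom ==> hat (z - w) = hat z - hat w"
 using mdom_add[of z "- w"] hat_add[of z "- w"] mdom_minus_hat[of w] by auto

lemma Fin_mdom: "p \<in> Fin ==> p \<in> mdom" and hat_Fin: "p \<in> Fin ==> hat p = wr p"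
proof -
 assume "p \<in> Fin"
 with hat_eq[of p 0 0 0] show "hat p = wr p" by (simp add: complex_eq_iff)
 show "p \<in> mdom" using mdomI[of p 0 0 0] \<open>p \<in> Fin\<close> by simp
qed

lemma mdom_zero [simp]: "0 \<in> mdom" and hat_zero [simp]: "hat 0 = 0"
 using Fin_mdom[of 0] hat_Fin[of 0] by auto

lemma mdom_adj: "z \<in> mdom ==> adj z \<in> mdom"
 and hat_adj: "z \<in> mdom ==> hat (adj z) = cnj (hat z)"
proof -
 assume "z \<in> mdom"
 then obtain p q r s where F: "p \<in> Fin" "q \<in> Fin" "r \<in> Fin" "s \<in> Fin"
  and e: "z = p - q + \<i> *C (r - s)" by (rule mdomE)
 have tz: "adj z = p - q + \<i> *C (s - r)"
  unfolding e using F by (simp add: scaleC_rules FinD pos_op_adj)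
 show "adj z \<in> mdom" "hat (adj z) = cnj (hat z)" unfolding tz
  using F by (simp_all add: mdomI e hat_eq complex_eq_iff)
qed

subsection \<open>Columns of finite weight\<close>

text \<open>A bounded operator \<open>A\<close> from \<open>H\<close> to another Hilbert space is an infinite column of operators,
 and \<open>gram A B\<close> is \<open>A\<^sup>*B\<close>.\<close>

definition fcol :: "('i ell2 => 'k ell2) => bool" where
 "fcol A \<longleftrightarrow> bcl A \<and> gram A A \<in> Fin"

definition nrm :: "('i ell2 => 'k ell2) => real" where
 "nrm A = sqrt (wr (gram A A))"

lemma nrm_nonneg [simp]: "0 \<le> nrm A" and nrm_sq: "(nrm A)^2 = wr (gram A A)"
 by (simp_all add: nrm_def)

lemma N_iff: "a \<in> N \<longleftrightarrow> a \<in> M \<and> fcol (apply_bop a)"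
 by (auto simp: left_ideal_of_weight_def fcol_def gram_apply_bop Fin_def pos_part_def)

lemma N_mem: "a \<in> N ==> a \<in> M" by (simp add: N_iff)

lemma fcol_scale: "fcol A ==> fcol (\<lambda>x. c *C A x)"
 and nrm_scale: "fcol A ==> nrm (\<lambda>x. c *C A x) = cmod c * nrm A"
proof -
 assume A: "fcol A"
 then have "gram (\<lambda>x. c *C A x) (\<lambda>x. c *C A x) = (cnj c * c) *C gram A A"
  by (simp add: fcol_def gram_scaleC_left gram_scaleC_right bcl_scaleC_fun scaleC_scaleC mult.commute)
 also have "cnj c * c = of_real ((cmod c)^2)" by (subst complex_norm_square) (rule mult.commute)
 finally have e: "gram (\<lambda>x. c *C A x) (\<lambda>x. c *C A x) = (cmod c)^2 *R gram A A" by (simp only: scaleC_of_real)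
 show "fcol (\<lambda>x. c *C A x)" "nrm (\<lambda>x. c *C A x) = cmod c * nrm A"
  using A by (auto simp: fcol_def nrm_def e Fin_scale bcl_scaleC_fun wr_scale real_sqrt_mult)
qed

lemma gram_expand:
 assumes "bcl A" "bcl B"
 shows "gram (\<lambda>x. A x + B x) (\<lambda>x. A x + B x) = gram A A + gram B B + (gram A B + gram B A)"
 using assms by (simp add: gram_add_left gram_add_right bcl_add_fun algebra_simps)

text \<open>The parallelogram identity bounds the square of A + B by twice the sum of the squares;
  the assumption on the mixed product puts that square into \<open>M\<close>.\<close>

lemma fcol_add: assumes A: "fcol A" and B: "fcol B" and M: "gram A B \<in> M"
 shows "fcol (\<lambda>x. A x + B x)"
proof -
 have b: "bcl A" "bcl B" using A B by (auto simp: fcol_def)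
 have "gram B A \<in> M" using M adj_gram[OF b] by (metis adj_mem)
 have eq: "2 *R (gram A A + gram B B) - gram (\<lambda>x. A x + B x) (\<lambda>x. A x + B x) = gram (\<lambda>x. A x - B x) (\<lambda>x. A x - B x)"
  using b by (simp add: gram_expand gram_diff_left gram_diff_right bcl_diff_fun scaleR_2)
 have "gram (\<lambda>x. A x + B x) (\<lambda>x. A x + B x) \<in> Fin"
 proof (rule Fin_le)
  show "2 *R (gram A A + gram B B) \<in> Fin" using A B by (intro Fin_scale Fin_add) (auto simp: fcol_def)
  show "gram (\<lambda>x. A x + B x) (\<lambda>x. A x + B x) \<in> M"
   unfolding gram_expand[OF b] using A B M \<open>gram B A \<in> M\<close> by (intro add_mem) (auto simp: fcol_def FinD)
  show "gram (\<lambda>x. A x + B x) (\<lambda>x. A x + B x) \<preceq> 2 *R (gram A A + gram B B)"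
   unfolding eq using b by (simp add: bcl_diff_fun)
 qed (use b in "simp add: bcl_add_fun")
 with b show ?thesis by (simp add: fcol_def bcl_add_fun)
qed

lemma gram_mdom: assumes A: "fcol A" and B: "fcol B" and M: "gram A B \<in> M"
 shows "gram A B \<in> mdom"
proof -
 have b: "bcl A" "bcl B" using A B by (auto simp: fcol_def)
 have F: "gram (\<lambda>x. A x + c *C B x) (\<lambda>x. A x + c *C B x) \<in> Fin" for c
  using fcol_add[OF A fcol_scale[OF B, of c]] M b by (simp add: fcol_def gram_scaleC_right)
 let ?Q = "\<lambda>c. gram (\<lambda>x. A x + c *C B x) (\<lambda>x. A x + c *C B x)"
 have "4 *C gram A B = ?Q 1 - ?Q (-1) + \<i> *C (?Q (- \<i>) - ?Q \<i>)"
 proof (rule bop_cinner_ext)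
  fix x y
  have q: "\<langle>y, ?Q c $ x\<rangle> = \<langle>A y + c *C B y, A x + c *C B x\<rangle>" for c
   using b by (simp add: cinner_gram bcl_add_fun bcl_scaleC_fun)
  show "\<langle>y, (4 *C gram A B) $ x\<rangle> = \<langle>y, (?Q 1 - ?Q (-1) + \<i> *C (?Q (- \<i>) - ?Q \<i>)) $ x\<rangle>"
   by (simp only: minus_bop.rep_eq plus_bop.rep_eq scaleC_bop.rep_eq ci_rules q cinner_gram[OF b])
    (simp add: algebra_simps)
 qed
 then have "4 *C gram A B \<in> mdom" by (simp only: mdomI[OF F F F F])
 then have "(1/4) *C 4 *C gram A B \<in> mdom" by (rule mdom_scaleC)
 then show ?thesis by (simp add: scaleC_scaleC)
qed

lemma hat_gram_swap: "fcol A ==> fcol B ==> gram A B \<in> M ==> hat (gram B A) = cnj (hat (gram A B))"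
 using hat_adj[OF gram_mdom, of A B] adj_gram[of A B] by (simp add: fcol_def)

lemma nrm_add_sq: assumes A: "fcol A" and B: "fcol B" and M: "gram A B \<in> M"
 shows "(nrm (\<lambda>x. A x + B x))^2 = (nrm A)^2 + (nrm B)^2 + 2 * Re (hat (gram A B))"
proof -
 have b: "bcl A" "bcl B" using A B by (auto simp: fcol_def)
 have AB: "gram A B \<in> mdom" by (rule gram_mdom[OF A B M])
 then have BA: "gram B A \<in> mdom" using mdom_adj adj_gram[OF b] by metis
 have F: "gram A A \<in> Fin" "gram B B \<in> Fin" using A B by (auto simp: fcol_def)
 have F': "gram (\<lambda>x. A x + B x) (\<lambda>x. A x + B x) \<in> Fin" using fcol_add[OF A B M] by (simp add: fcol_def)
 have "complex_of_real ((nrm (\<lambda>x. A x + B x))^2) = hat (gram A A + gram B B + (gram A B + gram B A))"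
  using hat_Fin[OF F'] by (simp only: nrm_sq gram_expand[OF b])
 also have "\<dots> = (nrm A)^2 + (nrm B)^2 + (hat (gram A B) + cnj (hat (gram A B)))"
  using F AB BA by (simp add: hat_add mdom_add Fin_mdom hat_gram_swap[OF A B M] hat_Fin nrm_sq del: of_real_power)
 finally show ?thesis by (simp only: complex_eq_iff) simp
qed

lemma hat_gram_le: assumes A: "fcol A" and B: "fcol B" and M: "gram A B \<in> M"
 shows "cmod (hat (gram A B)) \<le> nrm A * nrm B"
proof -
 have b: "bcl A" "bcl B" using A B by (auto simp: fcol_def)
 define c where "c = cmod (hat (gram A B))"
 define u where "u = (if c = 0 then 1 else - cnj (hat (gram A B)) / c)"
 have u: "u * hat (gram A B) = - complex_of_real c" "cmod u = 1"
  by (auto simp: u_def c_def norm_divide complex_norm_square[symmetric] power2_eq_square mult.commute)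
 have "2 * s * t * c \<le> s\<^sup>2 * (nrm A)^2 + t\<^sup>2 * (nrm B)^2" for s t :: real
 proof -
  let ?A = "\<lambda>x. complex_of_real s *C A x" and ?B = "\<lambda>x. (of_real t * u) *C B x"
  have g: "gram ?A ?B = (of_real (s * t) * u) *C gram A B"
   using b by (simp add: gram_scaleC_left gram_scaleC_right bcl_scaleC_fun scaleC_scaleC mult_ac)
  have "hat (gram ?A ?B) = of_real (s * t) * (u * hat (gram A B))"
   unfolding g using hat_scaleC[OF gram_mdom[OF A B M]] by simp
  then have "Re (hat (gram ?A ?B)) = - (s * t * c)" unfolding u by simp
  moreover have "gram ?A ?B \<in> M" unfolding g using M by simp
  ultimately show ?thesis
   using nrm_add_sq[OF fcol_scale[OF A] fcol_scale[OF B], of "of_real s" "of_real t * u"]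
    nrm_scale[OF A, of "of_real s"] nrm_scale[OF B, of "of_real t * u"] u(2)
    zero_le_power2[of "nrm (\<lambda>x. ?A x + ?B x)"]
   by (simp add: norm_mult power_mult_distrib)
 qed note q = this
 show ?thesis
 proof (cases "nrm A = 0")
  case True
  have "\<not> 0 < c"
  proof
   assume "0 < c"
   then show False using q[of "(1 + (nrm B)^2) / c" 1] zero_le_power2[of "nrm B"] True by simp
  qed
  then show ?thesis using True by (simp add: c_def)
 next
  case False
  then have "nrm A > 0" using nrm_nonneg[of A] by linarith
  have "2 * nrm B * nrm A * c \<le> 2 * (nrm B * nrm A)^2" using q[of "nrm B" "nrm A"] by (simp add: power_mult_distrib mult.commute)
  then have *: "nrm B * nrm A * c \<le> nrm B * nrm A * (nrm B * nrm A)" by (simp add: power2_eq_square)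
  show ?thesis
  proof (cases "nrm B = 0")
   case True
   have "\<not> 0 < c"
   proof
    assume "0 < c"
    then show False using q[of 1 "(1 + (nrm A)^2) / c"] zero_le_power2[of "nrm A"] True by simp
   qed
   then show ?thesis using True by (simp add: c_def)
  next
   case False
   then have "nrm B * nrm A > 0" using \<open>nrm A > 0\<close> nrm_nonneg[of B] by (simp add: less_le)
   with * have "c \<le> nrm B * nrm A" by (metis mult_le_cancel_left_pos)
   then show ?thesis by (simp add: c_def mult.commute)
  qed
 qed
qed

lemma nrm_triangle: assumes A: "fcol A" and B: "fcol B" and M: "gram A B \<in> M"
 shows "nrm (\<lambda>x. A x + B x) \<le> nrm A + nrm B"
proof (rule power2_le_imp_le)
 show "(nrm (\<lambda>x. A x + B x))^2 \<le> (nrm A + nrm B)^2"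
  using nrm_add_sq[OF A B M] hat_gram_le[OF A B M] complex_Re_le_cmod[of "hat (gram A B)"]
  unfolding power2_sum by linarith
qed simp

end

subsection \<open>The left ideal of a weight\<close>

context nsf begin

abbreviation nr :: "'i bop => real" where "nr a \<equiv> nrm (apply_bop a)"

lemma N_Fin: "a \<in> N ==> adj a * a \<in> Fin" by (simp add: N_iff fcol_def gram_apply_bop)
lemma N_I: "a \<in> M ==> adj a * a \<in> Fin ==> a \<in> N" by (simp add: N_iff fcol_def gram_apply_bop)
lemma nr_sq: "(nr a)^2 = wr (adj a * a)" by (simp add: nrm_sq gram_apply_bop)

lemma gram_mem: "a \<in> M ==> b \<in> M ==> gram (apply_bop a) (apply_bop b) \<in> M"
 by (simp add: gram_apply_bop)

lemma N_add: "a \<in> N ==> b \<in> N ==> a + b \<in> N"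
 and nr_triangle: "a \<in> N ==> b \<in> N ==> nr (a + b) \<le> nr a + nr b"
 using fcol_add[of "apply_bop a" "apply_bop b"] nrm_triangle[of "apply_bop a" "apply_bop b"]
 by (simp_all add: N_iff gram_mem plus_bop.rep_eq)

lemma N_scaleC: "a \<in> N ==> c *C a \<in> N"
 and nr_scaleC: "a \<in> N ==> nr (c *C a) = cmod c * nr a"
 using fcol_scale[of "apply_bop a" c] nrm_scale[of "apply_bop a" c] by (simp_all add: N_iff scaleC_bop.rep_eq)

lemma N_minus: "a \<in> N ==> - a \<in> N" and nr_minus: "a \<in> N ==> nr (- a) = nr a"
 using N_scaleC[of a "-1"] nr_scaleC[of a "-1"] by (simp_all add: complex_vector.scale_minus_left)

lemma N_diff: "a \<in> N ==> b \<in> N ==> a - b \<in> N"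
 using N_add[of a "- b"] N_minus by simp

lemma N_zero [simp]: "0 \<in> N" by (rule N_I) auto

lemma N_sum: "(\<And>i. i \<in> I ==> f i \<in> N) ==> sum f I \<in> N"
 by (induction I rule: infinite_finite_induct) (auto intro: N_add)

lemma N_le: assumes "b \<in> N" "a \<in> M" "adj a * a \<preceq> c *R (adj b * b)" "0 \<le> c"
 shows "a \<in> N" "(nr a)^2 \<le> c * (nr b)^2"
proof -
 have F: "c *R (adj b * b) \<in> Fin" using N_Fin[OF assms(1)] assms(4) by (rule Fin_scale)
 then show "a \<in> N" using assms by (intro N_I) (auto intro: Fin_le)
 show "(nr a)^2 \<le> c * (nr b)^2"
  using wr_mono[OF F _ _ assms(3)] assms by (simp add: nr_sq wr_scale N_Fin)
qed

lemma N_left_ideal: assumes "m \<in> M" "a \<in> N" shows "m * a \<in> N"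
 by (rule N_le[OF assms(2) _ adj_times_le]) (use assms N_mem in auto)

lemma adj_times_mdom: "a \<in> N ==> b \<in> N ==> adj a * b \<in> mdom"
 using gram_mdom[of "apply_bop a" "apply_bop b"] by (simp add: N_iff gram_apply_bop)

lemma hat_adj_times_le: "a \<in> N ==> b \<in> N ==> cmod (hat (adj a * b)) \<le> nr a * nr b"
 using hat_gram_le[of "apply_bop a" "apply_bop b"] by (simp add: N_iff gram_apply_bop)

lemma N_nondegenerate': assumes "\<And>a. a \<in> N ==> \<langle>x, a $ x\<rangle> = 0" shows "x = 0"
proof -
 have "cmod \<langle>x, x\<rangle> < \<epsilon>" if e: "\<epsilon> > 0" for \<epsilon>
 proof -
  obtain n where n: "n \<in> N" and "cmod (\<langle>x, n $ x\<rangle> - \<langle>x, 1 $ x\<rangle>) < \<epsilon>"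
   by (rule semifinite_approx[of 1 "\<lambda>T. \<langle>x, T $ x\<rangle>", OF one_mem vector_predual e])
  with assms[OF n] show ?thesis by simp
 qed
 then have "\<not> 0 < cmod \<langle>x, x\<rangle>" by blast
 then show ?thesis by (simp add: cinner_norm)
qed

text \<open>The graph norm is complete: along a subsequence with rapidly decreasing increments \<open>d\<^sub>k\<close>,
 the operator \<open>\<Sum> 2\<^sup>k |d\<^sub>k|\<^sup>2\<close> has finite weight and dominates the squares of the remainders.\<close>

lemma N_complete:
 assumes x: "\<And>n. x n \<in> N" and l: "x \<longlonglongrightarrow> l"
  and Cau: "\<And>e. 0 < e ==> \<exists>K. \<forall>m\<ge>K. \<forall>n\<ge>K. nr (x m - x n) < e"
 shows "l \<in> N" "(\<lambda>n. nr (x n - l)) \<longlonglongrightarrow> 0"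
proof -
 \<comment> \<open>The rate 4^-k leaves room for the weights 2^k: the terms 2^k 16^-k are summable,
   both for the weight and for the operator norm.\<close>
 have "\<exists>K. \<forall>m\<ge>K. \<forall>n\<ge>K. nr (x m - x n) < 1 / 4 ^ k \<and> norm (x m - x n) < 1 / 4 ^ k" for k :: nat
 proof -
  have "Cauchy x" using l by (rule LIMSEQ_imp_Cauchy)
  then obtain K1 where K1: "\<And>m n. m \<ge> K1 ==> n \<ge> K1 ==> norm (x m - x n) < 1 / 4 ^ k"
   unfolding Cauchy_iff by (meson zero_less_divide_1_iff zero_less_numeral zero_less_power)
  obtain K2 where "\<forall>m\<ge>K2. \<forall>n\<ge>K2. nr (x m - x n) < 1 / 4 ^ k" using Cau[of "1 / 4 ^ k"] by auto
  with K1 show ?thesis by (intro exI[of _ "max K1 K2"]) auto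
 qed
 then obtain K where K: "\<And>k m n. m \<ge> K k ==> n \<ge> K k ==> nr (x m - x n) < 1 / 4 ^ k \<and> norm (x m - x n) < 1 / 4 ^ k"
  by metis
 define r where "r k = (\<Sum>j\<le>k. K j) + k" for k
 have rK: "K k \<le> r k" "r k < r (Suc k)" for k
  using member_le_sum[of k "{..k}" K] by (auto simp: r_def)
 have smr: "strict_mono r" using rK(2) by (simp add: strict_mono_Suc_iff)
 define d where "d k = x (r (Suc k)) - x (r k)" for k
 have dN: "d k \<in> N" for k using x by (simp add: d_def N_diff)
 have dn: "nr (d k) \<le> 1 / 4 ^ k" "norm (d k) \<le> 1 / 4 ^ k" for k
  using K[of k "r (Suc k)" "r k"] rK[of k] by (auto simp: d_def less_imp_le intro: order_trans)
 have xr: "(\<lambda>k. x (r k)) \<longlonglongrightarrow> l" using LIMSEQ_subseq_LIMSEQ[OF l smr] by (simp add: o_def)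
 have geo: "(\<Sum>k<m. (1/2::real) ^ (n + k)) \<le> 2 * (1/2) ^ n" for n m
 proof -
  have "(\<Sum>k<m. (1/2::real) ^ k) \<le> 2" by (subst sum_gp_strict) simp
  then have "(1/2) ^ n * (\<Sum>k<m. (1/2::real) ^ k) \<le> (1/2) ^ n * 2" by (intro mult_left_mono) auto
  then show ?thesis by (simp add: sum_distrib_left power_add mult.commute)
 qed
 have sq: "2 ^ k * (1 / 4 ^ k)^2 \<le> (1/2::real) ^ k" for k :: nat
 proof -
  have "2 ^ k * (1 / 4 ^ k)^2 = (1/8::real) ^ k"
   by (simp add: power2_eq_square power_divide flip: power_mult_distrib)
    (use power_mult_distrib[of "2 :: real" 8 k] in simp)
  also have "\<dots> \<le> (1/2) ^ k" by (rule power_mono) auto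
  finally show ?thesis .
 qed
 have geo1: "(\<Sum>k<m. 2 ^ (n + k) * (1 / 4 ^ (n + k))^2 :: real) \<le> 2" for n m
 proof -
  have "(\<Sum>k<m. 2 ^ (n + k) * (1 / 4 ^ (n + k))^2 :: real) \<le> (\<Sum>k<m. (1/2) ^ (n + k))" by (intro sum_mono sq)
  also have "\<dots> \<le> 2 * (1/2) ^ n" by (rule geo)
  also have "\<dots> \<le> 2" by (simp add: power_le_one)
  finally show ?thesis .
 qed
 have rem: "l - x (r n) \<in> N \<and> (nr (l - x (r n)))^2 \<le> 4 * (1/2) ^ n" for n
 proof -
  define P where "P m = (\<Sum>k<m. 2 ^ (n + k) *R (adj (d (n + k)) * d (n + k)))" for m
  have Pq: "Re \<langle>y, P m $ y\<rangle> = (\<Sum>k<m. 2 ^ (n + k) * (norm (d (n + k) $ y))^2)" for m y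
   by (simp add: P_def bop_sum_left cinner_sum_right cinner_scaleR_right adj_right cinner_norm)
  have PF: "P m \<in> Fin" for m unfolding P_def by (intro Fin_sum Fin_scale N_Fin dN) simp
  have Pw: "wr (P m) \<le> 2" for m
  proof -
   have "wr (P m) = (\<Sum>k<m. 2 ^ (n + k) * (nr (d (n + k)))^2)"
    unfolding P_def by (subst wr_sum) (auto intro!: Fin_scale N_Fin dN simp: wr_scale[OF N_Fin[OF dN]] nr_sq)
   also have "\<dots> \<le> (\<Sum>k<m. 2 ^ (n + k) * (1 / 4 ^ (n + k))^2)"
    by (intro sum_mono mult_left_mono power_mono dn) auto
   also have "\<dots> \<le> 2" by (rule geo1)
   finally show ?thesis .
  qed
  have inc: "P m \<preceq> P (Suc m)" for m by (simp add: P_def pos_op_scaleR)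
  have bd: "P m \<preceq> 2 *R 1" for m
  proof -
   have "Re \<langle>y, P m $ y\<rangle> \<le> 2 * (norm y)^2" for y
   proof -
    have "Re \<langle>y, P m $ y\<rangle> \<le> (\<Sum>k<m. 2 ^ (n + k) * (1 / 4 ^ (n + k) * norm y)^2)"
     unfolding Pq using dn(2)
     by (intro sum_mono mult_left_mono power_mono order_trans[OF norm_bop] mult_right_mono) auto
    also have "\<dots> = (\<Sum>k<m. 2 ^ (n + k) * (1 / 4 ^ (n + k))^2) * (norm y)^2"
     by (simp add: sum_distrib_right power_divide)
    also have "\<dots> \<le> 2 * (norm y)^2" by (intro mult_right_mono geo1) simp
    finally show ?thesis .
   qed
   then show ?thesis
    by (subst bop_le_iff) (simp_all add: pos_op_adj FinD(3)[OF PF] cinner_scaleR_right cinner_norm)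
  qed
  obtain B where B: "pos_op B" "\<And>y z. (\<lambda>m. \<langle>y, P m $ z\<rangle>) \<longlonglongrightarrow> \<langle>y, B $ z\<rangle>"
   "\<And>m. P m \<preceq> B" "B \<preceq> 2 *R 1"
   by (rule mono_weak_limit[where A = P and c = 2, OF FinD(3)[OF PF] inc bd]) (rule that)
  note Bl = w_increasing_limit[where P = P and B = B, OF FinD(1)[OF PF] inc B(1,3,2)]
  have "\<phi> (P m) \<le> ennreal 2" for m unfolding ennreal_wr[OF PF, symmetric] using Pw by (rule ennreal_leI)
  then have Bw: "\<phi> B \<le> ennreal 2" unfolding Bl(2) by (intro SUP_least)
  then have BF: "B \<in> Fin" by (rule Fin_leI[OF Bl(1)])
  have key: "(norm ((l - x (r n)) $ y))^2 \<le> 2 * (1/2) ^ n * Re \<langle>y, B $ y\<rangle>" for y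
  proof (rule LIMSEQ_le_const2)
   show "(\<lambda>m. (norm ((x (r (n + m)) - x (r n)) $ y))^2) \<longlonglongrightarrow> (norm ((l - x (r n)) $ y))^2"
    by (intro tendsto_intros bop_tendsto_apply LIMSEQ_ignore_initial_segment[OF xr, of n, unfolded add.commute[of _ n]])
   have "(norm ((x (r (n + m)) - x (r n)) $ y))^2 \<le> 2 * (1/2) ^ n * Re \<langle>y, B $ y\<rangle>" for m
   proof -
    \<comment> \<open>Telescoping, then Cauchy-Schwarz after splitting each term into the square
      roots of 2^-(n+k) and 2^(n+k): the first factors sum to a geometric series, the second ones
      give the form of \<open>P m\<close>.\<close>
    have "x (r (n + m)) - x (r n) = (\<Sum>k<m. d (n + k))"
     using sum_lessThan_telescope[of "\<lambda>k. x (r (n + k))" m] by (simp add: d_def)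
    then have "norm ((x (r (n + m)) - x (r n)) $ y) \<le> (\<Sum>k<m. sqrt ((1/2) ^ (n + k)) * (sqrt (2 ^ (n + k)) * norm (d (n + k) $ y)))"
     by (auto simp: bop_sum_left mult.assoc[symmetric] real_sqrt_mult[symmetric] power_mult_distrib[symmetric] intro!: norm_sum)
    then have "(norm ((x (r (n + m)) - x (r n)) $ y))^2 \<le> (\<Sum>k<m. sqrt ((1/2) ^ (n + k)) * (sqrt (2 ^ (n + k)) * norm (d (n + k) $ y)))^2"
     by (rule power_mono) simp
    also have "\<dots> \<le> (\<Sum>k<m. (sqrt ((1/2) ^ (n + k)))^2) * (\<Sum>k<m. (sqrt (2 ^ (n + k)) * norm (d (n + k) $ y))^2)"
     by (rule Cauchy_Schwarz_ineq_sum)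
    also have "\<dots> = (\<Sum>k<m. (1/2) ^ (n + k)) * Re \<langle>y, P m $ y\<rangle>"
     by (simp add: Pq power_mult_distrib)
    also have "\<dots> \<le> (2 * (1/2) ^ n) * Re \<langle>y, B $ y\<rangle>"
     using pos_op_nonneg[OF B(3)[of m], of y] pos_op_nonneg[OF FinD(3)[OF PF], of y m]
     by (intro mult_mono geo) (auto simp: ci_rules)
    finally show ?thesis .
   qed
   then show "\<exists>K. \<forall>m\<ge>K. (norm ((x (r (n + m)) - x (r n)) $ y))^2 \<le> 2 * (1/2) ^ n * Re \<langle>y, B $ y\<rangle>" by blast
  qed
  have lM: "l - x (r n) \<in> M" using limit_mem[OF l] x N_mem by (simp add: diff_mem)
  have F: "(2 * (1/2) ^ n) *R B \<in> Fin" by (intro Fin_scale BF) simp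
  have le: "adj (l - x (r n)) * (l - x (r n)) \<preceq> (2 * (1/2) ^ n) *R B"
   by (subst bop_le_iff)
    (use key in "simp_all add: pos_op_adj[OF B(1)] cinner_scaleR_right adj_right cinner_norm del: adj_diff minus_bop.rep_eq")
  have "l - x (r n) \<in> N" using lM by (intro N_I Fin_le[OF F]) (auto intro: le simp del: adj_diff)
  moreover have "(nr (l - x (r n)))^2 \<le> wr ((2 * (1/2) ^ n) *R B)"
   unfolding nr_sq by (rule wr_mono[OF F _ _ le]) (use lM in "auto simp del: adj_diff")
  moreover have "wr ((2 * (1/2) ^ n) *R B) \<le> 2 * (1/2) ^ n * 2"
   using wr_le[OF _ Bw] by (subst wr_scale[OF BF]) (auto intro!: mult_left_mono)
  ultimately show ?thesis by simp
 qed
 from rem[of 0] x have "(l - x (r 0)) + x (r 0) \<in> N" by (intro N_add) auto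
 then show lN: "l \<in> N" by simp
 show "(\<lambda>n. nr (x n - l)) \<longlonglongrightarrow> 0"
 proof (rule LIMSEQ_I)
  fix e :: real assume e: "e > 0"
  then obtain K' where K': "\<And>m n. m \<ge> K' ==> n \<ge> K' ==> nr (x m - x n) < e / 2"
   using Cau[of "e / 2"] by auto
  have "(\<lambda>n. 4 * (1/2::real) ^ n) \<longlonglongrightarrow> 4 * 0" by (intro tendsto_intros LIMSEQ_power_zero) simp
  then have "\<forall>\<^sub>F n in sequentially. 4 * (1/2::real) ^ n < (e / 2)^2" by (rule order_tendstoD) (use e in simp)
  then obtain n0 where n0: "\<And>n. n \<ge> n0 ==> 4 * (1/2::real) ^ n < (e / 2)^2" unfolding eventually_sequentially by blast
  define n where "n = max n0 K'"
  have "(nr (l - x (r n)))^2 < (e / 2)^2" using rem[of n] n0[of n] by (simp add: n_def)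
  then have 1: "nr (l - x (r n)) < e / 2" by (rule power2_less_imp_less) (use e in simp)
  have "r n \<ge> n" by (rule strict_mono_imp_increasing[OF smr])
  show "\<exists>K. \<forall>m\<ge>K. norm (nr (x m - l) - 0) < e"
  proof (intro exI[of _ K'] allI impI)
   fix m assume "m \<ge> K'"
   have "x m - l = (x m - x (r n)) + - (l - x (r n))" by simp
   then have "nr (x m - l) \<le> nr (x m - x (r n)) + nr (- (l - x (r n)))"
    using nr_triangle[OF N_diff[OF x x] N_minus, of "l - x (r n)" m "r n"] rem[of n] by (simp only:)
   also have "\<dots> < e" using K'[of m "r n"] \<open>m \<ge> K'\<close> \<open>r n \<ge> n\<close> 1 nr_minus[of "l - x (r n)"] rem[of n] by (simp add: n_def)
   finally show "norm (nr (x m - l) - 0) < e" by simp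
  qed
 qed
qed

text \<open>Semifiniteness in resolvent form. The vectors with this property form a closed subspace,
  since resolvents are antitone and \<open>Fin\<close> is closed under sums; for
  \<open>adj a $ x\<close> with \<open>a\<close> in \<open>N\<close>, large multiples of
  \<open>adj a * a\<close> work by \<open>res_adj_bound\<close>.\<close>

lemma res_small:
 assumes "\<epsilon> > 0"
 shows "\<exists>T\<in>Fin. Re \<langle>v, res T $ v\<rangle> < \<epsilon>"
proof -
 define P where "P v \<longleftrightarrow> (\<forall>\<epsilon>>0. \<exists>T\<in>Fin. Re \<langle>v, res T $ v\<rangle> < \<epsilon>)" for v
 have quad: "Re \<langle>v + w, res T $ (v + w)\<rangle> \<le> 2 * Re \<langle>v, res T $ v\<rangle> + 2 * Re \<langle>w, res T $ w\<rangle>" if "T \<in> Fin" for T v w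
  using pos_op_nonneg[OF pos_res[OF FinD(3)[OF that]], of "v - w"] by (simp add: ci_rules bop_rules)
 have anti: "Re \<langle>v, res (S + T) $ v\<rangle> \<le> Re \<langle>v, res S $ v\<rangle>" if "T \<in> Fin" "S \<in> Fin" for S T v
  using pos_op_nonneg[OF res_antimono[of S "S + T"], of v] FinD(3)[OF that(1)] FinD(3)[OF that(2)]
  by (simp add: ci_rules pos_op_add)
 have "P v"
 proof (rule total_induct[OF total_N_adj])
  show "csubspace {v. P v}"
   unfolding complex_vector.subspace_def
  proof (intro conjI ballI allI CollectI)
   show "P 0" unfolding P_def using Fin_zero by (intro allI impI bexI[of _ 0]) auto
  next
   fix v w assume "v \<in> {v. P v}" "w \<in> {v. P v}"
   then have vw: "P v" "P w" by auto
   show "P (v + w)" unfolding P_def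
   proof (intro allI impI)
    fix e :: real assume "e > 0"
    then have "e / 4 > 0" by simp
    then obtain S T where ST: "S \<in> Fin" "T \<in> Fin" "Re \<langle>v, res S $ v\<rangle> < e / 4" "Re \<langle>w, res T $ w\<rangle> < e / 4"
     using vw unfolding P_def by meson
    have "Re \<langle>v + w, res (S + T) $ (v + w)\<rangle> < e"
     using quad[OF Fin_add[OF ST(1,2)], of v w] anti[OF ST(2,1), of v] anti[OF ST(1,2), of w] ST(3,4)
     by (simp add: add.commute)
    then show "\<exists>T\<in>Fin. Re \<langle>v + w, res T $ (v + w)\<rangle> < e" using Fin_add[OF ST(1,2)] by blast
   qed
  next
   fix c v assume "v \<in> {v. P v}"
   then have v: "P v" by simp
   show "P (c *C v)" unfolding P_def
   proof (intro allI impI)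
    fix e :: real assume "e > 0"
    then have "e / ((cmod c)^2 + 1) > 0" by (simp add: add_nonneg_pos)
    then obtain T where T: "T \<in> Fin" "Re \<langle>v, res T $ v\<rangle> < e / ((cmod c)^2 + 1)" using v unfolding P_def by meson
    have nn: "0 \<le> Re \<langle>v, res T $ v\<rangle>" using T(1) by (simp add: FinD pos_res pos_op_nonneg)
    have "\<langle>c *C v, res T $ (c *C v)\<rangle> = of_real ((cmod c)^2) * \<langle>v, res T $ v\<rangle>"
     by (subst complex_norm_square) (simp add: bop_rules ci_rules mult_ac)
    then have "Re \<langle>c *C v, res T $ (c *C v)\<rangle> = (cmod c)^2 * Re \<langle>v, res T $ v\<rangle>" by simp
    also have "\<dots> \<le> ((cmod c)^2 + 1) * Re \<langle>v, res T $ v\<rangle>" using nn by (intro mult_right_mono) auto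
    also have "\<dots> < e" using T(2) by (simp add: pos_less_divide_eq add_nonneg_pos mult.commute)
    finally show "\<exists>T\<in>Fin. Re \<langle>c *C v, res T $ (c *C v)\<rangle> < e" using T(1) by blast
   qed
  qed
  show "closed {v. P v}"
   unfolding closed_sequential_limits
  proof (intro allI impI CollectI, elim conjE)
   fix v l assume v: "\<forall>n. v n \<in> {v. P v}" "v \<longlonglongrightarrow> l"
   show "P l" unfolding P_def
   proof (intro allI impI)
    fix e :: real assume "e > 0"
    then obtain n where n: "norm (l - v n) < sqrt (e / 4)"
     using LIMSEQ_D[OF v(2), of "sqrt (e / 4)"] by (auto simp: norm_minus_commute)
    have "e / 4 > 0" using \<open>e > 0\<close> by simp
    then obtain T where T: "T \<in> Fin" "Re \<langle>v n, res T $ v n\<rangle> < e / 4" using v(1) unfolding P_def by blast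
    have "Re \<langle>l - v n, res T $ (l - v n)\<rangle> \<le> (norm (l - v n))^2"
     using pos_op_nonneg[OF res_le_one[OF FinD(3)[OF T(1)]], of "l - v n"]
     unfolding minus_bop.rep_eq one_bop.rep_eq cinner_diff_right[of "l - v n" "l - v n"] cinner_norm by simp
    also have "\<dots> < (sqrt (e / 4))^2" using n by (intro power_strict_mono) auto
    finally have "Re \<langle>l - v n, res T $ (l - v n)\<rangle> < e / 4" using \<open>e > 0\<close> by simp
    then show "\<exists>T\<in>Fin. Re \<langle>l, res T $ l\<rangle> < e"
     using quad[OF T(1), of "v n" "l - v n"] T by (intro bexI[of _ T]) auto
   qed
  qed
  fix s assume "s \<in> {adj a $ x | a x. a \<in> N}"
  then obtain a x where s: "s = adj a $ x" "a \<in> N" by auto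
  show "P s" unfolding P_def
  proof (intro allI impI)
   fix e :: real assume e: "e > 0"
   define c where "c = (norm x)^2 / e + 1"
   have c: "c > 0" using e by (simp add: c_def add_nonneg_pos)
   have F: "c *R (adj a * a) \<in> Fin" using N_Fin[OF s(2)] c by (intro Fin_scale) auto
   have "Re \<langle>s, res (c *R (adj a * a)) $ s\<rangle> \<le> (norm x)^2 / c"
    unfolding s by (rule res_adj_bound[OF FinD(3)[OF F] _ c]) simp
   also have "\<dots> < e" using e c by (simp add: c_def field_simps)
   finally show "\<exists>T\<in>Fin. Re \<langle>s, res T $ s\<rangle> < e" using F by blast
  qed
 qed
 then show ?thesis using assms by (simp add: P_def)
qed

end

text \<open>The transforms T / (1 + T), for T of finite \<phi>-weight, increase to 1 by
  \<open>res_small\<close>. Normality of \<psi> makes the \<psi>-weight of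
  \<open>adj x0 * res T * x0\<close> small. With a = T / (1 + T) the error x0 - a x0 is (1 + T)^-1
  x0, whose square is dominated by that compression.\<close>

lemma two_weights_approx:
 assumes "nsf M \<phi>" "nsf M \<psi>" and x0: "x0 \<in> left_ideal_of_weight M \<psi>" and \<epsilon>: "\<epsilon> > 0"
 shows "\<exists>a\<in>left_ideal_of_weight M \<phi>. x0 - adj a * x0 \<in> left_ideal_of_weight M \<psi> \<and>
  (nsf.nrm \<psi> (apply_bop (x0 - adj a * x0)))^2 < \<epsilon>"
proof -
 interpret p: nsf M \<phi> by fact
 interpret q: nsf M \<psi> by fact
 define C where "C T = adj x0 * frac_op T * x0" for T
 have x0M: "x0 \<in> M" using x0 by (rule q.N_mem)
 have CP: "C T \<in> pos_part M" if "T \<in> p.Fin" for T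
  unfolding C_def using p.FinD[OF that] x0M by (intro p.pos_partI pos_op_conj pos_frac) auto
 have conj_le: "adj x0 * A * x0 \<preceq> adj x0 * B * x0" if "A \<preceq> B" for A B
  using pos_op_conj[OF that, of x0] by (simp add: algebra_simps)
 have frac_mono: "frac_op S \<preceq> frac_op (S + T)" if "S \<in> p.Fin" "T \<in> p.Fin" for S T
  using res_antimono[of S "S + T"] that p.FinD(3) by (simp add: pos_op_add)
 have "\<psi> (adj x0 * x0) = (SUP d\<in>C ` p.Fin. \<psi> d)"
 proof (rule q.w_sup)
  show "C ` p.Fin \<noteq> {}" using p.Fin_zero by blast
  show "C ` p.Fin \<subseteq> pos_part M" using CP by blast
  show "\<exists>f\<in>C ` p.Fin. d \<preceq> f \<and> e \<preceq> f" if de: "d \<in> C ` p.Fin" "e \<in> C ` p.Fin" for d e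
  proof -
   from de obtain S T where ST: "S \<in> p.Fin" "T \<in> p.Fin" "d = C S" "e = C T" by blast
   then have "C S \<preceq> C (S + T)" "C T \<preceq> C (S + T)"
    using conj_le[OF frac_mono[of S T]] conj_le[OF frac_mono[of T S]] by (simp_all add: C_def add.commute)
   then show ?thesis using ST p.Fin_add by blast
  qed
  show "adj x0 * x0 \<in> pos_part M" using x0M by (intro p.pos_partI) auto
  show "d \<preceq> adj x0 * x0" if "d \<in> C ` p.Fin" for d
   using that conj_le[OF frac_le_one[OF p.FinD(3)]] by (auto simp: C_def)
  show "\<exists>d\<in>C ` p.Fin. Re \<langle>x, (adj x0 * x0) $ x\<rangle> - e < Re \<langle>x, d $ x\<rangle>" if e: "0 < e" for x and e :: real
  proof -
   obtain T where T: "T \<in> p.Fin" "Re \<langle>x0 $ x, res T $ x0 $ x\<rangle> < e" using p.res_small[OF e] by blast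
   then show ?thesis by (intro bexI[of _ "C T"]) (auto simp: C_def adj_right ci_rules)
  qed
 qed
 moreover have x0F: "adj x0 * x0 \<in> q.Fin" by (rule q.N_Fin[OF x0])
 moreover have CF: "C T \<in> q.Fin" if "T \<in> p.Fin" for T
  using conj_le[OF frac_le_one[OF p.FinD(3)[OF that]]]
  by (intro q.Fin_le[OF x0F]) (use CP[OF that] in "auto simp: C_def pos_part_def")
 ultimately have "ennreal (q.wr (adj x0 * x0)) = (SUP T\<in>p.Fin. ennreal (q.wr (C T)))"
  by (simp add: q.ennreal_wr image_comp)
 moreover have "q.wr (adj x0 * x0) - \<epsilon> < q.wr (adj x0 * x0)" using \<epsilon> by simp
 ultimately have "\<not> (\<forall>T\<in>p.Fin. q.wr (C T) \<le> q.wr (adj x0 * x0) - \<epsilon>)"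
 proof (intro notI)
  assume s: "ennreal (q.wr (adj x0 * x0)) = (SUP T\<in>p.Fin. ennreal (q.wr (C T)))"
   and c: "\<forall>T\<in>p.Fin. q.wr (C T) \<le> q.wr (adj x0 * x0) - \<epsilon>"
  have "(SUP T\<in>p.Fin. ennreal (q.wr (C T))) \<le> ennreal (q.wr (adj x0 * x0) - \<epsilon>)"
   using c by (intro SUP_least ennreal_leI) auto
  with s have "ennreal (q.wr (adj x0 * x0)) \<le> ennreal (q.wr (adj x0 * x0) - \<epsilon>)" by simp
  moreover have "0 \<le> q.wr (adj x0 * x0) - \<epsilon>" using c p.Fin_zero q.wr_nonneg order_trans by blast
  ultimately have "q.wr (adj x0 * x0) \<le> q.wr (adj x0 * x0) - \<epsilon>" by (simp only: ennreal_le_iff)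
  then show False using \<epsilon> by linarith
 qed
 then obtain T where T: "T \<in> p.Fin" "q.wr (adj x0 * x0) - \<epsilon> < q.wr (C T)" by (auto simp: not_le)
 let ?a = "frac_op T"
 have pos: "pos_op T" and TM: "T \<in> M" using p.FinD[OF T(1)] by auto
 have adja: "adj ?a = ?a" by (rule pos_op_adj[OF pos_frac[OF pos]])
 have aM: "?a \<in> M" using pos TM by simp
 have "?a \<in> p.Fin" by (rule p.Fin_le[OF T(1) aM pos_frac[OF pos] frac_le[OF pos]])
 then have "adj ?a * ?a \<in> p.Fin" using aM by (intro p.Fin_le[OF _ _ _ frac_sq_le[OF pos]]) (auto simp del: adj_diff)
 with aM have aN: "?a \<in> left_ideal_of_weight M \<phi>" by (rule p.N_I)
 have e: "x0 - adj ?a * x0 = res T * x0" unfolding adja by (simp add: algebra_simps)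
 have rM: "res T * x0 \<in> M" using pos TM x0M by simp
 have d: "adj x0 * x0 - C T = adj x0 * res T * x0" by (simp add: C_def algebra_simps)
 have dF: "adj x0 * res T * x0 \<in> q.Fin"
  using conj_le[OF res_le_one[OF pos]] pos TM x0M
  by (intro q.Fin_le[OF x0F]) (auto intro: pos_op_conj pos_res)
 have "adj x0 * x0 = C T + adj x0 * res T * x0" using d by (simp add: algebra_simps)
 then have "q.wr (adj x0 * x0) = q.wr (C T) + q.wr (adj x0 * res T * x0)"
  using q.wr_add[OF CF[OF T(1)] dF] by metis
 with T(2) have lt: "q.wr (adj x0 * res T * x0) < \<epsilon>" by simp
 have le: "adj (res T * x0) * (res T * x0) \<preceq> adj x0 * res T * x0"
 proof -
  have "(norm (res T $ x0 $ x))^2 \<le> Re \<langle>x0 $ x, res T $ x0 $ x\<rangle>" for x by (rule res_sq_le[OF pos])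
  then show ?thesis
   by (subst bop_le_iff) (simp_all add: pos_op_adj[OF pos_res[OF pos]] mult.assoc adj_right cinner_norm,
    metis adj_left cinner_norm Re_complex_of_real pos_op_adj[OF pos_res[OF pos]])
 qed
 have rN: "res T * x0 \<in> left_ideal_of_weight M \<psi>"
  by (rule q.N_I[OF rM q.Fin_le[OF dF _ _ le]]) (use rM in "auto simp del: adj_times")
 have "(q.nr (res T * x0))^2 \<le> q.wr (adj x0 * res T * x0)"
  unfolding q.nr_sq by (rule q.wr_mono[OF dF _ _ le]) (use rM in "auto simp del: adj_times")
 with lt rN aN show ?thesis by (intro bexI[OF _ aN]) (simp only: e, simp)
qed

subsection \<open>The GNS construction\<close>

lemma subspace_closure:
 fixes S :: "'a :: real_normed_vector set"
 assumes S: "subspace S"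
 shows "subspace (closure S)"
 unfolding subspace_def
proof (intro conjI ballI allI)
 show "0 \<in> closure S" using closure_subset subspace_0[OF S] by blast
next
 fix x y assume "x \<in> closure S" "y \<in> closure S"
 then obtain f g where "\<forall>n. f n \<in> S" "f \<longlonglongrightarrow> x" "\<forall>n. g n \<in> S" "g \<longlonglongrightarrow> y"
  unfolding closure_sequential by blast
 then have "(\<forall>n. f n + g n \<in> S) \<and> (\<lambda>n. f n + g n) \<longlonglongrightarrow> x + y"
  by (auto intro: tendsto_add subspace_add[OF S])
 then show "x + y \<in> closure S" unfolding closure_sequential by (rule exI[of _ "\<lambda>n. f n + g n"])
next
 fix c x assume "x \<in> closure S"
 then obtain f where "\<forall>n. f n \<in> S" "f \<longlonglongrightarrow> x" unfolding closure_sequential by blast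
 then have "(\<forall>n. c *R f n \<in> S) \<and> (\<lambda>n. c *R f n) \<longlonglongrightarrow> c *R x"
  by (auto intro: tendsto_scaleR subspace_scale[OF S])
 then show "c *R x \<in> closure S" unfolding closure_sequential by (rule exI[of _ "\<lambda>n. c *R f n"])
qed

locale gns = nsf +
 fixes \<Lambda> :: "'a bop => 'a ell2"
 assumes gns: "gns_construction M \<phi> \<Lambda>"
begin

lemma Lam_add: "a \<in> N ==> b \<in> N ==> \<Lambda> (a + b) = \<Lambda> a + \<Lambda> b"
 and Lam_scaleC: "a \<in> N ==> \<Lambda> (c *C a) = c *C \<Lambda> a"
 and Lam_mult: "m \<in> M ==> a \<in> N ==> \<Lambda> (m * a) = m $ \<Lambda> a"
 and Lam_dense: "closure (\<Lambda> ` N) = UNIV"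
 using gns by (auto simp: gns_construction_def Let_def)

lemma norm_Lam: assumes "a \<in> N" shows "norm (\<Lambda> a) = nr a"
proof -
 have "ennreal ((norm (\<Lambda> a))^2) = ennreal (wr (adj a * a))"
  using gns assms by (simp add: gns_construction_def Let_def ennreal_wr N_Fin)
 then have "(norm (\<Lambda> a))^2 = (nr a)^2" by (simp add: nr_sq)
 then show ?thesis by (metis norm_ge_zero nrm_nonneg power2_eq_iff_nonneg)
qed

lemma Lam_minus: "a \<in> N ==> \<Lambda> (- a) = - \<Lambda> a"
 using Lam_scaleC[of a "-1"] by (simp add: complex_vector.scale_minus_left)
lemma Lam_diff: "a \<in> N ==> b \<in> N ==> \<Lambda> (a - b) = \<Lambda> a - \<Lambda> b"
 using Lam_add[of a "- b"] by (simp add: N_minus Lam_minus)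
lemma Lam_zero [simp]: "\<Lambda> 0 = 0" using Lam_scaleC[of 0 0] by simp
lemma Lam_sum: "(\<And>i. i \<in> I ==> f i \<in> N) ==> \<Lambda> (sum f I) = (\<Sum>i\<in>I. \<Lambda> (f i))"
 by (induction I rule: infinite_finite_induct) (auto simp: Lam_add N_sum)

lemma total_Lam: "total (\<Lambda> ` N)" by (rule total_closure[OF Lam_dense])

lemma Lam_closed:
 assumes x: "\<And>n. x n \<in> N" and l: "x \<longlonglongrightarrow> l" and z: "(\<lambda>n. \<Lambda> (x n)) \<longlonglongrightarrow> \<zeta>"
 shows "l \<in> N" "\<Lambda> l = \<zeta>"
proof -
 have nrd: "nr (x m - x n) = norm (\<Lambda> (x m) - \<Lambda> (x n))" for m n
  using x by (metis Lam_diff N_diff norm_Lam)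
 have C: "\<exists>K. \<forall>m\<ge>K. \<forall>n\<ge>K. nr (x m - x n) < e" if "0 < e" for e
  unfolding nrd using LIMSEQ_imp_Cauchy[OF z] that by (simp add: Cauchy_iff)
 note * = N_complete[where x = x and l = l, OF x l C]
 show lN: "l \<in> N" by (rule *(1))
 have "(\<lambda>n. norm (\<Lambda> (x n) - \<Lambda> l)) \<longlonglongrightarrow> 0"
  using *(2) norm_Lam[OF N_diff[OF x lN]] Lam_diff[OF x lN] by (simp del: minus_bop.rep_eq)
 then have "(\<lambda>n. \<Lambda> (x n)) \<longlonglongrightarrow> \<Lambda> l" by (simp add: tendsto_norm_zero_iff LIM_zero_iff)
 then show "\<Lambda> l = \<zeta>" using z by (rule LIMSEQ_unique)
qed

text \<open>The domain of the involution from \<open>\<Lambda> y\<close> to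
  \<open>\<Lambda> (adj y)\<close>, whose closability is the part of modular theory that
  enters.\<close>

definition NN :: "'a bop set" where "NN = {y \<in> N. adj y \<in> N}"

lemma NN_D: "y \<in> NN ==> y \<in> N" "y \<in> NN ==> adj y \<in> N" by (auto simp: NN_def)
lemma NN_mult: "a \<in> N ==> b \<in> N ==> adj a * b \<in> NN"
 using N_left_ideal N_mem by (simp add: NN_def)

lemma total_Lam_NN: "total (\<Lambda> ` NN)"
 unfolding total_def
proof (intro allI impI)
 fix z assume *: "\<forall>s\<in>\<Lambda> ` NN. \<langle>s, z\<rangle> = 0"
 show "z = 0"
 proof (rule N_nondegenerate, rule totalD[OF total_Lam])
  fix a s assume a: "a \<in> N" and "s \<in> \<Lambda> ` N"
  then obtain b where b: "s = \<Lambda> b" "b \<in> N" by auto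
  have "\<langle>\<Lambda> (adj a * b), z\<rangle> = 0" using * NN_mult[OF a b(2)] by blast
  then show "\<langle>s, a $ z\<rangle> = 0" using a b by (simp add: Lam_mult N_mem adj_left)
 qed
qed

text \<open>\<open>Fpair \<xi> f\<close> says that \<open>\<xi>\<close> is in the domain of the adjoint \<open>F\<close> of \<open>\<Lambda>(y) \<mapsto> \<Lambda>(y\<^sup>*)\<close> and \<open>F\<xi> = f\<close>.\<close>

definition Fpair :: "'a ell2 => 'a ell2 => bool" where
 "Fpair \<xi> f \<longleftrightarrow> (\<forall>y\<in>NN. \<langle>f, \<Lambda> y\<rangle> = \<langle>\<Lambda> (adj y), \<xi>\<rangle>)"

lemma Fpair_sym: "Fpair \<xi> f ==> Fpair f \<xi>"
proof -
 assume F: "Fpair \<xi> f"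
 show "Fpair f \<xi>" unfolding Fpair_def
 proof
  fix y assume y: "y \<in> NN"
  then have "adj y \<in> NN" by (simp add: NN_def)
  then have "\<langle>f, \<Lambda> (adj y)\<rangle> = \<langle>\<Lambda> y, \<xi>\<rangle>" using F by (auto simp: Fpair_def)
  then show "\<langle>\<xi>, \<Lambda> y\<rangle> = \<langle>\<Lambda> (adj y), f\<rangle>" by (metis cinner_commute)
 qed
qed

text \<open>If \<open>\<Lambda>(y\<^sub>k) \<rightarrow> 0\<close> fast while \<open>\<Lambda>(y\<^sub>k\<^sup>*) \<rightarrow> \<eta>\<close>, let \<open>g\<^sub>n\<close> be the resolvent of \<open>\<Sum>\<^sub>k\<^sub>\<ge>\<^sub>n 4\<^sup>k |y\<^sub>k|\<^sup>2\<close>.  Then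
 \<open>g\<^sub>n y\<^sub>k\<^sup>* \<rightarrow> 0\<close> in norm, so \<open>g\<^sub>n \<eta> = 0\<close>, whereas \<open>g\<^sub>n \<rightarrow> 1\<close> because \<open>\<phi>(1 - g\<^sub>n) \<rightarrow> 0\<close>.\<close>

lemma closable_involution:
 assumes y: "\<And>k. y k \<in> NN" and small: "\<And>k. (norm (\<Lambda> (y k)))^2 \<le> (1/8) ^ k"
  and lim: "(\<lambda>k. \<Lambda> (adj (y k))) \<longlonglongrightarrow> \<eta>"
 shows "\<eta> = 0"
proof -
 \<comment> \<open>The operator norms of the \<open>y k\<close> are not controlled, so the infinite
   sum need not be an operator. Only truncations are formed, and \<open>h n\<close> is the limit of
   their transforms \<open>frac_op\<close>.\<close>
 define T where "T n m = (\<Sum>k=n..<n+m. 4 ^ k *R (adj (y k) * y k))" for n m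
 have TF: "T n m \<in> Fin" for n m
  unfolding T_def by (intro Fin_sum Fin_scale N_Fin NN_D y) simp
 note Tpos = FinD(3)[OF TF] and TM = FinD(2)[OF TF]
 have Tmono: "T n m \<preceq> T n (Suc m)" for n m by (simp add: T_def pos_op_scaleR)
 have Tdec: "T (Suc n) m \<preceq> T n (Suc m)" for n m
 proof -
  have "{n..<n + Suc m} = insert n {Suc n..<Suc n + m}" by auto
  then show ?thesis by (simp add: T_def pos_op_scaleR)
 qed
 have Tw: "wr (T n m) \<le> 2 * (1/2) ^ n" for n m
 proof -
  have "wr (T n m) = (\<Sum>k=n..<n+m. 4 ^ k * (norm (\<Lambda> (y k)))^2)"
   unfolding T_def
   by (subst wr_sum) (auto intro!: Fin_scale N_Fin NN_D y simp: wr_scale[OF N_Fin[OF NN_D(1)[OF y]]] norm_Lam[OF NN_D(1)[OF y]] nr_sq)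
  also have "\<dots> \<le> (\<Sum>k=n..<n+m. 4 ^ k * (1/8) ^ k)" by (intro sum_mono mult_left_mono small) simp
  also have "\<dots> = (\<Sum>k=n..<n+m. (1/2) ^ k)" by (simp flip: power_mult_distrib)
  also have "\<dots> = (1/2) ^ n * (\<Sum>k<m. (1/2) ^ k)"
   by (simp add: sum_distrib_left sum.shift_bounds_nat_ivl[of _ 0 n m, simplified] atLeast0LessThan add.commute flip: power_add)
  also have "\<dots> \<le> (1/2) ^ n * 2" by (intro mult_left_mono) (subst sum_gp_strict, simp_all)
  finally show ?thesis by simp
 qed
 have fmono: "frac_op S \<preceq> frac_op S'" if "pos_op S" "pos_op S'" "S \<preceq> S'" for S S' :: "'a bop"
  using res_antimono[OF that] by simp
 have "\<exists>B. pos_op B \<and> (\<forall>x z. (\<lambda>m. \<langle>x, frac_op (T n m) $ z\<rangle>) \<longlonglongrightarrow> \<langle>x, B $ z\<rangle>) \<and>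
   (\<forall>m. frac_op (T n m) \<preceq> B) \<and> B \<preceq> 1" for n
 proof -
  obtain B where "pos_op B" "\<And>x z. (\<lambda>m. \<langle>x, frac_op (T n m) $ z\<rangle>) \<longlonglongrightarrow> \<langle>x, B $ z\<rangle>"
   "\<And>m. frac_op (T n m) \<preceq> B" "B \<preceq> 1 *R 1"
   by (rule mono_weak_limit[where A = "\<lambda>m. frac_op (T n m)" and c = 1, OF pos_frac[OF Tpos] fmono[OF Tpos Tpos Tmono]])
    (simp add: pos_res[OF Tpos], rule that)
  then show ?thesis by auto
 qed
 then obtain h where h: "\<And>n. pos_op (h n)" "\<And>n x z. (\<lambda>m. \<langle>x, frac_op (T n m) $ z\<rangle>) \<longlonglongrightarrow> \<langle>x, h n $ z\<rangle>"
  "\<And>n m. frac_op (T n m) \<preceq> h n" "\<And>n. h n \<preceq> 1" by metis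
 have fracF: "frac_op (T n m) \<in> Fin" for n m
  using Tpos[of n m] TM[of n m] by (intro Fin_le[OF TF _ pos_frac frac_le]) auto
 note hl = w_increasing_limit[where P = "\<lambda>m. frac_op (T n m)" and B = "h n" for n,
   OF FinD(1)[OF fracF] fmono[OF Tpos Tpos Tmono] h(1,3,2)]
 have hw: "\<phi> (h n) \<le> ennreal (2 * (1/2) ^ n)" for n
  unfolding hl(2)
 proof (rule SUP_least)
  fix m
  have "\<phi> (frac_op (T n m)) \<le> \<phi> (T n m)"
   by (rule w_mono[OF FinD(1)[OF fracF] FinD(1)[OF TF] frac_le[OF Tpos]])
  also have "\<dots> \<le> ennreal (2 * (1/2) ^ n)" unfolding ennreal_wr[OF TF, symmetric] by (rule ennreal_leI[OF Tw])
  finally show "\<phi> (frac_op (T n m)) \<le> ennreal (2 * (1/2) ^ n)" .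
 qed
 have hM: "h n \<in> M" for n using hl(1) by (rule pos_partD)
 have hdec: "h (Suc n) \<preceq> h n" for n
 proof -
  have "Re \<langle>x, h (Suc n) $ x\<rangle> \<le> Re \<langle>x, h n $ x\<rangle>" for x
  proof (rule LIMSEQ_le_const2[OF tendsto_Re[OF h(2)[of x "Suc n" x]]])
   have "Re \<langle>x, frac_op (T (Suc n) m) $ x\<rangle> \<le> Re \<langle>x, h n $ x\<rangle>" for m
    using pos_op_nonneg[OF bop_le_trans[OF fmono[OF Tpos Tpos Tdec] h(3)[of n "Suc m"]], of x]
    by (simp only: minus_bop.rep_eq cinner_diff_right minus_complex.simps)
   then show "\<exists>K. \<forall>m\<ge>K. Re \<langle>x, frac_op (T (Suc n) m) $ x\<rangle> \<le> Re \<langle>x, h n $ x\<rangle>" by blast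
  qed
  then show ?thesis by (subst bop_le_iff) (simp_all add: pos_op_adj h(1))
 qed
 have g0: "h n $ \<eta> = \<eta>" for n
 proof -
  let ?g = "1 - h n"
  \<comment> \<open>\<open>T n m\<close> dominates \<open>4 ^ k *R (adj (y k) * y k)\<close> once
    the index k occurs, so \<open>y k\<close> composed with the resolvent has norm at most 2^-k;
    adjoints and the limit in m transfer this to \<open>?g\<close>.\<close>
  have small: "norm (?g * adj (y k)) \<le> (1/2) ^ k" if "n \<le> k" for k
  proof (rule norm_bop_le)
   fix x
   have b: "cmod \<langle>w, ?g $ adj (y k) $ x\<rangle> \<le> (1/2) ^ k * norm x * norm w" for w
   proof (rule LIMSEQ_le_const2)
    show "(\<lambda>m. cmod (\<langle>w, adj (y k) $ x\<rangle> - \<langle>w, frac_op (T n m) $ adj (y k) $ x\<rangle>)) \<longlonglongrightarrow> cmod \<langle>w, ?g $ adj (y k) $ x\<rangle>"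
     using tendsto_norm[OF tendsto_diff[OF tendsto_const[of "\<langle>w, adj (y k) $ x\<rangle>"] h(2)[of w n "adj (y k) $ x"]]]
     by (simp add: cinner_diff_right[of w "adj (y k) $ x" "h n $ adj (y k) $ x"])
    have "cmod (\<langle>w, adj (y k) $ x\<rangle> - \<langle>w, frac_op (T n m) $ adj (y k) $ x\<rangle>) \<le> (1/2) ^ k * norm x * norm w"
     if "m \<ge> Suc k" for m
    proof -
     have "T n m - 4 ^ k *R (adj (y k) * y k) = (\<Sum>j\<in>{n..<n+m} - {k}. 4 ^ j *R (adj (y j) * y j))"
      using that \<open>n \<le> k\<close> by (subst sum_diff1) (auto simp: T_def)
     then have le: "4 ^ k *R (adj (y k) * y k) \<preceq> T n m" by (auto intro!: pos_op_sum pos_op_scaleR)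
     have "\<langle>w, adj (y k) $ x\<rangle> - \<langle>w, frac_op (T n m) $ adj (y k) $ x\<rangle> = \<langle>y k $ res (T n m) $ w, x\<rangle>"
      by (simp add: ci_rules) (metis adj_left adj_right pos_op_adj[OF pos_res[OF Tpos]])
     also have "cmod \<dots> \<le> norm (y k $ res (T n m) $ w) * norm x" by (rule cauchy_schwarz)
     also have "\<dots> \<le> (norm w / sqrt (4 ^ k)) * norm x"
      by (intro mult_right_mono norm_mult_res[OF Tpos le]) auto
     also have "sqrt (4 ^ k) = 2 ^ k" by (simp add: real_sqrt_power)
     finally show ?thesis by (simp add: power_one_over field_simps)
    qed
    then show "\<exists>K. \<forall>m\<ge>K. cmod (\<langle>w, adj (y k) $ x\<rangle> - \<langle>w, frac_op (T n m) $ adj (y k) $ x\<rangle>) \<le> (1/2) ^ k * norm x * norm w" by blast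
   qed
   let ?v = "?g $ adj (y k) $ x"
   have "norm ?v * norm ?v \<le> (1/2) ^ k * norm x * norm ?v"
    using b[of ?v] unfolding cinner_norm[of ?v] by (simp add: power2_eq_square norm_mult)
   then have "norm ?v \<le> (1/2) ^ k * norm x" by (cases "?v = 0") auto
   then show "norm ((?g * adj (y k)) $ x) \<le> (1/2) ^ k * norm x" by simp
  qed simp
  have "(\<lambda>k. ?g * adj (y k)) \<longlonglongrightarrow> 0"
  proof (rule Lim_null_comparison)
   show "\<forall>\<^sub>F k in sequentially. norm (?g * adj (y k)) \<le> (1/2) ^ k"
    using small by (auto simp: eventually_sequentially)
   show "(\<lambda>k. (1/2::real) ^ k) \<longlonglongrightarrow> 0" by (rule LIMSEQ_power_zero) simp
  qed
  moreover have "(\<lambda>k. \<Lambda> (?g * adj (y k))) \<longlonglongrightarrow> ?g $ \<eta>"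
   using bop_tendsto[OF lim, of ?g] y hM by (simp add: Lam_mult NN_D)
  ultimately have "\<Lambda> 0 = ?g $ \<eta>"
   by (rule Lam_closed(2)[rotated]) (rule N_left_ideal, simp add: hM, rule NN_D(2)[OF y])
  then show ?thesis by simp
 qed
 \<comment> \<open>The \<open>1 - h n\<close> increase to some B, and the weight of 1 - B is at most
   that of each \<open>h n\<close>, hence zero; faithfulness gives B = 1. As every
   \<open>h n\<close> fixes \<eta>, the forms at \<eta> are zero and converge to |\<eta>|^2.\<close>
 obtain B where B: "\<And>x z. (\<lambda>n. \<langle>x, (1 - h n) $ z\<rangle>) \<longlonglongrightarrow> \<langle>x, B $ z\<rangle>" "\<And>n. 1 - h n \<preceq> B" "B \<preceq> 1 *R 1"
  by (rule mono_weak_limit[where A = "\<lambda>n. 1 - h n" and c = 1, OF h(4)]) (use hdec h(1) in auto)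
 have BM: "1 - B \<in> M"
  using weak_limit_mem[OF _ B(1)] hM by auto
 have "\<phi> (1 - B) \<le> ennreal (2 * (1/2) ^ n)" for n
  using B(2)[of n] B(3) BM hM hl(1) by (intro order_trans[OF w_mono hw[of n]]) (auto simp: pos_part_def algebra_simps)
 moreover have "(\<lambda>n. ennreal (2 * (1/2) ^ n)) \<longlonglongrightarrow> ennreal (2 * 0)"
  by (intro tendsto_ennrealI tendsto_intros LIMSEQ_power_zero) simp
 ultimately have "\<phi> (1 - B) \<le> ennreal (2 * 0)" by (intro LIMSEQ_le_const) auto
 then have "1 - B = 0" using B(3) BM by (intro w_faithful) (auto simp: pos_part_def)
 then have "B = 1" by simp
 with B(1)[of \<eta> \<eta>] have "(\<lambda>n. 0) \<longlonglongrightarrow> \<langle>\<eta>, \<eta>\<rangle>" by (simp add: g0 ci_rules)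
 then show "\<eta> = 0" by (simp add: LIMSEQ_const_iff cinner_norm)
qed

text \<open>For \<eta> orthogonal to the domain of F, project (0, \<eta>) onto the closed graph of
  the involution. Up to a sign the residual is a pair of F, so orthogonality makes it vanish; then
  (0, \<eta>) is in the closed graph and closability gives \<eta> = 0.\<close>

lemma total_Fdomain: "total {\<xi>. \<exists>f. Fpair \<xi> f}"
 unfolding total_def
proof (intro allI impI)
 fix \<eta> assume orth: "\<forall>s\<in>{\<xi>. \<exists>f. Fpair \<xi> f}. \<langle>s, \<eta>\<rangle> = 0"
 \<comment> \<open>The involution is antilinear, so its graph is only a real subspace; the real
   inner product is used, and imaginary parts are recovered from \<open>\<i> *C y\<close>.\<close>
 define G where "G = (\<lambda>y. (\<Lambda> y, \<Lambda> (adj y))) ` NN"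
 have G: "subspace G"
  unfolding subspace_def G_def
 proof (intro conjI ballI allI)
  show "0 \<in> (\<lambda>y. (\<Lambda> y, \<Lambda> (adj y))) ` NN" by (rule image_eqI[of _ _ 0]) (auto simp: NN_def zero_prod_def)
 next
  fix u v assume "u \<in> (\<lambda>y. (\<Lambda> y, \<Lambda> (adj y))) ` NN" "v \<in> (\<lambda>y. (\<Lambda> y, \<Lambda> (adj y))) ` NN"
  then obtain y z where "y \<in> NN" "z \<in> NN" "u = (\<Lambda> y, \<Lambda> (adj y))" "v = (\<Lambda> z, \<Lambda> (adj z))" by auto
  then show "u + v \<in> (\<lambda>y. (\<Lambda> y, \<Lambda> (adj y))) ` NN"
   by (intro image_eqI[of _ _ "y + z"]) (auto simp: NN_def N_add Lam_add)
 next
  fix c u assume "u \<in> (\<lambda>y. (\<Lambda> y, \<Lambda> (adj y))) ` NN"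
  then obtain y where "y \<in> NN" "u = (\<Lambda> y, \<Lambda> (adj y))" by auto
  then show "c *R u \<in> (\<lambda>y. (\<Lambda> y, \<Lambda> (adj y))) ` NN"
   by (intro image_eqI[of _ _ "of_real c *C y"])
    (auto simp: NN_def N_scaleC Lam_scaleC scaleC_of_real simp del: scaleC_of_real simp flip: scaleC_of_real)
 qed
 obtain st where st: "st \<in> closure G" "\<And>u. u \<in> closure G ==> inner ((0, \<eta>) - st) u = 0"
  using orthogonal_decomposition[OF subspace_closure[OF G] closed_closure] by metis
 obtain s t where e: "st = (s, t)" by force
 have r: "Re \<langle>\<eta> - t, \<Lambda> (adj y)\<rangle> = Re \<langle>s, \<Lambda> y\<rangle>" if "y \<in> NN" for y
 proof -
  have "(\<Lambda> y, \<Lambda> (adj y)) \<in> G" using that by (simp add: G_def)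
  then have "(\<Lambda> y, \<Lambda> (adj y)) \<in> closure G" using closure_subset by blast
  from st(2)[OF this] show ?thesis by (simp add: e inner_Pair inner_eq_Re_cinner ci_rules)
 qed
 have F: "Fpair (\<eta> - t) s"
  unfolding Fpair_def
 proof
  fix y assume y: "y \<in> NN"
  have "\<i> *C y \<in> NN" using y by (simp add: NN_def N_scaleC N_minus complex_vector.scale_minus_left)
  from r[OF this] have "Im \<langle>\<eta> - t, \<Lambda> (adj y)\<rangle> = - Im \<langle>s, \<Lambda> y\<rangle>"
   using y by (simp add: NN_def Lam_scaleC Lam_minus N_scaleC complex_vector.scale_minus_left cinner_scaleC_right cinner_minus_right)
  with r[OF y] have "\<langle>s, \<Lambda> y\<rangle> = cnj \<langle>\<eta> - t, \<Lambda> (adj y)\<rangle>" by (simp add: complex_eq_iff)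
  then show "\<langle>s, \<Lambda> y\<rangle> = \<langle>\<Lambda> (adj y), \<eta> - t\<rangle>" by (metis cinner_commute)
 qed
 have "\<langle>\<eta> - t, \<eta>\<rangle> = 0" using F orth by blast
 then have "Re \<langle>\<eta> - t, \<eta>\<rangle> = 0" by simp
 moreover have "- ((norm s)^2) + Re \<langle>\<eta> - t, t\<rangle> = 0"
  using st(2)[OF st(1)] by (simp add: e inner_Pair inner_eq_Re_cinner ci_rules cinner_norm)
 moreover have "Re \<langle>\<eta> - t, \<eta>\<rangle> - Re \<langle>\<eta> - t, t\<rangle> = (norm (\<eta> - t))^2"
  by (metis Re_complex_of_real cinner_diff_right cinner_norm minus_complex.simps(1))
 ultimately have "(norm (\<eta> - t))^2 + (norm s)^2 = 0" by linarith
 then have "s = 0" "t = \<eta>" unfolding sum_power2_eq_zero_iff by simp_all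
 then have cl: "(0, \<eta>) \<in> closure G" using st(1) e by simp
 have "\<exists>y. y \<in> NN \<and> (norm (\<Lambda> y))^2 \<le> (1/8) ^ k \<and> norm (\<Lambda> (adj y) - \<eta>) \<le> (1/2) ^ k" for k
 proof -
  have "(0::real) < (1/8) ^ k" by simp
  then obtain u where "u \<in> G" "dist u (0, \<eta>) < (1/8) ^ k" using cl unfolding closure_approachable by blast
  then obtain y where y: "y \<in> NN" "dist (\<Lambda> y, \<Lambda> (adj y)) (0, \<eta>) < (1/8) ^ k" by (auto simp: G_def)
  have "norm (\<Lambda> y) \<le> (1/8) ^ k" "norm (\<Lambda> (adj y) - \<eta>) \<le> (1/8) ^ k"
   using dist_fst_le[of "(\<Lambda> y, \<Lambda> (adj y))" "(0, \<eta>)"] dist_snd_le[of "(\<Lambda> y, \<Lambda> (adj y))" "(0, \<eta>)"] y(2)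
   by (auto simp: dist_norm)
  moreover have "(1/8::real) ^ k \<le> (1/2) ^ k" by (intro power_mono) auto
  moreover have "(norm (\<Lambda> y))^2 \<le> (1/8) ^ k * 1"
   unfolding power2_eq_square using calculation(1) power_le_one[of "1/8::real" k] by (intro mult_mono) auto
  ultimately show ?thesis using y(1) by (intro exI[of _ y]) auto
 qed
 then obtain y where y: "\<And>k. y k \<in> NN" "\<And>k. (norm (\<Lambda> (y k)))^2 \<le> (1/8) ^ k"
  "\<And>k. norm (\<Lambda> (adj (y k)) - \<eta>) \<le> (1/2) ^ k" by metis
 show "\<eta> = 0"
 proof (rule closable_involution[OF y(1,2)])
  have "(\<lambda>k. \<Lambda> (adj (y k)) - \<eta>) \<longlonglongrightarrow> 0"
   by (rule Lim_null_comparison[OF always_eventually[OF allI[OF y(3)]]]) (rule LIMSEQ_power_zero, simp)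
  then show "(\<lambda>k. \<Lambda> (adj (y k))) \<longlonglongrightarrow> \<eta>" by (simp add: LIM_zero_iff)
 qed
qed

section \<open>Vector functionals that are bounded in the GNS norm\<close>

definition FP :: "'a ell2 => 'a ell2 => 'a ell2 => bool" where
 "FP f \<eta> \<xi> \<longleftrightarrow> (\<forall>m\<in>N. \<langle>f, \<Lambda> m\<rangle> = \<langle>\<eta>, m $ \<xi>\<rangle>)"

lemma FP_D: "FP f \<eta> \<xi> ==> m \<in> N ==> \<langle>f, \<Lambda> m\<rangle> = \<langle>\<eta>, m $ \<xi>\<rangle>" by (simp add: FP_def)

text \<open>The products \<open>adj n * m\<close> lie in \<open>NN\<close>, where
  \<open>Fpair\<close> can be tested; moving the factors across yields the functional. With
  \<open>total_Fdomain\<close> this supplies a total set of Riesz vectors \<open>f\<close> of vector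
  functionals on \<open>N\<close>.\<close>

lemma FP_Fpair: assumes "Fpair \<xi> f" "n \<in> N" shows "FP (n $ f) (\<Lambda> n) \<xi>"
 unfolding FP_def
proof
 fix m assume m: "m \<in> N"
 have "\<langle>n $ f, \<Lambda> m\<rangle> = \<langle>f, \<Lambda> (adj n * m)\<rangle>" using assms m by (simp add: Lam_mult N_mem adj_right)
 also have "\<dots> = \<langle>\<Lambda> (adj m * n), \<xi>\<rangle>" using assms(1) NN_mult[OF assms(2) m] by (simp add: Fpair_def)
 also have "\<dots> = \<langle>\<Lambda> n, m $ \<xi>\<rangle>" using assms m by (simp add: Lam_mult N_mem adj_left)
 finally show "\<langle>n $ f, \<Lambda> m\<rangle> = \<langle>\<Lambda> n, m $ \<xi>\<rangle>" .
qed

lemma FP_mult: "FP f \<eta> \<xi> ==> m \<in> M ==> FP (m $ f) (m $ \<eta>) \<xi>"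
 unfolding FP_def by (metis Lam_mult N_left_ideal adj_mem adj_right times_bop.rep_eq)

lemma total_FP: "total {f. \<exists>\<eta> \<xi>. FP f \<eta> \<xi>}"
 unfolding total_def
proof (intro allI impI)
 fix z assume *: "\<forall>f\<in>{f. \<exists>\<eta> \<xi>. FP f \<eta> \<xi>}. \<langle>f, z\<rangle> = 0"
 have z: "adj n $ z = 0" if n: "n \<in> N" for n
 proof (rule totalD[OF total_Fdomain])
  fix f assume "f \<in> {\<xi>. \<exists>f. Fpair \<xi> f}"
  then obtain \<xi> where "Fpair \<xi> f" using Fpair_sym by blast
  then have "\<langle>n $ f, z\<rangle> = 0" using FP_Fpair n * by blast
  then show "\<langle>f, adj n $ z\<rangle> = 0" by (simp add: adj_right)
 qed
 show "z = 0"
 proof (rule N_nondegenerate')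
  fix a assume "a \<in> N"
  then show "\<langle>z, a $ z\<rangle> = 0" using z by (metis adj_left cinner_zero_left)
 qed
qed

end

section \<open>The regular representation\<close>

subsection \<open>Maps determined on total sets\<close>

lemma bcl_eq_on_total:
 assumes "bcl S" "bcl T" "total A" "\<And>x. x \<in> A ==> S x = T x"
 shows "S x = T x"
proof (rule total_induct[OF assms(3), where P = "\<lambda>x. S x = T x"])
 show "closed {x. S x = T x}"
  using assms(1,2) by (intro closed_Collect_eq) (auto simp: bcl_def linear_continuous_on)
 show "csubspace {x. S x = T x}"
  using assms(1,2) by (auto simp: complex_vector.subspace_def bcl_zero bcl_add bcl_scaleC)
qed (rule assms(4))

text \<open>\<open>A\<close> is a bare index set, so linearity is expressed by witnesses
  \<open>c\<close>; the bound makes \<open>v a\<close> depend on \<open>u a\<close> alone, and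
  continuously.\<close>

lemma dense_extension:
 fixes u :: "'a => 'i ell2" and v :: "'a => 'j ell2"
 assumes dense: "closure (u ` A) = UNIV" and C: "0 \<le> C"
  and add: "\<And>a b. a \<in> A ==> b \<in> A ==> \<exists>c\<in>A. u c = u a + u b \<and> v c = v a + v b"
  and sc: "\<And>k a. a \<in> A ==> \<exists>c\<in>A. u c = k *C u a \<and> v c = k *C v a"
  and bd: "\<And>a. a \<in> A ==> norm (v a) \<le> C * norm (u a)"
 obtains S where "bcl S" "\<And>a. a \<in> A ==> S (u a) = v a" "\<And>x. norm (S x) \<le> C * norm x"
proof -
 have df: "norm (v a - v b) \<le> C * norm (u a - u b)" if ab: "a \<in> A" "b \<in> A" for a b
 proof -
  obtain b' where b': "b' \<in> A" "u b' = (-1) *C u b" "v b' = (-1) *C v b" using sc[OF ab(2)] by blast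
  obtain c where c: "c \<in> A" "u c = u a + u b'" "v c = v a + v b'" using add[OF ab(1) b'(1)] by blast
  have "u c = u a - u b" "v c = v a - v b" using b' c by (simp_all add: complex_vector.scale_minus_left)
  then show ?thesis using bd[OF c(1)] by simp
 qed
 have "\<exists>f. (\<forall>n. f n \<in> A) \<and> (\<lambda>n. u (f n)) \<longlonglongrightarrow> x" for x
 proof -
  have "x \<in> closure (u ` A)" by (simp add: dense)
  then obtain g where g: "\<forall>n. g n \<in> u ` A" "g \<longlonglongrightarrow> x" unfolding closure_sequential by blast
  then have "\<forall>n. \<exists>a. a \<in> A \<and> g n = u a" by blast
  then obtain f where f: "\<And>n. f n \<in> A" "\<And>n. g n = u (f n)" by metis
  have "g = (\<lambda>n. u (f n))" by (rule ext) (rule f)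
  with g(2) f(1) show ?thesis by auto
 qed
 then obtain F where F: "\<And>x n. F x n \<in> A" "\<And>x. (\<lambda>n. u (F x n)) \<longlonglongrightarrow> x" by metis
 define S where "S x = lim (\<lambda>n. v (F x n))" for x
 have Sl: "(\<lambda>n. v (F x n)) \<longlonglongrightarrow> S x" for x
 proof -
  have "Cauchy (\<lambda>n. v (F x n))"
   unfolding Cauchy_iff
  proof (intro allI impI)
   fix e :: real assume e: "e > 0"
   have "Cauchy (\<lambda>n. u (F x n))" by (rule LIMSEQ_imp_Cauchy[OF F(2)])
   moreover have "e / (C + 1) > 0" using e C by simp
   ultimately obtain K where K: "\<And>m n. m \<ge> K ==> n \<ge> K ==> norm (u (F x m) - u (F x n)) < e / (C + 1)"
    unfolding Cauchy_iff by meson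
   have "norm (v (F x m) - v (F x n)) < e" if "m \<ge> K" "n \<ge> K" for m n
   proof -
    have "norm (v (F x m) - v (F x n)) \<le> (C + 1) * norm (u (F x m) - u (F x n))"
     using df[OF F(1) F(1), of x m x n] norm_ge_zero[of "u (F x m) - u (F x n)"] unfolding distrib_right by linarith
    also have "\<dots> < e" using K[OF that] C by (simp add: pos_less_divide_eq mult.commute)
    finally show ?thesis .
   qed
   then show "\<exists>K. \<forall>m\<ge>K. \<forall>n\<ge>K. norm (v (F x m) - v (F x n)) < e" by blast
  qed
  then show ?thesis unfolding S_def by (simp add: Cauchy_convergent_iff convergent_LIMSEQ_iff)
 qed
 have key: "S x = y" if g: "\<And>n. g n \<in> A" "(\<lambda>n. u (g n)) \<longlonglongrightarrow> x" "(\<lambda>n. v (g n)) \<longlonglongrightarrow> y" for g x y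
 proof -
  have "(\<lambda>n. norm (v (g n) - v (F x n))) \<longlonglongrightarrow> 0"
  proof (rule Lim_null_comparison)
   show "\<forall>\<^sub>F n in sequentially. norm (norm (v (g n) - v (F x n))) \<le> C * norm (u (g n) - u (F x n))"
    by (rule always_eventually) (use df g(1) F(1) in simp)
   have "(\<lambda>n. C * norm (u (g n) - u (F x n))) \<longlonglongrightarrow> C * norm (x - x)" by (intro tendsto_intros g F)
   then show "(\<lambda>n. C * norm (u (g n) - u (F x n))) \<longlonglongrightarrow> 0" by simp
  qed
  moreover have "(\<lambda>n. norm (v (g n) - v (F x n))) \<longlonglongrightarrow> norm (y - S x)" by (intro tendsto_intros g Sl)
  ultimately have "norm (y - S x) = 0" using LIMSEQ_unique by blast
  then show ?thesis by simp
 qed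
 show thesis
 proof (rule that[of S])
  show bd': "norm (S x) \<le> C * norm x" for x
   by (rule LIMSEQ_le[OF tendsto_norm[OF Sl] tendsto_mult[OF tendsto_const tendsto_norm[OF F(2)]]])
    (use bd F(1) in blast)
  show "S (u a) = v a" if "a \<in> A" for a by (rule key[of "\<lambda>_. a"]) (auto simp: that)
  show "bcl S"
  proof (rule bclI[OF _ _ bd'])
   fix x y
   have "\<forall>n. \<exists>c\<in>A. u c = u (F x n) + u (F y n) \<and> v c = v (F x n) + v (F y n)" by (intro allI add F)
   then obtain h where "\<And>n. h n \<in> A \<and> u (h n) = u (F x n) + u (F y n) \<and> v (h n) = v (F x n) + v (F y n)"
    by metis
   then show "S (x + y) = S x + S y" by (intro key[of h]) (auto intro: tendsto_add F Sl)
  next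
   fix k x
   have "\<forall>n. \<exists>c\<in>A. u c = k *C u (F x n) \<and> v c = k *C v (F x n)" by (intro allI sc F)
   then obtain h where "\<And>n. h n \<in> A \<and> u (h n) = k *C u (F x n) \<and> v (h n) = k *C v (F x n)"
    by metis
   then show "S (k *C x) = k *C S x" by (intro key[of h]) (auto intro: tendsto_scaleC_right F Sl)
  qed
 qed
qed

text \<open>The bound makes the series absolutely convergent, so the operator singled out weakly by
  \<open>THE\<close> is a norm limit. Slices by normal functionals thereby reduce to slices by
  vector functionals.\<close>

lemma weak_sums_slice:
 fixes V :: "nat => 'k bop"
 assumes sq: "sq_summable \<xi>" "sq_summable \<eta>" and bd: "\<And>n. norm (V n) \<le> C * norm (\<xi> n) * norm (\<eta> n)"
 shows "V sums (THE T. \<forall>\<zeta> \<theta>. \<langle>\<theta>, T $ \<zeta>\<rangle> = (\<Sum>n. \<langle>\<theta>, V n $ \<zeta>\<rangle>))"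
proof -
 have "summable V"
 proof (rule summable_comparison_test')
  show "summable (\<lambda>n. \<bar>C\<bar> * ((norm (\<xi> n))^2 + (norm (\<eta> n))^2))"
   using sq unfolding sq_summable_def by (intro summable_mult summable_add)
  fix n
  have "C * norm (\<xi> n) * norm (\<eta> n) \<le> \<bar>C\<bar> * (norm (\<xi> n) * norm (\<eta> n))"
   by (simp add: mult.assoc mult_right_mono)
  also have "\<dots> \<le> \<bar>C\<bar> * ((norm (\<xi> n))^2 + (norm (\<eta> n))^2)"
   using sum_squares_bound[of "norm (\<xi> n)" "norm (\<eta> n)"] zero_le_power2[of "norm (\<xi> n)"] zero_le_power2[of "norm (\<eta> n)"]
   by (intro mult_left_mono) (auto simp: mult.assoc intro: order_trans[of _ "2 * (norm (\<xi> n) * norm (\<eta> n))"])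
  finally show "norm (V n) \<le> \<bar>C\<bar> * ((norm (\<xi> n))^2 + (norm (\<eta> n))^2)" using bd[of n] by linarith
 qed
 then have s: "V sums suminf V" by (rule summable_sums)
 have "(\<lambda>n. \<langle>\<theta>, V n $ \<zeta>\<rangle>) sums \<langle>\<theta>, suminf V $ \<zeta>\<rangle>" for \<theta> \<zeta>
  using tendsto_cinner_right[OF bop_tendsto_apply[OF s[unfolded sums_def]], of \<theta> \<zeta>]
  by (simp add: sums_def bop_sum_left cinner_sum_right)
 from sums_unique[OF this]
 have "(THE T. \<forall>\<zeta> \<theta>. \<langle>\<theta>, T $ \<zeta>\<rangle> = (\<Sum>n. \<langle>\<theta>, V n $ \<zeta>\<rangle>)) = suminf V"
  by (intro the_equality) (auto intro: bop_cinner_ext)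
 with s show ?thesis by simp
qed

lemma slice_left_sums:
 assumes "sq_summable \<xi>" "sq_summable \<eta>"
 shows "(\<lambda>n. lslice (\<xi> n) (\<eta> n) X) sums slice_left (\<lambda>T. \<Sum>n. \<langle>\<eta> n, T $ \<xi> n\<rangle>) X"
 using weak_sums_slice[OF assms norm_lslice, of X]
 by (simp add: slice_left_def cinner_lslice cinner_rslice)

lemma slice_right_sums:
 assumes "sq_summable \<xi>" "sq_summable \<eta>"
 shows "(\<lambda>n. rslice (\<xi> n) (\<eta> n) X) sums slice_right (\<lambda>T. \<Sum>n. \<langle>\<eta> n, T $ \<xi> n\<rangle>) X"
 using weak_sums_slice[OF assms norm_rslice, of X]
 by (simp add: slice_right_def cinner_lslice cinner_rslice)

lemma slice_left_vector: "slice_left (\<lambda>T. \<langle>\<eta>, T $ \<xi>\<rangle>) X = lslice \<xi> \<eta> X"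
 unfolding slice_left_def
 by (rule the_equality) (auto simp: cinner_lslice cinner_rslice intro: bop_cinner_ext)

lemma slice_right_vector: "slice_right (\<lambda>T. \<langle>\<eta>, T $ \<xi>\<rangle>) X = rslice \<xi> \<eta> X"
 unfolding slice_right_def
 by (rule the_equality) (auto simp: cinner_lslice cinner_rslice intro: bop_cinner_ext)

subsection \<open>Slices of the coproduct\<close>

locale qg =
 fixes G :: "'i lcqg_data"
 assumes lcqg: "lcqg G"

sublocale qg \<subseteq> gns "Linf G" "left_haar G" "Lam G"
 using lcqg by unfold_locales (auto simp: lcqg_def)

sublocale qg \<subseteq> q: nsf "Linf G" "right_haar G"
 using lcqg by unfold_locales (auto simp: lcqg_def)

context qg begin

abbreviation "M \<equiv> Linf G"
abbreviation "\<Delta> \<equiv> Delta G"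
abbreviation "\<Lambda> \<equiv> Lam G"
abbreviation "L \<xi> \<eta> z \<equiv> lslice \<xi> \<eta> (\<Delta> z)"
abbreviation "T \<beta> \<tau> z \<equiv> rslice \<beta> \<tau> (\<Delta> z)"

lemma D_hom: "normal_unital_star_hom M (M \<otimes>\<^sub>v\<^sub>N M) \<Delta>" using lcqg by (simp add: lcqg_def)

lemma D_mem [simp]: "a \<in> M ==> \<Delta> a \<in> M \<otimes>\<^sub>v\<^sub>N M"
 and D_add: "a \<in> M ==> b \<in> M ==> \<Delta> (a + b) = \<Delta> a + \<Delta> b"
 and D_mult: "a \<in> M ==> b \<in> M ==> \<Delta> (a * b) = \<Delta> a * \<Delta> b"
 and D_scaleC: "a \<in> M ==> \<Delta> (c *C a) = c *C \<Delta> a"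
 and D_adj: "a \<in> M ==> \<Delta> (adj a) = adj (\<Delta> a)"
 and D_one: "\<Delta> 1 = 1"
 using D_hom by (auto simp: normal_unital_star_hom_def)

lemma D_diff: "a \<in> M ==> b \<in> M ==> \<Delta> (a - b) = \<Delta> a - \<Delta> b"
 using D_add[of "a - b" b] by (simp add: algebra_simps)

lemma D_zero [simp]: "\<Delta> 0 = 0" using D_scaleC[of 0 0] by simp

lemma D_sum: "(\<And>i. i \<in> I ==> f i \<in> M) ==> \<Delta> (sum f I) = (\<Sum>i\<in>I. \<Delta> (f i))"
 by (induction I rule: infinite_finite_induct) (auto simp: D_add sum_mem)

lemma L_mem [simp]: "a \<in> M ==> L \<xi> \<eta> a \<in> M" and T_mem [simp]: "a \<in> M ==> T \<xi> \<eta> a \<in> M"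
 by auto

lemma gram_left: "gram (\<lambda>x. \<Delta> a $ (\<xi> \<otimes> x)) (\<lambda>x. \<Delta> b $ (\<eta> \<otimes> x)) = L \<eta> \<xi> (adj a * b)" if "a \<in> M" "b \<in> M"
 using that
 by (intro gram_eqI bcl_comp[OF bcl_bop bcl_tensor_right]) (simp add: cinner_lslice D_mult D_adj adj_right)

lemma gram_right: "gram (\<lambda>x. \<Delta> a $ (x \<otimes> \<xi>)) (\<lambda>x. \<Delta> b $ (x \<otimes> \<eta>)) = T \<eta> \<xi> (adj a * b)" if "a \<in> M" "b \<in> M"
 using that
 by (intro gram_eqI bcl_comp[OF bcl_bop bcl_tensor_left]) (simp add: cinner_rslice D_mult D_adj adj_right)

subsection \<open>Invariance\<close>

lemma vector_functional_nonneg: "pos_op a ==> \<langle>\<xi>, a $ \<xi>\<rangle> \<in> \<real>\<^sub>\<ge>\<^sub>0"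
 by (simp add: pos_op_def)

lemma left_inv: "a \<in> Fin ==> left_haar G (L \<xi> \<xi> a) = ennreal ((norm \<xi>)^2) * left_haar G a"
 using lcqg vector_predual[of \<xi> \<xi>] FinD[of a]
 by (fastforce simp: lcqg_def left_invariant_def pos_part_def vector_functional_nonneg slice_left_vector cinner_norm
   dest: bspec[where x = "\<lambda>T. \<langle>\<xi>, T $ \<xi>\<rangle>"])

lemma right_inv: "a \<in> q.Fin ==> right_haar G (T \<xi> \<xi> a) = ennreal ((norm \<xi>)^2) * right_haar G a"
 using lcqg vector_predual[of \<xi> \<xi>] q.FinD[of a]
 by (fastforce simp: lcqg_def right_invariant_def pos_part_def vector_functional_nonneg slice_right_vector cinner_norm
   dest: bspec[where x = "\<lambda>T. \<langle>\<xi>, T $ \<xi>\<rangle>"])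

abbreviation "cleft a \<xi> \<equiv> (\<lambda>x. \<Delta> a $ (\<xi> \<otimes> x))"
abbreviation "cright a \<beta> \<equiv> (\<lambda>x. \<Delta> a $ (x \<otimes> \<beta>))"

lemma bcl_cleft [simp]: "bcl (cleft a \<xi>)" and bcl_cright [simp]: "bcl (cright a \<xi>)"
 by (rule bcl_comp[OF bcl_bop bcl_tensor_right], rule bcl_comp[OF bcl_bop bcl_tensor_left])

text \<open>The square of this column is a slice of \<Delta>(\<open>adj a * a\<close>) by a positive
  vector functional, so left invariance computes its weight; no weight on the tensor product has to
  be formed.\<close>

lemma fcol_left: assumes a: "a \<in> N" shows "fcol (cleft a \<xi>)" "nrm (cleft a \<xi>) = norm \<xi> * nr a"
proof -
 have g: "gram (cleft a \<xi>) (cleft a \<xi>) = L \<xi> \<xi> (adj a * a)" by (simp add: gram_left N_mem a)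
 have e: "left_haar G (L \<xi> \<xi> (adj a * a)) = ennreal ((norm \<xi>)^2) * left_haar G (adj a * a)"
  by (rule left_inv[OF N_Fin[OF a]])
 have "pos_op (L \<xi> \<xi> (adj a * a))" unfolding g[symmetric] by simp
 then have F: "L \<xi> \<xi> (adj a * a) \<in> Fin"
  using FinD(4)[OF N_Fin[OF a]] a by (auto simp: Fin_def pos_part_def e ennreal_mult_less_top N_mem)
 then show "fcol (cleft a \<xi>)" by (simp add: fcol_def g)
 show "nrm (cleft a \<xi>) = norm \<xi> * nr a"
  by (simp add: nrm_def gram_apply_bop g wr_def e enn2real_mult real_sqrt_mult)
qed

lemma fcol_right: assumes a: "a \<in> q.N" shows "q.fcol (cright a \<xi>)" "q.nrm (cright a \<xi>) = norm \<xi> * q.nr a"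
proof -
 have g: "gram (cright a \<xi>) (cright a \<xi>) = T \<xi> \<xi> (adj a * a)" by (simp add: gram_right q.N_mem a)
 have e: "right_haar G (T \<xi> \<xi> (adj a * a)) = ennreal ((norm \<xi>)^2) * right_haar G (adj a * a)"
  by (rule right_inv[OF q.N_Fin[OF a]])
 have "pos_op (T \<xi> \<xi> (adj a * a))" unfolding g[symmetric] by simp
 then have F: "T \<xi> \<xi> (adj a * a) \<in> q.Fin"
  using q.FinD(4)[OF q.N_Fin[OF a]] a by (auto simp: q.Fin_def pos_part_def e ennreal_mult_less_top q.N_mem)
 then show "q.fcol (cright a \<xi>)" by (simp add: q.fcol_def g)
 show "q.nrm (cright a \<xi>) = norm \<xi> * q.nr a"
  by (simp add: q.nrm_def gram_apply_bop g q.wr_def e enn2real_mult real_sqrt_mult)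
qed

lemma T_mdom: "a \<in> q.N ==> b \<in> q.N ==> T \<beta> \<tau> (adj a * b) \<in> q.mdom"
 using q.gram_mdom[OF fcol_right(1) fcol_right(1), of a b \<tau> \<beta>] by (simp add: gram_right q.N_mem)

text \<open>Right invariance concerns squares and equal vectors. It is polarized twice, first in the
  pair of vectors, then in the pair of operators.\<close>

lemma hat_T: assumes a: "a \<in> q.N" and b: "b \<in> q.N"
 shows "q.hat (T \<beta> \<tau> (adj a * b)) = \<langle>\<tau>, \<beta>\<rangle> * q.hat (adj a * b)"
proof -
 define E where "E a b \<tau> \<beta> = q.hat (T \<beta> \<tau> (adj a * b))" for a b \<tau> \<beta>
 have diag: "E a a \<tau> \<beta> = \<langle>\<tau>, \<beta>\<rangle> * q.hat (adj a * a)" if a: "a \<in> q.N" for a \<tau> \<beta>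
 proof -
  note md = T_mdom[OF a a]
  have s: "E a a \<xi> \<xi> = \<langle>\<xi>, \<xi>\<rangle> * q.hat (adj a * a)" for \<xi>
  proof -
   have "T \<xi> \<xi> (adj a * a) \<in> q.Fin" using fcol_right(1)[OF a, of \<xi>] by (simp add: q.fcol_def gram_right q.N_mem a)
   moreover have "q.wr (T \<xi> \<xi> (adj a * a)) = (norm \<xi>)^2 * q.wr (adj a * a)"
    using arg_cong[OF fcol_right(2)[OF a, of \<xi>], of "\<lambda>t. t\<^sup>2"]
    by (simp add: power_mult_distrib q.nrm_sq gram_right q.N_mem a gram_apply_bop)
   ultimately show ?thesis by (simp add: E_def q.hat_Fin q.N_Fin[OF a] cinner_norm)
  qed
  have "4 * E a a \<tau> \<beta> = 4 * (\<langle>\<tau>, \<beta>\<rangle> * q.hat (adj a * a))"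
   using polarization[where B = "E a a" and x = \<tau> and y = \<beta>] polarization[where B = "\<lambda>\<tau> \<beta>. \<langle>\<tau>, \<beta>\<rangle> * q.hat (adj a * a)" and x = \<tau> and y = \<beta>]
   unfolding s by (simp add: E_def rslice_rules md q.hat_add q.hat_scaleC q.mdom_add ci_rules algebra_simps)
  then show ?thesis by simp
 qed
 \<comment> \<open>A sesquilinear defect that vanishes on the diagonal; its values at a + k b for k
   = 1 and k = \<i> remove the off-diagonal terms.\<close>
 define F where "F a b = E a b \<tau> \<beta> - \<langle>\<tau>, \<beta>\<rangle> * q.hat (adj a * b)" for a b
 have F0: "F c c = 0" if "c \<in> q.N" for c using diag[OF that] by (simp add: F_def)
 have exp: "F (a + k *C b) (a + k *C b) = F a a + k * F a b + cnj k * F b a + cnj k * k * F b b" for k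
 proof -
  have e: "adj (a + k *C b) * (a + k *C b) = adj a * a + k *C (adj a * b) + cnj k *C (adj b * a) + (cnj k * k) *C (adj b * b)"
   by (simp add: distrib_left distrib_right scaleC_scaleC scaleC_add_right mult.commute)
  have M: "adj a * a \<in> M" "adj a * b \<in> M" "adj b * a \<in> M" "adj b * b \<in> M" using a b by (simp_all add: q.N_mem)
  show ?thesis
   unfolding F_def E_def e using a b M
   by (simp add: D_add D_scaleC rslice_rules q.hat_add q.hat_scaleC q.mdom_add q.mdom_scaleC T_mdom
     q.adj_times_mdom algebra_simps)
 qed
 have 1: "F a b + F b a = 0" using exp[of 1] F0 a b by (simp add: q.N_add)
 have 2: "\<i> * F a b - \<i> * F b a = 0" using exp[of \<i>] F0[OF q.N_add[OF a q.N_scaleC[OF b]], of \<i>] F0 a b by simp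
 have "\<i> * (F a b + F b a) + (\<i> * F a b - \<i> * F b a) = 0" unfolding 1 2 by simp
 then have "F a b = 0" by (simp add: algebra_simps)
 then show ?thesis by (simp add: F_def E_def)
qed

lemma L_N: assumes a: "a \<in> N" shows "L \<xi> \<eta> a \<in> N" "nr (L \<xi> \<eta> a) \<le> norm \<eta> * (norm \<xi> * nr a)"
proof -
 have F: "gram (cleft a \<xi>) (cleft a \<xi>) \<in> Fin" and w: "wr (gram (cleft a \<xi>) (cleft a \<xi>)) = (norm \<xi> * nr a)^2"
  using fcol_left[OF a, of \<xi>] by (auto simp: fcol_def nrm_sq[symmetric])
 have F': "(norm \<eta>)^2 *R gram (cleft a \<xi>) (cleft a \<xi>) \<in> Fin" using F by (intro Fin_scale) auto
 have le: "adj (L \<xi> \<eta> a) * L \<xi> \<eta> a \<preceq> (norm \<eta>)^2 *R gram (cleft a \<xi>) (cleft a \<xi>)"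
 proof (subst bop_le_iff)
  have "(norm (L \<xi> \<eta> a $ x))^2 \<le> (norm \<eta> * norm (\<Delta> a $ (\<xi> \<otimes> x)))^2" for x
   unfolding lslice_apply by (intro power_mono norm_cl) simp
  then show "\<forall>x. Re \<langle>x, (adj (L \<xi> \<eta> a) * L \<xi> \<eta> a) $ x\<rangle> \<le> Re \<langle>x, ((norm \<eta>)^2 *R gram (cleft a \<xi>) (cleft a \<xi>)) $ x\<rangle>"
   by (simp add: cinner_scaleR_right cinner_gram cinner_norm adj_right power_mult_distrib)
  show "adj ((norm \<eta>)^2 *R gram (cleft a \<xi>) (cleft a \<xi>)) = (norm \<eta>)^2 *R gram (cleft a \<xi>) (cleft a \<xi>)"
   by (rule pos_op_adj[OF FinD(3)[OF F']])
 qed simp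
 have m: "L \<xi> \<eta> a \<in> M" using a by (simp add: N_mem)
 show "L \<xi> \<eta> a \<in> N" by (intro N_I m Fin_le[OF F' _ _ le]) (use m in auto)
 have "(nr (L \<xi> \<eta> a))^2 \<le> (norm \<eta> * (norm \<xi> * nr a))^2"
  unfolding nr_sq using wr_mono[OF F' _ _ le] m wr_scale[OF F, of "(norm \<eta>)^2"] w by (simp add: power_mult_distrib)
 then show "nr (L \<xi> \<eta> a) \<le> norm \<eta> * (norm \<xi> * nr a)" by (rule power2_le_imp_le) simp
qed

text \<open>Slices by basis vectors are the rows of the column of \<open>a\<close>, and normality
  sums the weight over rows. This is the isometry of \<open>adj W\<close> before W is
  constructed.\<close>

lemma L_has_sum: assumes a: "a \<in> N"
 shows "((\<lambda>j. (norm (\<Lambda> (L \<xi> (ket j) a)))^2) has_sum (norm \<xi> * norm (\<Lambda> a))^2) UNIV"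
proof -
 have F: "gram (cleft a \<xi>) (cleft a \<xi>) \<in> Fin" and w: "wr (gram (cleft a \<xi>) (cleft a \<xi>)) = (norm \<xi> * nr a)^2"
  using fcol_left[OF a, of \<xi>] by (auto simp: fcol_def nrm_sq[symmetric])
 have "((\<lambda>j. wr (adj (L \<xi> (ket j) a) * L \<xi> (ket j) a)) has_sum wr (gram (cleft a \<xi>) (cleft a \<xi>))) UNIV"
 proof (rule wr_has_sum(1)[OF FinD(1)[OF N_Fin[OF L_N(1)[OF a]]] F])
  show "((\<lambda>j. Re \<langle>x, (adj (L \<xi> (ket j) a) * L \<xi> (ket j) a) $ x\<rangle>) has_sum Re \<langle>x, gram (cleft a \<xi>) (cleft a \<xi>) $ x\<rangle>) UNIV" for x
   using cl_ket_norm_has_sum[of "\<Delta> a $ (\<xi> \<otimes> x)"]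
   by (simp add: cinner_gram cinner_norm adj_right lslice_apply)
 qed
 then show ?thesis by (simp add: w norm_Lam a L_N nr_sq)
qed

subsection \<open>Construction of \<open>W\<close>\<close>

lemma Lam_L_rules:
 assumes "a \<in> N" "b \<in> N"
 shows "\<Lambda> (L \<xi> \<eta> (a + b)) = \<Lambda> (L \<xi> \<eta> a) + \<Lambda> (L \<xi> \<eta> b)"
  "\<Lambda> (L \<xi> \<eta> (c *C a)) = c *C \<Lambda> (L \<xi> \<eta> a)"
  "\<Lambda> (L (\<xi> + \<xi>') \<eta> a) = \<Lambda> (L \<xi> \<eta> a) + \<Lambda> (L \<xi>' \<eta> a)"
  "\<Lambda> (L (c *C \<xi>) \<eta> a) = c *C \<Lambda> (L \<xi> \<eta> a)"
  "\<Lambda> (L \<xi> (\<eta> + \<eta>') a) = \<Lambda> (L \<xi> \<eta> a) + \<Lambda> (L \<xi> \<eta>' a)"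
  "\<Lambda> (L \<xi> (c *C \<eta>) a) = cnj c *C \<Lambda> (L \<xi> \<eta> a)"
 using assms by (simp_all add: D_add D_scaleC N_mem lslice_rules Lam_add Lam_scaleC L_N)

lemma ex_V: "\<exists>V. bcl V \<and> (\<forall>a\<in>N. \<forall>j. cl (ket j) (V (\<Lambda> a)) = \<Lambda> (L \<xi> (ket j) a)) \<and> (\<forall>\<zeta>. norm (V \<zeta>) = norm \<xi> * norm \<zeta>)"
proof -
 have "\<exists>X. (\<forall>j. cl (ket j) X = \<Lambda> (L \<xi> (ket j) a)) \<and> norm X = norm \<xi> * norm (\<Lambda> a)" if a: "a \<in> N" for a
 proof -
  have "(\<Sum>j\<in>K. (norm (\<Lambda> (L \<xi> (ket j) a)))^2) \<le> (norm \<xi> * norm (\<Lambda> a))^2" if "finite K" for K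
   using that by (rule has_sum_mono_neutral[OF has_sum_finite L_has_sum[OF a]]) auto
  then obtain X where X: "\<And>j. cl (ket j) X = \<Lambda> (L \<xi> (ket j) a)"
   by (rule tensor_construct) (assumption, metis that)
  have "((\<lambda>j. (norm (\<Lambda> (L \<xi> (ket j) a)))^2) has_sum (norm X)^2) UNIV"
   using cl_ket_norm_has_sum[of X] by (simp add: X)
  then have "(norm X)^2 = (norm \<xi> * norm (\<Lambda> a))^2" using L_has_sum[OF a] by (rule has_sum_unique)
  then have "norm X = norm \<xi> * norm (\<Lambda> a)" by (rule power2_eq_imp_eq) auto
  with X show ?thesis by blast
 qed
 then obtain X where X: "\<And>a j. a \<in> N ==> cl (ket j) (X a) = \<Lambda> (L \<xi> (ket j) a)" "\<And>a. a \<in> N ==> norm (X a) = norm \<xi> * norm (\<Lambda> a)"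
  by metis
 obtain S where S: "bcl S" "\<And>a. a \<in> N ==> S (\<Lambda> a) = X a"
 proof (rule dense_extension[of \<Lambda> N "norm \<xi>" X])
  show "\<exists>c\<in>N. \<Lambda> c = \<Lambda> a + \<Lambda> b \<and> X c = X a + X b" if "a \<in> N" "b \<in> N" for a b
   using that by (intro bexI[of _ "a + b"] conjI Lam_add ell2_eq_if_cl_ket_eq) (auto simp: X N_add cl_rules Lam_L_rules)
  show "\<exists>c\<in>N. \<Lambda> c = k *C \<Lambda> a \<and> X c = k *C X a" if "a \<in> N" for k a
   using that by (intro bexI[of _ "k *C a"] conjI Lam_scaleC ell2_eq_if_cl_ket_eq) (auto simp: X N_scaleC cl_rules Lam_L_rules)
 qed (auto simp: Lam_dense X)
 have "norm (S \<zeta>) = norm \<xi> * norm \<zeta>" for \<zeta>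
 proof -
  have "closed {\<zeta>. norm (S \<zeta>) = norm \<xi> * norm \<zeta>}"
   using S(1) by (intro closed_Collect_eq continuous_intros) (auto simp: bcl_def linear_continuous_on)
  moreover have "\<Lambda> ` N \<subseteq> {\<zeta>. norm (S \<zeta>) = norm \<xi> * norm \<zeta>}" by (auto simp: S X)
  ultimately have "closure (\<Lambda> ` N) \<subseteq> {\<zeta>. norm (S \<zeta>) = norm \<xi> * norm \<zeta>}" by (simp add: closure_minimal)
  then show ?thesis using Lam_dense by auto
 qed
 then show ?thesis using S X by metis
qed

text \<open>\<open>V \<xi> \<zeta>\<close> will be \<open>adj W $ (\<xi> \<otimes> \<zeta>)\<close>.
  It is built for one \<xi> at a time from its rows, which are GNS vectors of slices.\<close>

definition V :: "'i ell2 => 'i ell2 => ('i \<times> 'i) ell2" where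
 "V \<xi> = (SOME V. bcl V \<and> (\<forall>a\<in>N. \<forall>j. cl (ket j) (V (\<Lambda> a)) = \<Lambda> (L \<xi> (ket j) a)) \<and> (\<forall>\<zeta>. norm (V \<zeta>) = norm \<xi> * norm \<zeta>))"

lemma bcl_V [simp]: "bcl (V \<xi>)"
 and cl_ket_V: "a \<in> N ==> cl (ket j) (V \<xi> (\<Lambda> a)) = \<Lambda> (L \<xi> (ket j) a)"
 and norm_V: "norm (V \<xi> \<zeta>) = norm \<xi> * norm \<zeta>"
 unfolding V_def using someI_ex[OF ex_V[of \<xi>]] by auto

lemma V_add_left: "V (\<xi> + \<xi>') \<zeta> = V \<xi> \<zeta> + V \<xi>' \<zeta>"
 by (rule bcl_eq_on_total[OF _ bcl_add_fun total_Lam])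
  (auto intro!: ell2_eq_if_cl_ket_eq simp: cl_rules cl_ket_V Lam_L_rules)

lemma V_scaleC_left: "V (c *C \<xi>) \<zeta> = c *C V \<xi> \<zeta>"
 by (rule bcl_eq_on_total[OF _ bcl_scaleC_fun total_Lam])
  (auto intro!: ell2_eq_if_cl_ket_eq simp: cl_rules cl_ket_V Lam_L_rules)

lemma cl_V: assumes a: "a \<in> N" shows "cl \<eta> (V \<xi> (\<Lambda> a)) = \<Lambda> (L \<xi> \<eta> a)"
proof (rule total_induct[OF total_ket, where P = "\<lambda>\<eta>. cl \<eta> (V \<xi> (\<Lambda> a)) = \<Lambda> (L \<xi> \<eta> a)"])
 let ?X = "V \<xi> (\<Lambda> a)"
 show "csubspace {\<eta>. cl \<eta> ?X = \<Lambda> (L \<xi> \<eta> a)}"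
  using a by (auto simp: complex_vector.subspace_def cl_rules Lam_L_rules) (simp add: lslice_rules)
 have sc: "cl (r *R \<eta>) ?X = r *R cl \<eta> ?X" "\<Lambda> (L \<xi> (r *R \<eta>) a) = r *R \<Lambda> (L \<xi> \<eta> a)" for r \<eta>
  using cl_rules(6)[of "of_real r" \<eta> ?X] Lam_L_rules(6)[OF a a, of \<xi> "of_real r" \<eta>] by (simp_all add: scaleC_of_real)
 have "bounded_linear (\<lambda>\<eta>. cl \<eta> ?X)"
  by (rule bounded_linear_intro[where K = "norm ?X"]) (auto simp: cl_rules sc norm_cl)
 moreover have "bounded_linear (\<lambda>\<eta>. \<Lambda> (L \<xi> \<eta> a))"
  by (rule bounded_linear_intro[where K = "norm \<xi> * nr a"]) (use a in "auto simp: Lam_L_rules sc norm_Lam L_N")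
 ultimately show "closed {\<eta>. cl \<eta> ?X = \<Lambda> (L \<xi> \<eta> a)}"
  by (intro closed_Collect_eq linear_continuous_on)
qed (use a cl_ket_V in auto)

lemma sesquilinear_ext:
 fixes B C :: "'k ell2 => 'k ell2 => complex"
 assumes "\<And>x y z. B (x + y) z = B x z + B y z" "\<And>x y z. B z (x + y) = B z x + B z y"
  "\<And>c x y. B (c *C x) y = cnj c * B x y" "\<And>c x y. B x (c *C y) = c * B x y"
  "\<And>x y z. C (x + y) z = C x z + C y z" "\<And>x y z. C z (x + y) = C z x + C z y"
  "\<And>c x y. C (c *C x) y = cnj c * C x y" "\<And>c x y. C x (c *C y) = c * C x y"
  and "\<And>x. B x x = C x x"
 shows "B x y = C x y"
proof -
 have "4 * B x y = 4 * C x y"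
  unfolding polarization[of B, OF assms(1-4)] polarization[of C, OF assms(5-8)] assms(9) ..
 then show ?thesis by simp
qed

lemma cinner_V: "\<langle>V \<xi> \<zeta>, V \<xi>' \<zeta>'\<rangle> = \<langle>\<xi>, \<xi>'\<rangle> * \<langle>\<zeta>, \<zeta>'\<rangle>"
proof -
 have diag: "\<langle>V \<xi> \<zeta>, V \<xi> \<zeta>'\<rangle> = \<langle>\<xi>, \<xi>\<rangle> * \<langle>\<zeta>, \<zeta>'\<rangle>" for \<xi>
  by (rule sesquilinear_ext[where B = "\<lambda>\<zeta> \<zeta>'. \<langle>V \<xi> \<zeta>, V \<xi> \<zeta>'\<rangle>" and C = "\<lambda>\<zeta> \<zeta>'. \<langle>\<xi>, \<xi>\<rangle> * \<langle>\<zeta>, \<zeta>'\<rangle>"])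
   (auto simp: bcl_add[OF bcl_V] bcl_scaleC[OF bcl_V] ci_rules cinner_norm norm_V power_mult_distrib algebra_simps)
 show ?thesis
  by (rule sesquilinear_ext[where B = "\<lambda>\<xi> \<xi>'. \<langle>V \<xi> \<zeta>, V \<xi>' \<zeta>'\<rangle>" and C = "\<lambda>\<xi> \<xi>'. \<langle>\<xi>, \<xi>'\<rangle> * \<langle>\<zeta>, \<zeta>'\<rangle>"])
   (simp_all add: diag V_add_left V_scaleC_left ci_rules distrib_left distrib_right)
qed

text \<open>By \<open>cinner_V\<close> the maps for distinct basis vectors are isometries with
  orthogonal ranges, so this is Bessel's inequality; \<open>y\<close> is the projection of \<Omega>
  onto finitely many ranges.\<close>

lemma V_bessel: assumes F: "finite F" shows "(\<Sum>i\<in>F. (norm (Adj (V (ket i)) \<Omega>))^2) \<le> (norm \<Omega>)^2"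
proof -
 let ?A = "\<lambda>i. Adj (V (ket i)) \<Omega>"
 define y where "y = (\<Sum>i\<in>F. V (ket i) (?A i))"
 let ?s = "\<Sum>i\<in>F. (norm (?A i))^2"
 have yO: "\<langle>y, \<Omega>\<rangle> = of_real ?s"
  by (simp add: y_def cinner_sum_left cinner_Adj_right[OF bcl_V, symmetric] cinner_norm)
 have "\<langle>y, y\<rangle> = of_real ?s"
  unfolding y_def cinner_sum_left cinner_sum_right cinner_V cinner_ket_ket
  using F by (simp add: if_distrib[of "\<lambda>c. c * _"] cinner_norm cong: if_cong)
 then have y2: "(norm y)^2 = ?s" unfolding cinner_norm by (simp only: of_real_eq_iff)
 have "?s = cmod \<langle>y, \<Omega>\<rangle>" unfolding yO norm_of_real by (simp add: sum_nonneg)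
 then have "norm y * norm y \<le> norm y * norm \<Omega>"
  using cauchy_schwarz[of y \<Omega>] y2 by (simp add: power2_eq_square)
 then have "norm y \<le> norm \<Omega>" by (cases "y = 0") auto
 then show ?thesis unfolding y2[symmetric] by (intro power_mono) auto
qed

text \<open>The rows of the image of \<Omega> under W are prescribed as
  \<open>Adj (V (ket i)) \<Omega>\<close>, and \<open>V_bessel\<close> makes them square summable;
  the adjoint is then \<open>V\<close> on basis vectors, hence everywhere.\<close>

lemma ex_W: "\<exists>X. \<forall>\<xi> \<zeta>. adj X $ (\<xi> \<otimes> \<zeta>) = V \<xi> \<zeta>"
proof -
 have "\<exists>X. (\<forall>i. cl (ket i) X = Adj (V (ket i)) \<Omega>) \<and> (norm X)^2 \<le> (norm \<Omega>)^2" for \<Omega>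
  using V_bessel[of _ \<Omega>] by (rule tensor_construct) (assumption, blast)
 then obtain w where w: "\<And>\<Omega> i. cl (ket i) (w \<Omega>) = Adj (V (ket i)) \<Omega>" "\<And>\<Omega>. (norm (w \<Omega>))^2 \<le> (norm \<Omega>)^2"
  by metis
 have A: "bcl (Adj (V \<xi>))" for \<xi> by (rule bcl_Adj) simp
 have "bcl w"
 proof (rule bclI[where C = 1])
  show "w (x + y) = w x + w y" for x y
   by (rule ell2_eq_if_cl_ket_eq) (simp add: w cl_rules bcl_add[OF A])
  show "w (c *C x) = c *C w x" for c x
   by (rule ell2_eq_if_cl_ket_eq) (simp add: w cl_rules bcl_scaleC[OF A])
  show "norm (w x) \<le> 1 * norm x" for x using power2_le_imp_le[OF w(2)] by simp
 qed
 then have wa: "Abs_bop w $ \<Omega> = w \<Omega>" for \<Omega> by (rule apply_Abs_bop)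
 have "adj (Abs_bop w) $ (\<xi> \<otimes> \<zeta>) = V \<xi> \<zeta>" for \<xi> \<zeta>
 proof (rule bcl_eq_on_total[where S = "\<lambda>\<xi>. adj (Abs_bop w) $ (\<xi> \<otimes> \<zeta>)" and T = "\<lambda>\<xi>. V \<xi> \<zeta>", OF _ _ total_ket])
  show "bcl (\<lambda>\<xi>. adj (Abs_bop w) $ (\<xi> \<otimes> \<zeta>))" by (rule bcl_comp[OF bcl_bop bcl_tensor_left])
  show "bcl (\<lambda>\<xi>. V \<xi> \<zeta>)" by (rule bclI[where C = "norm \<zeta>"]) (auto simp: V_add_left V_scaleC_left norm_V)
  fix x :: "'i ell2" assume "x \<in> range ket"
  then obtain i where x: "x = ket i" by auto
  show "adj (Abs_bop w) $ (x \<otimes> \<zeta>) = V x \<zeta>"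
  proof (rule cinner_ext)
   fix \<Omega>
   have "\<langle>\<Omega>, adj (Abs_bop w) $ (x \<otimes> \<zeta>)\<rangle> = \<langle>cl x (w \<Omega>), \<zeta>\<rangle>" by (simp add: adj_right wa cinner_cl_left)
   also have "\<dots> = \<langle>\<Omega>, V x \<zeta>\<rangle>" by (simp add: x w cinner_Adj_left)
   finally show "\<langle>\<Omega>, adj (Abs_bop w) $ (x \<otimes> \<zeta>)\<rangle> = \<langle>\<Omega>, V x \<zeta>\<rangle>" .
  qed
 qed
 then show ?thesis by blast
qed

abbreviation "W \<equiv> W_op G"

text \<open>\<open>W_op\<close> is described by slices with all normal functionals. Existence passes
  from vector functionals to series because the GNS map is closed; uniqueness follows from vector
  functionals.\<close>

lemma W_adj: "adj W $ (\<xi> \<otimes> \<zeta>) = V \<xi> \<zeta>"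
proof -
 obtain X where X: "\<And>\<xi> \<zeta>. adj X $ (\<xi> \<otimes> \<zeta>) = V \<xi> \<zeta>" using ex_W by blast
 have "W = X"
  unfolding W_op_def
 proof (rule the_equality)
  show "\<forall>\<omega>\<in>predual. \<forall>b\<in>N. slice_left \<omega> (adj X) $ \<Lambda> b = \<Lambda> (slice_left \<omega> (\<Delta> b))"
  proof (intro ballI)
   fix \<omega> :: "'i bop => complex" and b assume "\<omega> \<in> predual" and b: "b \<in> N"
   then obtain \<xi> \<eta> where sq: "sq_summable \<xi>" "sq_summable \<eta>" and \<omega>: "\<omega> = (\<lambda>T. \<Sum>n. \<langle>\<eta> n, T $ \<xi> n\<rangle>)"
    by (auto simp: predual_def)
   have 1: "(\<lambda>m. \<Sum>n<m. L (\<xi> n) (\<eta> n) b) \<longlonglongrightarrow> slice_left \<omega> (\<Delta> b)"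
    using slice_left_sums[OF sq] by (simp add: sums_def \<omega>)
   have "(\<lambda>m. (\<Sum>n<m. lslice (\<xi> n) (\<eta> n) (adj X)) $ \<Lambda> b) \<longlonglongrightarrow> slice_left \<omega> (adj X) $ \<Lambda> b"
    using slice_left_sums[OF sq] by (intro bop_tendsto_apply) (simp add: sums_def \<omega>)
   moreover have "(\<Sum>n<m. lslice (\<xi> n) (\<eta> n) (adj X)) $ \<Lambda> b = \<Lambda> (\<Sum>n<m. L (\<xi> n) (\<eta> n) b)" for m
    using b by (simp add: bop_sum_left lslice_apply X cl_V Lam_sum L_N)
   ultimately have 2: "(\<lambda>m. \<Lambda> (\<Sum>n<m. L (\<xi> n) (\<eta> n) b)) \<longlonglongrightarrow> slice_left \<omega> (adj X) $ \<Lambda> b" by simp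
   show "slice_left \<omega> (adj X) $ \<Lambda> b = \<Lambda> (slice_left \<omega> (\<Delta> b))"
    using Lam_closed(2)[OF _ 1 2] b by (simp add: N_sum L_N)
  qed
  fix Y assume Y: "\<forall>\<omega>\<in>predual. \<forall>b\<in>N. slice_left \<omega> (adj Y) $ \<Lambda> b = \<Lambda> (slice_left \<omega> (\<Delta> b))"
  have "adj Y $ \<Omega> = adj X $ \<Omega>" for \<Omega>
  proof (rule bcl_eq_on_tensors[where A = UNIV and B = "\<Lambda> ` N", OF bcl_bop bcl_bop _ total_UNIV total_Lam])
   fix \<xi> y assume "y \<in> \<Lambda> ` N"
   then obtain b where b: "b \<in> N" "y = \<Lambda> b" by auto
   have "cl \<eta> (adj Y $ (\<xi> \<otimes> y)) = cl \<eta> (adj X $ (\<xi> \<otimes> y))" for \<eta>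
    using bspec[OF bspec[OF Y vector_predual[of \<eta> \<xi>]] b(1)]
    by (simp add: slice_left_vector lslice_apply X cl_V b)
   then show "adj Y $ (\<xi> \<otimes> y) = adj X $ (\<xi> \<otimes> y)" by (intro ell2_eq_if_cl_ket_eq)
  qed
  then show "Y = X" by (metis adj_adj bop_ext)
 qed
 with X show ?thesis by simp
qed

lemma cl_W_adj: "a \<in> N ==> cl \<eta> (adj W $ (\<xi> \<otimes> \<Lambda> a)) = \<Lambda> (L \<xi> \<eta> a)"
 by (simp add: W_adj cl_V)

text \<open>Left invariance gives this half of unitarity; the other half, \<open>W_isometry\<close>,
  comes from the right Haar weight.\<close>

lemma W_coisometry: "W * adj W = 1"
 by (rule bop_tensor_cinner_ext) (simp add: adj_left[symmetric] W_adj cinner_V cinner_tensor)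

abbreviation "w v s \<equiv> rslice v s W"

lemma adj_w: "adj (w v s) = rslice s v (adj W)" by (rule adj_rslice)

lemma cinner_W_adj: "FP f \<eta> \<mu> ==> a \<in> N ==> \<langle>\<zeta> \<otimes> f, adj W $ (\<xi> \<otimes> \<Lambda> a)\<rangle> = \<langle>\<zeta> \<otimes> \<eta>, \<Delta> a $ (\<xi> \<otimes> \<mu>)\<rangle>"
 by (simp add: cinner_cl_right[symmetric] cl_W_adj FP_D L_N lslice_apply)

lemma adj_w_FP: "FP f \<eta> \<mu> ==> a \<in> N ==> adj (w f (\<Lambda> a)) = T \<mu> \<eta> a"
 by (rule bop_cinner_ext) (simp add: adj_w cinner_rslice cinner_W_adj)

lemma total_FP_Lam: "total {f \<otimes> \<zeta> | f \<zeta>. f \<in> UNIV \<and> \<zeta> \<in> {f. \<exists>\<eta> \<mu>. FP f \<eta> \<mu>}}"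
 by (rule total_tensor[OF total_UNIV total_FP])

text \<open>Against vectors \<zeta> \<otimes> f with \<open>FP f \<eta> \<mu>\<close>, the
  coefficients of \<open>adj W\<close> become those of slices of \<Delta>(a), which lie in
  \<open>M\<close>.\<close>

lemma W_adj_commute: assumes S: "S \<in> commutant M" shows "adj W * (S \<otimes>\<^sub>o 1) = (S \<otimes>\<^sub>o 1) * adj W"
proof (rule bop_ext)
 fix \<Omega>
 show "(adj W * (S \<otimes>\<^sub>o 1)) $ \<Omega> = ((S \<otimes>\<^sub>o 1) * adj W) $ \<Omega>"
 proof (rule bcl_eq_on_tensors[where A = UNIV and B = "\<Lambda> ` N", OF bcl_bop bcl_bop _ total_UNIV total_Lam])
  fix \<xi> y assume "y \<in> \<Lambda> ` N"
  then obtain a where a: "a \<in> N" "y = \<Lambda> a" by auto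
  have "\<langle>z, (adj W * (S \<otimes>\<^sub>o 1)) $ (\<xi> \<otimes> y) - ((S \<otimes>\<^sub>o 1) * adj W) $ (\<xi> \<otimes> y)\<rangle> = 0"
   if "z \<in> {\<zeta> \<otimes> f | \<zeta> f. \<zeta> \<in> UNIV \<and> f \<in> {f. \<exists>\<eta> \<mu>. FP f \<eta> \<mu>}}" for z
  proof -
   from that obtain \<zeta> f \<eta> \<mu> where z: "z = \<zeta> \<otimes> f" "FP f \<eta> \<mu>" by blast
   have "\<langle>z, adj W $ ((S $ \<xi>) \<otimes> y)\<rangle> = \<langle>\<zeta>, T \<mu> \<eta> a $ S $ \<xi>\<rangle>"
    using a z by (simp add: cinner_W_adj cinner_rslice)
   also have "\<dots> = \<langle>adj S $ \<zeta>, T \<mu> \<eta> a $ \<xi>\<rangle>"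
    using memD_apply[OF T_mem[OF N_mem[OF a(1)]] S] by (simp add: adj_left)
   also have "\<dots> = \<langle>adj (S \<otimes>\<^sub>o 1) $ z, adj W $ (\<xi> \<otimes> y)\<rangle>"
    using a z by (simp add: cinner_W_adj cinner_rslice adj_tensor_op tensor_op_apply)
   also have "\<dots> = \<langle>z, (S \<otimes>\<^sub>o 1) $ adj W $ (\<xi> \<otimes> y)\<rangle>" by (rule adj_left)
   finally show ?thesis by (simp add: cinner_diff_right tensor_op_apply)
  qed
  from totalD[OF total_FP_Lam this] show "(adj W * (S \<otimes>\<^sub>o 1)) $ (\<xi> \<otimes> y) = ((S \<otimes>\<^sub>o 1) * adj W) $ (\<xi> \<otimes> y)" by simp
 qed
qed

lemma w_mem [simp]: "w v s \<in> M"
proof -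
 have "rslice s v (adj W) \<in> M" by (rule slice_right_mem_if_commute) (rule W_adj_commute)
 then show ?thesis by (metis adj_adj adj_mem adj_w)
qed

text \<open>Stated as an intertwining relation, as only \<open>W * adj W = 1\<close> is known so
  far. Testing against \<open>FP\<close> vectors replaces \<open>adj W\<close> by \<Delta> row by
  row; Parseval's identity reassembles the rows, and multiplicativity of \<Delta> concludes.\<close>

lemma W_D: assumes m: "m \<in> M" shows "(1 \<otimes>\<^sub>o m) * W = W * \<Delta> m"
proof -
 have "adj W * (1 \<otimes>\<^sub>o m) = \<Delta> m * adj W" if m: "m \<in> M" for m
 proof (rule bop_ext)
  fix \<Omega>
  show "(adj W * (1 \<otimes>\<^sub>o m)) $ \<Omega> = (\<Delta> m * adj W) $ \<Omega>"
  proof (rule bcl_eq_on_tensors[where A = UNIV and B = "\<Lambda> ` N", OF bcl_bop bcl_bop _ total_UNIV total_Lam])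
   fix \<xi> y assume "y \<in> \<Lambda> ` N"
   then obtain a where a: "a \<in> N" "y = \<Lambda> a" by auto
   have "\<langle>z, (adj W * (1 \<otimes>\<^sub>o m)) $ (\<xi> \<otimes> y) - (\<Delta> m * adj W) $ (\<xi> \<otimes> y)\<rangle> = 0"
    if "z \<in> {\<zeta> \<otimes> f | \<zeta> f. \<zeta> \<in> UNIV \<and> f \<in> {f. \<exists>\<eta> \<mu>. FP f \<eta> \<mu>}}" for z
   proof -
    from that obtain \<zeta> f \<eta> \<mu> where z: "z = \<zeta> \<otimes> f" and FP: "FP f \<eta> \<mu>" by blast
    have ma: "m * a \<in> N" "\<Lambda> (m * a) = m $ y" using m a by (auto simp: N_left_ideal Lam_mult)
    let ?X = "adj W $ (\<xi> \<otimes> y)"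
    have "\<langle>cl (ket k) (adj (\<Delta> m) $ z), cl (ket k) ?X\<rangle>
      = \<langle>cl (ket k) (adj (\<Delta> m) $ (\<zeta> \<otimes> \<eta>)), cl (ket k) (\<Delta> a $ (\<xi> \<otimes> \<mu>))\<rangle>" for k
    proof -
     have e: "cl (ket k) (adj (\<Delta> m) $ (\<zeta> \<otimes> x)) = L \<zeta> (ket k) (adj m) $ x" for x
      using m by (simp add: lslice_apply D_adj)
     have "FP (L \<zeta> (ket k) (adj m) $ f) (L \<zeta> (ket k) (adj m) $ \<eta>) \<mu>"
      by (rule FP_mult[OF FP]) (use m in simp)
     then show ?thesis unfolding z e using a by (simp add: cl_W_adj FP_D L_N lslice_apply)
    qed
    then have "((\<lambda>k. \<langle>cl (ket k) (adj (\<Delta> m) $ z), cl (ket k) ?X\<rangle>) has_sum \<langle>adj (\<Delta> m) $ (\<zeta> \<otimes> \<eta>), \<Delta> a $ (\<xi> \<otimes> \<mu>)\<rangle>) UNIV"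
     using cl_ket_parseval[of "adj (\<Delta> m) $ (\<zeta> \<otimes> \<eta>)" "\<Delta> a $ (\<xi> \<otimes> \<mu>)"] by simp
    then have "\<langle>adj (\<Delta> m) $ z, ?X\<rangle> = \<langle>adj (\<Delta> m) $ (\<zeta> \<otimes> \<eta>), \<Delta> a $ (\<xi> \<otimes> \<mu>)\<rangle>"
     using cl_ket_parseval has_sum_unique by blast
    also have "\<dots> = \<langle>z, adj W $ (\<xi> \<otimes> \<Lambda> (m * a))\<rangle>"
     unfolding z cinner_W_adj[OF FP ma(1)] using m a by (simp add: D_mult N_mem adj_left)
    finally show ?thesis by (simp add: cinner_diff_right tensor_op_apply ma adj_left)
   qed
   from totalD[OF total_FP_Lam this] show "(adj W * (1 \<otimes>\<^sub>o m)) $ (\<xi> \<otimes> y) = (\<Delta> m * adj W) $ (\<xi> \<otimes> y)" by simp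
  qed
 qed
 then have "adj W * (1 \<otimes>\<^sub>o adj m) = \<Delta> (adj m) * adj W" using m by simp
 from arg_cong[OF this, of adj] show ?thesis using m by (simp add: adj_tensor_op D_adj)
qed

end

subsection \<open>Coassociativity in slices\<close>

lemma functional_zero_on_total:
 fixes h :: "'i ell2 => complex"
 assumes "\<And>x y. h (x + y) = h x + h y" "\<And>c x. h (c *C x) = c * h x" "\<And>x. cmod (h x) \<le> C * norm x"
  and A: "total A" "\<And>x. x \<in> A ==> h x = 0"
 shows "h x = 0"
proof -
 obtain t where t: "\<And>x. h x = \<langle>t, x\<rangle>" using riesz_complex[of h C] assms(1-3) by metis
 have "t = 0" by (rule totalD'[OF A(1)]) (use A(2) t in metis)
 with t show ?thesis by simp
qed

lemma sq_summable_tensor: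
 assumes "sq_summable x" shows "sq_summable (\<lambda>n. x n \<otimes> z)" "sq_summable (\<lambda>n. z \<otimes> x n)"
 using assms summable_mult[of "\<lambda>n. (norm (x n))^2" "(norm z)^2"]
 by (auto simp: sq_summable_def norm_tensor_vec power_mult_distrib mult.commute)

lemma predual_slice:
 assumes "\<omega> \<in> predual"
 shows "(\<lambda>X. \<omega> (rslice \<xi> \<eta> X)) \<in> predual" "(\<lambda>X. \<omega> (lslice \<xi>' \<eta>' X)) \<in> predual"
proof -
 obtain x y where *: "sq_summable x" "sq_summable y" "\<omega> = (\<lambda>T. \<Sum>n. \<langle>y n, T $ x n\<rangle>)"
  using assms by (auto simp: predual_def)
 show "(\<lambda>X. \<omega> (rslice \<xi> \<eta> X)) \<in> predual"
  unfolding predual_def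
  by (rule CollectI, rule exI[of _ "\<lambda>n. x n \<otimes> \<xi>"], rule exI[of _ "\<lambda>n. y n \<otimes> \<eta>"])
   (simp add: * sq_summable_tensor cinner_rslice)
 show "(\<lambda>X. \<omega> (lslice \<xi>' \<eta>' X)) \<in> predual"
  unfolding predual_def
  by (rule CollectI, rule exI[of _ "\<lambda>n. \<xi>' \<otimes> x n"], rule exI[of _ "\<lambda>n. \<eta>' \<otimes> y n"])
   (simp add: * sq_summable_tensor cinner_lslice)
qed

lemma normal_on_pullback:
 assumes G: "normal_on M G" and f: "\<And>X. X \<in> N ==> f X \<in> M" "\<And>X Y. f (X - Y) = f X - f Y" "\<And>c X. f (c *C X) = c *C f X"
  and pre: "\<And>\<omega>. \<omega> \<in> predual ==> (\<lambda>X. \<omega> (f X)) \<in> predual"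
 shows "normal_on N (\<lambda>X. G (f X))"
proof -
 obtain F \<epsilon> where F: "finite F" "F \<subseteq> predual" "\<epsilon> > 0" "\<And>T. T \<in> M ==> (\<forall>\<omega>\<in>F. cmod (\<omega> T) < \<epsilon>) ==> cmod (G T) < 1"
  using G unfolding normal_on_def by metis
 show ?thesis unfolding normal_on_def
 proof (intro conjI exI ballI allI impI)
  let ?F = "(\<lambda>\<omega> X. \<omega> (f X)) ` F"
  show "finite ?F" "?F \<subseteq> predual" "\<epsilon> > 0" using F pre by auto
  show "cmod (G (f T)) < 1" if "T \<in> N" "\<forall>\<omega>\<in>?F. cmod (\<omega> T) < \<epsilon>" for T
   using that f by (intro F(4)) auto
 qed (use G f in "auto simp: normal_on_def")
qed

lemma (in vna) normal_on_zero_tensor: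
 assumes G: "normal_on (M \<otimes>\<^sub>v\<^sub>N M) G" and 0: "\<And>a b. a \<in> M ==> b \<in> M ==> G (a \<otimes>\<^sub>o b) = 0" and X: "X \<in> M \<otimes>\<^sub>v\<^sub>N M"
 shows "G X = 0"
proof (rule normal_on_zeroI[OF G alg_tensor_subset _ X vna_tensor tensor_vna_dense[OF X]])
 interpret t: vna "M \<otimes>\<^sub>v\<^sub>N M" by (rule vna_tensor)
 fix a assume "a \<in> M \<odot> M"
 moreover have "M \<odot> M \<subseteq> {X \<in> M \<otimes>\<^sub>v\<^sub>N M. G X = 0}"
  unfolding alg_tensor_def
 proof (rule complex_vector.span_minimal)
  show "{a \<otimes>\<^sub>o b |a b. a \<in> M \<and> b \<in> M} \<subseteq> {X \<in> M \<otimes>\<^sub>v\<^sub>N M. G X = 0}"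
  proof safe
   fix a b assume "a \<in> M" "b \<in> M"
   then show "G (a \<otimes>\<^sub>o b) = 0" "a \<otimes>\<^sub>o b \<in> M \<otimes>\<^sub>v\<^sub>N M"
    by (rule 0, intro subsetD[OF alg_tensor_subset]) (auto simp: alg_tensor_def intro: complex_vector.span_base)
  qed
  have sc: "G (c *C X) = c * G X" and df: "G (X - Y) = G X - G Y" if "X \<in> M \<otimes>\<^sub>v\<^sub>N M" "Y \<in> M \<otimes>\<^sub>v\<^sub>N M" for c X Y
   using G that by (auto simp: normal_on_def)
  show "csubspace {X \<in> M \<otimes>\<^sub>v\<^sub>N M. G X = 0}"
   unfolding complex_vector.subspace_def
  proof (intro conjI ballI allI)
   show "0 \<in> {X \<in> M \<otimes>\<^sub>v\<^sub>N M. G X = 0}" using df[of 0 0] by simp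
   fix x y assume "x \<in> {X \<in> M \<otimes>\<^sub>v\<^sub>N M. G X = 0}" "y \<in> {X \<in> M \<otimes>\<^sub>v\<^sub>N M. G X = 0}"
   then show "x + y \<in> {X \<in> M \<otimes>\<^sub>v\<^sub>N M. G X = 0}" using df[of x "- y"] df[of 0 y] df[of 0 0] by simp
  qed (use sc in auto)
 qed
 ultimately show "G a = 0" by blast
qed

context qg begin

lemma cinner_D_normal: "normal_on M (\<lambda>m. \<langle>p, \<Delta> m $ q\<rangle>)"
 by (rule normal_on_comp[OF D_hom vector_predual vna_axioms])

text \<open>The amplified coproducts are known as normal maps with given values on elementary
  tensors. There they agree with slicing followed by \<Delta>, hence also at \<Delta>(a), and
  coassociativity becomes a statement about slices.\<close>

lemma coassoc:
 assumes a: "a \<in> M"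
 shows "\<langle>x \<otimes> y, \<Delta> (T z' z a) $ (x' \<otimes> y')\<rangle> = \<langle>y \<otimes> z, \<Delta> (L x' x a) $ (y' \<otimes> z')\<rangle>"
proof -
 have "coassociative M \<Delta>" using lcqg by (simp add: lcqg_def)
 then obtain \<Delta>1 \<Delta>2 where 1: "normal_unital_star_hom (M \<otimes>\<^sub>v\<^sub>N M) ((M \<otimes>\<^sub>v\<^sub>N M) \<otimes>\<^sub>v\<^sub>N M) \<Delta>1"
   "\<forall>a\<in>M. \<forall>b\<in>M. \<Delta>1 (a \<otimes>\<^sub>o b) = \<Delta> a \<otimes>\<^sub>o b"
  and 2: "normal_unital_star_hom (M \<otimes>\<^sub>v\<^sub>N M) (M \<otimes>\<^sub>v\<^sub>N (M \<otimes>\<^sub>v\<^sub>N M)) \<Delta>2"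
   "\<forall>a\<in>M. \<forall>b\<in>M. \<Delta>2 (a \<otimes>\<^sub>o b) = a \<otimes>\<^sub>o \<Delta> b"
  and 3: "\<forall>a\<in>M. \<forall>x y z x' y' z'. \<langle>(x \<otimes> y) \<otimes> z, \<Delta>1 (\<Delta> a) $ ((x' \<otimes> y') \<otimes> z')\<rangle>
   = \<langle>x \<otimes> (y \<otimes> z), \<Delta>2 (\<Delta> a) $ (x' \<otimes> (y' \<otimes> z'))\<rangle>"
  unfolding coassociative_def by (elim exE conjE) (rule that)
 let ?G1 = "\<lambda>X. \<langle>(x \<otimes> y) \<otimes> z, \<Delta>1 X $ ((x' \<otimes> y') \<otimes> z')\<rangle> - \<langle>x \<otimes> y, \<Delta> (rslice z' z X) $ (x' \<otimes> y')\<rangle>"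
 let ?G2 = "\<lambda>X. \<langle>x \<otimes> (y \<otimes> z), \<Delta>2 X $ (x' \<otimes> (y' \<otimes> z'))\<rangle> - \<langle>y \<otimes> z, \<Delta> (lslice x' x X) $ (y' \<otimes> z')\<rangle>"
 have "normal_on (M \<otimes>\<^sub>v\<^sub>N M) ?G1" "normal_on (M \<otimes>\<^sub>v\<^sub>N M) ?G2"
  using normal_on_comp[OF 1(1) vector_predual vna_tensor] normal_on_comp[OF 2(1) vector_predual vna_tensor]
   normal_on_pullback[where f = "rslice z' z" and N = "M \<otimes>\<^sub>v\<^sub>N M", OF cinner_D_normal slice_right_mem]
   normal_on_pullback[where f = "lslice x' x" and N = "M \<otimes>\<^sub>v\<^sub>N M", OF cinner_D_normal slice_left_mem]
  by (auto intro!: normal_on_diff vna_tensor simp: rslice_rules lslice_rules predual_slice)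
 moreover have "?G1 (c \<otimes>\<^sub>o d) = 0" "?G2 (c \<otimes>\<^sub>o d) = 0" if "c \<in> M" "d \<in> M" for c d
  using that by (simp_all add: 1(2) 2(2) rslice_tensor lslice_tensor D_scaleC tensor_op_apply cinner_tensor cinner_scaleC_right)
 ultimately have "?G1 (\<Delta> a) = 0" "?G2 (\<Delta> a) = 0"
  using normal_on_zero_tensor[of ?G1 "\<Delta> a"] normal_on_zero_tensor[of ?G2 "\<Delta> a"] a by simp_all
 then show ?thesis using bspec[OF 3 a] by simp
qed

lemma w_rules:
 "w (v + v') s = w v s + w v' s" "w (c *C v) s = c *C w v s"
 "w v (s + s') = w v s + w v s'" "w v (c *C s) = cnj c *C w v s"
 by (rule rslice_rules)+

text \<open>If s comes from \<open>FP\<close> data and u is a GNS vector, then \<open>w s u\<close>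
  is the adjoint of a slice of \<Delta>(a), and the formula is coassociativity. Boundedness in s and
  u, antilinear in the latter, extends it to all vectors.\<close>

lemma D_w_adj: "\<langle>x \<otimes> y, \<Delta> (w s u) $ (\<mu> \<otimes> \<kappa>)\<rangle> = \<langle>y, w s (cl \<mu> (adj W $ (x \<otimes> u))) $ \<kappa>\<rangle>"
proof -
 define h where "h s u = \<langle>x \<otimes> y, \<Delta> (w s u) $ (\<mu> \<otimes> \<kappa>)\<rangle> - \<langle>y, w s (cl \<mu> (adj W $ (x \<otimes> u))) $ \<kappa>\<rangle>" for s u
 obtain C where C: "C \<ge> 0" "\<And>m. m \<in> M ==> cmod \<langle>x \<otimes> y, \<Delta> m $ (\<mu> \<otimes> \<kappa>)\<rangle> \<le> C * norm m"
  by (rule normal_on_bounded[OF cinner_D_normal vna_axioms]) (rule that)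
 have lin: "h (s + s') u = h s u + h s' u" "h (c *C s) u = c * h s u"
  "h s (u + u') = h s u + h s u'" "h s (c *C u) = cnj c * h s u" for s s' u u' c
  by (simp_all add: h_def w_rules D_add D_scaleC tensor_vec_rules bop_rules cl_rules ci_rules algebra_simps)
 define K where "K = (C + norm y * norm \<mu> * norm (adj W) * norm x * norm \<kappa>) * norm W"
 have bd: "cmod (h s u) \<le> K * norm s * norm u" for s u
 proof -
  have "cmod \<langle>x \<otimes> y, \<Delta> (w s u) $ (\<mu> \<otimes> \<kappa>)\<rangle> \<le> C * (norm W * norm s * norm u)"
   using C(2)[OF w_mem, of s u] mult_left_mono[OF norm_rslice C(1), of s u W] by linarith
  moreover have "cmod \<langle>y, w s (cl \<mu> (adj W $ (x \<otimes> u))) $ \<kappa>\<rangle>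
    \<le> norm y * ((norm W * norm s * (norm \<mu> * (norm (adj W) * (norm x * norm u)))) * norm \<kappa>)"
   by (intro order_trans[OF cauchy_schwarz] mult_left_mono order_trans[OF norm_bop] mult_right_mono
     order_trans[OF norm_rslice] order_trans[OF norm_cl])
    (auto simp: norm_tensor_vec[symmetric] intro: norm_bop simp del: norm_adj)
  ultimately show ?thesis
   using norm_triangle_ineq4[of "\<langle>x \<otimes> y, \<Delta> (w s u) $ (\<mu> \<otimes> \<kappa>)\<rangle>" "\<langle>y, w s (cl \<mu> (adj W $ (x \<otimes> u))) $ \<kappa>\<rangle>"]
   unfolding h_def K_def by (simp add: algebra_simps)
 qed
 have 1: "h f (\<Lambda> a) = 0" if FP: "FP f \<eta> \<xi>" and a: "a \<in> N" for f \<eta> \<xi> a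
 proof -
  have "\<langle>\<mu> \<otimes> \<kappa>, \<Delta> (adj (w f (\<Lambda> a))) $ (x \<otimes> y)\<rangle> = \<langle>\<kappa> \<otimes> \<eta>, \<Delta> (L x \<mu> a) $ (y \<otimes> \<xi>)\<rangle>"
   unfolding adj_w_FP[OF FP a] by (rule coassoc[OF N_mem[OF a]])
  also have "\<dots> = \<langle>\<kappa>, adj (w f (\<Lambda> (L x \<mu> a))) $ y\<rangle>"
   unfolding adj_w_FP[OF FP L_N(1)[OF a]] by (simp add: cinner_rslice)
  finally have "\<langle>x \<otimes> y, \<Delta> (w f (\<Lambda> a)) $ (\<mu> \<otimes> \<kappa>)\<rangle> = \<langle>y, w f (\<Lambda> (L x \<mu> a)) $ \<kappa>\<rangle>"
   by (simp only: D_adj[OF w_mem] adj_right) (metis cinner_commute)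
  then show ?thesis by (simp add: h_def cl_W_adj a)
 qed
 have 2: "h s (\<Lambda> a) = 0" if a: "a \<in> N" for s a
  by (rule functional_zero_on_total[where h = "\<lambda>s. h s (\<Lambda> a)" and C = "K * norm (\<Lambda> a)", OF _ _ _ total_FP])
   (use lin bd[of _ "\<Lambda> a"] 1 a in "auto simp: mult_ac")
 have "cnj (h s u) = 0"
  by (rule functional_zero_on_total[where h = "\<lambda>u. cnj (h s u)" and C = "K * norm s", OF _ _ _ total_Lam])
   (use lin bd[of s] 2 in "auto simp: mult_ac")
 then show ?thesis by (simp add: h_def)
qed

text \<open>In coefficients, (\<Delta> \<otimes> id)(W) = W_13 W_23, which is the pentagon equation
  once \<Delta> is expressed by W.\<close>

lemma D_w: "\<langle>x \<otimes> y, \<Delta> (w \<xi> u) $ (\<mu> \<otimes> \<tau>)\<rangle> = \<langle>x \<otimes> u, W $ (\<mu> \<otimes> cl y (W $ (\<tau> \<otimes> \<xi>)))\<rangle>"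
proof -
 have "\<langle>x \<otimes> y, \<Delta> (w \<xi> u) $ (\<mu> \<otimes> \<tau>)\<rangle> = \<langle>y \<otimes> cl \<mu> (adj W $ (x \<otimes> u)), W $ (\<tau> \<otimes> \<xi>)\<rangle>"
  by (simp add: D_w_adj cinner_rslice)
 also have "\<dots> = \<langle>adj W $ (x \<otimes> u), \<mu> \<otimes> cl y (W $ (\<tau> \<otimes> \<xi>))\<rangle>"
  by (simp only: cinner_cl_right[symmetric] cinner_cl_left)
 finally show ?thesis by (simp add: adj_left)
qed

subsection \<open>Unitarity of \<open>W\<close>\<close>

definition flip :: "('i \<times> 'i) ell2 => ('i \<times> 'i) ell2" where
 "flip = (SOME S. bcl S \<and> (\<forall>x y. S (x \<otimes> y) = y \<otimes> x))"

lemma bcl_flip [simp]: "bcl flip" and flip_tensor [simp]: "flip (x \<otimes> y) = y \<otimes> x"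
 unfolding flip_def using someI_ex[OF swap_exists] by auto

lemma cr_flip: "cr y (flip \<Omega>) = cl y \<Omega>"
 by (rule bcl_eq_on_tensors[OF bcl_comp[OF bcl_cr bcl_flip] bcl_cl _ total_UNIV total_UNIV]) simp

definition Kop :: "'i ell2 => 'i ell2 => 'i bop" where
 "Kop u \<mu> = Abs_bop (\<lambda>\<xi>. cr u (W $ (\<mu> \<otimes> \<xi>)))"

lemma Kop_apply: "Kop u \<mu> $ \<xi> = w \<xi> u $ \<mu>"
 unfolding Kop_def rslice_apply
 by (rule apply_Abs_bop) (rule bcl_comp[OF bcl_cr bcl_comp[OF bcl_bop bcl_tensor_right]])

text \<open>For \<Omega> = \<tau> \<otimes> \<xi> this is the column sending \<mu> to
  \<open>(w \<xi> u $ \<mu>) \<otimes> \<tau>\<close>, extended to all \<Omega> so that W may act on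
  \<Omega>. It lets the right Haar weight see W.\<close>

definition Gc :: "'i ell2 => ('i \<times> 'i) ell2 => 'i ell2 => ('i \<times> 'i) ell2" where
 "Gc u \<Omega> \<mu> = flip ((1 \<otimes>\<^sub>o Kop u \<mu>) $ \<Omega>)"

lemma cr_Gc: "cr y (Gc u \<Omega> \<mu>) = w (cl y \<Omega>) u $ \<mu>"
 by (simp add: Gc_def cr_flip cl_id_tensor Kop_apply)

lemma Gc_rules: "Gc u (\<Omega> + \<Omega>') \<mu> = Gc u \<Omega> \<mu> + Gc u \<Omega>' \<mu>" "Gc u (c *C \<Omega>) \<mu> = c *C Gc u \<Omega> \<mu>"
 "Gc u \<Omega> (\<mu> + \<mu>') = Gc u \<Omega> \<mu> + Gc u \<Omega> \<mu>'" "Gc u \<Omega> (c *C \<mu>) = c *C Gc u \<Omega> \<mu>"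
 by (rule ell2_eq_if_cr_ket_eq, simp add: cr_Gc cr_rules cl_rules w_rules bop_rules)+

lemma Gc_tensor: "Gc u (\<tau> \<otimes> \<xi>) \<mu> = (w \<xi> u $ \<mu>) \<otimes> \<tau>"
 by (simp add: Gc_def tensor_op_apply Kop_apply)

text \<open>\<open>D_w\<close> read as an equality of columns: applying W to \<Omega> trades the
  column of an elementary tensor for a column of the coproduct, and right invariance compares the
  two.\<close>

lemma Gc_W: "Gc u (W $ (\<tau> \<otimes> \<xi>)) = cright (w \<xi> u) \<tau>"
 by (rule ext, rule tensor_eqI) (simp only: D_w, simp add: cinner_cr_right[symmetric] cr_Gc rslice_apply)

lemma bcl_Gc [simp]: "bcl (Gc u \<Omega>)"
proof (rule bclI[where C = "norm W * norm u * norm \<Omega>"])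
 fix \<mu>
 have "((\<lambda>j. (norm (cr (ket j) (Gc u \<Omega> \<mu>)))^2) has_sum (norm (Gc u \<Omega> \<mu>))^2) UNIV" by (rule cr_ket_norm_has_sum)
 moreover have "((\<lambda>j. (norm W * norm u * norm \<mu>)^2 * (norm (cl (ket j) \<Omega>))^2) has_sum (norm W * norm u * norm \<mu>)^2 * (norm \<Omega>)^2) UNIV"
  by (intro has_sum_cmult_right cl_ket_norm_has_sum)
 moreover have "(norm (cr (ket j) (Gc u \<Omega> \<mu>)))^2 \<le> (norm W * norm u * norm \<mu>)^2 * (norm (cl (ket j) \<Omega>))^2" for j
 proof -
  have "norm (w (cl (ket j) \<Omega>) u $ \<mu>) \<le> (norm W * norm (cl (ket j) \<Omega>) * norm u) * norm \<mu>"
   by (intro order_trans[OF norm_bop] mult_right_mono norm_rslice) simp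
  then have "norm (cr (ket j) (Gc u \<Omega> \<mu>)) \<le> (norm W * norm u * norm \<mu>) * norm (cl (ket j) \<Omega>)"
   by (simp add: cr_Gc mult_ac)
  from power_mono[OF this, of 2] show ?thesis by (simp add: power_mult_distrib)
 qed
 ultimately have "(norm (Gc u \<Omega> \<mu>))^2 \<le> (norm W * norm u * norm \<mu>)^2 * (norm \<Omega>)^2" by (rule has_sum_mono)
 then have "(norm (Gc u \<Omega> \<mu>))^2 \<le> (norm W * norm u * norm \<Omega> * norm \<mu>)^2" by (simp add: power_mult_distrib mult_ac)
 then show "norm (Gc u \<Omega> \<mu>) \<le> norm W * norm u * norm \<Omega> * norm \<mu>" by (rule power2_le_imp_le) simp
qed (simp_all add: Gc_rules)

definition Mcol :: "('i ell2 => ('i \<times> 'i) ell2) => bool" where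
 "Mcol A \<longleftrightarrow> bcl A \<and> (\<forall>j. \<exists>m\<in>M. \<forall>x. cr (ket j) (A x) = m $ x)"

lemma Mcol_gram: assumes "Mcol A" "Mcol B" shows "gram A B \<in> M"
proof (rule memI, rule bop_cinner_ext)
 fix S x y assume S: "S \<in> commutant M"
 have c: "C (S $ x) = (S \<otimes>\<^sub>o 1) $ C x" if C: "Mcol C" and S: "S \<in> commutant M" for C S x
 proof (rule ell2_eq_if_cr_ket_eq)
  fix j
  obtain m where "m \<in> M" "\<And>x. cr (ket j) (C x) = m $ x" using C unfolding Mcol_def by blast
  then show "cr (ket j) (C (S $ x)) = cr (ket j) ((S \<otimes>\<^sub>o 1) $ C x)"
   by (simp add: cr_tensor_id memD_apply[OF _ S])
 qed
 have b: "bcl A" "bcl B" using assms by (auto simp: Mcol_def)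
 have "\<langle>A y, B (S $ x)\<rangle> = \<langle>A (adj S $ y), B x\<rangle>"
  using c[OF assms(2) S] c[OF assms(1) adj_mem_commutant[OF S]]
   adj_left[of "S \<otimes>\<^sub>o 1" "A y" "B x"] by (simp add: adj_tensor_op)
 then show "\<langle>y, (gram A B * S) $ x\<rangle> = \<langle>y, (S * gram A B) $ x\<rangle>"
  using b adj_left[of S y "gram A B $ x"] by (simp add: cinner_gram)
qed

lemma Mcol_Gc [simp]: "Mcol (Gc u \<Omega>)" by (auto simp: Mcol_def cr_Gc)

lemma Mcol_cright [simp]: "a \<in> M ==> Mcol (cright a \<beta>)"
 unfolding Mcol_def by (auto intro!: bexI[of _ "T \<beta> (ket _) a"] simp: rslice_apply)

text \<open>For such \<open>u\<close> the columns \<open>Gc u \<Omega>\<close> have finite right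
  Haar weight, bounded by a multiple of |\<Omega>|^2.\<close>

definition uvec :: "'i ell2 => bool" where
 "uvec u \<longleftrightarrow> (\<exists>C\<ge>0. \<forall>\<mu>. w \<mu> u \<in> q.N \<and> (q.nr (w \<mu> u))^2 \<le> C * (norm \<mu>)^2)"

lemma uvec_N: "uvec u ==> w \<mu> u \<in> q.N" by (auto simp: uvec_def)

text \<open>The adjoint in the second vector becomes 1 \<otimes> x0 in front of W, and
  \<open>W_D\<close> moves it behind W as \<Delta>(x0); so the slice is dominated by a column of
  \<open>x0\<close>, whose weight right invariance computes.\<close>

lemma uvec_adj: assumes x: "x0 \<in> q.N" shows "uvec (adj x0 $ \<gamma>)"
proof -
 let ?C = "(norm W * norm \<gamma> * q.nr x0)^2"
 have "w \<mu> (adj x0 $ \<gamma>) \<in> q.N \<and> (q.nr (w \<mu> (adj x0 $ \<gamma>)))^2 \<le> ?C * (norm \<mu>)^2" for \<mu>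
 proof -
  let ?A = "cright x0 \<mu>" and ?c = "(norm W * norm \<gamma>)^2" and ?w = "w \<mu> (adj x0 $ \<gamma>)"
  have M: "x0 \<in> M" by (rule q.N_mem[OF x])
  have F: "gram ?A ?A \<in> q.Fin" and wr: "q.wr (gram ?A ?A) = (norm \<mu> * q.nr x0)^2"
   using fcol_right[OF x, of \<mu>] by (auto simp: q.fcol_def q.nrm_sq[symmetric])
  have F': "?c *R gram ?A ?A \<in> q.Fin" by (rule q.Fin_scale[OF F]) simp
  have "(norm (?w $ y))^2 \<le> ?c * (norm (?A y))^2" for y
  proof -
   have "?w $ y = cr \<gamma> (W $ ?A y)"
    using arg_cong[OF W_D[OF M], of "\<lambda>X. cr \<gamma> (X $ (y \<otimes> \<mu>))"] by (simp add: rslice_apply cr_id_tensor)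
   then have "norm (?w $ y) \<le> norm \<gamma> * (norm W * norm (?A y))"
    by (simp only:) (intro order_trans[OF norm_cr] mult_left_mono norm_bop norm_ge_zero)
   from power_mono[OF this, of 2] show ?thesis by (simp add: power_mult_distrib mult_ac)
  qed
  then have le: "adj ?w * ?w \<preceq> ?c *R gram ?A ?A"
   by (subst bop_le_iff) (simp_all add: pos_op_adj cinner_scaleR_right cinner_gram adj_right cinner_norm)
  have "?w \<in> q.N" by (rule q.N_I[OF w_mem q.Fin_le[OF F' _ _ le]]) auto
  moreover have "(q.nr ?w)^2 \<le> q.wr (?c *R gram ?A ?A)" unfolding q.nr_sq by (rule q.wr_mono[OF F' _ _ le]) auto
  ultimately show ?thesis using wr by (simp add: q.wr_scale[OF F] power_mult_distrib mult_ac)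
 qed
 then show ?thesis unfolding uvec_def by (intro exI[of _ ?C]) auto
qed

lemma total_uvec: "total {u. uvec u}"
 using q.total_N_adj uvec_adj unfolding total_def by blast

lemma fcol_Gc: assumes u: "uvec u"
 obtains C where "C \<ge> 0" "\<And>\<Omega>. q.fcol (Gc u \<Omega>)" "\<And>\<Omega>. q.nrm (Gc u \<Omega>) \<le> C * norm \<Omega>"
proof -
 obtain C where C: "C \<ge> 0" "\<And>\<mu>. w \<mu> u \<in> q.N" "\<And>\<mu>. (q.nr (w \<mu> u))^2 \<le> C * (norm \<mu>)^2"
  using u by (auto simp: uvec_def)
 have *: "right_haar G (gram (Gc u \<Omega>) (Gc u \<Omega>)) \<le> ennreal (C * (norm \<Omega>)^2)" and P: "gram (Gc u \<Omega>) (Gc u \<Omega>) \<in> pos_part M" for \<Omega>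
 proof -
  show P: "gram (Gc u \<Omega>) (Gc u \<Omega>) \<in> pos_part M" by (simp add: pos_part_def Mcol_gram)
  let ?w = "\<lambda>j. w (cl (ket j) \<Omega>) u"
  note wF = q.N_Fin[OF C(2)]
  show "right_haar G (gram (Gc u \<Omega>) (Gc u \<Omega>)) \<le> ennreal (C * (norm \<Omega>)^2)"
  proof (rule q.w_has_sum_le[where p = "\<lambda>j. adj (?w j) * ?w j", OF q.FinD(1)[OF wF] P])
   show "((\<lambda>j. Re \<langle>x, (adj (?w j) * ?w j) $ x\<rangle>) has_sum Re \<langle>x, gram (Gc u \<Omega>) (Gc u \<Omega>) $ x\<rangle>) UNIV" for x
    using cr_ket_norm_has_sum[of "Gc u \<Omega> x"] by (simp add: cinner_gram cinner_norm adj_right cr_Gc)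
   fix F :: "'i set" assume F: "finite F"
   have "(\<Sum>j\<in>F. (norm (cl (ket j) \<Omega>))^2) \<le> (norm \<Omega>)^2"
    by (rule has_sum_mono_neutral[OF has_sum_finite[OF F] cl_ket_norm_has_sum]) auto
   from mult_left_mono[OF this C(1)] have "(\<Sum>j\<in>F. (q.nr (?w j))^2) \<le> C * (norm \<Omega>)^2"
    using sum_mono[of F "\<lambda>j. (q.nr (?w j))^2" "\<lambda>j. C * (norm (cl (ket j) \<Omega>))^2"] C(3) by (simp add: sum_distrib_left)
   then show "(\<Sum>j\<in>F. right_haar G (adj (?w j) * ?w j)) \<le> ennreal (C * (norm \<Omega>)^2)"
    by (simp add: q.ennreal_wr[OF wF, symmetric] q.nr_sq sum_ennreal ennreal_leI)
  qed
 qed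
 show thesis
 proof (rule that[of "sqrt C"])
  show "q.fcol (Gc u \<Omega>)" for \<Omega> using q.Fin_leI[OF P *] by (simp add: q.fcol_def)
  have "(q.nrm (Gc u \<Omega>))^2 \<le> (sqrt C * norm \<Omega>)^2" for \<Omega>
   using q.wr_le[OF _ *, of \<Omega>] C(1) by (simp add: q.nrm_sq power_mult_distrib)
  then show "q.nrm (Gc u \<Omega>) \<le> sqrt C * norm \<Omega>" for \<Omega> by (rule power2_le_imp_le) (simp add: C(1))
 qed (simp add: C(1))
qed

text \<open>The right Haar weight of the columns is a bounded form in \<Omega>. For elementary
  tensors it does not change when W is applied, by \<open>Gc_W\<close> and \<open>hat_T\<close>,
  which is the invariance of B.\<close>

lemma Gc_form: assumes u: "uvec u"
 obtains B where "\<And>\<Omega> \<Omega>'. q.hat (gram (Gc u \<Omega>) (Gc u \<Omega>')) = \<langle>\<Omega>, B $ \<Omega>'\<rangle>" "adj W * B * W = B"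
proof -
 obtain C where C: "C \<ge> 0" "\<And>\<Omega>. q.fcol (Gc u \<Omega>)" "\<And>\<Omega>. q.nrm (Gc u \<Omega>) \<le> C * norm \<Omega>"
  by (rule fcol_Gc[OF u]) (rule that)
 define K where "K \<Omega> \<Omega>' = q.hat (gram (Gc u \<Omega>) (Gc u \<Omega>'))" for \<Omega> \<Omega>'
 have md: "gram (Gc u \<Omega>) (Gc u \<Omega>') \<in> q.mdom" for \<Omega> \<Omega>' by (intro q.gram_mdom C Mcol_gram) auto
 have Gr: "Gc u (\<Omega> + \<Omega>') = (\<lambda>x. Gc u \<Omega> x + Gc u \<Omega>' x)" "Gc u (c *C \<Omega>) = (\<lambda>x. c *C Gc u \<Omega> x)" for \<Omega> \<Omega>' c
  by (auto simp: Gc_rules)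
 obtain B where B: "\<And>\<Omega> \<Omega>'. \<langle>\<Omega>, B $ \<Omega>'\<rangle> = K \<Omega> \<Omega>'"
 proof (rule sesquilinear_to_bop[of K "C * C"])
  fix x y
  have "cmod (K x y) \<le> (C * norm x) * (C * norm y)"
   unfolding K_def by (intro order_trans[OF q.hat_gram_le] mult_mono C Mcol_gram) (auto simp: C)
  then show "cmod (K x y) \<le> C * C * norm x * norm y" by (simp add: mult_ac)
 qed (auto simp: K_def Gr gram_add_left gram_add_right gram_scaleC_left gram_scaleC_right q.hat_add q.hat_scaleC md)
 show thesis
 proof (rule that[of B])
  show "adj W * B * W = B"
  proof (rule bop_tensor_cinner_ext)
   fix \<tau> \<xi> \<tau>' \<xi>'
   have t: "gram (Gc u (\<tau>' \<otimes> \<xi>')) (Gc u (\<tau> \<otimes> \<xi>)) = \<langle>\<tau>', \<tau>\<rangle> *C (adj (w \<xi>' u) * w \<xi> u)"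
    by (rule gram_eqI) (auto simp: Gc_tensor cinner_tensor cinner_scaleC_right adj_right mult.commute)
   have "K (W $ (\<tau>' \<otimes> \<xi>')) (W $ (\<tau> \<otimes> \<xi>)) = K (\<tau>' \<otimes> \<xi>') (\<tau> \<otimes> \<xi>)"
    unfolding K_def Gc_W t using u by (simp add: gram_right hat_T uvec_N q.hat_scaleC q.adj_times_mdom)
   then show "\<langle>\<tau>' \<otimes> \<xi>', (adj W * B * W) $ (\<tau> \<otimes> \<xi>)\<rangle> = \<langle>\<tau>' \<otimes> \<xi>', B $ (\<tau> \<otimes> \<xi>)\<rangle>"
    by (simp add: adj_right B)
  qed
 qed (simp add: B K_def)
qed

text \<open>W is a coisometry, so a trivial kernel suffices. On the kernel the invariant form
  vanishes, and faithfulness gives Q \<Omega>: W kills every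
  \<open>\<mu> \<otimes> cl y \<Omega>\<close>. This is then used again for
  \<open>adj W $ \<Omega>\<close>.\<close>

lemma W_isometry: "adj W * W = 1"
proof -
 define Q where "Q \<Omega> \<longleftrightarrow> (\<forall>\<mu> y. W $ (\<mu> \<otimes> cl y \<Omega>) = 0)" for \<Omega> :: "('i \<times> 'i) ell2"
 have Q1: "Q \<Omega>" if W0: "\<And>u B. uvec u ==> (\<And>\<Omega> \<Omega>'. q.hat (gram (Gc u \<Omega>) (Gc u \<Omega>')) = \<langle>\<Omega>, B $ \<Omega>'\<rangle>) ==> adj W * B * W = B ==> \<langle>\<Omega>, B $ \<Omega>\<rangle> = 0" for \<Omega>
  unfolding Q_def
 proof (intro allI)
  fix \<mu> y
  have "w (cl y \<Omega>) u $ \<mu> = 0" if u: "uvec u" for u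
  proof -
   obtain B where B: "\<And>\<Omega> \<Omega>'. q.hat (gram (Gc u \<Omega>) (Gc u \<Omega>')) = \<langle>\<Omega>, B $ \<Omega>'\<rangle>" "adj W * B * W = B"
    by (rule Gc_form[OF u]) (rule that)
   have "q.fcol (Gc u \<Omega>)" by (rule fcol_Gc[OF u])
   then have "gram (Gc u \<Omega>) (Gc u \<Omega>) \<in> q.Fin" by (simp add: q.fcol_def)
   moreover from this have "q.wr (gram (Gc u \<Omega>) (Gc u \<Omega>)) = 0"
    using W0[OF u B] q.hat_Fin by (simp add: B(1)[symmetric])
   ultimately have "gram (Gc u \<Omega>) (Gc u \<Omega>) = 0" by (rule q.wr_faithful)
   then have "\<langle>Gc u \<Omega> \<mu>, Gc u \<Omega> \<mu>\<rangle> = 0" using cinner_gram[OF bcl_Gc bcl_Gc, of \<mu> u \<Omega> u \<Omega> \<mu>] by simp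
   then have "Gc u \<Omega> \<mu> = 0" by (simp add: cinner_norm)
   then show ?thesis using cr_Gc[of y u \<Omega> \<mu>] by (simp add: cr_rules)
  qed
  then have "\<langle>z, W $ (\<mu> \<otimes> cl y \<Omega>)\<rangle> = 0" if "z \<in> {x \<otimes> u | x u. x \<in> UNIV \<and> u \<in> {u. uvec u}}" for z
   using that by (auto simp: cinner_rslice[symmetric])
  then show "W $ (\<mu> \<otimes> cl y \<Omega>) = 0" by (rule totalD[OF total_tensor[OF total_UNIV total_uvec]])
 qed
 have ker: "\<Omega> = 0" if W0: "W $ \<Omega> = 0" for \<Omega>
 proof -
  have "Q \<Omega>"
  proof (rule Q1)
   fix B assume "adj W * B * W = B"
   then have "\<langle>\<Omega>, B $ \<Omega>\<rangle> = \<langle>\<Omega>, (adj W * B * W) $ \<Omega>\<rangle>" by simp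
   then show "\<langle>\<Omega>, B $ \<Omega>\<rangle> = 0" using W0 by simp
  qed
  have "\<Omega> = W $ adj W $ \<Omega>" using arg_cong[OF W_coisometry, of "\<lambda>X. X $ \<Omega>"] by simp
  \<comment> \<open>Q \<Omega> makes the column \<open>Gc u \<Omega>\<close> zero, so by invariance
    the form vanishes at \<open>adj W $ \<Omega>\<close> too and Q holds there. Expanding that
    vector along its rows shows that W kills it, that is \<Omega> = 0.\<close>
  define \<Omega>' where "\<Omega>' = adj W $ \<Omega>"
  have "Q \<Omega>'"
  proof (rule Q1)
   fix u B assume u: "uvec u" and B: "\<And>\<Omega> \<Omega>'. q.hat (gram (Gc u \<Omega>) (Gc u \<Omega>')) = \<langle>\<Omega>, B $ \<Omega>'\<rangle>" "adj W * B * W = B"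
   have "Gc u \<Omega> = (\<lambda>x. 0)"
    using \<open>Q \<Omega>\<close> by (intro ext ell2_eq_if_cr_ket_eq) (simp add: cr_Gc Q_def rslice_apply cr_rules)
   then have "gram (Gc u \<Omega>) (Gc u \<Omega>) = 0" by (intro gram_eqI) (simp_all add: bcl_zero_fun)
   then have "\<langle>\<Omega>, B $ \<Omega>\<rangle> = 0" by (simp add: B(1)[symmetric])
   then show "\<langle>\<Omega>', B $ \<Omega>'\<rangle> = 0"
    using arg_cong[OF B(2), of "\<lambda>B. \<langle>\<Omega>', B $ \<Omega>'\<rangle>"] \<open>\<Omega> = W $ adj W $ \<Omega>\<close> by (simp add: adj_right \<Omega>'_def)
  qed
  have "\<langle>z, \<Omega>\<rangle> = 0" for z
  proof -
   have "((\<lambda>j. \<langle>cl (ket j) (adj W $ z), cl (ket j) \<Omega>'\<rangle>) has_sum \<langle>adj W $ z, \<Omega>'\<rangle>) UNIV" by (rule cl_ket_parseval)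
   moreover have "\<langle>cl (ket j) (adj W $ z), cl (ket j) \<Omega>'\<rangle> = 0" for j
    using \<open>Q \<Omega>'\<close> by (simp add: cinner_cl_left adj_left Q_def)
   ultimately have "\<langle>adj W $ z, \<Omega>'\<rangle> = 0" using has_sum_unique[OF _ has_sum_0] by force
   then show ?thesis using \<open>\<Omega> = W $ adj W $ \<Omega>\<close> by (simp add: \<Omega>'_def adj_left)
  qed
  then show "\<Omega> = 0" by (metis cinner_ext cinner_zero_right)
 qed
 have "W $ (x - adj W $ W $ x) = 0" for x
  using arg_cong[OF W_coisometry, of "\<lambda>X. X $ W $ x"] by (simp add: bop_diff_right)
 from ker[OF this] have "adj W $ W $ x = x" for x by (metis eq_iff_diff_eq_0)
 then show ?thesis by (intro bop_ext) simp
qed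

lemma W_inverse [simp]: "adj W $ W $ x = x" "W $ adj W $ x = x"
 using arg_cong[OF W_isometry, of "\<lambda>X. X $ x"] arg_cong[OF W_coisometry, of "\<lambda>X. X $ x"] by simp_all

lemma D_W: "m \<in> M ==> \<Delta> m $ x = adj W $ (1 \<otimes>\<^sub>o m) $ W $ x"
 using arg_cong[OF W_D, of m "\<lambda>X. adj W $ X $ x"] by simp

end

subsection \<open>Vector functionals intertwined by the antipode\<close>

context qg begin

text \<open>The Riesz vector of the right Haar weight of \<open>adj y * w \<mu> u\<close> as a
  function of \<mu>. It plays the part of a GNS vector for the right weight, but on the space of the
  left one.\<close>

definition kap :: "'i bop => 'i ell2 => 'i ell2" where
 "kap y u = (SOME \<kappa>. \<forall>\<mu>. \<langle>\<kappa>, \<mu>\<rangle> = q.hat (adj y * w \<mu> u))"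

lemma kap: assumes y: "y \<in> q.N" and u: "uvec u"
 shows "\<langle>\<mu>, kap y u\<rangle> = q.hat (adj (w \<mu> u) * y)"
proof -
 obtain C where C0: "C \<ge> 0" "\<forall>\<mu>. w \<mu> u \<in> q.N \<and> (q.nr (w \<mu> u))^2 \<le> C * (norm \<mu>)^2"
  using u unfolding uvec_def by blast
 have C: "w \<mu> u \<in> q.N" "(q.nr (w \<mu> u))^2 \<le> C * (norm \<mu>)^2" for \<mu> using C0(2) by auto
 note md = q.adj_times_mdom[OF y C(1)]
 have "\<exists>\<kappa>. \<forall>\<mu>. \<langle>\<kappa>, \<mu>\<rangle> = q.hat (adj y * w \<mu> u)"
 proof -
  have "q.nr (w \<mu> u) \<le> sqrt C * norm \<mu>" for \<mu>
   by (rule power2_le_imp_le) (use C0(1) C(2)[of \<mu>] in "auto simp: power_mult_distrib")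
  then have "cmod (q.hat (adj y * w \<mu> u)) \<le> (q.nr y * sqrt C) * norm \<mu>" for \<mu>
   using order_trans[OF q.hat_adj_times_le[OF y C(1)] mult_left_mono] by (simp add: mult.assoc)
  then obtain t where "\<And>\<mu>. q.hat (adj y * w \<mu> u) = \<langle>t, \<mu>\<rangle>"
   by (rule riesz_complex[rotated 2]) (auto simp: w_rules distrib_left q.hat_add q.hat_scaleC md)
  then show ?thesis by metis
 qed
 from someI_ex[OF this] have "\<langle>kap y u, \<mu>\<rangle> = q.hat (adj y * w \<mu> u)" by (simp add: kap_def)
 then have "cnj \<langle>kap y u, \<mu>\<rangle> = q.hat (adj (adj y * w \<mu> u))" by (simp only: q.hat_adj[OF md])
 then show ?thesis by (simp add: cinner_commute[of \<mu>])
qed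

text \<open>Strong right invariance of \<open>\<psi>\<close>.\<close>

lemma W_kap: assumes y: "y \<in> q.N" and u: "uvec u"
 shows "adj (w f u) * T \<beta> \<xi> y \<in> q.mdom" "\<langle>\<xi> \<otimes> f, W $ (\<beta> \<otimes> kap y u)\<rangle> = q.hat (adj (w f u) * T \<beta> \<xi> y)"
proof -
 obtain C where C: "C \<ge> 0" "\<And>\<Omega>. q.fcol (Gc u \<Omega>)" "\<And>\<Omega>. q.nrm (Gc u \<Omega>) \<le> C * norm \<Omega>"
  by (rule fcol_Gc[OF u]) (rule that)
 have yM: "y \<in> M" by (rule q.N_mem[OF y])
 have g: "gram (Gc u (\<xi> \<otimes> f)) (cright y \<beta>) = adj (w f u) * T \<beta> \<xi> y"
  by (rule gram_eqI) (simp_all add: Gc_tensor adj_right rslice_apply cinner_cr_right)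
 have M: "gram (Gc u \<Omega>) (cright y \<beta>) \<in> M" for \<Omega> by (intro Mcol_gram Mcol_Gc Mcol_cright yM)
 have md: "gram (Gc u \<Omega>) (cright y \<beta>) \<in> q.mdom" for \<Omega>
  by (rule q.gram_mdom[OF C(2) fcol_right(1)[OF y] M])
 from md[of "\<xi> \<otimes> f"] show "adj (w f u) * T \<beta> \<xi> y \<in> q.mdom" by (simp add: g)
 \<comment> \<open>The difference of two functionals, conjugated to be linear in \<Omega>. On
   elementary tensors it vanishes by \<open>Gc_W\<close> and \<open>hat_T\<close>; the claim is its
   value at \<open>adj W $ (\<xi> \<otimes> f)\<close>.\<close>
 define h where "h \<Omega> = cnj (q.hat (gram (Gc u (W $ \<Omega>)) (cright y \<beta>)) - \<langle>\<Omega>, \<beta> \<otimes> kap y u\<rangle>)" for \<Omega>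
 have Gr: "Gc u (\<Omega> + \<Omega>') = (\<lambda>x. Gc u \<Omega> x + Gc u \<Omega>' x)" "Gc u (c *C \<Omega>) = (\<lambda>x. c *C Gc u \<Omega> x)" for \<Omega> \<Omega>' c
  by (auto simp: Gc_rules)
 have "h \<Omega> = 0" for \<Omega>
 proof (rule functional_zero_on_total[OF _ _ _ total_tensor[OF total_UNIV total_UNIV]])
  show "h (x + y) = h x + h y" "h (c *C x) = c * h x" for x y c
   by (simp_all add: h_def Gr bop_rules gram_add_left gram_scaleC_left q.hat_add q.hat_scaleC md ci_rules algebra_simps)
  show "cmod (h x) \<le> (C * norm W * (norm \<beta> * q.nr y) + norm (\<beta> \<otimes> kap y u)) * norm x" for x
  proof -
   have "cmod (q.hat (gram (Gc u (W $ x)) (cright y \<beta>))) \<le> (C * (norm W * norm x)) * (norm \<beta> * q.nr y)"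
    by (intro order_trans[OF q.hat_gram_le] mult_mono order_trans[OF C(3)] mult_left_mono norm_bop C M fcol_right[OF y])
     (auto simp: C fcol_right[OF y])
   then show ?thesis
    using norm_triangle_ineq4[of "q.hat (gram (Gc u (W $ x)) (cright y \<beta>))" "\<langle>x, \<beta> \<otimes> kap y u\<rangle>"]
     cauchy_schwarz[of x "\<beta> \<otimes> kap y u"]
    unfolding h_def complex_mod_cnj by (simp add: algebra_simps)
  qed
  fix z :: "('i \<times> 'i) ell2" assume "z \<in> {x \<otimes> y | x y. x \<in> UNIV \<and> y \<in> UNIV}"
  then obtain \<tau> \<zeta> where z: "z = \<tau> \<otimes> \<zeta>" by blast
  show "h z = 0"
   using y yM u by (simp add: h_def z Gc_W gram_right hat_T uvec_N cinner_tensor kap)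
 qed
 from this[of "adj W $ (\<xi> \<otimes> f)"] show "\<langle>\<xi> \<otimes> f, W $ (\<beta> \<otimes> kap y u)\<rangle> = q.hat (adj (w f u) * T \<beta> \<xi> y)"
  by (simp add: h_def g adj_left)
qed

text \<open>Elements that can occur in both slots of \<open>kap\<close>: directly through the right
  weight, and through the GNS vector of the adjoint.\<close>

definition adm :: "'i bop => bool" where
 "adm x \<longleftrightarrow> x \<in> q.N \<and> adj x \<in> N \<and> uvec (\<Lambda> (adj x))"

text \<open>By strong invariance the left side is the right Haar weight of
  \<open>T \<xi>1 \<eta>1 (adj x) * T \<eta>2 \<xi>2 y\<close>; exchanging the roles of the data
  takes the adjoint of this product. This symmetry is the source of the nice quadruples.\<close>

lemma W_kap_symmetric:
 assumes x: "adm x" and y: "adm y" and FP1: "FP f1 \<eta>1 \<xi>1" and FP2: "FP f2 \<eta>2 \<xi>2"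
 shows "\<langle>\<xi>2 \<otimes> f1, W $ (\<eta>2 \<otimes> kap y (\<Lambda> (adj x)))\<rangle> = cnj \<langle>\<xi>1 \<otimes> f2, W $ (\<eta>1 \<otimes> kap x (\<Lambda> (adj y)))\<rangle>"
proof -
 have a: "x \<in> q.N" "adj x \<in> N" "uvec (\<Lambda> (adj x))" "y \<in> q.N" "adj y \<in> N" "uvec (\<Lambda> (adj y))"
  using x y by (auto simp: adm_def)
 note md = W_kap(1)[OF a(1,6), of f2 \<eta>1 \<xi>1]
 have e: "w f2 (\<Lambda> (adj y)) = T \<eta>2 \<xi>2 y"
  using arg_cong[OF adj_w_FP[OF FP2 a(5)], of adj] q.N_mem[OF a(4)] by (simp add: adj_rslice D_adj)
 show ?thesis
  unfolding W_kap(2)[OF a(4,3)] W_kap(2)[OF a(1,6)] q.hat_adj[OF md, symmetric] adj_w_FP[OF FP1 a(2)]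
  using q.N_mem[OF a(1)] by (simp add: e adj_rslice D_adj)
qed

text \<open>The pentagon equation \<open>W\<^sub>1\<^sub>2 W\<^sub>2\<^sub>3\<^sup>* = W\<^sub>2\<^sub>3\<^sup>* W\<^sub>1\<^sub>2 W\<^sub>1\<^sub>3\<close>, evaluated on vectors.\<close>

lemma pentagon_sum:
 "((\<lambda>k. \<langle>x \<otimes> (w s (ket k) $ y), W $ ((w v (ket k) $ \<eta>) \<otimes> \<kappa>)\<rangle>) has_sum \<langle>x \<otimes> y, W $ (\<eta> \<otimes> (adj (w s v) $ \<kappa>))\<rangle>) UNIV"
proof -
 define B where "B = Abs_bop (\<lambda>p. cl x (W $ (p \<otimes> \<kappa>)))"
 define C where "C = Abs_bop (\<lambda>\<tau>. cl \<kappa> (W $ (\<tau> \<otimes> s)))"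
 have B: "B $ p = cl x (W $ (p \<otimes> \<kappa>))" and C: "C $ p = cl \<kappa> (W $ (p \<otimes> s))" for p
  unfolding B_def C_def by (rule apply_Abs_bop, rule bcl_comp[OF bcl_cl bcl_comp[OF bcl_bop bcl_tensor_left]])+
 let ?R = "W * (1 \<otimes>\<^sub>o C)"
 have E: "\<Delta> (adj (w s u)) $ (p \<otimes> \<kappa>) = adj ?R $ (p \<otimes> u)" for p u
 proof (rule tensor_eqI)
  fix \<mu> \<tau>
  have "\<langle>p \<otimes> \<kappa>, \<Delta> (w s u) $ (\<mu> \<otimes> \<tau>)\<rangle> = \<langle>p \<otimes> u, ?R $ (\<mu> \<otimes> \<tau>)\<rangle>" by (simp add: D_w tensor_op_apply C)
  then show "\<langle>\<mu> \<otimes> \<tau>, \<Delta> (adj (w s u)) $ (p \<otimes> \<kappa>)\<rangle> = \<langle>\<mu> \<otimes> \<tau>, adj ?R $ (p \<otimes> u)\<rangle>"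
   unfolding D_adj[OF w_mem] adj_right by (metis cinner_commute)
 qed
 have R: "adj (B \<otimes>\<^sub>o 1) $ W $ (y \<otimes> s) = ?R $ adj W $ (x \<otimes> y)"
 proof (rule tensor_eqI)
  fix p u
  have "\<langle>W $ (y \<otimes> s), (B \<otimes>\<^sub>o 1) $ (p \<otimes> u)\<rangle> = \<langle>w s u $ y, B $ p\<rangle>"
   by (simp add: tensor_op_apply rslice_apply cinner_cr_left)
  also have "\<dots> = \<langle>(1 \<otimes>\<^sub>o w s u) $ (x \<otimes> y), W $ (p \<otimes> \<kappa>)\<rangle>" by (simp add: B cinner_cl_right tensor_op_apply)
  also have "\<dots> = \<langle>x \<otimes> y, (1 \<otimes>\<^sub>o adj (w s u)) $ W $ (p \<otimes> \<kappa>)\<rangle>"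
   using adj_right[of "x \<otimes> y" "1 \<otimes>\<^sub>o w s u"] by (simp add: adj_tensor_op)
  also have "\<dots> = \<langle>x \<otimes> y, W $ \<Delta> (adj (w s u)) $ (p \<otimes> \<kappa>)\<rangle>"
   using arg_cong[OF W_D[OF adj_mem[OF w_mem]], of "\<lambda>X. X $ (p \<otimes> \<kappa>)" s u] by simp
  also have "\<dots> = \<langle>?R $ adj W $ (x \<otimes> y), p \<otimes> u\<rangle>"
   by (simp only: E adj_left[of W, symmetric] adj_right)
  finally show "\<langle>p \<otimes> u, adj (B \<otimes>\<^sub>o 1) $ W $ (y \<otimes> s)\<rangle> = \<langle>p \<otimes> u, ?R $ adj W $ (x \<otimes> y)\<rangle>"
   unfolding adj_right by (metis cinner_commute)
 qed
 have Cv: "adj C $ v = adj (w s v) $ \<kappa>"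
  by (rule cinner_ext) (simp add: adj_right C cinner_cl_left rslice_apply cinner_cr_left)
 have "\<langle>W $ (y \<otimes> s), (B \<otimes>\<^sub>o 1) $ W $ (\<eta> \<otimes> v)\<rangle> = \<langle>W $ (1 \<otimes>\<^sub>o C) $ adj W $ (x \<otimes> y), W $ (\<eta> \<otimes> v)\<rangle>"
  using R by (simp add: adj_left[of "B \<otimes>\<^sub>o 1", symmetric])
 also have "\<dots> = \<langle>adj W $ (x \<otimes> y), adj (1 \<otimes>\<^sub>o C) $ (\<eta> \<otimes> v)\<rangle>"
  using adj_right[of "(1 \<otimes>\<^sub>o C) $ adj W $ (x \<otimes> y)" W "W $ (\<eta> \<otimes> v)"] by (simp only: W_inverse adj_right)
 also have "\<dots> = \<langle>x \<otimes> y, W $ (\<eta> \<otimes> (adj (w s v) $ \<kappa>))\<rangle>"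
  by (simp add: adj_tensor_op tensor_op_apply Cv adj_left)
 finally have e: "\<langle>W $ (y \<otimes> s), (B \<otimes>\<^sub>o 1) $ W $ (\<eta> \<otimes> v)\<rangle> = \<langle>x \<otimes> y, W $ (\<eta> \<otimes> (adj (w s v) $ \<kappa>))\<rangle>" .
 have "\<langle>x \<otimes> (w s (ket k) $ y), W $ ((w v (ket k) $ \<eta>) \<otimes> \<kappa>)\<rangle>
   = \<langle>cr (ket k) (W $ (y \<otimes> s)), cr (ket k) ((B \<otimes>\<^sub>o 1) $ W $ (\<eta> \<otimes> v))\<rangle>" for k
  by (simp add: cr_tensor_id B cinner_cl_right rslice_apply)
 then show ?thesis using cr_ket_parseval[of "W $ (y \<otimes> s)" "(B \<otimes>\<^sub>o 1) $ W $ (\<eta> \<otimes> v)"] by (simp add: e)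
qed

abbreviation "lam a b \<equiv> lslice a b W"

text \<open>\<open>nice a b c d\<close> says that the functionals \<open>\<rho>(m) = \<langle>b, m a\<rangle>\<close> and \<open>\<theta>(m) = \<langle>d, m c\<rangle>\<close> satisfy
 \<open>\<rho> = \<theta> \<circ> S\<close> on the core of the antipode \<open>S\<close>.\<close>

definition nice :: "'i ell2 => 'i ell2 => 'i ell2 => 'i ell2 => bool" where
 "nice a b c d \<longleftrightarrow> lam a b = adj (lam d c)"

lemma cinner_lam: "\<langle>s, lam a b $ v\<rangle> = \<langle>b, w v s $ a\<rangle>"
 by (simp add: cinner_lslice cinner_rslice)

lemma cinner_adj_lam: "\<langle>s, adj (lam d c) $ v\<rangle> = \<langle>d, adj (w s v) $ c\<rangle>"
 unfolding adj_right using cinner_lam by (metis cinner_commute)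

lemma nice_iff: "nice a b c d \<longleftrightarrow> (\<forall>v s. \<langle>b, w v s $ a\<rangle> = \<langle>d, adj (w s v) $ c\<rangle>)"
 unfolding nice_def cinner_lam[symmetric] cinner_adj_lam[symmetric] by (auto intro: bop_cinner_ext)

lemma nice_sym: "nice a b c d ==> nice d c b a" by (simp add: nice_def)

text \<open>The symmetry is applied to \<open>FP\<close> data moved by \<open>w s (ket k)\<close>
  and \<open>w v (ket k)\<close>, which \<open>FP_mult\<close> permits; summation over k by the
  pentagon equation produces \<open>w s v\<close> and \<open>w v s\<close> on the two sides.\<close>

lemma nice_kap:
 assumes x: "adm x" and y: "adm y" and FP1: "FP f1 \<eta>1 \<xi>1" and FP2: "FP f2 \<eta>2 \<xi>2"
 shows "nice (cl \<eta>1 (adj W $ (\<xi>1 \<otimes> f2))) (kap x (\<Lambda> (adj y))) (kap y (\<Lambda> (adj x))) (cl \<eta>2 (adj W $ (\<xi>2 \<otimes> f1)))"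
 unfolding nice_iff
proof (intro allI)
 fix v s
 let ?\<kappa> = "kap y (\<Lambda> (adj x))" and ?\<kappa>' = "kap x (\<Lambda> (adj y))"
 have "\<langle>\<xi>2 \<otimes> (w s (ket k) $ f1), W $ ((w v (ket k) $ \<eta>2) \<otimes> ?\<kappa>)\<rangle>
   = cnj \<langle>\<xi>1 \<otimes> (w v (ket k) $ f2), W $ ((w s (ket k) $ \<eta>1) \<otimes> ?\<kappa>')\<rangle>" for k
  by (rule W_kap_symmetric[OF x y FP_mult[OF FP1 w_mem] FP_mult[OF FP2 w_mem]])
 then have "((\<lambda>k. \<langle>\<xi>2 \<otimes> (w s (ket k) $ f1), W $ ((w v (ket k) $ \<eta>2) \<otimes> ?\<kappa>)\<rangle>) has_sum
   cnj \<langle>\<xi>1 \<otimes> f2, W $ (\<eta>1 \<otimes> (adj (w v s) $ ?\<kappa>'))\<rangle>) UNIV"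
  using pentagon_sum[of \<xi>1 v f2 s \<eta>1 ?\<kappa>'] by simp
 from has_sum_unique[OF pentagon_sum this]
 have "\<langle>\<xi>2 \<otimes> f1, W $ (\<eta>2 \<otimes> (adj (w s v) $ ?\<kappa>))\<rangle> = cnj \<langle>\<xi>1 \<otimes> f2, W $ (\<eta>1 \<otimes> (adj (w v s) $ ?\<kappa>'))\<rangle>" .
 moreover have "\<langle>?\<kappa>', w v s $ cl \<eta>1 (adj W $ (\<xi>1 \<otimes> f2))\<rangle> = cnj \<langle>cl \<eta>1 (adj W $ (\<xi>1 \<otimes> f2)), adj (w v s) $ ?\<kappa>'\<rangle>"
  unfolding adj_right by (metis cinner_commute)
 ultimately show "\<langle>?\<kappa>', w v s $ cl \<eta>1 (adj W $ (\<xi>1 \<otimes> f2))\<rangle> = \<langle>cl \<eta>2 (adj W $ (\<xi>2 \<otimes> f1)), adj (w s v) $ ?\<kappa>\<rangle>"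
  by (simp add: cinner_cl_left adj_left del: cinner_commute)
qed

lemma adm_mult: assumes a: "a \<in> N" and x: "x \<in> q.N" shows "adm (adj a * x)" "\<Lambda> (adj (adj a * x)) = adj x $ \<Lambda> a"
proof -
 have m: "adj x \<in> M" "adj a \<in> M" using a x N_mem q.N_mem by auto
 show e: "\<Lambda> (adj (adj a * x)) = adj x $ \<Lambda> a" using Lam_mult[OF m(1) a] by simp
 have "adj x * a \<in> N" by (rule N_left_ideal[OF m(1) a])
 then show "adm (adj a * x)" using q.N_left_ideal[OF m(2) x] uvec_adj[OF x, of "\<Lambda> a"] e by (simp add: adm_def)
qed

text \<open>If all coefficients vanish, m annihilates the vectors \<open>kap\<close>. For x0 =
  \<open>w (adj m $ \<mu>) u\<close> this says that \<open>adj x0 * (adj a * x0)\<close> has right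
  weight zero, and \<open>adj a * x0\<close> can approach x0. So x0 = 0, and unitarity of W gives
  \<open>adj m $ \<mu> = 0\<close>.\<close>

lemma nice_separating:
 assumes m: "\<And>a b c d. nice a b c d ==> \<langle>d, m $ c\<rangle> = 0"
 shows "m = 0"
proof -
 obtain \<zeta> :: "'i ell2" where \<zeta>: "\<zeta> \<noteq> 0" using ex_nonzero_ell2 by blast
 have tz: "y = 0" if "x \<noteq> 0" "x \<otimes> y = 0" for x y :: "'i ell2"
  using that norm_tensor_vec[of x y] by simp
 have k0: "m $ kap y (\<Lambda> (adj x)) = 0" if x: "adm x" and y: "adm y" for x y
 proof -
  let ?k = "m $ kap y (\<Lambda> (adj x))"
  have "W $ (\<Lambda> n \<otimes> ?k) = 0" if n: "n \<in> N" for n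
  proof (rule totalD[OF total_tensor[OF total_Fdomain total_FP]])
   fix z assume "z \<in> {x \<otimes> y | x y. x \<in> {\<xi>. \<exists>f. Fpair \<xi> f} \<and> y \<in> {f. \<exists>\<eta> \<xi>. FP f \<eta> \<xi>}}"
   then obtain \<xi>2 f f1 \<eta>1 \<xi>1 where z: "z = \<xi>2 \<otimes> f1" and F: "Fpair \<xi>2 f" and FP1: "FP f1 \<eta>1 \<xi>1" by blast
   from m[OF nice_kap[OF x y FP1 FP_Fpair[OF F n]]]
   show "\<langle>z, W $ (\<Lambda> n \<otimes> ?k)\<rangle> = 0" by (simp add: z cinner_cl_left adj_left)
  qed
  then have z: "\<Lambda> n \<otimes> ?k = 0" if "n \<in> N" for n using that W_inverse(1)[of "\<Lambda> n \<otimes> ?k"] by simp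
  show ?thesis
  proof (rule ccontr)
   assume k: "?k \<noteq> 0"
   have "\<Lambda> n = 0" if "n \<in> N" for n using z[OF that] k norm_tensor_vec[of "\<Lambda> n" ?k] by simp
   then have "\<zeta> = 0" by (intro totalD[OF total_Lam]) auto
   with \<zeta> show False by simp
  qed
 qed
 have w0: "w (adj m $ \<mu>) (adj x1 $ \<Lambda> a1) = 0" if x1: "x1 \<in> q.N" and a1: "a1 \<in> N" for \<mu> x1 a1
 proof -
  let ?u = "adj x1 $ \<Lambda> a1"
  define x0 where "x0 = w (adj m $ \<mu>) ?u"
  have u: "uvec ?u" by (rule uvec_adj[OF x1])
  have x0: "x0 \<in> q.N" unfolding x0_def by (rule uvec_N[OF u])
  \<comment> \<open>The only comparison of the left and right weights: \<open>a\<close> comes from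
    the left ideal of the left weight, the error is measured by the right one.\<close>
  have le: "(q.nr x0)^2 \<le> q.nr x0 * sqrt \<epsilon>" if \<epsilon>: "\<epsilon> > 0" for \<epsilon>
  proof -
   obtain a where a: "a \<in> N" "x0 - adj a * x0 \<in> q.N" "(q.nr (x0 - adj a * x0))^2 < \<epsilon>"
    using two_weights_approx[OF nsf_axioms q.nsf_axioms x0 \<epsilon>] by blast
   note ad = adm_mult[OF a(1) x0]
   have yN: "adj a * x0 \<in> q.N" using ad(1) by (simp add: adm_def)
   have "\<langle>adj m $ \<mu>, kap (adj a * x0) ?u\<rangle> = 0"
    using k0[OF adm_mult(1)[OF a1 x1] ad(1)] unfolding adm_mult(2)[OF a1 x1] by (simp add: adj_left)
   then have "q.hat (adj x0 * (adj a * x0)) = 0"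
    using kap[OF yN u, of "adj m $ \<mu>"] by (simp only: x0_def[symmetric])
   then have "q.hat (adj x0 * x0) = q.hat (adj x0 * (x0 - adj a * x0))"
    using q.hat_diff[OF q.adj_times_mdom[OF x0 x0] q.adj_times_mdom[OF x0 yN]] by (simp add: right_diff_distrib)
   then have e: "q.hat (adj x0 * (x0 - adj a * x0)) = complex_of_real ((q.nr x0)^2)"
    using q.hat_Fin[OF q.N_Fin[OF x0]] by (simp only: q.nr_sq)
   have "(q.nr x0)^2 \<le> q.nr x0 * q.nr (x0 - adj a * x0)"
    using q.hat_adj_times_le[OF x0 a(2)] unfolding e norm_of_real by (simp only: abs_power2)
   also have "\<dots> \<le> q.nr x0 * sqrt \<epsilon>" using a(3) by (intro mult_left_mono real_le_rsqrt) auto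
   finally show ?thesis .
  qed
  have "q.nr x0 = 0"
  proof (rule ccontr)
   assume "q.nr x0 \<noteq> 0"
   then have p: "q.nr x0 > 0" using q.nrm_nonneg[of "apply_bop x0"] by linarith
   then have "q.nr x0 * q.nr x0 \<le> q.nr x0 * (q.nr x0 / 2)"
    using le[of "(q.nr x0 / 2)^2"] by (simp only: real_sqrt_abs abs_of_pos power2_eq_square[of "q.nr x0"] half_gt_zero zero_less_power)
   then have "q.nr x0 \<le> q.nr x0 / 2" using p by (metis mult_le_cancel_left_pos)
   with p show False by simp
  qed
  then have "q.wr (adj x0 * x0) = 0" unfolding q.nr_sq[symmetric] by simp
  then have 0: "adj x0 * x0 = 0" by (rule q.wr_faithful[OF q.N_Fin[OF x0]])
  have "\<langle>x0 $ z, x0 $ z\<rangle> = 0" for z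
   using adj_right[of z x0 "x0 $ z"] arg_cong[OF 0, of "\<lambda>X. X $ z"] by simp
  then show ?thesis unfolding x0_def[symmetric] by (intro bop_ext) (simp add: cinner_norm)
 qed
 have tot: "total {adj x1 $ \<Lambda> a1 | x1 a1. x1 \<in> q.N \<and> a1 \<in> N}"
  unfolding total_def
 proof (intro allI impI)
  fix z assume *: "\<forall>s\<in>{adj x1 $ \<Lambda> a1 | x1 a1. x1 \<in> q.N \<and> a1 \<in> N}. \<langle>s, z\<rangle> = 0"
  show "z = 0"
  proof (rule q.N_nondegenerate, rule totalD[OF total_Lam])
   fix x1 s assume "x1 \<in> q.N" "s \<in> \<Lambda> ` N"
   then show "\<langle>s, x1 $ z\<rangle> = 0" using * by (force simp: adj_left)
  qed
 qed
 have "adj m $ \<mu> = 0" for \<mu>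
 proof -
  have "W $ (\<zeta> \<otimes> (adj m $ \<mu>)) = 0"
  proof (rule totalD[OF total_tensor[OF total_UNIV tot]])
   fix z :: "('i \<times> 'i) ell2" assume "z \<in> {x \<otimes> y | x y. x \<in> UNIV \<and> y \<in> {adj x1 $ \<Lambda> a1 | x1 a1. x1 \<in> q.N \<and> a1 \<in> N}}"
   then obtain p x1 a1 where z: "z = p \<otimes> (adj x1 $ \<Lambda> a1)" "x1 \<in> q.N" "a1 \<in> N" by blast
   show "\<langle>z, W $ (\<zeta> \<otimes> (adj m $ \<mu>))\<rangle> = 0"
    unfolding z(1) cinner_rslice[symmetric] w0[OF z(2,3)] by simp
  qed
  then have "\<zeta> \<otimes> (adj m $ \<mu>) = 0" using W_inverse(1)[of "\<zeta> \<otimes> (adj m $ \<mu>)"] by simp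
  then show ?thesis by (rule tz[OF \<zeta>])
 qed
 then have "adj m = 0" by (intro bop_ext) simp
 then show ?thesis by (metis adj_adj adj_zero)
qed

lemma nice_separating': assumes m: "\<And>a b c d. nice a b c d ==> \<langle>b, m $ a\<rangle> = 0" shows "m = 0"
proof -
 have "adj m = 0"
 proof (rule nice_separating)
  fix a b c d assume "nice a b c d"
  from m[OF nice_sym[OF this]] show "\<langle>d, adj m $ c\<rangle> = 0"
   unfolding adj_right by (metis cinner_commute complex_cnj_zero)
 qed
 then show ?thesis by (metis adj_adj adj_zero)
qed

end

subsection \<open>The antipode\<close>

context qg begin

text \<open>A slice of the pentagon equation: on elementary tensors \<open>Gc_W\<close> and
  \<open>D_W\<close> move the coefficient of W across W. The form of the result, a conjugation by W,
  makes its behaviour under adjoints visible.\<close>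

lemma lam_w: "lam (w f u $ a) b $ v = cr u (W $ (lam a b \<otimes>\<^sub>o 1) $ adj W $ (v \<otimes> f))"
proof -
 have "cl b (W $ Gc u (W $ \<Omega>) a) = cr u (W $ (lam a b \<otimes>\<^sub>o 1) $ \<Omega>)" for \<Omega>
 proof (rule bcl_eq_on_tensors[where S = "\<lambda>\<Omega>. cl b (W $ Gc u (W $ \<Omega>) a)" and T = "\<lambda>\<Omega>. cr u (W $ (lam a b \<otimes>\<^sub>o 1) $ \<Omega>)", OF _ _ _ total_UNIV total_UNIV])
  show "bcl (\<lambda>\<Omega>. cl b (W $ Gc u (W $ \<Omega>) a))"
   unfolding Gc_def by (intro bcl_comp[OF bcl_cl] bcl_comp[OF bcl_bop] bcl_comp[OF bcl_flip] bcl_bop)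
  show "bcl (\<lambda>\<Omega>. cr u (W $ (lam a b \<otimes>\<^sub>o 1) $ \<Omega>))"
   by (intro bcl_comp[OF bcl_cr] bcl_comp[OF bcl_bop] bcl_bop)
  show "cl b (W $ Gc u (W $ (\<tau> \<otimes> \<xi>)) a) = cr u (W $ (lam a b \<otimes>\<^sub>o 1) $ (\<tau> \<otimes> \<xi>))" for \<tau> \<xi>
   by (simp add: Gc_W D_W cl_id_tensor tensor_op_apply lslice_apply rslice_apply)
 qed
 from this[of "adj W $ (v \<otimes> f)"] show ?thesis by (simp add: Gc_tensor lslice_apply)
qed

text \<open>\<open>anti m n\<close> is a version of \<open>S(m) = n\<close> with a domain large enough to be multiplicative.\<close>

definition anti :: "'i bop => 'i bop => bool" where
 "anti m n \<longleftrightarrow> (\<forall>a b c d. nice a b c d \<longrightarrow> nice (m $ a) b c (adj n $ d))"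

lemma anti_iff: "anti m n \<longleftrightarrow>
  (\<forall>a b c d v s. nice a b c d \<longrightarrow> \<langle>b, w v s $ m $ a\<rangle> = \<langle>d, n $ adj (w s v) $ c\<rangle>)"
 unfolding anti_def nice_iff[of "m $ _"] adj_left by blast

text \<open>In \<open>lam_w\<close> the operator \<open>lam a b\<close> may be replaced by
  \<open>adj (lam d c)\<close>; taking the adjoint of the conjugation by W exchanges f and
  u.\<close>

lemma anti_w: "anti (w f u) (adj (w u f))"
 unfolding anti_def
proof (intro allI impI)
 fix a b c d assume n: "nice a b c d"
 have "\<langle>s, lam (w f u $ a) b $ v\<rangle> = \<langle>s, adj (lam (w u f $ d) c) $ v\<rangle>" for s v
 proof -
  have "\<langle>s, lam (w f u $ a) b $ v\<rangle> = \<langle>s \<otimes> u, W $ (adj (lam d c) \<otimes>\<^sub>o 1) $ adj W $ (v \<otimes> f)\<rangle>"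
   using n by (simp add: lam_w cinner_cr_right nice_def)
  also have "\<dots> = \<langle>adj (adj (lam d c) \<otimes>\<^sub>o 1) $ adj W $ (s \<otimes> u), adj W $ (v \<otimes> f)\<rangle>"
   by (simp only: adj_left)
  also have "\<dots> = \<langle>lam (w u f $ d) c $ s, v\<rangle>"
   by (simp add: lam_w cinner_cr_left adj_tensor_op adj_right)
  finally show ?thesis by (simp add: adj_right)
 qed
 then show "nice (w f u $ a) b c (adj (adj (w u f)) $ d)" by (simp add: nice_def bop_cinner_ext)
qed

lemma anti_one: "anti 1 1" by (simp add: anti_def)
lemma anti_zero: "anti 0 0" by (simp add: anti_iff)
lemma anti_add: "anti m n ==> anti m' n' ==> anti (m + m') (n + n')"
 unfolding anti_iff by (simp add: bop_rules ci_rules)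
lemma anti_scaleC: "anti m n ==> anti (k *C m) (k *C n)"
 unfolding anti_iff by (simp add: bop_rules ci_rules)
lemma anti_sum: "(\<And>i. i \<in> I ==> anti (m i) (n i)) ==> anti (\<Sum>i\<in>I. m i) (\<Sum>i\<in>I. n i)"
 by (induction I rule: infinite_finite_induct) (auto intro: anti_add anti_zero)
lemma anti_mult: "anti m n ==> anti m' n' ==> anti (m * m') (n' * n)"
 unfolding anti_def by simp
lemma anti_adj: "anti m n ==> anti (adj n) (adj m)"
 unfolding anti_def using nice_sym by simp

lemma total_adj_w: "total {adj (w v s) $ x | v s x. True}"
 unfolding total_def
proof (intro allI impI)
 fix z assume *: "\<forall>y\<in>{adj (w v s) $ x | v s x. True}. \<langle>y, z\<rangle> = 0"
 obtain v :: "'i ell2" where v: "v \<noteq> 0" using ex_nonzero_ell2 by blast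
 have "W $ (z \<otimes> v) = 0"
 proof (rule totalD[OF total_tensor[OF total_UNIV total_UNIV]])
  fix y :: "('i \<times> 'i) ell2" assume "y \<in> {x \<otimes> s | x s. x \<in> UNIV \<and> s \<in> UNIV}"
  then obtain x s where y: "y = x \<otimes> s" by blast
  have "\<langle>adj (w v s) $ x, z\<rangle> = 0" using * by blast
  then show "\<langle>y, W $ (z \<otimes> v)\<rangle> = 0" by (simp add: y adj_left cinner_rslice)
 qed
 then have "z \<otimes> v = 0" using W_inverse(1)[of "z \<otimes> v"] by simp
 then show "z = 0" using v norm_tensor_vec[of z v] by simp
qed

text \<open>Separation determines the products of n with the \<open>adj (w v s)\<close>, and the
  ranges of the latter are jointly total.\<close>

lemma anti_unique: assumes "anti m n" "anti m n'" shows "n = n'"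
proof (rule bop_ext, rule bcl_eq_on_total[OF bcl_bop bcl_bop total_adj_w])
 fix y assume "y \<in> {adj (w v s) $ x | v s x. True}"
 then obtain v s x where y: "y = adj (w v s) $ x" by blast
 have "(n - n') * adj (w v s) = 0"
 proof (rule nice_separating)
  fix a b c d assume n: "nice a b c d"
  have "\<langle>d, n $ adj (w v s) $ c\<rangle> = \<langle>d, n' $ adj (w v s) $ c\<rangle>" using assms n unfolding anti_iff by metis
  then show "\<langle>d, ((n - n') * adj (w v s)) $ c\<rangle> = 0" by (simp add: cinner_diff_right)
 qed
 from arg_cong[OF this, of "\<lambda>X. X $ x"] show "n $ y = n' $ y" by (simp add: y)
qed

lemma anti_inj: "anti m n ==> anti m' n ==> m = m'"
 using anti_unique[OF anti_adj anti_adj] by (metis adj_adj)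

section \<open>The antipode identities\<close>

lemma nice_Lam: assumes n: "nice a b c d" and X: "X \<in> N" and y: "y \<in> N"
 shows "\<langle>\<Lambda> X, \<Lambda> (L c d y)\<rangle> = \<langle>\<Lambda> (L b a X), \<Lambda> y\<rangle>"
proof -
 have "\<langle>\<Lambda> X, \<Lambda> (L c d y)\<rangle> = \<langle>lam d c $ \<Lambda> X, \<Lambda> y\<rangle>"
  by (simp add: cl_W_adj[OF y, symmetric] cinner_cl_right lslice_apply cinner_cl_left adj_right)
 also have "\<dots> = \<langle>\<Lambda> X, lam a b $ \<Lambda> y\<rangle>" using n by (simp add: nice_def adj_right)
 also have "\<dots> = \<langle>\<Lambda> (L b a X), \<Lambda> y\<rangle>"
  by (simp add: cl_W_adj[OF X, symmetric] cinner_cl_left lslice_apply cinner_cl_right adj_left)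
 finally show ?thesis .
qed

lemma Lam_inj: assumes "x \<in> N" "y \<in> N" "\<Lambda> x = \<Lambda> y" shows "x = y"
proof -
 have d: "x - y \<in> N" and "\<Lambda> (x - y) = 0" using assms by (auto simp: N_diff Lam_diff)
 then have "wr (adj (x - y) * (x - y)) = 0" using norm_Lam[OF d] unfolding nr_sq[symmetric] by (simp del: minus_bop.rep_eq)
 then have 0: "adj (x - y) * (x - y) = 0" by (rule wr_faithful[OF N_Fin[OF d]])
 have "\<langle>(x - y) $ z, (x - y) $ z\<rangle> = 0" for z
  using adj_right[of z "x - y" "(x - y) $ z"] arg_cong[OF 0, of "\<lambda>X. X $ z"] by simp
 then have "x - y = 0" by (intro bop_ext) (simp add: cinner_norm)
 then show ?thesis by simp
qed

lemma Lam_ext: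
 assumes "\<And>y. y \<in> N ==> \<langle>p, \<Lambda> y\<rangle> = \<langle>q, \<Lambda> y\<rangle>" shows "p = q"
proof -
 have "p - q = 0"
 proof (rule totalD[OF total_Lam])
  fix s assume "s \<in> \<Lambda> ` N"
  then have "\<langle>p - q, s\<rangle> = 0" using assms by (auto simp: cinner_diff_left)
  then show "\<langle>s, p - q\<rangle> = 0" by (metis cinner_commute complex_cnj_zero)
 qed
 then show ?thesis by simp
qed

lemma total_N: "total {X $ x | X x. X \<in> N}"
 unfolding total_def
proof (intro allI impI)
 fix s assume *: "\<forall>y\<in>{X $ x | X x. X \<in> N}. \<langle>y, s\<rangle> = 0"
 show "s = 0"
 proof (rule N_nondegenerate')
  fix X assume "X \<in> N"
  then have "\<langle>X $ s, s\<rangle> = 0" using * by blast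
  then show "\<langle>s, X $ s\<rangle> = 0" by (metis cinner_commute complex_cnj_zero)
 qed
qed

lemma lslice_tensor_mult:
 "lslice c d ((p \<otimes>\<^sub>o q) * Y) = q * lslice c (adj p $ d) Y"
proof (rule bop_cinner_ext)
 fix s r
 have "\<langle>s, lslice c d ((p \<otimes>\<^sub>o q) * Y) $ r\<rangle> = \<langle>adj (p \<otimes>\<^sub>o q) $ (d \<otimes> s), Y $ (c \<otimes> r)\<rangle>"
  by (simp add: cinner_lslice adj_left)
 also have "\<dots> = \<langle>s, (q * lslice c (adj p $ d) Y) $ r\<rangle>"
  by (simp add: adj_tensor_op tensor_op_apply cinner_lslice[symmetric] adj_left)
 finally show "\<langle>s, lslice c d ((p \<otimes>\<^sub>o q) * Y) $ r\<rangle> = \<langle>s, (q * lslice c (adj p $ d) Y) $ r\<rangle>" .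
qed

text \<open>Tested on GNS vectors: \<open>nice_Lam\<close> moves the slice to the other argument,
  where \<Delta>(z y) = \<Delta>(z) \<Delta>(y) splits off the terms; \<open>anti\<close> trades
  \<open>g i\<close> in one functional for \<open>h i\<close> in the other, and
  \<open>nice_Lam\<close> leads back.\<close>

lemma antipode_identity_slice:
 assumes z: "z \<in> M" "\<Delta> z = (\<Sum>i\<in>I. g i \<otimes>\<^sub>o b i)" and mem: "\<And>i. i \<in> I ==> b i \<in> M"
  and anti: "\<And>i. i \<in> I ==> anti (h i) (g i)" and n: "nice a e c d" and X: "X \<in> N"
 shows "adj z * L e a X = (\<Sum>i\<in>I. L e (h i $ a) (adj (b i) * X))"
proof (rule Lam_inj)
 have bX: "adj (b i) * X \<in> N" if "i \<in> I" for i using that mem X by (simp add: N_left_ideal)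
 show l: "adj z * L e a X \<in> N" using z X by (intro N_left_ideal L_N) simp_all
 show r: "(\<Sum>i\<in>I. L e (h i $ a) (adj (b i) * X)) \<in> N" by (intro N_sum L_N bX)
 show "\<Lambda> (adj z * L e a X) = \<Lambda> (\<Sum>i\<in>I. L e (h i $ a) (adj (b i) * X))"
 proof (rule Lam_ext)
  fix y assume y: "y \<in> N"
  have yM: "y \<in> M" by (rule N_mem[OF y])
  have L: "L c d (z * y) = (\<Sum>i\<in>I. b i * L c (adj (g i) $ d) y)"
   by (simp only: D_mult[OF z(1) yM] z(2) sum_distrib_right lslice_sum lslice_tensor_mult)
  have "\<Lambda> (adj z * L e a X) = adj z $ \<Lambda> (L e a X)" using z X by (intro Lam_mult L_N) simp_all
  then have "\<langle>\<Lambda> (adj z * L e a X), \<Lambda> y\<rangle> = \<langle>\<Lambda> (L e a X), \<Lambda> (z * y)\<rangle>"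
   using Lam_mult[OF z(1) y] by (simp add: adj_left)
  also have "\<dots> = \<langle>\<Lambda> X, \<Lambda> (L c d (z * y))\<rangle>"
   using nice_Lam[OF n X N_left_ideal[OF z(1) y]] by simp
  also have "\<Lambda> (L c d (z * y)) = (\<Sum>i\<in>I. b i $ \<Lambda> (L c (adj (g i) $ d) y))"
   unfolding L by (subst Lam_sum) (auto intro!: sum.cong Lam_mult N_left_ideal L_N y mem)
  also have "\<langle>\<Lambda> X, \<dots>\<rangle> = (\<Sum>i\<in>I. \<langle>\<Lambda> (adj (b i) * X), \<Lambda> (L c (adj (g i) $ d) y)\<rangle>)"
   unfolding cinner_sum_right by (intro sum.cong refl) (simp add: Lam_mult mem X adj_left)
  also have "\<dots> = (\<Sum>i\<in>I. \<langle>\<Lambda> (L e (h i $ a) (adj (b i) * X)), \<Lambda> y\<rangle>)"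
  proof (intro sum.cong refl nice_Lam bX y)
   fix i assume "i \<in> I"
   then show "nice (h i $ a) e c (adj (g i) $ d)" using anti n by (auto simp: anti_def)
  qed
  also have "\<dots> = \<langle>\<Lambda> (\<Sum>i\<in>I. L e (h i $ a) (adj (b i) * X)), \<Lambda> y\<rangle>"
   by (subst Lam_sum) (auto intro!: L_N bX simp: cinner_sum_left)
  finally show "\<langle>\<Lambda> (adj z * L e a X), \<Lambda> y\<rangle> = \<langle>\<Lambda> (\<Sum>i\<in>I. L e (h i $ a) (adj (b i) * X)), \<Lambda> y\<rangle>" .
 qed
qed

text \<open>In Sweedler notation z2 S^-1(z1) \<otimes> z3 = 1 \<otimes> z, with h = S^-1(g).
  \<open>Q\<close> is the adjoint of the difference; the sliced identity and separation give Q
  \<Delta>(X) = 0 for X in \<open>N\<close>.\<close>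

lemma antipode_identity':
 assumes z: "z \<in> M" "\<Delta> z = (\<Sum>i\<in>I. g i \<otimes>\<^sub>o b i)" and mem: "\<And>i. i \<in> I ==> b i \<in> M"
  and anti: "\<And>i. i \<in> I ==> anti (h i) (g i)"
 shows "1 \<otimes>\<^sub>o z = (\<Sum>i\<in>I. \<Delta> (b i) * (h i \<otimes>\<^sub>o 1))"
proof -
 define Q where "Q = 1 \<otimes>\<^sub>o adj z - (\<Sum>i\<in>I. (adj (h i) \<otimes>\<^sub>o 1) * \<Delta> (adj (b i)))"
 have slice: "lslice e a (Q * \<Delta> X) = adj z * L e a X - (\<Sum>i\<in>I. L e (h i $ a) (adj (b i) * X))"
  if X: "X \<in> M" for e a X
 proof -
  have "(adj (h i) \<otimes>\<^sub>o 1) * \<Delta> (adj (b i)) * \<Delta> X = (adj (h i) \<otimes>\<^sub>o 1) * \<Delta> (adj (b i) * X)" if "i \<in> I" for i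
   using D_mult[of "adj (b i)" X] mem that X by (simp add: mult.assoc)
  then have "Q * \<Delta> X = (1 \<otimes>\<^sub>o adj z) * \<Delta> X - (\<Sum>i\<in>I. (adj (h i) \<otimes>\<^sub>o 1) * \<Delta> (adj (b i) * X))"
   unfolding Q_def left_diff_distrib sum_distrib_right by (intro arg_cong2[of _ _ _ _ minus] sum.cong refl)
  then show ?thesis
   by (simp only: lslice_rules lslice_sum lslice_tensor_mult adj_adj adj_one mult_1_left one_bop.rep_eq)
 qed
 have Q0: "Q * \<Delta> X = 0" if X: "X \<in> N" for X
 proof (rule bop_tensor_cinner_ext)
  fix q' q p' p
  have XM: "X \<in> M" by (rule N_mem[OF X])
  have "adj (rslice q p (Q * \<Delta> X)) = 0"
  proof (rule nice_separating')
   fix a e c d assume n: "nice a e c d"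
   have "adj z * L e a X = (\<Sum>i\<in>I. L e (h i $ a) (adj (b i) * X))"
    by (rule antipode_identity_slice[OF z _ _ n X]) (use mem anti in auto)
   with slice[OF XM] have "lslice e a (Q * \<Delta> X) = 0" by simp
   then have "\<langle>p, lslice e a (Q * \<Delta> X) $ q\<rangle> = 0" by simp
   then have "\<langle>a, rslice q p (Q * \<Delta> X) $ e\<rangle> = 0"
    unfolding cinner_rslice cinner_lslice .
   then show "\<langle>e, adj (rslice q p (Q * \<Delta> X)) $ a\<rangle> = 0"
    unfolding adj_right by (metis cinner_commute complex_cnj_zero)
  qed
  then have 0: "rslice q p (Q * \<Delta> X) = 0" by (metis adj_adj adj_zero)
  have "\<langle>p' \<otimes> p, (Q * \<Delta> X) $ (q' \<otimes> q)\<rangle> = \<langle>p', rslice q p (Q * \<Delta> X) $ q'\<rangle>"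
   by (simp only: cinner_rslice)
  also have "\<dots> = 0" unfolding 0 by simp
  finally show "\<langle>p' \<otimes> p, (Q * \<Delta> X) $ (q' \<otimes> q)\<rangle> = \<langle>p' \<otimes> p, 0 $ (q' \<otimes> q)\<rangle>" by simp
 qed
 \<comment> \<open>Since \<Delta>(X) adj W = adj W (1 \<otimes> X), the vanishing of Q \<Delta>(X)
   means that Q adj W kills all p \<otimes> X x, and these are total.\<close>
 have "Q $ adj W $ \<Omega> = 0" for \<Omega>
 proof (rule bcl_eq_on_tensors[where S = "\<lambda>\<Omega>. Q $ adj W $ \<Omega>" and T = "\<lambda>\<Omega>. 0", OF bcl_comp[OF bcl_bop bcl_bop] bcl_zero_fun _ total_UNIV total_N])
  fix p y assume "y \<in> {X $ x | X x. X \<in> N}"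
  then obtain X x where y: "y = X $ x" "X \<in> N" by blast
  have "(Q * \<Delta> X) $ adj W $ (p \<otimes> x) = 0" unfolding Q0[OF y(2)] by simp
  then show "Q $ adj W $ (p \<otimes> y) = 0" using D_W[OF N_mem[OF y(2)]] by (simp add: y(1) tensor_op_apply)
 qed
 then have "Q $ \<Omega> = 0" for \<Omega> using W_inverse(1)[of \<Omega>] by metis
 then have "Q = 0" by (intro bop_ext) simp
 then have "1 \<otimes>\<^sub>o adj z = (\<Sum>i\<in>I. (adj (h i) \<otimes>\<^sub>o 1) * \<Delta> (adj (b i)))" by (simp add: Q_def)
 from arg_cong[OF this, of adj] show ?thesis using mem by (simp add: adj_sum adj_tensor_op D_adj)
qed

text \<open>The companion S(z1) z2 \<otimes> z3 = 1 \<otimes> z. It is the previous identity for the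
  adjoint of z, because \<open>anti_adj\<close> turns S into its inverse on adjoints.\<close>

lemma antipode_identity:
 assumes z: "z \<in> M" "\<Delta> z = (\<Sum>i\<in>I. g i \<otimes>\<^sub>o b i)" and mem: "\<And>i. i \<in> I ==> b i \<in> M"
  and anti: "\<And>i. i \<in> I ==> anti (g i) (g' i)"
 shows "1 \<otimes>\<^sub>o z = (\<Sum>i\<in>I. (g' i \<otimes>\<^sub>o 1) * \<Delta> (b i))"
proof -
 have "1 \<otimes>\<^sub>o adj z = (\<Sum>i\<in>I. \<Delta> (adj (b i)) * (adj (g' i) \<otimes>\<^sub>o 1))"
  by (rule antipode_identity'[where g = "\<lambda>i. adj (g i)"])
   (use z mem anti anti_adj in "auto simp: D_adj adj_sum adj_tensor_op")
 from arg_cong[OF this, of adj] show ?thesis using mem by (simp add: adj_sum adj_tensor_op D_adj)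
qed

subsection \<open>Approximation by the core of the antipode\<close>

text \<open>Finite sums of vector functionals, with scalars absorbed in the vectors, so that
  inductions are finite; general normal functionals are reached as norm limits in
  \<open>antipode_graph_approx\<close>.\<close>

inductive core :: "'i bop => 'i bop => bool" where
 core_zero: "core 0 0"
| core_step: "core x y ==> core (w v s + x) (adj (w s v) + y)"

lemma core_mem: "core x y ==> x \<in> M \<and> y \<in> M"
 by (induction rule: core.induct) (simp_all add: add_mem)

lemma core_anti: "core x y ==> anti x y"
 by (induction rule: core.induct) (auto intro: anti_add anti_w anti_zero)

lemma T_w: "T a b (w v s) = w (lam a b $ v) s"
 by (rule bop_cinner_ext) (simp add: cinner_rslice D_w lslice_apply)

lemma L_w: "L a b (w v s) = w v (adj (lam a b) $ s)"
proof (rule bop_cinner_ext)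
 fix x y
 have "cl a (adj W $ (b \<otimes> s)) = adj (lam a b) $ s"
  by (rule cinner_ext, unfold adj_right cinner_cl_right lslice_apply cinner_cl_left) simp
 then show "\<langle>y, L a b (w v s) $ x\<rangle> = \<langle>y, w v (adj (lam a b) $ s) $ x\<rangle>"
  unfolding cinner_lslice D_w_adj by simp
qed

text \<open>Slicing the coproduct of \<open>w v s\<close> only moves one of its vectors by a
  \<open>lam\<close>, and for a nice quadruple the corresponding vector of the second member moves
  in the same way. The antipode exchanges left and right slices.\<close>

lemma core_slice: assumes "core x y" and n: "nice a b c d"
 shows "core (T a b x) (L c d y) \<and> core (L a b x) (T c d y)"
 using assms(1)
proof (induction rule: core.induct)
 case (core_step x y v s)
 have adjs: "L c d (adj m) = adj (L d c m)" "T c d (adj m) = adj (T d c m)" if "m \<in> M" for m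
  using that by (simp_all add: D_adj adj_lslice adj_rslice)
 have l: "adj (lam d c) = lam a b" "adj (lam a b) = lam d c" using n by (simp_all add: nice_def)
 have m: "x \<in> M" "y \<in> M" using core_mem core_step by auto
 have "core (w (lam a b $ v) s + T a b x) (adj (w s (lam a b $ v)) + L c d y)"
  "core (w v (lam d c $ s) + L a b x) (adj (w (lam d c $ s) v) + T c d y)"
  using core_step by (auto intro: core.core_step)
 then show ?case
  using m by (simp add: D_add rslice_rules lslice_rules adjs L_w T_w l del: adj_lslice adj_rslice)
qed (simp add: D_zero core_zero rslice_rules lslice_rules)

text \<open>The \<open>\<sigma>\<close>-weak closure of the core, described by its annihilator.\<close>

definition SG :: "'i bop => 'i bop => bool" where
 "SG x y \<longleftrightarrow> x \<in> M \<and> y \<in> M \<and>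
  (\<forall>f g. normal_on M f \<and> normal_on M g \<and> (\<forall>x y. core x y \<longrightarrow> f x = g y) \<longrightarrow> f x = g y)"

lemma SG_mem: "SG x y ==> x \<in> M" "SG x y ==> y \<in> M" by (simp_all add: SG_def)

lemma SG_eq:
 "SG x y ==> normal_on M f ==> normal_on M g ==> (\<And>x y. core x y ==> f x = g y) ==> f x = g y"
 unfolding SG_def by blast

lemma normal_on_small:
 assumes "normal_on M h" "e > 0"
 shows "\<exists>F \<delta>. finite F \<and> F \<subseteq> predual \<and> \<delta> > 0 \<and> (\<forall>T\<in>M. (\<forall>\<omega>\<in>F. cmod (\<omega> T) < \<delta>) \<longrightarrow> cmod (h T) < e)"
proof -
 obtain F \<delta> where F: "finite F" "F \<subseteq> predual" "\<delta> > 0" "\<And>T. T \<in> M ==> \<forall>\<omega>\<in>F. cmod (\<omega> T) < \<delta> ==> cmod (h T) < 1"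
  using assms(1) unfolding normal_on_def by metis
 have "cmod (h T) < e" if T: "T \<in> M" "\<forall>\<omega>\<in>F. cmod (\<omega> T) < \<delta> * e" for T
 proof -
  have "cmod (\<omega> (of_real (1 / e) *C T)) < \<delta>" if "\<omega> \<in> F" for \<omega>
  proof -
   have "cmod (\<omega> (of_real (1 / e) *C T)) = cmod (\<omega> T) / e"
    using predual_scaleC[of \<omega>] F(2) that assms(2) by (auto simp: norm_mult norm_divide)
   also have "\<dots> < \<delta>" using T(2) that assms(2) by (simp add: divide_less_eq)
   finally show ?thesis .
  qed
  then have "cmod (h (of_real (1 / e) *C T)) < 1" using F(4) T by (simp add: scaleC_mem)
  also have "h (of_real (1 / e) *C T) = of_real (1 / e) * h T" using assms(1) T unfolding normal_on_def by blast
  finally show ?thesis using assms(2) by (simp add: norm_mult norm_divide divide_less_eq)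
 qed
 then show ?thesis using F assms(2) by (intro exI[of _ F] exI[of _ "\<delta> * e"]) auto
qed

lemma normal_on_family_small:
 assumes "finite \<G>" "\<And>h. h \<in> \<G> ==> normal_on M h" "e > 0"
 shows "\<exists>F \<delta>. finite F \<and> F \<subseteq> predual \<and> \<delta> > 0 \<and> (\<forall>T\<in>M. (\<forall>\<omega>\<in>F. cmod (\<omega> T) < \<delta>) \<longrightarrow> (\<forall>h\<in>\<G>. cmod (h T) < e))"
 using assms
proof (induction \<G> rule: finite_induct)
 case empty
 show ?case by (intro exI[of _ "{}"] exI[of _ 1]) simp
next
 case (insert h \<G>)
 obtain F \<delta> where F: "finite F" "F \<subseteq> predual" "\<delta> > 0" "\<And>T. T \<in> M ==> \<forall>\<omega>\<in>F. cmod (\<omega> T) < \<delta> ==> \<forall>h\<in>\<G>. cmod (h T) < e"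
  using insert.IH[OF insert.prems(1,2)] by (metis insertI2)
 obtain F' \<delta>' where F': "finite F'" "F' \<subseteq> predual" "\<delta>' > 0" "\<And>T. T \<in> M ==> \<forall>\<omega>\<in>F'. cmod (\<omega> T) < \<delta>' ==> cmod (h T) < e"
  using normal_on_small[of h e] insert.prems by (metis insertI1)
 show ?case
  by (rule exI[of _ "F \<union> F'"], rule exI[of _ "min \<delta> \<delta>'"]) (use F F' in auto)
qed

lemma normal_on_map:
 assumes h: "normal_on M h" and f: "\<And>\<omega>. \<omega> \<in> predual ==> normal_on M (\<lambda>m. \<omega> (f m))" "\<And>m. m \<in> M ==> f m \<in> M"
  "\<And>m m'. m \<in> M ==> m' \<in> M ==> f (m - m') = f m - f m'" "\<And>c m. m \<in> M ==> f (c *C m) = c *C f m"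
 shows "normal_on M (\<lambda>m. h (f m))"
proof -
 obtain F \<delta> where F: "finite F" "F \<subseteq> predual" "\<delta> > 0" "\<And>T. T \<in> M ==> \<forall>\<omega>\<in>F. cmod (\<omega> T) < \<delta> ==> cmod (h T) < 1"
  using h unfolding normal_on_def by metis
 have n: "normal_on M h'" if "h' \<in> (\<lambda>\<omega> m. \<omega> (f m)) ` F" for h' using that F(2) f(1) by auto
 obtain F' \<delta>' where F': "finite F'" "F' \<subseteq> predual" "\<delta>' > 0" "\<forall>T\<in>M. (\<forall>\<omega>\<in>F'. cmod (\<omega> T) < \<delta>') \<longrightarrow> (\<forall>h\<in>(\<lambda>\<omega> m. \<omega> (f m)) ` F. cmod (h T) < \<delta>)"
  by (rule exE[OF normal_on_family_small[OF finite_imageI[OF F(1)] n F(3)]], assumption, elim exE conjE, rule that)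
 have "cmod (h (f T)) < 1" if "T \<in> M" "\<forall>\<omega>\<in>F'. cmod (\<omega> T) < \<delta>'" for T
  by (rule F(4)) (use f(2) F'(4) that in auto)
 then have "\<exists>F' \<delta>'. finite F' \<and> F' \<subseteq> predual \<and> \<delta>' > 0 \<and> (\<forall>T\<in>M. (\<forall>\<omega>\<in>F'. cmod (\<omega> T) < \<delta>') \<longrightarrow> cmod (h (f T)) < 1)"
  using F'(1-3) by (intro exI[of _ F'] exI[of _ \<delta>']) simp
 then show ?thesis using h f(2-4) unfolding normal_on_def by simp
qed

lemma SG_nice: assumes "SG x y" "nice a b c d" shows "\<langle>b, x $ a\<rangle> = \<langle>d, y $ c\<rangle>"
proof (rule SG_eq[OF assms(1) normal_on_predual[OF vector_predual] normal_on_predual[OF vector_predual]])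
 fix x y assume "core x y"
 then show "\<langle>b, x $ a\<rangle> = \<langle>d, y $ c\<rangle>"
  by (induction rule: core.induct) (use assms(2) in "auto simp: nice_iff cinner_add_right")
qed

lemma SG_anti: assumes "SG x y" shows "anti x y"
 unfolding anti_iff
proof (intro allI impI)
 fix a b c d v s assume n: "nice a b c d"
 have f: "normal_on M (\<lambda>x. \<langle>b, w v s $ x $ a\<rangle>)"
  using normal_on_predual[OF vector_predual, of M "adj (w v s) $ b" a] by (simp add: adj_left)
 show "\<langle>b, w v s $ x $ a\<rangle> = \<langle>d, y $ adj (w s v) $ c\<rangle>"
  by (rule SG_eq[OF assms f normal_on_predual[OF vector_predual]])
   (use core_anti n in "auto simp: anti_iff")
qed

lemma normal_on_linear:
 assumes f: "normal_on M f"
 shows "x \<in> M ==> f (k *C x) = k * f x" "x \<in> M ==> y \<in> M ==> f (x + y) = f x + f y" "f 0 = 0"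
proof -
 show sc: "f (k *C x) = k * f x" if "x \<in> M" for k x using f that unfolding normal_on_def by blast
 show "f 0 = 0" using sc[of 0 0] by simp
 have d: "f (x - y) = f x - f y" if "x \<in> M" "y \<in> M" for x y using f that unfolding normal_on_def by blast
 show "f (x + y) = f x + f y" if x: "x \<in> M" and y: "y \<in> M"
  using d[OF x scaleC_mem[OF y, of "-1"]] sc[OF y, of "-1"] by (simp add: scaleC_one)
qed

lemma SG_scaleC: "SG x y ==> SG (k *C x) (k *C y)"
 unfolding SG_def by (simp add: normal_on_linear)

lemma SG_zero: "SG 0 0"
 unfolding SG_def by (simp add: normal_on_linear)

lemma SG_add: assumes "SG x y" "SG x' y'" shows "SG (x + x') (y + y')"
proof -
 have m: "x \<in> M" "y \<in> M" "x' \<in> M" "y' \<in> M" using assms by (simp_all add: SG_def)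
 have "f (x + x') = g (y + y')" if "normal_on M f" "normal_on M g" "\<forall>x y. core x y \<longrightarrow> f x = g y" for f g
  using SG_eq[OF assms(1) that(1,2)] SG_eq[OF assms(2) that(1,2)] that m by (simp add: normal_on_linear)
 then show ?thesis using m unfolding SG_def by simp
qed

text \<open>Precomposition with slices of \<Delta> keeps functionals normal and, by
  \<open>core_slice\<close>, preserves agreement on the core. For a closure described by its
  annihilator this is stability under slicing.\<close>

lemma SG_slice: assumes "SG x y" "nice a b c d"
 shows "SG (T a b x) (L c d y)" "SG (L a b x) (T c d y)"
proof -
 have n: "normal_on M (\<lambda>m. h (T a b m))" "normal_on M (\<lambda>m. h (L a b m))" if h: "normal_on M h" for h a b
 proof -
  have "normal_on M (\<lambda>m. \<omega> (T a b m))" "normal_on M (\<lambda>m. \<omega> (L a b m))" if "\<omega> \<in> predual" for \<omega>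
   by (rule normal_on_comp[OF D_hom predual_slice(1)[OF that] vna_axioms] normal_on_comp[OF D_hom predual_slice(2)[OF that] vna_axioms])+
  then show "normal_on M (\<lambda>m. h (T a b m))" "normal_on M (\<lambda>m. h (L a b m))"
   by (auto intro!: normal_on_map[OF h] simp: D_diff D_scaleC rslice_rules lslice_rules)
 qed
 have m: "x \<in> M" "y \<in> M" using assms(1) by (auto dest: SG_mem)
 have "f (T a b x) = g (L c d y)" if "normal_on M f" "normal_on M g" "\<forall>x y. core x y \<longrightarrow> f x = g y" for f g
  by (rule SG_eq[OF assms(1) n(1)[OF that(1)] n(2)[OF that(2)]]) (use core_slice[OF _ assms(2)] that(3) in simp)
 then show "SG (T a b x) (L c d y)" using m unfolding SG_def by simp
 have "f (L a b x) = g (T c d y)" if "normal_on M f" "normal_on M g" "\<forall>x y. core x y \<longrightarrow> f x = g y" for f g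
  by (rule SG_eq[OF assms(1) n(2)[OF that(1)] n(1)[OF that(2)]]) (use core_slice[OF _ assms(2)] that(3) in simp)
 then show "SG (L a b x) (T c d y)" using m unfolding SG_def by simp
qed

section \<open>From the graph of the antipode to its normal functionals\<close>

lemma sigma_strong_star_neighbourhood:
 fixes x :: "'k bop"
 assumes "finite F" "F \<subseteq> predual" "0 < \<epsilon>"
 shows "\<exists>U. openin sigma_strong_star U \<and> x \<in> U \<and> (\<forall>T\<in>U. \<forall>\<omega>\<in>F. cmod (\<omega> (T - x)) < \<epsilon>)"
 using assms(1,2)
proof (induction F rule: finite_induct)
 case empty
 have "openin sigma_strong_star {T :: 'k bop. (\<Sum>n. (norm ((T - x) $ (0 :: 'k ell2)))^2 + (norm (adj (T - x) $ (0 :: 'k ell2)))^2) < 1}"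
  unfolding sigma_strong_star_def openin_topology_generated_by_iff
  by (rule generate_topology_on.Basis, rule CollectI, rule exI[of _ "\<lambda>_. 0"], rule exI[of _ x], rule exI[of _ 1]) (simp add: sq_summable_def)
 then show ?case by (intro exI conjI) auto
next
 case (insert \<omega> F)
 obtain U where U: "openin sigma_strong_star U" "x \<in> U" "\<forall>T\<in>U. \<forall>\<omega>\<in>F. cmod (\<omega> (T - x)) < \<epsilon>"
  using insert by blast
 obtain \<xi> \<eta> where sq: "sq_summable \<xi>" "sq_summable \<eta>" and \<omega>: "\<omega> = (\<lambda>T. \<Sum>n. \<langle>\<eta> n, T $ \<xi> n\<rangle>)"
  using insert.prems by (auto simp: predual_def)
 \<comment> \<open>With this weight and the radius \<epsilon> t, the estimate of
   \<open>predual_bound\<close> is the mean of a number below \<epsilon> and of \<epsilon>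
   itself.\<close>
 define t where "t = \<epsilon> / ((\<Sum>n. (norm (\<eta> n))^2) + 1)"
 have h: "0 \<le> (\<Sum>n. (norm (\<eta> n))^2)" using sq(2) unfolding sq_summable_def by (rule suminf_nonneg) simp
 have t: "t > 0" "t * (\<Sum>n. (norm (\<eta> n))^2) < \<epsilon>" using assms(3) h by (simp_all add: t_def field_simps)
 define V where "V = {T. (\<Sum>n. (norm ((T - x) $ \<xi> n))^2 + (norm (adj (T - x) $ \<xi> n))^2) < \<epsilon> * t}"
 have V: "openin sigma_strong_star V"
  unfolding sigma_strong_star_def openin_topology_generated_by_iff V_def
  by (rule generate_topology_on.Basis, rule CollectI, rule exI[of _ \<xi>], rule exI[of _ x], rule exI[of _ "\<epsilon> * t"]) (use sq assms(3) t in simp)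
 have xV: "x \<in> V" using assms(3) t by (simp add: V_def)
 have "cmod (\<omega> (T - x)) < \<epsilon>" if T: "T \<in> V" for T
 proof -
  have sm: "summable (\<lambda>n. (norm (S $ \<xi> n))^2)" for S :: "'k bop"
   by (rule summableI_nonneg_bounded[OF _ sq_summable_apply_bound[OF sq(1)]]) simp
  have "(\<Sum>n<K. (norm ((T - x) $ \<xi> n))^2) \<le> \<epsilon> * t" for K
  proof -
   have "(\<Sum>n<K. (norm ((T - x) $ \<xi> n))^2) \<le> (\<Sum>n<K. (norm ((T - x) $ \<xi> n))^2 + (norm (adj (T - x) $ \<xi> n))^2)"
    by (rule sum_mono) simp
   also have "\<dots> \<le> (\<Sum>n. (norm ((T - x) $ \<xi> n))^2 + (norm (adj (T - x) $ \<xi> n))^2)"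
    by (rule sum_le_suminf[OF summable_add[OF sm sm]]) auto
   finally show ?thesis using T by (simp add: V_def del: minus_bop.rep_eq adj_diff)
  qed
  from predual_bound(2)[OF sq t(1) this] have "cmod (\<omega> (T - x)) \<le> (t * (\<Sum>n. (norm (\<eta> n))^2) + \<epsilon> * t / t) / 2"
   unfolding \<omega> .
  also have "\<dots> < \<epsilon>" using t by simp
  finally show ?thesis .
 qed
 then show ?case using U V xV by (intro exI[of _ "U \<inter> V"]) auto
qed

lemma antipode_graph_approx:
 assumes "(x, y) \<in> antipode_graph G" and F: "finite F" "F \<subseteq> predual" "0 < \<epsilon>"
 obtains x' y' where "core x' y'" "\<And>\<omega>. \<omega> \<in> F ==> cmod (\<omega> (x - x')) < \<epsilon>" "\<And>\<omega>. \<omega> \<in> F ==> cmod (\<omega> (y - y')) < \<epsilon>"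
proof -
 have e: "0 < \<epsilon> / 2" using F by simp
 obtain U where U: "openin sigma_strong_star U" "x \<in> U" "\<forall>T\<in>U. \<forall>\<omega>\<in>F. cmod (\<omega> (T - x)) < \<epsilon> / 2"
  using sigma_strong_star_neighbourhood[OF F(1,2) e] by blast
 obtain V where V: "openin sigma_strong_star V" "y \<in> V" "\<forall>T\<in>V. \<forall>\<omega>\<in>F. cmod (\<omega> (T - y)) < \<epsilon> / 2"
  using sigma_strong_star_neighbourhood[OF F(1,2) e] by blast
 have UV: "openin (prod_topology sigma_strong_star sigma_strong_star) (U \<times> V)" "(x, y) \<in> U \<times> V"
  using U V by (simp_all add: openin_prod_Times_iff)
 have "(x, y) \<in> U \<times> V \<and> openin (prod_topology sigma_strong_star sigma_strong_star) (U \<times> V)" using UV by simp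
 from mp[OF spec[OF conjunct2[OF assms(1)[unfolded antipode_graph_def in_closure_of]], of "U \<times> V"] this]
 obtain \<omega>0 where w0: "\<omega>0 \<in> predual" "slice_right \<omega>0 W \<in> U" "slice_right \<omega>0 (adj W) \<in> V" by auto
 obtain \<xi> \<eta> where sq: "sq_summable \<xi>" "sq_summable \<eta>" and \<omega>: "\<omega>0 = (\<lambda>T. \<Sum>n. \<langle>\<eta> n, T $ \<xi> n\<rangle>)"
  using w0(1) by (auto simp: predual_def)
 define P Q where "P = (\<lambda>N. \<Sum>n<N. w (\<xi> n) (\<eta> n))" and "Q = (\<lambda>N. \<Sum>n<N. adj (w (\<eta> n) (\<xi> n)))"
 have PQ: "core (P n) (Q n)" for n
  by (induction n) (auto simp: P_def Q_def add.commute intro: core.intros)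
 have lim: "P \<longlonglongrightarrow> slice_right \<omega>0 W" "Q \<longlonglongrightarrow> slice_right \<omega>0 (adj W)"
  using slice_right_sums[OF sq, of W] slice_right_sums[OF sq, of "adj W"]
  by (simp_all add: sums_def P_def Q_def \<omega> adj_rslice)
 have small: "\<forall>\<^sub>F n in sequentially. cmod (\<omega> (z - X n)) < \<epsilon> / 2" if lim: "X \<longlonglongrightarrow> z" and F': "\<omega> \<in> F" for X \<omega> and z :: "'i bop"
 proof -
  obtain C where C: "C \<ge> 0" "\<And>T. cmod (\<omega> T) \<le> C * norm T" using predual_norm_bound[OF subsetD[OF F(2) F']] by metis
  have "(\<lambda>n. C * norm (z - X n)) \<longlonglongrightarrow> C * norm (z - z)" by (intro tendsto_intros lim)
  then have "\<forall>\<^sub>F n in sequentially. C * norm (z - X n) < \<epsilon> / 2" by (rule order_tendstoD(2)) (use e in simp)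
  then show ?thesis by eventually_elim (use C(2) order_le_less_trans in blast)
 qed
 have "\<forall>\<^sub>F n in sequentially. \<forall>\<omega>\<in>F. cmod (\<omega> (slice_right \<omega>0 W - P n)) < \<epsilon> / 2 \<and> cmod (\<omega> (slice_right \<omega>0 (adj W) - Q n)) < \<epsilon> / 2"
  by (intro eventually_ball_finite F(1) ballI eventually_conj small lim)
 then obtain n where n: "\<And>\<omega>. \<omega> \<in> F ==> cmod (\<omega> (slice_right \<omega>0 W - P n)) < \<epsilon> / 2" "\<And>\<omega>. \<omega> \<in> F ==> cmod (\<omega> (slice_right \<omega>0 (adj W) - Q n)) < \<epsilon> / 2"
  unfolding eventually_sequentially by blast
 have tri: "cmod (\<omega> (p - r)) < \<epsilon>" if "\<omega> \<in> F" "cmod (\<omega> (q - p)) < \<epsilon> / 2" "cmod (\<omega> (q - r)) < \<epsilon> / 2" for \<omega> and p q r :: "'i bop"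
 proof -
  have "\<omega> (p - r) = \<omega> (q - r) - \<omega> (q - p)" using F(2) that(1) predual_diff[of \<omega>] by auto
  then show ?thesis using norm_triangle_ineq4[of "\<omega> (q - r)" "\<omega> (q - p)"] that by simp
 qed
 show thesis
  by (rule that[OF PQ[of n]]) (use tri n U(3) V(3) w0(2,3) in blast)+
qed

lemma antipode_graph_mem: assumes "(x, y) \<in> antipode_graph G" shows "x \<in> M" "y \<in> M"
proof -
 have *: "S * x = x * S \<and> S * y = y * S" if S: "S \<in> commutant M" for S
 proof -
  have "\<langle>p, S $ x $ q\<rangle> = \<langle>p, x $ S $ q\<rangle> \<and> \<langle>p, S $ y $ q\<rangle> = \<langle>p, y $ S $ q\<rangle>" for p q
  proof -
   define f g where "f = (\<lambda>T. \<langle>adj S $ p, T $ q\<rangle>)" and "g = (\<lambda>T. \<langle>p, T $ S $ q\<rangle>)"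
   have fg: "f \<in> predual" "g \<in> predual" unfolding f_def g_def by (rule vector_predual)+
   have "cmod (f x - g x) \<le> e \<and> cmod (f y - g y) \<le> e" if e: "0 < e" for e
   proof -
    obtain x' y' where c: "core x' y'" and *: "\<And>\<omega>. \<omega> \<in> {f, g} ==> cmod (\<omega> (x - x')) < e / 2" "\<And>\<omega>. \<omega> \<in> {f, g} ==> cmod (\<omega> (y - y')) < e / 2"
     by (rule antipode_graph_approx[OF assms, of "{f, g}" "e / 2"]) (use fg e in auto)
    have fz: "f z = g z" if "z \<in> M" for z
    proof -
     have "S * z = z * S" using S that by (simp add: commutant_def)
     from arg_cong[OF this, of "\<lambda>X. X $ q"] show ?thesis by (simp add: f_def g_def adj_left)
    qed
    have eq: "f z' - g z' = f (z' - z) - g (z' - z)" if "z \<in> M" for z z'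
     unfolding predual_diff[OF fg(1)] predual_diff[OF fg(2)] fz[OF that] by simp
    have "cmod (f z' - g z') \<le> cmod (f (z' - z)) + cmod (g (z' - z))" if "z \<in> M" for z z'
     by (subst eq[OF that]) (rule norm_triangle_ineq4)
    from this[of x' x] this[of y' y] show ?thesis
     using *(1)[of f] *(1)[of g] *(2)[of f] *(2)[of g] core_mem[OF c] by simp
   qed
   then have "cmod (f x - g x) \<le> 0" "cmod (f y - g y) \<le> 0"
    using field_le_epsilon[of "cmod (f x - g x)" 0] field_le_epsilon[of "cmod (f y - g y)" 0] by simp_all
   then show ?thesis by (simp add: f_def g_def adj_left)
  qed
  then show ?thesis by (auto intro!: bop_cinner_ext)
 qed
 show "x \<in> M" "y \<in> M" using * by (simp_all add: memI)
qed

lemma antipode_graph_SG: assumes xy: "(x, y) \<in> antipode_graph G" shows "SG x y"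
 unfolding SG_def
proof (intro conjI allI impI; (elim conjE)?)
 show m: "x \<in> M" "y \<in> M" using antipode_graph_mem[OF xy] by auto
 fix f g assume n: "normal_on M f" "normal_on M g" and eq: "\<forall>x y. core x y \<longrightarrow> f x = g y"
 have "cmod (f x - g y) \<le> e" if e: "0 < e" for e
 proof -
  have e2: "0 < e / 2" using e by simp
  have "\<exists>F \<delta>. finite F \<and> F \<subseteq> predual \<and> \<delta> > 0 \<and> (\<forall>T\<in>M. (\<forall>\<omega>\<in>F. cmod (\<omega> T) < \<delta>) \<longrightarrow> (\<forall>h\<in>{f, g}. cmod (h T) < e / 2))"
   by (rule normal_on_family_small[OF _ _ e2]) (use n in auto)
  then obtain F \<delta> where F: "finite F" "F \<subseteq> predual" "\<delta> > 0"
   "\<And>T. T \<in> M ==> \<forall>\<omega>\<in>F. cmod (\<omega> T) < \<delta> ==> cmod (f T) < e / 2 \<and> cmod (g T) < e / 2" by (metis insertI1 insertI2)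
  obtain x' y' where c: "core x' y'" "\<And>\<omega>. \<omega> \<in> F ==> cmod (\<omega> (x - x')) < \<delta>" "\<And>\<omega>. \<omega> \<in> F ==> cmod (\<omega> (y - y')) < \<delta>"
   by (rule antipode_graph_approx[OF xy F(1-3)]) (rule that)
  have c': "x' \<in> M" "y' \<in> M" "f x' = g y'" using core_mem[OF c(1)] eq c(1) by auto
  have "f (x - x') = f x - f x'" "g (y - y') = g y - g y'" using n m c' unfolding normal_on_def by blast+
  then have "f x - g y = f (x - x') - g (y - y')" using c'(3) by simp
  also have "cmod \<dots> \<le> cmod (f (x - x')) + cmod (g (y - y'))" by (rule norm_triangle_ineq4)
  finally show ?thesis using F(4)[of "x - x'"] F(4)[of "y - y'"] c(2,3) m c' by (simp add: diff_mem)
 qed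
 then have "cmod (f x - g y) \<le> 0" using field_le_epsilon[of "cmod (f x - g y)" 0] by simp
 then show "f x = g y" by simp
qed

end

subsection \<open>Finite-rank tensors\<close>

definition lin_indep :: "nat => (nat => 'i bop) => bool" where
 "lin_indep n b \<longleftrightarrow> (\<forall>c. (\<Sum>i<n. c i *C b i) = 0 \<longrightarrow> (\<forall>i<n. c i = 0))"

lemma lin_indepD: "lin_indep n b ==> (\<Sum>i<n. c i *C b i) = 0 ==> i < n ==> c i = 0"
 by (simp add: lin_indep_def)

lemma lin_indep_cinner:
 assumes "lin_indep n b" "i < n" and eq: "\<And>x y. (\<Sum>i<n. \<langle>x, b i $ y\<rangle> * c i) = (\<Sum>i<n. \<langle>x, b i $ y\<rangle> * d i)"
 shows "c i = d i"
proof -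
 have "(\<Sum>i<n. (c i - d i) *C b i) = 0"
  by (rule bop_cinner_ext)
   (use eq in "simp add: bop_sum_left cinner_sum_right cinner_scaleC_right left_diff_distrib sum_subtractf mult.commute")
 from lin_indepD[OF assms(1) this assms(2)] show ?thesis by simp
qed

lemma lin_indep_tensor:
 assumes "lin_indep n b" "i < n" and eq: "(\<Sum>i<n. X i \<otimes>\<^sub>o b i) = (\<Sum>i<n. Y i \<otimes>\<^sub>o b i)"
 shows "X i = Y i"
proof (rule bop_cinner_ext)
 fix p q
 show "\<langle>q, X i $ p\<rangle> = \<langle>q, Y i $ p\<rangle>"
 proof (rule lin_indep_cinner[OF assms(1,2)])
  fix x y
  show "(\<Sum>i<n. \<langle>x, b i $ y\<rangle> * \<langle>q, X i $ p\<rangle>) = (\<Sum>i<n. \<langle>x, b i $ y\<rangle> * \<langle>q, Y i $ p\<rangle>)"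
   using arg_cong[OF eq, of "\<lambda>Z. \<langle>q \<otimes> x, Z $ (p \<otimes> y)\<rangle>"]
   by (simp add: bop_sum_left cinner_sum_right tensor_op_apply cinner_tensor mult.commute)
 qed
qed

text \<open>A linear relation among the \<open>b i\<close> lets the k-th term be absorbed by the
  others, against minimality. The bilinear map \<open>B\<close> is abstract so that both legs of a
  tensor are covered.\<close>

lemma lin_indep_if_minimal:
 fixes B :: "'i bop => 'i bop => 'j bop"
 assumes B: "\<And>x y z. B (x + y) z = B x z + B y z" "\<And>x y z. B z (x + y) = B z x + B z y"
   "\<And>c x y. B (c *C x) y = c *C B x y" "\<And>c x y. B x (c *C y) = c *C B x y"
  and X: "X = (\<Sum>i<n. B (a i) (b i))" and M: "\<And>i. a i \<in> M" "\<And>x y. x \<in> M ==> y \<in> M ==> x + y \<in> M" "\<And>c x. x \<in> M ==> c *C x \<in> M"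
  and min: "\<And>J a'. finite J ==> X = (\<Sum>i\<in>J. B (a' i) (b i)) ==> (\<And>i. a' i \<in> M) ==> n \<le> card (J :: nat set)"
 shows "lin_indep n b"
 unfolding lin_indep_def
proof (intro allI impI, rule ccontr)
 fix c k assume c: "(\<Sum>i<n. c i *C b i) = 0" and k: "k < n" "c k \<noteq> 0"
 define a' where "a' i = a i + (- (c i / c k)) *C a k" for i
 have zero: "B x 0 = 0" "B 0 x = 0" for x using B(3)[of 0 0 x] B(4)[of x 0 0] by simp_all
 have "(\<Sum>i<m. B x (c i *C b i)) = B x (\<Sum>i<m. c i *C b i)" for x m by (induction m) (simp_all add: B zero)
 from this[of "(- inverse (c k)) *C a k" n] have "0 = (\<Sum>i<n. B ((- inverse (c k)) *C a k) (c i *C b i))"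
  unfolding c zero by simp
 also have "\<dots> = (\<Sum>i<n. B ((- (c i / c k)) *C a k) (b i))"
  by (intro sum.cong refl) (simp only: B scaleC_scaleC divide_inverse mult_minus_left mult_minus_right mult.commute)
 finally have "(\<Sum>i<n. B (a' i) (b i)) = X"
  unfolding a'_def B(1) sum.distrib X by simp
 moreover have "a' k = 0" using k(2) by (simp add: a'_def scaleC_one complex_vector.scale_minus_left)
 ultimately have "X = (\<Sum>i\<in>{..<n} - {k}. B (a' i) (b i))" using k(1) by (simp add: sum.remove zero)
 then have "n \<le> card ({..<n} - {k})" by (rule min[rotated]) (unfold a'_def, intro M, simp)
 then show False using k(1) by simp
qed

lemma (in vna) minimal_decomposition:
 assumes "X \<in> M \<odot> M"
 obtains n a b where "X = (\<Sum>i<n. a i \<otimes>\<^sub>o b i)" "\<And>i. a i \<in> M" "\<And>i. b i \<in> M" "lin_indep n a" "lin_indep n b"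
proof -
 \<comment> \<open>Index sets are arbitrary finite sets of naturals, because dropping a term need
   not leave an initial segment.\<close>
 define P where "P k \<longleftrightarrow> (\<exists>(J :: nat set) a b. finite J \<and> card J = k \<and> (\<forall>i. a i \<in> M \<and> b i \<in> M) \<and> X = (\<Sum>i\<in>J. a i \<otimes>\<^sub>o b i))"
  for k :: nat
 have "\<exists>(n :: nat) a b. (\<forall>i. a i \<in> M \<and> b i \<in> M) \<and> X = (\<Sum>i<n. a i \<otimes>\<^sub>o b i)"
  using assms unfolding alg_tensor_def
 proof (induction rule: complex_vector.span_induct_alt)
  case base
  show ?case by (rule exI[of _ 0], rule exI[of _ "\<lambda>_. 0"], rule exI[of _ "\<lambda>_. 0"]) simp
 next
  case (step c y X)
  then obtain n :: nat and a b where X: "\<forall>i. a i \<in> M \<and> b i \<in> M" "X = (\<Sum>i<n. a i \<otimes>\<^sub>o b i)" by blast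
  obtain p q where y: "y = p \<otimes>\<^sub>o q" "p \<in> M" "q \<in> M" using step by blast
  show ?case
   by (rule exI[of _ "Suc n"], rule exI[of _ "\<lambda>i. if i < n then a i else c *C p"], rule exI[of _ "\<lambda>i. if i < n then b i else q"])
    (use X y in "auto simp: tensor_op_scaleC_left")
 qed
 then obtain k :: nat and a b where "\<forall>i. a i \<in> M \<and> b i \<in> M" "X = (\<Sum>i<k. a i \<otimes>\<^sub>o b i)" by blast
 then have "P k"
  unfolding P_def by (intro exI[of _ "{..<k}"] exI[of _ a] exI[of _ b]) simp
 define n where "n = (LEAST k. P k)"
 have "P n" unfolding n_def by (rule LeastI) fact
 then obtain J :: "nat set" and a b where J: "finite J" "card J = n" "\<And>i. a i \<in> M" "\<And>i. b i \<in> M" "X = (\<Sum>i\<in>J. a i \<otimes>\<^sub>o b i)"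
  unfolding P_def by (elim exE conjE) (rule that, auto)
 obtain h where "bij_betw h {0..<n} J" using ex_bij_betw_nat_finite[OF J(1)] J(2) by blast
 then have X: "X = (\<Sum>i<n. a (h i) \<otimes>\<^sub>o b (h i))"
  unfolding J(5) by (simp add: sum.reindex_bij_betw[of h, symmetric] lessThan_atLeast0)
 have min: "n \<le> card J'" if "finite J'" "X = (\<Sum>i\<in>J'. a' i \<otimes>\<^sub>o b' i)" "\<And>i. a' i \<in> M" "\<And>i. b' i \<in> M" for J' :: "nat set" and a' b'
  unfolding n_def by (rule Least_le) (unfold P_def, rule exI[of _ J'], rule exI[of _ a'], rule exI[of _ b'], use that in simp)
 show thesis
 proof (rule that[OF X])
  note tensor = tensor_op_add_left tensor_op_add_right tensor_op_scaleC_left tensor_op_scaleC_right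
  show "lin_indep n (\<lambda>i. b (h i))"
   by (rule lin_indep_if_minimal[where M = M and B = tensor_op, OF tensor X]) (simp_all add: J min)
  show "lin_indep n (\<lambda>i. a (h i))"
   by (rule lin_indep_if_minimal[where M = M and B = "\<lambda>x y. y \<otimes>\<^sub>o x", OF tensor(2,1,4,3) X]) (simp_all add: J min)
 qed (simp_all add: J)
qed

text \<open>Induction as in Gram-Schmidt. Removing from \<open>b n\<close> its components leaves a
  nonzero \<open>m\<close>; a functional not vanishing at \<open>m\<close> is corrected to vanish on
  the earlier vectors and normalized, and then corrects the earlier functionals.\<close>

lemma dual_basis:
 assumes lin: "\<And>f x y. f \<in> F ==> f (x + y) = f x + f y" "\<And>f c x. f \<in> F ==> f (c *C x) = c * f x"
  and comb: "\<And>f g c. f \<in> F ==> g \<in> F ==> (\<lambda>x. f x + c * g x) \<in> F" and zero: "(\<lambda>_. 0) \<in> F"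
  and sep: "\<And>x. (\<And>f. f \<in> F ==> f x = 0) ==> x = 0"
 shows "lin_indep n b ==> \<exists>f. \<forall>j<n. f j \<in> F \<and> (\<forall>i<n. f j (b i) = (if i = j then 1 else 0))"
proof (induction n)
 case (Suc n)
 have "lin_indep n b" unfolding lin_indep_def
 proof (intro allI impI)
  fix c i assume c: "(\<Sum>i<n. c i *C b i) = 0" and i: "i < n"
  have "(\<Sum>i<n. (if i < n then c i else 0) *C b i) = (\<Sum>i<n. c i *C b i)" by (rule sum.cong) auto
  then have "(\<Sum>i<Suc n. (if i < n then c i else 0) *C b i) = 0" unfolding c by simp
  from lin_indepD[OF Suc.prems this, of i] show "c i = 0" using i by simp
 qed
 from Suc.IH[OF this] obtain f where f: "\<And>j. j < n ==> f j \<in> F" "\<And>i j. i < n ==> j < n ==> f j (b i) = (if i = j then 1 else 0)"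
  by blast
 define m where "m = b n + (\<Sum>i<n. (- f i (b n)) *C b i)"
 have "m \<noteq> 0"
 proof
  assume "m = 0"
  moreover have "(\<Sum>i<n. (if i = n then 1 else - f i (b n)) *C b i) = (\<Sum>i<n. (- f i (b n)) *C b i)" by (rule sum.cong) auto
  ultimately have "(\<Sum>i<Suc n. (if i = n then 1 else - f i (b n)) *C b i) = 0" by (simp add: m_def scaleC_one add.commute)
  from lin_indepD[OF Suc.prems this, of n] show False by simp
 qed
 then obtain \<theta> where \<theta>: "\<theta> \<in> F" "\<theta> m \<noteq> 0" using sep by blast
 have "(\<lambda>x. \<theta> x + (\<Sum>i<k. (- \<theta> (b i)) * f i x)) \<in> F" if "k \<le> n" for k
  using that
 proof (induction k)
  case (Suc k)
  then have "(\<lambda>x. (\<theta> x + (\<Sum>i<k. (- \<theta> (b i)) * f i x)) + (- \<theta> (b k)) * f k x) \<in> F" by (intro comb f) auto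
  then show ?case by (simp add: algebra_simps)
 qed (use \<theta> in simp)
 from comb[OF zero this[OF order_refl], of "1 / \<theta> m"]
 have g: "(\<lambda>x. (\<theta> x + (\<Sum>i<n. (- \<theta> (b i)) * f i x)) / \<theta> m) \<in> F" (is "?g \<in> F") by simp
 have \<theta>0: "\<theta> 0 = 0" using lin(2)[OF \<theta>(1), of 0 0] by simp
 have \<theta>s: "\<theta> (\<Sum>i<k. c i *C b i) = (\<Sum>i<k. c i * \<theta> (b i))" for k c
  by (induction k) (simp_all add: lin[OF \<theta>(1)] \<theta>0)
 have gb: "?g (b i) = 0" if i: "i < n" for i
 proof -
  have "(\<Sum>k<n. (- \<theta> (b k)) * f k (b i)) = (\<Sum>k<n. if k = i then - \<theta> (b i) else 0)"
   using f(2) i by (intro sum.cong) auto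
  then show ?thesis using i by simp
 qed
 have "\<theta> m = \<theta> (b n) + (\<Sum>i<n. (- \<theta> (b i)) * f i (b n))"
  unfolding m_def lin(1)[OF \<theta>(1)] \<theta>s by (simp add: mult.commute)
 then have gn: "?g (b n) = 1" using \<theta>(2) by simp
 define h where "h = ?g"
 have h: "h \<in> F" "\<And>i. i < n ==> h (b i) = 0" "h (b n) = 1" unfolding h_def by (rule g gb gn, assumption?)+
 have "(\<lambda>x. f j x + (- f j (b n)) * h x) \<in> F" if "j < n" for j by (rule comb[OF f(1)[OF that] h(1)])
 then show ?case
  by (intro exI[of _ "\<lambda>j. if j = n then h else (\<lambda>x. f j x + (- f j (b n)) * h x)"])
   (use f h in "auto simp: less_Suc_eq")
qed simp

subsection \<open>The corepresentation of a periodic element\<close>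

context qg begin

text \<open>Linear combinations are taken in both members at once, so that f = g \<circ> S persists
  on the core.\<close>

inductive nf :: "('i bop => complex) => ('i bop => complex) => bool" where
 nf_nice: "nice a b c d ==> nf (\<lambda>m. \<langle>b, m $ a\<rangle>) (\<lambda>m. \<langle>d, m $ c\<rangle>)"
| nf_zero: "nf (\<lambda>_. 0) (\<lambda>_. 0)"
| nf_comb: "nf f g ==> nf f' g' ==> nf (\<lambda>m. f m + k * f' m) (\<lambda>m. g m + k * g' m)"

lemma nf_linear: "nf f g ==> (\<forall>x y c. f (x + y) = f x + f y \<and> f (c *C x) = c * f x \<and> g (x + y) = g x + g y \<and> g (c *C x) = c * g x)"
 by (induction rule: nf.induct) (simp_all add: ci_rules algebra_simps)

lemma nf_dual_basis:
 assumes b: "lin_indep n b" and F: "F = {f. \<exists>g. nf f g} \<or> F = {g. \<exists>f. nf f g}"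
 obtains f where "\<And>j. j < n ==> f j \<in> F" "\<And>i j. i < n ==> j < n ==> f j (b i) = (if i = j then 1 else 0)"
proof -
 have "\<exists>f. \<forall>j<n. f j \<in> F \<and> (\<forall>i<n. f j (b i) = (if i = j then 1 else 0))"
 proof (rule dual_basis[OF _ _ _ _ _ b])
  fix x assume x: "\<And>f. f \<in> F ==> f x = 0"
  show "x = 0"
   using F
  proof
   assume F: "F = {f. \<exists>g. nf f g}"
   show "x = 0"
   proof (rule nice_separating')
    fix a b c d assume "nice a b c d"
    then have "(\<lambda>m. \<langle>b, m $ a\<rangle>) \<in> F" unfolding F using nf_nice by blast
    from x[OF this] show "\<langle>b, x $ a\<rangle> = 0" .
   qed
  next
   assume F: "F = {g. \<exists>f. nf f g}"
   show "x = 0"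
   proof (rule nice_separating)
    fix a b c d assume "nice a b c d"
    then have "(\<lambda>m. \<langle>d, m $ c\<rangle>) \<in> F" unfolding F using nf_nice by blast
    from x[OF this] show "\<langle>d, x $ c\<rangle> = 0" .
   qed
  qed
 qed (use F nf_linear nf_zero nf_comb in blast)+
 then obtain f where "\<forall>j<n. f j \<in> F \<and> (\<forall>i<n. f j (b i) = (if i = j then 1 else 0))" by (elim exE)
 then show thesis by (intro that[of f]) auto
qed

text \<open>For vector functionals the sums are slices of \<Delta>(x), covered by
  \<open>SG_slice\<close>; linearity of \<open>SG\<close> does the rest. Both legs and both
  directions of S feed into \<open>DR_factor\<close>.\<close>

lemma nf_SG:
 fixes n :: nat
 assumes "nf f g" and D: "\<Delta> x = (\<Sum>i<n. a i \<otimes>\<^sub>o b i)"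
 shows "SG x y ==> \<exists>s t. SG (\<Sum>i<n. f (b i) *C a i) s \<and> SG (\<Sum>i<n. f (a i) *C b i) t"
  and "SG y x ==> \<exists>s t. SG s (\<Sum>i<n. g (b i) *C a i) \<and> SG t (\<Sum>i<n. g (a i) *C b i)"
proof -
 have sl: "T p q x = (\<Sum>i<n. \<langle>q, b i $ p\<rangle> *C a i)" "L p q x = (\<Sum>i<n. \<langle>q, a i $ p\<rangle> *C b i)" for p q
  by (simp_all add: D rslice_sum lslice_sum rslice_tensor lslice_tensor)
 have co: "(\<Sum>i<n. (p i + k * q i) *C c i) = (\<Sum>i<n. p i *C c i) + k *C (\<Sum>i<n. q i *C c i)" for p q k and c :: "nat => 'i bop"
  by (simp add: scaleC_add_left sum.distrib complex_vector.scale_sum_right scaleC_scaleC)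
 note cl = SG_add[OF _ SG_scaleC]
 show "\<exists>s t. SG (\<Sum>i<n. f (b i) *C a i) s \<and> SG (\<Sum>i<n. f (a i) *C b i) t" if "SG x y"
  using assms(1)
 proof (induction rule: nf.induct)
  case (nf_nice a b c d) then show ?case using SG_slice[OF \<open>SG x y\<close> nf_nice] unfolding sl by blast
 next
  case nf_zero then show ?case using SG_zero by auto
 next
  case (nf_comb f g f' g' k) then show ?case unfolding co using cl by meson
 qed
 show "\<exists>s t. SG s (\<Sum>i<n. g (b i) *C a i) \<and> SG t (\<Sum>i<n. g (a i) *C b i)" if "SG y x"
  using assms(1)
 proof (induction rule: nf.induct)
  case (nf_nice a b c d) then show ?case using SG_slice[OF \<open>SG y x\<close> nf_nice] unfolding sl by blast
 next
  case nf_zero then show ?case using SG_zero by auto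
 next
  case (nf_comb f g f' g' k) then show ?case unfolding co using cl by meson
 qed
qed

definition DR :: "'i bop => bool" where "DR z \<longleftrightarrow> (\<exists>y. SG z y) \<and> (\<exists>y. SG y z)"

lemma dual_sum: "(j :: nat) < n ==> (\<And>i. i < n ==> f i = (if i = j then 1 else 0)) ==> (\<Sum>i<n. f i *C c i) = (c j :: 'i bop)"
proof -
 assume j: "j < n" and f: "\<And>i. i < n ==> f i = (if i = j then 1 else 0)"
 have "(\<Sum>i<n. f i *C c i) = (\<Sum>i<n. if i = j then c j else 0)"
  using f by (intro sum.cong) (auto simp: scaleC_one)
 then show ?thesis using j by simp
qed

text \<open>A dual basis chosen among the tested functionals isolates \<open>c j\<close>. It exists
  in either family because each family separates operators.\<close>

lemma DR_if_sums:
 fixes c :: "nat => 'i bop"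
 assumes li: "lin_indep n d" and j: "j < n"
  and SG: "\<And>f g. nf f g ==> \<exists>s. SG (\<Sum>i<n. f (d i) *C c i) s" "\<And>f g. nf f g ==> \<exists>s. SG s (\<Sum>i<n. g (d i) *C c i)"
 shows "DR (c j)"
proof -
 obtain f where f: "\<And>j. j < n ==> f j \<in> {f. \<exists>g. nf f g}" "\<And>i j. i < n ==> j < n ==> f j (d i) = (if i = j then 1 else 0)"
  by (rule nf_dual_basis[OF li disjI1[OF refl]]) (rule that)
 obtain g where g: "\<And>j. j < n ==> g j \<in> {g. \<exists>f. nf f g}" "\<And>i j. i < n ==> j < n ==> g j (d i) = (if i = j then 1 else 0)"
  by (rule nf_dual_basis[OF li disjI2[OF refl]]) (rule that)
 have "(\<Sum>i<n. f j (d i) *C c i) = c j" "(\<Sum>i<n. g j (d i) *C c i) = c j"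
  by (intro dual_sum j f(2) g(2); assumption)+
 then show ?thesis using SG(1)[of "f j"] SG(2)[of _ "g j"] f(1)[OF j] g(1)[OF j] unfolding DR_def by auto
qed

lemma DR_factor:
 assumes x: "DR x" and D: "\<Delta> x = (\<Sum>i<n. a i \<otimes>\<^sub>o b i)" and j: "j < n"
 shows "lin_indep n b ==> DR (a j)" "lin_indep n a ==> DR (b j)"
proof -
 obtain y y' where y: "SG x y" "SG y' x" using x by (auto simp: DR_def)
 have "\<exists>s. SG (\<Sum>i<n. f (b i) *C a i) s" "\<exists>s. SG (\<Sum>i<n. f (a i) *C b i) s"
  "\<exists>s. SG s (\<Sum>i<n. g (b i) *C a i)" "\<exists>s. SG s (\<Sum>i<n. g (a i) *C b i)" if "nf f g" for f g
  using nf_SG(1)[OF that D y(1)] nf_SG(2)[OF that D y(2)] by auto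
 note * = this
 show "DR (a j)" if "lin_indep n b" using that j *(1,3) by (rule DR_if_sums)
 show "DR (b j)" if "lin_indep n a" using that j *(2,4) by (rule DR_if_sums)
qed

lemma coassoc_sum:
 fixes n :: nat
 assumes m: "m \<in> M" "\<Delta> m = (\<Sum>i<n. a i \<otimes>\<^sub>o b i)" "\<And>i. a i \<in> M" "\<And>i. b i \<in> M"
 shows "(\<Sum>i<n. \<langle>z, b i $ z'\<rangle> * \<langle>x \<otimes> y, \<Delta> (a i) $ (x' \<otimes> y')\<rangle>) = (\<Sum>i<n. \<langle>x, a i $ x'\<rangle> * \<langle>y \<otimes> z, \<Delta> (b i) $ (y' \<otimes> z')\<rangle>)"
 using coassoc[OF m(1), of x y z' z x' y'] m(3,4)
 by (simp add: m(2) rslice_sum lslice_sum rslice_tensor lslice_tensor D_sum D_scaleC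
   bop_sum_left cinner_sum_right cinner_scaleC_right)

lemma nf_coassoc:
 fixes n :: nat
 assumes "nf f g" and m: "m \<in> M" "\<Delta> m = (\<Sum>i<n. a i \<otimes>\<^sub>o b i)" "\<And>i. a i \<in> M" "\<And>i. b i \<in> M"
 obtains S where "\<And>i. S i \<in> M" "\<And>x y x' y'. (\<Sum>i<n. f (b i) * \<langle>x \<otimes> y, \<Delta> (a i) $ (x' \<otimes> y')\<rangle>) = (\<Sum>i<n. \<langle>x, a i $ x'\<rangle> * \<langle>y, S i $ y'\<rangle>)"
proof -
 define P where "P f S \<longleftrightarrow> (\<forall>i. S i \<in> M) \<and> (\<forall>x y x' y'. (\<Sum>i<n. f (b i) * \<langle>x \<otimes> y, \<Delta> (a i) $ (x' \<otimes> y')\<rangle>) = (\<Sum>i<n. \<langle>x, a i $ x'\<rangle> * \<langle>y, S i $ y'\<rangle>))" for f S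
 have "\<exists>S. P f S"
  using assms(1)
 proof (induction rule: nf.induct)
  case (nf_nice z' z c d)
  show ?case
   by (rule exI[of _ "\<lambda>i. T z' z (b i)"]) (use m in "simp add: P_def coassoc_sum[OF m] cinner_rslice")
 next
  case nf_zero
  show ?case by (rule exI[of _ "\<lambda>_. 0"]) (simp add: P_def)
 next
  case (nf_comb f g f' g' k)
  then obtain S S' where "P f S" "P f' S'" by (elim exE)
  moreover have "(\<Sum>i<n. (f (b i) + k * f' (b i)) * c i) = (\<Sum>i<n. f (b i) * c i) + k * (\<Sum>i<n. f' (b i) * c i)" for c
   by (simp add: distrib_right sum.distrib sum_distrib_left mult.assoc)
  moreover have "(\<Sum>i<n. c i * \<langle>y, (S i + k *C S' i) $ y'\<rangle>) = (\<Sum>i<n. c i * \<langle>y, S i $ y'\<rangle>) + k * (\<Sum>i<n. c i * \<langle>y, S' i $ y'\<rangle>)" for c y y'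
   by (simp add: ci_rules distrib_left sum.distrib sum_distrib_left mult.left_commute)
  ultimately show ?case
   by (intro exI[of _ "\<lambda>i. S i + k *C S' i"]) (simp add: P_def del: plus_bop.rep_eq scaleC_bop.rep_eq)
 qed
 then obtain S where "P f S" ..
 then show thesis by (intro that[of S]) (simp_all add: P_def)
qed

lemma periodic_decomposition:
 assumes x: "x \<in> M" "\<Delta> x \<in> M \<odot> M" "DR x"
 obtains n b u where "\<And>i. b i \<in> M" "\<And>i j. u i j \<in> M" "lin_indep n b" "\<And>i. i < n ==> DR (b i)" "\<And>i j. i < n ==> j < n ==> DR (u i j)"
  "\<And>i. i < n ==> \<Delta> (b i) = (\<Sum>j<n. u i j \<otimes>\<^sub>o b j)" "\<And>i j. i < n ==> j < n ==> \<Delta> (u i j) = (\<Sum>k<n. u i k \<otimes>\<^sub>o u k j)"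
  "x \<in> cspan (b ` {..<n})"
proof -
 obtain n a b where D: "\<Delta> x = (\<Sum>i<n. a i \<otimes>\<^sub>o b i)" and ab: "\<And>i. a i \<in> M" "\<And>i. b i \<in> M" and li: "lin_indep n a" "lin_indep n b"
  by (rule minimal_decomposition[OF x(2)]) (rule that)
 note DRab = DR_factor(1)[OF x(3) D _ li(2)] DR_factor(2)[OF x(3) D _ li(1)]
 obtain f where f: "\<And>j. j < n ==> f j \<in> {f. \<exists>g. nf f g}" "\<And>i j. i < n ==> j < n ==> f j (b i) = (if i = j then 1 else 0)"
  by (rule nf_dual_basis[OF li(2) disjI1[OF refl]]) (rule that)
 have "\<forall>j. \<exists>S. (\<forall>i. S i \<in> M) \<and> (j < n \<longrightarrow> \<Delta> (a j) = (\<Sum>i<n. a i \<otimes>\<^sub>o S i))"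
 proof
  fix j show "\<exists>S. (\<forall>i. S i \<in> M) \<and> (j < n \<longrightarrow> \<Delta> (a j) = (\<Sum>i<n. a i \<otimes>\<^sub>o S i))"
  proof (cases "j < n")
   case j: True
   obtain g where g: "nf (f j) g" using f(1)[OF j] by blast
   obtain S where S: "\<And>i. S i \<in> M" "\<And>x y x' y'. (\<Sum>i<n. f j (b i) * \<langle>x \<otimes> y, \<Delta> (a i) $ (x' \<otimes> y')\<rangle>) = (\<Sum>i<n. \<langle>x, a i $ x'\<rangle> * \<langle>y, S i $ y'\<rangle>)"
    by (rule nf_coassoc[OF g x(1) D ab]) (rule that)
   have "\<Delta> (a j) = (\<Sum>i<n. a i \<otimes>\<^sub>o S i)"
   proof (rule bop_tensor_cinner_ext)
    fix x y x' y'
    have "(\<Sum>i<n. f j (b i) * c i) = c j" for c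
    proof -
     have "(\<Sum>i<n. f j (b i) * c i) = (\<Sum>i<n. if i = j then c j else 0)" using f(2) j by (intro sum.cong) auto
     then show ?thesis using j by simp
    qed
    from this[of "\<lambda>i. \<langle>x \<otimes> y, \<Delta> (a i) $ (x' \<otimes> y')\<rangle>"]
    show "\<langle>x \<otimes> y, \<Delta> (a j) $ (x' \<otimes> y')\<rangle> = \<langle>x \<otimes> y, (\<Sum>i<n. a i \<otimes>\<^sub>o S i) $ (x' \<otimes> y')\<rangle>"
     by (simp add: S(2) bop_sum_left cinner_sum_right tensor_op_apply cinner_tensor)
   qed
   then show ?thesis using S by blast
  qed (auto intro: exI[of _ "\<lambda>_. 0"])
 qed
 then obtain S where S: "\<And>j i. S j i \<in> M" "\<And>j. j < n ==> \<Delta> (a j) = (\<Sum>i<n. a i \<otimes>\<^sub>o S j i)" by metis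
 \<comment> \<open>The transposed indices turn \<Delta>(a_j) = sum_i a_i \<otimes> u_ij into the
   convention of a corepresentation acting on the column \<open>b\<close>. Independence of
   \<open>a\<close> then gives \<open>Db\<close>, independence of \<open>b\<close> gives
   \<open>Du\<close>.\<close>
 define u where "u i j = S j i" for i j
 have Db: "\<Delta> (b i) = (\<Sum>j<n. u i j \<otimes>\<^sub>o b j)" if i: "i < n" for i
 proof (rule bop_tensor_cinner_ext)
  fix y z y' z'
  show "\<langle>y \<otimes> z, \<Delta> (b i) $ (y' \<otimes> z')\<rangle> = \<langle>y \<otimes> z, (\<Sum>j<n. u i j \<otimes>\<^sub>o b j) $ (y' \<otimes> z')\<rangle>"
  proof (rule lin_indep_cinner[OF li(1) i])
   fix p q
   have "(\<Sum>k<n. \<langle>p, a k $ q\<rangle> * \<langle>y \<otimes> z, \<Delta> (b k) $ (y' \<otimes> z')\<rangle>) = (\<Sum>j<n. \<langle>z, b j $ z'\<rangle> * (\<Sum>k<n. \<langle>p, a k $ q\<rangle> * \<langle>y, S j k $ y'\<rangle>))"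
    by (simp add: coassoc_sum[OF x(1) D ab, symmetric] S(2) bop_sum_left cinner_sum_right tensor_op_apply cinner_tensor)
   also have "\<dots> = (\<Sum>k<n. \<Sum>j<n. \<langle>z, b j $ z'\<rangle> * (\<langle>p, a k $ q\<rangle> * \<langle>y, S j k $ y'\<rangle>))"
    unfolding sum_distrib_left by (rule sum.swap)
   finally show "(\<Sum>k<n. \<langle>p, a k $ q\<rangle> * \<langle>y \<otimes> z, \<Delta> (b k) $ (y' \<otimes> z')\<rangle>) = (\<Sum>k<n. \<langle>p, a k $ q\<rangle> * \<langle>y \<otimes> z, (\<Sum>j<n. u k j \<otimes>\<^sub>o b j) $ (y' \<otimes> z')\<rangle>)"
    by (simp add: u_def bop_sum_left cinner_sum_right tensor_op_apply cinner_tensor sum_distrib_left mult_ac)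
  qed
 qed
 have Du: "\<Delta> (u i j) = (\<Sum>k<n. u i k \<otimes>\<^sub>o u k j)" if i: "i < n" and j: "j < n" for i j
 proof (rule bop_tensor_cinner_ext)
  fix x y x' y'
  show "\<langle>x \<otimes> y, \<Delta> (u i j) $ (x' \<otimes> y')\<rangle> = \<langle>x \<otimes> y, (\<Sum>k<n. u i k \<otimes>\<^sub>o u k j) $ (x' \<otimes> y')\<rangle>"
  proof (rule lin_indep_cinner[OF li(2) j])
   fix z z'
   have "(\<Sum>k<n. \<langle>z, b k $ z'\<rangle> * \<langle>x \<otimes> y, \<Delta> (u i k) $ (x' \<otimes> y')\<rangle>) = (\<Sum>k<n. \<langle>x, u i k $ x'\<rangle> * (\<Sum>l<n. \<langle>y, u k l $ y'\<rangle> * \<langle>z, b l $ z'\<rangle>))"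
    using coassoc_sum[OF ab(2) Db[OF i], of z z' x y x' y'] S(1) ab
    by (simp add: u_def[symmetric] Db bop_sum_left cinner_sum_right tensor_op_apply cinner_tensor)
   also have "\<dots> = (\<Sum>l<n. \<Sum>k<n. \<langle>x, u i k $ x'\<rangle> * (\<langle>y, u k l $ y'\<rangle> * \<langle>z, b l $ z'\<rangle>))"
    unfolding sum_distrib_left by (rule sum.swap)
   finally show "(\<Sum>k<n. \<langle>z, b k $ z'\<rangle> * \<langle>x \<otimes> y, \<Delta> (u i k) $ (x' \<otimes> y')\<rangle>) = (\<Sum>j<n. \<langle>z, b j $ z'\<rangle> * \<langle>x \<otimes> y, (\<Sum>k<n. u i k \<otimes>\<^sub>o u k j) $ (x' \<otimes> y')\<rangle>)"
    by (simp add: bop_sum_left cinner_sum_right tensor_op_apply cinner_tensor sum_distrib_left mult_ac)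
  qed
 qed
 have DRu: "DR (u i j)" if "i < n" "j < n" for i j
  unfolding u_def by (rule DR_factor(2)[OF DRab(1)[OF that(2)] S(2)[OF that(2)] that(1) li(1)])
 \<comment> \<open>In place of a counit: slicing S(z1) z2 \<otimes> z3 = 1 \<otimes> z at z = x
   expresses a nonzero multiple of x by the \<open>b j\<close>.\<close>
 have "x \<in> cspan (b ` {..<n})"
 proof -
  have "\<forall>i. \<exists>y. i < n \<longrightarrow> anti (a i) y" using DRab(1) SG_anti by (auto simp: DR_def) metis
  then obtain a' where a': "\<And>i. i < n ==> anti (a i) (a' i)" by metis
  have "1 \<otimes>\<^sub>o x = (\<Sum>i<n. (a' i \<otimes>\<^sub>o 1) * \<Delta> (b i))"
   by (rule antipode_identity[OF x(1) D]) (use ab a' in auto)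
  also have "\<dots> = (\<Sum>i<n. \<Sum>j<n. (a' i * u i j) \<otimes>\<^sub>o b j)"
   by (intro sum.cong) (simp_all add: Db sum_distrib_left tensor_op_mult)
  finally have eq: "1 \<otimes>\<^sub>o x = (\<Sum>i<n. \<Sum>j<n. (a' i * u i j) \<otimes>\<^sub>o b j)" .
  obtain v :: "'i ell2" where v: "v \<noteq> 0" using ex_nonzero_ell2 by blast
  then have v': "\<langle>v, v\<rangle> \<noteq> 0" by (simp add: cinner_norm)
  have "\<langle>v, v\<rangle> *C x = (\<Sum>i<n. \<Sum>j<n. \<langle>v, (a' i * u i j) $ v\<rangle> *C b j)"
   using arg_cong[OF eq, of "lslice v v"] by (simp add: lslice_sum lslice_tensor)
  also have "\<dots> \<in> cspan (b ` {..<n})"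
   by (intro complex_vector.span_sum complex_vector.span_scale complex_vector.span_base) auto
  finally have "(1 / \<langle>v, v\<rangle>) *C \<langle>v, v\<rangle> *C x \<in> cspan (b ` {..<n})" by (rule complex_vector.span_scale)
  then show ?thesis using v' by (simp add: scaleC_scaleC scaleC_one)
 qed
 show thesis
  by (rule that[of b u n]) (fact ab li DRab(2) DRu Db Du \<open>x \<in> cspan (b ` {..<n})\<close> | simp add: u_def S)+
qed

end

context qg begin

lemma lin_indep_tensor_one:
 assumes li: "lin_indep n b" and ik: "i < n" "k < n" and eq: "1 \<otimes>\<^sub>o b i = (\<Sum>j<n. \<Sum>k<n. X j k \<otimes>\<^sub>o b k)"
 shows "(\<Sum>j<n. X j k) = (if i = k then 1 else 0)"
proof (rule lin_indep_tensor[OF li ik(2)])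
 have "(\<Sum>k<n. (\<Sum>j<n. X j k) \<otimes>\<^sub>o b k) = 1 \<otimes>\<^sub>o b i"
  unfolding eq tensor_op_sum_left by (rule sum.swap)
 also have "\<dots> = (\<Sum>k<n. if i = k then 1 \<otimes>\<^sub>o b i else 0)" using ik(1) by simp
 also have "\<dots> = (\<Sum>k<n. (if i = k then 1 else 0) \<otimes>\<^sub>o b k)" by (intro sum.cong) auto
 finally show "(\<Sum>k<n. (\<Sum>j<n. X j k) \<otimes>\<^sub>o b k) = (\<Sum>k<n. (if i = k then 1 else 0) \<otimes>\<^sub>o b k)" .
qed

text \<open>\<open>V\<close> is \<open>S(u)\<close> and \<open>t\<close> is \<open>S\<^sup>-\<^sup>1(u)\<close>.  The vector \<open>V b\<close> is fixed by the corepresentation, so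
 \<open>e = S\<^sup>-\<^sup>1(V b)\<close> satisfies \<open>\<Delta> e = e \<otimes> 1\<close> entrywise, which makes \<open>V b\<close> scalar and puts \<open>b = u (V b)\<close> in the span of \<open>u\<close>.\<close>

lemma corep_inverse:
 assumes bM: "\<And>i. b i \<in> M" and uM: "\<And>i j. u i j \<in> M" and li: "lin_indep n b"
  and DRb: "\<And>i. i < n ==> DR (b i)" and DRu: "\<And>i j. i < n ==> j < n ==> DR (u i j)"
  and Db: "\<And>i. i < n ==> \<Delta> (b i) = (\<Sum>j<n. u i j \<otimes>\<^sub>o b j)"
  and Du: "\<And>i j. i < n ==> j < n ==> \<Delta> (u i j) = (\<Sum>k<n. u i k \<otimes>\<^sub>o u k j)"
 obtains V t where "\<And>i k. i < n ==> k < n ==> (\<Sum>j<n. V i j * u j k) = (if i = k then 1 else 0)"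
  "\<And>i k. i < n ==> k < n ==> (\<Sum>j<n. u i j * V j k) = (if i = k then 1 else 0)"
  "\<And>i k. i < n ==> k < n ==> (\<Sum>j<n. t j i * u k j) = (if i = k then 1 else 0)"
  "\<And>i k. i < n ==> k < n ==> (\<Sum>j<n. u j i * t k j) = (if i = k then 1 else 0)"
  "\<And>k. k < n ==> b k \<in> matrix_elements n u"
proof -
 define V t r where "V i j = (SOME y. SG (u i j) y)" and "t i j = (SOME y. SG y (u i j))" and "r j = (SOME y. SG y (b j))" for i j
 have SGs: "SG (u i j) (V i j)" "SG (t i j) (u i j)" if "i < n" "j < n" for i j
  using DRu[OF that] unfolding DR_def V_def t_def by (auto intro: someI_ex)
 have SGr: "SG (r j) (b j)" if "j < n" for j
  using DRb[OF that] unfolding DR_def r_def by (auto intro: someI_ex)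
 have antis: "anti (u i j) (V i j)" "anti (t i j) (u i j)" if "i < n" "j < n" for i j
  using SGs[OF that] by (auto intro: SG_anti)
 have delta: "anti (if P then 1 else 0) (if P then 1 else 0)" for P by (simp add: anti_one anti_zero)
 have VU: "(\<Sum>j<n. V i j * u j k) = (if i = k then 1 else 0)" if i: "i < n" and k: "k < n" for i k
 proof (rule lin_indep_tensor_one[OF li i k])
  have "1 \<otimes>\<^sub>o b i = (\<Sum>j<n. (V i j \<otimes>\<^sub>o 1) * \<Delta> (b j))"
   by (rule antipode_identity[OF bM Db[OF i]]) (use bM antis i in auto)
  also have "\<dots> = (\<Sum>j<n. \<Sum>k<n. (V i j * u j k) \<otimes>\<^sub>o b k)"
   by (intro sum.cong) (simp_all add: Db sum_distrib_left tensor_op_mult)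
  finally show "1 \<otimes>\<^sub>o b i = (\<Sum>j<n. \<Sum>k<n. (V i j * u j k) \<otimes>\<^sub>o b k)" .
 qed
 have ut: "(\<Sum>j<n. u j k * t i j) = (if i = k then 1 else 0)" if i: "i < n" and k: "k < n" for i k
 proof (rule lin_indep_tensor_one[OF li i k])
  have "1 \<otimes>\<^sub>o b i = (\<Sum>j<n. \<Delta> (b j) * (t i j \<otimes>\<^sub>o 1))"
   by (rule antipode_identity'[OF bM Db[OF i]]) (use bM antis i in auto)
  also have "\<dots> = (\<Sum>j<n. \<Sum>k<n. (u j k * t i j) \<otimes>\<^sub>o b k)"
   by (intro sum.cong) (simp_all add: Db sum_distrib_right tensor_op_mult)
  finally show "1 \<otimes>\<^sub>o b i = (\<Sum>j<n. \<Sum>k<n. (u j k * t i j) \<otimes>\<^sub>o b k)" .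
 qed
 \<comment> \<open>The antimultiplicative S carries the identity \<open>ut\<close> to this one; in
   the same way \<open>tu\<close> is pulled back from \<open>VU\<close> by
   \<open>anti_inj\<close>.\<close>
 have UV: "(\<Sum>j<n. u i j * V j k) = (if i = k then 1 else 0)" if i: "i < n" and k: "k < n" for i k
 proof -
  have "anti (\<Sum>j<n. u j k * t i j) (\<Sum>j<n. u i j * V j k)"
   by (intro anti_sum anti_mult antis) (use i k in auto)
  then show ?thesis unfolding ut[OF that] using delta anti_unique by blast
 qed
 have tu: "(\<Sum>j<n. t j k * u i j) = (if i = k then 1 else 0)" if i: "i < n" and k: "k < n" for i k
 proof -
  have "anti (\<Sum>j<n. t j k * u i j) (\<Sum>j<n. V i j * u j k)"
   by (intro anti_sum anti_mult antis) (use i k in auto)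
  then show ?thesis unfolding VU[OF that] using delta anti_inj by blast
 qed
 \<comment> \<open>The inverse of S reverses the coproduct: \<open>SG_slice\<close> pairs a right
   slice of \<Delta>(r_j) with a left slice of \<Delta>(b_j), and separation removes the
   slices.\<close>
 have flip: "\<Delta> (r j) = (\<Sum>l<n. r l \<otimes>\<^sub>o t j l)" if j: "j < n" for j
 proof (rule bop_tensor_cinner_ext)
  fix q a' p e'
  define X where "X = \<Delta> (r j) - (\<Sum>l<n. r l \<otimes>\<^sub>o t j l)"
  have "lslice q p X = 0"
  proof (rule nice_separating')
   fix a e c d assume n: "nice a e c d"
   have "anti (T a e (r j)) (\<Sum>l<n. \<langle>d, u j l $ c\<rangle> *C b l)"
    using SG_anti[OF SG_slice(1)[OF SGr[OF j] n]] by (simp add: Db j lslice_sum lslice_tensor)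
   moreover have "anti (\<Sum>l<n. \<langle>d, u j l $ c\<rangle> *C r l) (\<Sum>l<n. \<langle>d, u j l $ c\<rangle> *C b l)"
    by (intro anti_sum anti_scaleC SG_anti SGr) simp
   ultimately have "T a e (r j) = (\<Sum>l<n. \<langle>d, u j l $ c\<rangle> *C r l)" by (rule anti_inj)
   also have "\<dots> = (\<Sum>l<n. \<langle>e, t j l $ a\<rangle> *C r l)"
    using SG_nice[OF SGs(2)[OF j] n] by (intro sum.cong) auto
   finally have "rslice a e X = 0"
    by (simp add: X_def rslice_rules rslice_sum rslice_tensor)
   then have "\<langle>p, rslice a e X $ q\<rangle> = 0" by simp
   then show "\<langle>e, lslice q p X $ a\<rangle> = 0" unfolding cinner_rslice cinner_lslice .
  qed
  then have "\<langle>e', lslice q p X $ a'\<rangle> = 0" by simp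
  then show "\<langle>p \<otimes> e', \<Delta> (r j) $ (q \<otimes> a')\<rangle> = \<langle>p \<otimes> e', (\<Sum>l<n. r l \<otimes>\<^sub>o t j l) $ (q \<otimes> a')\<rangle>"
   unfolding cinner_lslice X_def by (simp add: cinner_diff_right)
 qed
 have c: "\<exists>k. (\<Sum>j<n. V i j * b j) = k *C 1" if i: "i < n" for i
 proof -
  define e c where "e = (\<Sum>j<n. r j * u i j)" and "c = (\<Sum>j<n. V i j * b j)"
  have rM: "r j \<in> M" if "j < n" for j using SG_mem(1)[OF SGr[OF that]] .
  have eM: "e \<in> M" unfolding e_def using rM uM by (intro sum_mem mult_mem) auto
  have ec: "anti e c" unfolding e_def c_def
   by (intro anti_sum anti_mult SG_anti[OF SGr] antis) (use i in auto)
  have "\<Delta> e = (\<Sum>j<n. (\<Sum>l<n. r l \<otimes>\<^sub>o t j l) * (\<Sum>k<n. u i k \<otimes>\<^sub>o u k j))"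
   unfolding e_def by (subst D_sum) (use rM uM in "auto simp: D_mult flip Du i intro!: sum.cong")
  also have "\<dots> = (\<Sum>j<n. \<Sum>l<n. \<Sum>k<n. (r l * u i k) \<otimes>\<^sub>o (t j l * u k j))" by (simp add: sum_product tensor_op_mult)
  also have "\<dots> = (\<Sum>l<n. \<Sum>j<n. \<Sum>k<n. (r l * u i k) \<otimes>\<^sub>o (t j l * u k j))" by (rule sum.swap)
  also have "\<dots> = (\<Sum>l<n. \<Sum>k<n. \<Sum>j<n. (r l * u i k) \<otimes>\<^sub>o (t j l * u k j))" by (rule sum.cong[OF refl]) (rule sum.swap)
  also have "\<dots> = (\<Sum>l<n. \<Sum>k<n. (r l * u i k) \<otimes>\<^sub>o (if k = l then 1 else 0))"
   by (intro sum.cong refl) (simp add: tensor_op_sum_right[symmetric] tu)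
  also have "\<dots> = (\<Sum>l<n. \<Sum>k<n. if k = l then (r l * u i l) \<otimes>\<^sub>o 1 else 0)" by (intro sum.cong refl) simp
  also have "\<dots> = e \<otimes>\<^sub>o 1" by (simp add: e_def tensor_op_sum_left)
  \<comment> \<open>A one-element index set brings \<Delta>(e) = e \<otimes> 1 into the shape of
    \<open>antipode_identity\<close>. Since S(e) = c and \<Delta>(1) = 1, it yields 1 \<otimes> e =
    c \<otimes> 1, and slicing makes c scalar.\<close>
  finally have De: "\<Delta> e = (\<Sum>i\<in>{()}. e \<otimes>\<^sub>o 1)" by simp
  have "1 \<otimes>\<^sub>o e = (\<Sum>i\<in>{()}. (c \<otimes>\<^sub>o 1) * \<Delta> 1)" by (rule antipode_identity[OF eM De]) (auto intro: ec)
  then have eq: "1 \<otimes>\<^sub>o e = c \<otimes>\<^sub>o 1" by (simp add: D_one)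
  obtain v :: "'i ell2" where v: "v \<noteq> 0" using ex_nonzero_ell2 by blast
  then have v': "\<langle>v, v\<rangle> \<noteq> 0" by (simp add: cinner_norm)
  have "\<langle>v, e $ v\<rangle> *C 1 = \<langle>v, v\<rangle> *C c"
   using arg_cong[OF eq, of "rslice v v"] by (simp add: rslice_tensor)
  from arg_cong[OF this, of "\<lambda>X. (1 / \<langle>v, v\<rangle>) *C X"]
  have "((1 / \<langle>v, v\<rangle>) * \<langle>v, e $ v\<rangle>) *C 1 = c" using v' by (simp add: scaleC_scaleC scaleC_one)
  then show ?thesis unfolding c_def by metis
 qed
 have bk: "b k \<in> matrix_elements n u" if k: "k < n" for k
 proof -
  have "(\<Sum>i<n. u k i * (\<Sum>j<n. V i j * b j)) = (\<Sum>j<n. (\<Sum>i<n. u k i * V i j) * b j)"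
   unfolding sum_distrib_left sum_distrib_right mult.assoc[symmetric] by (rule sum.swap)
  also have "\<dots> = (\<Sum>j<n. if k = j then b k else 0)" by (intro sum.cong refl) (simp add: UV k)
  also have "\<dots> = b k" using k by simp
  finally have "b k = (\<Sum>i<n. u k i * (\<Sum>j<n. V i j * b j))" by simp
  moreover have "u k i * (\<Sum>j<n. V i j * b j) \<in> matrix_elements n u" if i: "i < n" for i
  proof -
   obtain z where "(\<Sum>j<n. V i j * b j) = z *C 1" using c[OF i] by blast
   then have "u k i * (\<Sum>j<n. V i j * b j) = z *C u k i" by simp
   then show ?thesis using k i unfolding matrix_elements_def
    by (simp only:) (rule complex_vector.span_scale, rule complex_vector.span_base, blast)
  qed
  ultimately show ?thesis unfolding matrix_elements_def by (simp only:) (rule complex_vector.span_sum, simp)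
 qed
 show thesis
  by (rule that[of V t]) (simp_all add: VU UV tu ut bk eq_commute[of _ k for k])
qed

end

subsection \<open>Inverse-closed algebras of operators\<close>

lemma matrix_bound:
 fixes S :: "nat => nat => 'i bop"
 obtains C where "C \<ge> 1" "\<And>z. (\<Sum>i<n. (norm (\<Sum>k<n. S i k $ z k))^2) \<le> C * (\<Sum>k<n. (norm (z k))^2)"
proof
 show "1 + (\<Sum>i<n. \<Sum>k<n. (norm (S i k))^2) \<ge> 1" by (simp add: sum_nonneg)
 fix z
 have "(\<Sum>i<n. (norm (\<Sum>k<n. S i k $ z k))^2) \<le> (\<Sum>i<n. (\<Sum>k<n. (norm (S i k))^2) * (\<Sum>k<n. (norm (z k))^2))"
 proof (rule sum_mono)
  fix i
  have "norm (\<Sum>k<n. S i k $ z k) \<le> (\<Sum>k<n. norm (S i k) * norm (z k))" by (rule sum_norm_le) (rule norm_bop)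
  then have "(norm (\<Sum>k<n. S i k $ z k))^2 \<le> (\<Sum>k<n. norm (S i k) * norm (z k))^2" by (rule power_mono) simp
  also have "\<dots> \<le> (\<Sum>k<n. (norm (S i k))^2) * (\<Sum>k<n. (norm (z k))^2)" by (rule Cauchy_Schwarz_ineq_sum)
  finally show "(norm (\<Sum>k<n. S i k $ z k))^2 \<le> (\<Sum>k<n. (norm (S i k))^2) * (\<Sum>k<n. (norm (z k))^2)" .
 qed
 also have "\<dots> = (\<Sum>i<n. \<Sum>k<n. (norm (S i k))^2) * (\<Sum>k<n. (norm (z k))^2)" by (simp only: sum_distrib_right)
 also have "\<dots> \<le> (1 + (\<Sum>i<n. \<Sum>k<n. (norm (S i k))^2)) * (\<Sum>k<n. (norm (z k))^2)"
  by (rule mult_right_mono) (simp_all add: sum_nonneg)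
 finally show "(\<Sum>i<n. (norm (\<Sum>k<n. S i k $ z k))^2) \<le> (1 + (\<Sum>i<n. \<Sum>k<n. (norm (S i k))^2)) * (\<Sum>k<n. (norm (z k))^2)" .
qed

text \<open>Let C bound the adjoint matrix, D the inverse, and put E = |U d|^2, y = adj U (U d).
  Then |d - y / C|^2 \<le> |d|^2 - 2 E / C + E / C, and |d|^2 \<le> D E gives the factor 1 - 1 / (C
  D).\<close>

lemma richardson_contraction:
 fixes U V :: "nat => nat => 'i bop"
 assumes VU: "\<And>i j. i < n ==> j < n ==> (\<Sum>k<n. V i k * U k j) = (if i = j then 1 else 0)"
 obtains r \<rho> where "0 \<le> \<rho>" "\<rho> < 1"
  "\<And>d. (\<Sum>i<n. (norm (d i - r *R (\<Sum>k<n. adj (U k i) $ (\<Sum>l<n. U k l $ d l))))^2) \<le> \<rho> * (\<Sum>i<n. (norm (d i))^2)"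
proof -
 obtain C where C: "C \<ge> 1" "\<And>z. (\<Sum>i<n. (norm (\<Sum>k<n. adj (U k i) $ z k))^2) \<le> C * (\<Sum>k<n. (norm (z k))^2)"
  by (rule matrix_bound[of "\<lambda>i k. adj (U k i)"]) (rule that)
 obtain D where D: "D \<ge> 1" "\<And>z. (\<Sum>i<n. (norm (\<Sum>k<n. V i k $ z k))^2) \<le> D * (\<Sum>k<n. (norm (z k))^2)"
  by (rule matrix_bound[of V]) (rule that)
 have CD: "1 \<le> C * D" using C(1) D(1) mult_mono[of 1 C 1 D] by simp
 show thesis
 proof (rule that[of "1 - 1 / (C * D)" "1 / C"])
  show "0 \<le> 1 - 1 / (C * D)" "1 - 1 / (C * D) < 1" using CD by simp_all
  fix d :: "nat => 'i ell2"
  define e y where "e k = (\<Sum>l<n. U k l $ d l)" and "y i = (\<Sum>k<n. adj (U k i) $ e k)" for k i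
  define E where "E = (\<Sum>k<n. (norm (e k))^2)"
  have d: "(\<Sum>k<n. V i k $ e k) = d i" if i: "i < n" for i
  proof -
   have "(\<Sum>k<n. V i k $ e k) = (\<Sum>l<n. (\<Sum>k<n. V i k * U k l) $ d l)"
    unfolding e_def bop_sum_right bop_sum_left times_bop.rep_eq by (rule sum.swap)
   also have "\<dots> = (\<Sum>l<n. if i = l then d i else 0)" by (intro sum.cong refl) (simp add: VU i)
   finally show ?thesis using i by simp
  qed
  have "(\<Sum>i<n. inner (d i) (y i)) = (\<Sum>i<n. \<Sum>k<n. inner (U k i $ d i) (e k))"
   unfolding y_def inner_sum_right by (simp add: inner_eq_Re_cinner adj_right)
  also have "\<dots> = (\<Sum>k<n. \<Sum>i<n. inner (U k i $ d i) (e k))" by (rule sum.swap)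
  also have "\<dots> = E" by (simp add: E_def e_def inner_sum_left[symmetric] power2_norm_eq_inner)
  finally have dy: "(\<Sum>i<n. inner (d i) (y i)) = E" .
  have y: "(\<Sum>i<n. (norm (y i))^2) \<le> C * E" unfolding y_def E_def by (rule C)
  have "(\<Sum>i<n. (norm (d i))^2) \<le> D * E" using D(2)[of e] by (simp add: d E_def)
  then have DE: "(\<Sum>i<n. (norm (d i))^2) / (C * D) \<le> E / C" using C(1) D(1) by (simp add: divide_simps mult_ac)
  have "(\<Sum>i<n. (norm (d i - (1 / C) *R y i))^2) = (\<Sum>i<n. (norm (d i))^2 - (2 / C) * inner (d i) (y i) + (norm (y i))^2 / C\<^sup>2)"
  proof (intro sum.cong refl)
   fix i
   have "(norm (d i - (1 / C) *R y i))^2 = inner (d i) (d i) - (1 / C) * inner (d i) (y i) - ((1 / C) * inner (y i) (d i) - (1 / C) * ((1 / C) * inner (y i) (y i)))"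
    unfolding power2_norm_eq_inner by (simp only: inner_diff_left inner_diff_right inner_scaleR_left inner_scaleR_right right_diff_distrib)
   then show "(norm (d i - (1 / C) *R y i))^2 = (norm (d i))^2 - (2 / C) * inner (d i) (y i) + (norm (y i))^2 / C\<^sup>2"
    unfolding power2_norm_eq_inner by (simp add: inner_commute[of "y i" "d i"] power2_eq_square)
  qed
  also have "\<dots> = (\<Sum>i<n. (norm (d i))^2) - (2 / C) * E + (\<Sum>i<n. (norm (y i))^2) / C\<^sup>2"
   by (simp add: sum.distrib sum_subtractf sum_distrib_left[symmetric] sum_divide_distrib[symmetric] dy)
  also have "\<dots> \<le> (\<Sum>i<n. (norm (d i))^2) - (2 / C) * E + C * E / C\<^sup>2"
   by (intro add_left_mono divide_right_mono y) simp
  also have "\<dots> = (\<Sum>i<n. (norm (d i))^2) - E / C" using C(1) by (simp add: field_simps power2_eq_square)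
  also have "\<dots> \<le> (1 - 1 / (C * D)) * (\<Sum>i<n. (norm (d i))^2)" using DE by (simp add: left_diff_distrib)
  finally show "(\<Sum>i<n. (norm (d i - (1 / C) *R (\<Sum>k<n. adj (U k i) $ (\<Sum>l<n. U k l $ d l))))^2) \<le> (1 - 1 / (C * D)) * (\<Sum>i<n. (norm (d i))^2)"
   unfolding y_def e_def .
 qed
qed

text \<open>The inverse is the limit of the Richardson iteration \<open>X \<mapsto> X + r U\<^sup>*(1 - U X)\<close>, which stays in \<open>A\<close>.\<close>

lemma inverse_closed:
 fixes U V :: "nat => nat => 'i bop"
 assumes A: "csubspace A" "closed A" "\<And>x y. x \<in> A ==> y \<in> A ==> x * y \<in> A" "\<And>x. x \<in> A ==> adj x \<in> A"
  and U: "\<And>i j. i < n ==> j < n ==> U i j \<in> A"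
  and UV: "\<And>i j. i < n ==> j < n ==> (\<Sum>k<n. U i k * V k j) = (if i = j then 1 else 0)"
  and VU: "\<And>i j. i < n ==> j < n ==> (\<Sum>k<n. V i k * U k j) = (if i = j then 1 else 0)"
  and ij: "i < n" "j < n"
 shows "V i j \<in> A"
proof -
 obtain r \<rho> where \<rho>: "0 \<le> \<rho>" "\<rho> < 1"
  "\<And>d. (\<Sum>i<n. (norm (d i - r *R (\<Sum>k<n. adj (U k i) $ (\<Sum>l<n. U k l $ d l))))^2) \<le> \<rho> * (\<Sum>i<n. (norm (d i))^2)"
  by (rule richardson_contraction[where U = U and V = V and n = n, OF VU]) (assumption | rule that)+
 \<comment> \<open>Column j of X + r adj U (1 - U X), multiplied out so that every term is visibly
   in \<open>A\<close>; the adjoint of U has the entry \<open>adj (U j i)\<close> in row i of that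
   column.\<close>
 define step where "step X i = X i + of_real r *C (adj (U j i) - (\<Sum>k<n. adj (U k i) * (\<Sum>l<n. U k l * X l)))" for X i
 define X where "X m = (step ^^ m) (\<lambda>_. 0)" for m
 have XA: "i < n ==> X m i \<in> A" for m i
 proof (induction m arbitrary: i)
  case 0 show ?case using A(1) by (simp add: X_def complex_vector.subspace_0)
 next
  case (Suc m)
  have "X (Suc m) i = step (X m) i" by (simp add: X_def)
  then show ?case using Suc ij unfolding step_def
   by (auto intro!: complex_vector.subspace_add complex_vector.subspace_scale complex_vector.subspace_diff complex_vector.subspace_sum A U)
 qed
 define B where "B = (\<Sum>i<n. (norm (V i j))^2)"
 have bd: "(\<Sum>i<n. (norm ((V i j - X m i) $ z))^2) \<le> \<rho> ^ m * (B * (norm z)^2)" for m z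
 proof (induction m)
  case 0
  have "(norm (V i j $ z))^2 \<le> (norm (V i j))^2 * (norm z)^2" for i
   using power_mono[OF norm_bop[of "V i j" z], of 2] by (simp add: power_mult_distrib)
  then show ?case by (simp add: X_def B_def sum_distrib_right sum_mono)
 next
  case (Suc m)
  define d where "d i = (V i j - X m i) $ z" for i
  have "(V i j - X (Suc m) i) $ z = d i - r *R (\<Sum>k<n. adj (U k i) $ (\<Sum>l<n. U k l $ d l))" for i
  proof -
   have "(\<Sum>k<n. adj (U k i) $ (\<Sum>l<n. (U k l * V l j) $ z)) = (\<Sum>k<n. if k = j then adj (U j i) $ z else 0)"
    unfolding bop_sum_left[symmetric] by (intro sum.cong refl) (simp add: UV ij)
   also have "\<dots> = adj (U j i) $ z" using ij by simp
   finally have 1: "(\<Sum>k<n. adj (U k i) $ (\<Sum>l<n. U k l $ V l j $ z)) = adj (U j i) $ z" by simp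
   have "(\<Sum>k<n. adj (U k i) $ (\<Sum>l<n. U k l $ d l)) = adj (U j i) $ z - (\<Sum>k<n. adj (U k i) $ (\<Sum>l<n. U k l $ X m l $ z))"
    unfolding 1[symmetric] d_def by (simp add: bop_diff_right sum_subtractf)
   moreover have "X (Suc m) i = step (X m) i" by (simp add: X_def)
   ultimately show ?thesis by (simp add: d_def step_def bop_sum_left scaleC_of_real)
  qed
  then have "(\<Sum>i<n. (norm ((V i j - X (Suc m) i) $ z))^2) \<le> \<rho> * (\<Sum>i<n. (norm (d i))^2)" using \<rho>(3)[of d] by simp
  also have "\<dots> \<le> \<rho> * (\<rho> ^ m * (B * (norm z)^2))" using Suc \<rho>(1) unfolding d_def by (rule mult_left_mono)
  finally show ?case by (simp add: mult.assoc)
 qed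
 have B: "B \<ge> 0" by (simp add: B_def sum_nonneg)
 have nb: "norm (X m i - V i j) \<le> sqrt (\<rho> ^ m * B)" for m
 proof (rule norm_bop_le)
  fix z
  have "(norm ((X m i - V i j) $ z))^2 = (norm ((V i j - X m i) $ z))^2" by (simp add: norm_minus_commute)
  also have "\<dots> \<le> (\<Sum>i<n. (norm ((V i j - X m i) $ z))^2)" by (rule member_le_sum) (use ij in auto)
  also have "\<dots> \<le> (sqrt (\<rho> ^ m * B) * norm z)^2" using bd[of m z] B \<rho>(1) by (simp add: power_mult_distrib mult.assoc)
  finally show "norm ((X m i - V i j) $ z) \<le> sqrt (\<rho> ^ m * B) * norm z" by (rule power2_le_imp_le) (use B \<rho>(1) in simp)
 qed (use B \<rho>(1) in simp)
 have "(\<lambda>m. X m i - V i j) \<longlonglongrightarrow> 0"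
 proof (rule Lim_null_comparison)
  show "\<forall>\<^sub>F m in sequentially. norm (X m i - V i j) \<le> sqrt (\<rho> ^ m * B)" using nb by simp
  have "(\<lambda>m. sqrt (\<rho> ^ m * B)) \<longlonglongrightarrow> sqrt (0 * B)" by (intro tendsto_intros LIMSEQ_power_zero) (use \<rho> in simp)
  then show "(\<lambda>m. sqrt (\<rho> ^ m * B)) \<longlonglongrightarrow> 0" by simp
 qed
 then have "(\<lambda>m. X m i) \<longlonglongrightarrow> V i j" by (simp add: LIM_zero_iff)
 with XA[OF ij(1)] show ?thesis by (rule closed_sequentially[OF A(2)])
qed

text \<open>The scalar condition asks for some factor, so that antilinear maps such as
  \<open>adj\<close> and slices in their second vector are included.\<close>

lemma vimage_closed_subspace:
 fixes f :: "'a :: {complex_vector, real_normed_vector} => 'k bop"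
 assumes add: "\<And>x y. f (x + y) = f x + f y" and sc: "\<And>c x. \<exists>c'. f (c *C x) = c' *C f x"
  and bd: "\<And>x. norm (f x) \<le> C * norm x" and Y: "csubspace Y" "closed Y"
 shows "csubspace {x. f x \<in> Y}" "closed {x. f x \<in> Y}"
proof -
 have "f 0 \<in> Y" using bd[of 0] Y by (simp add: complex_vector.subspace_0)
 moreover have "f (c *C x) \<in> Y" if "f x \<in> Y" for c x using sc[of c x] that Y complex_vector.subspace_scale by metis
 ultimately show "csubspace {x. f x \<in> Y}"
  unfolding complex_vector.subspace_def using Y by (auto simp: add complex_vector.subspace_add)
 have diff: "f x - f y = f (x - y)" for x y using add[of "x - y" y] by simp
 show "closed {x. f x \<in> Y}"
  unfolding closed_sequential_limits
 proof (intro allI impI, elim conjE)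
  fix x l assume x: "\<forall>n. x n \<in> {x. f x \<in> Y}" "x \<longlonglongrightarrow> l"
  have "(\<lambda>n. f (x n) - f l) \<longlonglongrightarrow> 0"
  proof (rule Lim_null_comparison)
   show "\<forall>\<^sub>F n in sequentially. norm (f (x n) - f l) \<le> C * norm (x n - l)" unfolding diff using bd by simp
   have "(\<lambda>n. C * norm (x n - l)) \<longlonglongrightarrow> C * norm (l - l)" by (intro tendsto_intros x)
   then show "(\<lambda>n. C * norm (x n - l)) \<longlonglongrightarrow> 0" by simp
  qed
  then have lim: "(\<lambda>n. f (x n)) \<longlonglongrightarrow> f l" by (simp add: LIM_zero_iff)
  have "f (x n) \<in> Y" for n using x(1) by simp
  then have "f l \<in> Y" by (rule closed_sequentially[OF Y(2) _ lim])
  then show "l \<in> {x. f x \<in> Y}" by simp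
 qed
qed

subsection \<open>Multipliers of \<open>C\<^sub>0(\<G>)\<close>\<close>

context qg begin

text \<open>A normal functional is a series of vector functionals whose slices converge in norm;
  conversely, a finite sum of vector functionals is normal after padding with zeros. Membership
  claims can thus be checked on the \<open>w v s\<close>.\<close>

lemma C0_closure: "C0 G = closure (cspan {w v s | v s. True})"
proof (rule antisym)
 show "C0 G \<subseteq> closure (cspan {w v s | v s. True})"
  unfolding C0_def
 proof (rule closure_minimal[OF _ closed_closure], rule subsetI)
  fix x assume "x \<in> {slice_right \<omega> W | \<omega>. \<omega> \<in> predual}"
  then obtain \<xi> \<eta> where sq: "sq_summable \<xi>" "sq_summable \<eta>" and x: "x = slice_right (\<lambda>T. \<Sum>n. \<langle>\<eta> n, T $ \<xi> n\<rangle>) W"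
   by (auto simp: predual_def)
  have "(\<lambda>n. \<Sum>k<n. w (\<xi> k) (\<eta> k)) \<longlonglongrightarrow> x" using slice_right_sums[OF sq, of W] by (simp add: x sums_def)
  moreover have "(\<Sum>k<n. w (\<xi> k) (\<eta> k)) \<in> cspan {w v s | v s. True}" for n
   by (intro complex_vector.span_sum complex_vector.span_base) blast
  ultimately show "x \<in> closure (cspan {w v s | v s. True})" unfolding closure_sequential by (intro exI conjI allI)
 qed
 have "x \<in> {slice_right \<omega> W | \<omega>. \<omega> \<in> predual}" if "x \<in> cspan {w v s | v s. True}" for x
 proof -
  have "\<exists>(n :: nat) \<xi> \<eta>. x = (\<Sum>k<n. w (\<xi> k) (\<eta> k))"
   using that
  proof (induction rule: complex_vector.span_induct_alt)
   case base show ?case by (rule exI[of _ 0]) simp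
  next
   case (step c y x)
   then obtain n :: nat and \<xi> \<eta> v s where *: "x = (\<Sum>k<n. w (\<xi> k) (\<eta> k))" "y = w v s" by blast
   show ?case
    by (rule exI[of _ "Suc n"], rule exI[of _ "\<lambda>i. if i < n then \<xi> i else c *C v"], rule exI[of _ "\<lambda>i. if i < n then \<eta> i else s"])
     (simp add: * w_rules)
  qed
  then obtain n :: nat and \<xi> \<eta> where x: "x = (\<Sum>k<n. w (\<xi> k) (\<eta> k))" by blast
  define \<xi>' \<eta>' where "\<xi>' k = (if k < n then \<xi> k else 0)" and "\<eta>' k = (if k < n then \<eta> k else 0)" for k
  have sq: "sq_summable \<xi>'" "sq_summable \<eta>'"
   unfolding sq_summable_def \<xi>'_def \<eta>'_def by (rule summable_finite[of "{..<n}"]; auto)+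
  have "(\<lambda>k. w (\<xi>' k) (\<eta>' k)) sums (\<Sum>k<n. w (\<xi>' k) (\<eta>' k))"
   by (rule sums_finite) (auto simp: \<xi>'_def rslice_rules)
  also have "(\<Sum>k<n. w (\<xi>' k) (\<eta>' k)) = x" by (simp add: x \<xi>'_def \<eta>'_def)
  finally have "x = slice_right (\<lambda>T. \<Sum>n. \<langle>\<eta>' n, T $ \<xi>' n\<rangle>) W"
   using slice_right_sums[OF sq, of W] sums_unique2 by blast
  then show ?thesis using sq unfolding predual_def by blast
 qed
 then show "closure (cspan {w v s | v s. True}) \<subseteq> C0 G" unfolding C0_def by (intro closure_mono subsetI)
qed

lemma C0_minimal: "csubspace Y ==> closed Y ==> (\<And>v s. w v s \<in> Y) ==> C0 G \<subseteq> Y"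
 unfolding C0_closure by (intro closure_minimal complex_vector.span_minimal) auto

lemma w_C0: "w v s \<in> C0 G"
 unfolding C0_closure by (rule subsetD[OF closure_subset], rule complex_vector.span_base) blast

lemma closed_C0: "closed (C0 G)" by (simp add: C0_def)

lemma subspace_C0: "csubspace (C0 G)"
proof -
 define S where "S = cspan {w v s | v s. True}"
 have S: "csubspace S" unfolding S_def by (rule complex_vector.subspace_span)
 then have "subspace S" unfolding subspace_def complex_vector.subspace_def by (metis scaleC_of_real)
 then have r: "subspace (closure S)" by (rule subspace_closure)
 have "scaleC c ` closure S \<subseteq> closure S" for c
 proof (rule image_closure_subset[OF linear_continuous_on[OF bounded_linear_scaleC_bop] closed_closure])
  show "scaleC c ` S \<subseteq> closure S" using S closure_subset complex_vector.subspace_scale by blast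
 qed
 then show ?thesis unfolding C0_closure S_def[symmetric] complex_vector.subspace_def using r by (auto simp: subspace_def)
qed

text \<open>For \<open>b \<in> N\<close> the element \<open>T \<mu> \<eta> b\<close> is the adjoint of some \<open>w f (\<Lambda> b)\<close> if \<open>\<mu>\<close> and \<open>\<eta>\<close> are in certain total
 sets, hence it is the adjoint of an element of \<open>C\<^sub>0(\<G>)\<close> for all \<open>\<mu>, \<eta>\<close>.  Now \<open>w f (\<Lambda> b) = T \<eta> \<mu> (adj b)\<close> for \<open>b \<in> NN\<close>.\<close>

lemma C0_adj: assumes "a \<in> C0 G" shows "adj a \<in> C0 G"
proof -
 define Y where "Y = {x. adj x \<in> C0 G}"
 have adjsc: "\<exists>c'. adj (c *C x) = c' *C adj x" for c and x :: "'i bop" by auto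
 have "norm (adj x) \<le> 1 * norm x" for x :: "'i bop" by simp
 from vimage_closed_subspace[OF adj_add adjsc this subspace_C0 closed_C0]
 have Y: "csubspace Y" "closed Y" unfolding Y_def by blast+
 have ext: "rslice x s X \<in> Y" if "total S" "total S'" and pq: "\<And>p q. p \<in> S ==> q \<in> S' ==> rslice p q X \<in> Y"
  for S S' x s and X :: "('i \<times> 'i) bop"
 proof -
  have s: "rslice x s X \<in> Y" if x: "x \<in> S" for x
  proof (rule total_induct[where P = "\<lambda>s. rslice x s X \<in> Y", OF \<open>total S'\<close>])
   have "norm (rslice x s X) \<le> (norm X * norm x) * norm s" for s by (rule norm_rslice)
   from vimage_closed_subspace[where f = "\<lambda>s. rslice x s X", OF rslice_rules(7) _ this Y]
   show "csubspace {s. rslice x s X \<in> Y}" "closed {s. rslice x s X \<in> Y}"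
    using rslice_rules(9) by blast+
  qed (rule pq[OF x])
  show ?thesis
  proof (rule total_induct[where P = "\<lambda>x. rslice x s X \<in> Y", OF \<open>total S\<close>])
   have "norm (rslice x s X) \<le> (norm X * norm s) * norm x" for x using norm_rslice[of x s X] by (simp add: mult_ac)
   from vimage_closed_subspace[where f = "\<lambda>x. rslice x s X", OF rslice_rules(4) _ this Y]
   show "csubspace {x. rslice x s X \<in> Y}" "closed {x. rslice x s X \<in> Y}"
    using rslice_rules(6) by blast+
  qed (rule s)
 qed
 have T: "T \<mu> \<eta> b \<in> Y" if b: "b \<in> N" for b \<mu> \<eta>
 proof (rule ext[OF total_Fdomain total_Lam])
  fix \<mu> \<eta> assume "\<mu> \<in> {\<xi>. \<exists>f. Fpair \<xi> f}" "\<eta> \<in> \<Lambda> ` N"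
  then obtain f n where "Fpair \<mu> f" "n \<in> N" "\<eta> = \<Lambda> n" by blast
  then have "adj (w (n $ f) (\<Lambda> b)) = T \<mu> \<eta> b" using adj_w_FP[OF FP_Fpair b] by simp
  then have "adj (T \<mu> \<eta> b) = w (n $ f) (\<Lambda> b)" by (metis adj_adj)
  then show "T \<mu> \<eta> b \<in> Y" unfolding Y_def by (simp only: mem_Collect_eq w_C0)
 qed
 have "w v s \<in> Y" for v s
 proof (rule ext[OF total_FP total_Lam_NN])
  fix f p assume "f \<in> {f. \<exists>\<eta> \<mu>. FP f \<eta> \<mu>}" "p \<in> \<Lambda> ` NN"
  then obtain \<eta> \<mu> b where *: "FP f \<eta> \<mu>" "b \<in> NN" "p = \<Lambda> b" by blast
  then have b: "b \<in> N" "adj b \<in> N" using NN_D by auto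
  have "w f p = adj (T \<mu> \<eta> b)" using adj_w_FP[OF *(1) b(1)] *(3) by (metis adj_adj)
  also have "\<dots> = T \<eta> \<mu> (adj b)" using N_mem[OF b(1)] by (simp add: adj_rslice D_adj)
  finally show "w f p \<in> Y" using T[OF b(2)] by simp
 qed
 then have "C0 G \<subseteq> Y" by (rule C0_minimal[OF Y])
 then show ?thesis using assms by (auto simp: Y_def)
qed

lemma C0_mult_corep:
 fixes n :: nat
 assumes uM: "\<And>i j. i < n ==> j < n ==> u i j \<in> M"
  and Du: "\<And>i j. i < n ==> j < n ==> \<Delta> (u i j) = (\<Sum>k<n. u i k \<otimes>\<^sub>o u k j)"
  and uV: "\<And>i j. i < n ==> j < n ==> (\<Sum>k<n. u i k * Z k j) = (if i = j then 1 else 0)"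
  and k: "k < n" and p: "p < n" and a: "a \<in> C0 G"
 shows "a * u k p \<in> C0 G"
proof -
 \<comment> \<open>An entry of W (u \<otimes> 1) = (1 \<otimes> u) W (1 \<otimes> Z): the left
   factor passes to \<open>s\<close> as an adjoint and the right factor to \<open>v\<close>, so the
   product is again a sum of coefficients of W.\<close>
 have w: "w v s * u k p = (\<Sum>l<n. w (Z l p $ v) (adj (u k l) $ s))" for v s
 proof (rule bop_cinner_ext)
  fix z y
  have 1: "\<langle>y, w (Z l p $ v) (adj (u k l) $ s) $ z\<rangle> = (\<Sum>m<n. \<langle>y \<otimes> s, W $ ((u k m $ z) \<otimes> ((u m l * Z l p) $ v))\<rangle>)" if l: "l < n" for l
  proof -
   have "\<langle>y, w (Z l p $ v) (adj (u k l) $ s) $ z\<rangle> = \<langle>adj (1 \<otimes>\<^sub>o u k l) $ (y \<otimes> s), W $ (z \<otimes> Z l p $ v)\<rangle>"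
    by (simp add: cinner_rslice adj_tensor_op tensor_op_apply)
   also have "\<dots> = \<langle>y \<otimes> s, W $ \<Delta> (u k l) $ (z \<otimes> Z l p $ v)\<rangle>"
    using arg_cong[OF W_D[OF uM[OF k l]], of "\<lambda>X. X $ (z \<otimes> Z l p $ v)"] by (simp add: adj_left)
   finally show ?thesis by (simp add: Du k l bop_sum_left bop_sum_right cinner_sum_right tensor_op_apply)
  qed
  have "(\<Sum>l<n. (u k m $ z) \<otimes> ((u m l * Z l p) $ v)) = (if m = p then (u k p $ z) \<otimes> v else 0)" if m: "m < n" for m
  proof -
   have "(\<Sum>l<n. (u k m $ z) \<otimes> ((u m l * Z l p) $ v)) = (u k m $ z) \<otimes> ((\<Sum>l<n. u m l * Z l p) $ v)"
    unfolding bop_sum_left by (induction n) (simp_all add: tensor_vec_rules)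
   then show ?thesis by (simp add: uV m p)
  qed
  then have 2: "(\<Sum>l<n. \<langle>y \<otimes> s, W $ ((u k m $ z) \<otimes> ((u m l * Z l p) $ v))\<rangle>) = (if m = p then \<langle>y, (w v s * u k p) $ z\<rangle> else 0)" if m: "m < n" for m
   using that by (simp add: cinner_sum_right[symmetric] bop_sum_right[symmetric] cinner_rslice)
  have "\<langle>y, (\<Sum>l<n. w (Z l p $ v) (adj (u k l) $ s)) $ z\<rangle> = (\<Sum>l<n. \<Sum>m<n. \<langle>y \<otimes> s, W $ ((u k m $ z) \<otimes> ((u m l * Z l p) $ v))\<rangle>)"
   using 1 by (simp add: bop_sum_left cinner_sum_right)
  also have "\<dots> = (\<Sum>m<n. \<Sum>l<n. \<langle>y \<otimes> s, W $ ((u k m $ z) \<otimes> ((u m l * Z l p) $ v))\<rangle>)" by (rule sum.swap)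
  also have "\<dots> = (\<Sum>m<n. if m = p then \<langle>y, (w v s * u k p) $ z\<rangle> else 0)" by (intro sum.cong refl 2) simp
  also have "\<dots> = \<langle>y, (w v s * u k p) $ z\<rangle>" using p by simp
  finally show "\<langle>y, (w v s * u k p) $ z\<rangle> = \<langle>y, (\<Sum>l<n. w (Z l p $ v) (adj (u k l) $ s)) $ z\<rangle>" by simp
 qed
 have "norm (x * u k p) \<le> norm (u k p) * norm x" for x using norm_mult_ineq[of x "u k p"] by (simp add: mult.commute)
 from vimage_closed_subspace[where f = "\<lambda>x. x * u k p", OF distrib_right _ this subspace_C0 closed_C0]
 have "csubspace {x. x * u k p \<in> C0 G}" "closed {x. x * u k p \<in> C0 G}"
  using scaleC_bop_times_left by blast+
 then have "C0 G \<subseteq> {x. x * u k p \<in> C0 G}"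
  by (rule C0_minimal) (simp add: w complex_vector.subspace_sum[OF subspace_C0] w_C0)
 then show ?thesis using a by blast
qed

lemma multiplier_algebra_C0:
 "csubspace (multiplier_algebra (C0 G))" "closed (multiplier_algebra (C0 G))"
 "x \<in> multiplier_algebra (C0 G) ==> y \<in> multiplier_algebra (C0 G) ==> x * y \<in> multiplier_algebra (C0 G)"
 "x \<in> multiplier_algebra (C0 G) ==> adj x \<in> multiplier_algebra (C0 G)"
proof -
 have "csubspace {x. x * a \<in> C0 G} \<and> closed {x. x * a \<in> C0 G}"
  "csubspace {x. a * x \<in> C0 G} \<and> closed {x. a * x \<in> C0 G}" for a
 proof -
  have "norm (x * a) \<le> norm a * norm x" "norm (a * x) \<le> norm a * norm x" for x
   using norm_mult_ineq[of x a] norm_mult_ineq[of a x] by (simp_all add: mult.commute)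
  from vimage_closed_subspace[where f = "\<lambda>x. x * a", OF distrib_right _ this(1) subspace_C0 closed_C0]
   vimage_closed_subspace[where f = "\<lambda>x. a * x", OF distrib_left _ this(2) subspace_C0 closed_C0]
  show "csubspace {x. x * a \<in> C0 G} \<and> closed {x. x * a \<in> C0 G}"
   "csubspace {x. a * x \<in> C0 G} \<and> closed {x. a * x \<in> C0 G}"
   using scaleC_bop_times_left scaleC_bop_times_right by blast+
 qed
 moreover have "multiplier_algebra (C0 G) = (\<Inter>a\<in>C0 G. {x. x * a \<in> C0 G} \<inter> {x. a * x \<in> C0 G})"
  by (auto simp: multiplier_algebra_def)
 ultimately show "csubspace (multiplier_algebra (C0 G))" "closed (multiplier_algebra (C0 G))"
  by (auto intro!: closed_INT closed_Int complex_vector.subspace_inter complex_vector.subspace_Inter)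
 show "x * y \<in> multiplier_algebra (C0 G)" if "x \<in> multiplier_algebra (C0 G)" "y \<in> multiplier_algebra (C0 G)"
  using that by (simp add: multiplier_algebra_def mult.assoc) (simp add: mult.assoc[symmetric])
 show "adj x \<in> multiplier_algebra (C0 G)" if x: "x \<in> multiplier_algebra (C0 G)"
  unfolding multiplier_algebra_def
 proof (intro CollectI ballI)
  fix a assume "a \<in> C0 G"
  then have "adj a * x \<in> C0 G" "x * adj a \<in> C0 G" using x C0_adj by (simp_all add: multiplier_algebra_def)
  from this[THEN C0_adj] show "adj x * a \<in> C0 G \<and> a * adj x \<in> C0 G" by simp
 qed
qed

lemma admissible_if_invertible:
 assumes n: "0 < n" and uM: "\<And>i j. i < n ==> j < n ==> u i j \<in> M"
  and Du: "\<And>i j. i < n ==> j < n ==> \<Delta> (u i j) = (\<Sum>k<n. u i k \<otimes>\<^sub>o u k j)"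
  and Vu: "\<And>i k. i < n ==> k < n ==> (\<Sum>j<n. Z i j * u j k) = (if i = k then 1 else 0)"
  and uV: "\<And>i k. i < n ==> k < n ==> (\<Sum>j<n. u i j * Z j k) = (if i = k then 1 else 0)"
  and tu: "\<And>i k. i < n ==> k < n ==> (\<Sum>j<n. t j i * u k j) = (if i = k then 1 else 0)"
  and ut: "\<And>i k. i < n ==> k < n ==> (\<Sum>j<n. u j i * t k j) = (if i = k then 1 else 0)"
 shows "admissible G n u"
proof -
 \<comment> \<open>The entrywise adjoints form a corepresentation with right inverse the adjoints of
   \<open>t\<close>; invertibility of the transpose of u enters here. Adjoints in
   \<open>C0 G\<close> then turn right into left multiplication.\<close>
 have au: "a * adj (u k p) \<in> C0 G" if "k < n" "p < n" "a \<in> C0 G" for a k p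
 proof (rule C0_mult_corep[where u = "\<lambda>i j. adj (u i j)" and Z = "\<lambda>i j. adj (t i j)" and n = n])
  show "\<Delta> (adj (u i j)) = (\<Sum>k<n. adj (u i k) \<otimes>\<^sub>o adj (u k j))" if "i < n" "j < n" for i j
   using that by (simp add: D_adj uM Du adj_sum adj_tensor_op)
  show "(\<Sum>k<n. adj (u i k) * adj (t k j)) = (if i = j then 1 else 0)" if "i < n" "j < n" for i j
   using arg_cong[OF tu[OF that(2,1)], of adj] by (cases "i = j") (simp_all add: adj_sum)
 qed (use that uM in auto)
 have uA: "u k p \<in> multiplier_algebra (C0 G)" if kp: "k < n" "p < n" for k p
  unfolding multiplier_algebra_def
 proof (intro CollectI ballI conjI)
  fix a assume a: "a \<in> C0 G"
  show "a * u k p \<in> C0 G" by (rule C0_mult_corep[OF uM Du uV kp a])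
  have "adj (adj a * adj (u k p)) \<in> C0 G" by (intro C0_adj au kp a)
  then show "u k p * a \<in> C0 G" by simp
 qed
 have Z: "Z i j \<in> multiplier_algebra (C0 G)" if "i < n" "j < n" for i j
  by (rule inverse_closed[OF multiplier_algebra_C0 uA uV Vu that])
 have t: "t j i \<in> multiplier_algebra (C0 G)" if "i < n" "j < n" for i j
 proof (rule inverse_closed[where U = "\<lambda>i j. u j i" and V = "\<lambda>i j. t j i" and n = n, OF multiplier_algebra_C0])
 qed (use uA ut tu that in auto)
 show ?thesis
  unfolding admissible_def corepresentation_def matrix_invertible_def
  by (intro conjI allI impI exI[of _ Z] exI[of _ "\<lambda>i j. t j i"])
   (use n uA Z t Vu uV tu ut Du in auto)
qed

lemma matrix_element_of_admissible:
 assumes "x \<in> periodic_elements G \<inter> dom_S G \<inter> dom_S_inv G"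
 shows "\<exists>n U. admissible G n U \<and> x \<in> matrix_elements n U"
proof -
 have x: "x \<in> M" "\<Delta> x \<in> M \<odot> M" using assms by (auto simp: periodic_elements_def)
 have DRx: "DR x" using assms antipode_graph_SG unfolding DR_def dom_S_def dom_S_inv_def by blast
 obtain n b u
  where b: "\<And>i. b i \<in> M" and u: "\<And>i j. u i j \<in> M" and li: "lin_indep n b"
   and DRb: "\<And>i. i < n ==> DR (b i)" and DRu: "\<And>i j. i < n ==> j < n ==> DR (u i j)"
   and Db: "\<And>i. i < n ==> \<Delta> (b i) = (\<Sum>j<n. u i j \<otimes>\<^sub>o b j)"
   and Du: "\<And>i j. i < n ==> j < n ==> \<Delta> (u i j) = (\<Sum>k<n. u i k \<otimes>\<^sub>o u k j)"
   and xb: "x \<in> cspan (b ` {..<n})"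
  by (rule periodic_decomposition[OF x DRx]) (rule that)
 show ?thesis
 proof (cases "n = 0")
  case True
  then have "x = 0" using xb by simp
  \<comment> \<open>A corepresentation has positive size, so x = 0 is placed in the trivial
    one.\<close>
  moreover have "admissible G 1 (\<lambda>i j. 1)"
   by (rule admissible_if_invertible[where Z = "\<lambda>i j. 1" and t = "\<lambda>i j. 1"]) (simp_all add: D_one)
  ultimately show ?thesis unfolding matrix_elements_def using complex_vector.span_zero by blast
 next
  case False
  obtain Z t where inv: "\<And>i k. i < n ==> k < n ==> (\<Sum>j<n. Z i j * u j k) = (if i = k then 1 else 0)"
   "\<And>i k. i < n ==> k < n ==> (\<Sum>j<n. u i j * Z j k) = (if i = k then 1 else 0)"
   "\<And>i k. i < n ==> k < n ==> (\<Sum>j<n. t j i * u k j) = (if i = k then 1 else 0)"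
   "\<And>i k. i < n ==> k < n ==> (\<Sum>j<n. u j i * t k j) = (if i = k then 1 else 0)"
   and bu: "\<And>k. k < n ==> b k \<in> matrix_elements n u"
   by (rule corep_inverse[OF b u li DRb DRu Db Du]) (assumption | rule that)+
  have "admissible G n u" by (rule admissible_if_invertible[where Z = Z and t = t]) (use False u Du inv in simp_all)
  moreover have "cspan (b ` {..<n}) \<subseteq> matrix_elements n u"
   unfolding matrix_elements_def
   by (rule complex_vector.span_minimal[OF _ complex_vector.subspace_span]) (use bu in "auto simp: matrix_elements_def")
  ultimately show ?thesis using xb by blast
 qed
qed

lemma matrix_elements_multiplier:
 assumes "admissible G n U" shows "matrix_elements n U \<subseteq> multiplier_algebra (C0 G)"
 unfolding matrix_elements_def
 by (rule complex_vector.span_minimal[OF _ multiplier_algebra_C0(1)])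
  (use assms in "auto simp: admissible_def corepresentation_def")

end

theorem theorem4p14:
  fixes G :: "'i lcqg_data" and x :: "'i bop"
  assumes "lcqg G"
    and "x \<in> periodic_elements G \<inter> dom_S G \<inter> dom_S_inv G"
  shows "(\<exists>n U. admissible G n U \<and> x \<in> matrix_elements n U) \<and>
    x \<in> multiplier_algebra (C0 G) \<and> x \<in> AP G"
proof -
  interpret qg G by unfold_locales (rule assms(1))
  obtain n U where U: "admissible G n U" "x \<in> matrix_elements n U"
    using matrix_element_of_admissible[OF assms(2)] by blast
  then show ?thesis using matrix_elements_multiplier[OF U(1)] unfolding AP_def by blast
qed

end
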